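(* There is an algorithm which, given as input an explicitly represented ordered graph $(G,<)$ with $n$ vertices and $m$ edges, computes in time $O(m+n)$ a distinguishing delayed decomposition $(T,<,\{G_x\}_{x\in V(T)})$ of $(G,<)$.
   Context: An ordered graph is a finite simple graph with a linear order on its vertices; explicit representation means a list of edges and the list of vertices sorted according to the order. For a rooted tree $T$, $L(T)$ is its set of leaves and $L(x)$ the set of leaves descending from a node $x$ (ancestors/descendants include the node itself). An ordered tree $(T,<)$ is a rooted tree with a linear order $<$ on $L(T)$ such that each $L(x)$ is an interval (set of consecutive elements) of $<$; for nodes $x,y$ not in ancestor–descendant relation we write $x<y$ if $L(x)<L(y)$, which orders the children of each node, so one can speak of consecutive children. A delayed structured tree $(T,<,\{G_x\}_{x\in V(T)})$ is an ordered tree $(T,<)$ in which every leaf is the only child of its parent, together with, for each node $x$, a graph $G_x$ whose vertex set is the set of grandchildren of $x$. Its realization is the ordered graph on vertex set $L(T)$ ordered by $<$, in which two leaves $u,v$ are adjacent iff $u'v'\in E(G_z)$, where $z$ is the closest common ancestor of $u,v$ and $u',v'$ are the grandchildren of $z$ that are ancestors of $u,v$ respectively. It is a delayed decomposition of $(G,<)$ if its realization is $(G,<)$ (leaves identified with vertices). It is distinguishing if for every node $x$ with at least $3$ children and every two consecutive children $x_1,x_2$ of $x$, there is a vertex $v\in V(G)\setminus L(x)$ adjacent to all vertices of one of $L(x_1),L(x_2)$ and to no vertex of the other. *)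

theory Defs
  imports Main
begin

section \<open>Ordered graphs\<close>

record 'a ordered_graph =
  verts :: "'a set"
  edges :: "'a set set"
  vorder :: "'a rel"

definition simple_graph :: "'a set \<Rightarrow> 'a set set \<Rightarrow> bool" where
  "simple_graph V E \<longleftrightarrow> finite V \<and> E \<subseteq> {{u, v} | u v. u \<in> V \<and> v \<in> V \<and> u \<noteq> v}"

text \<open>The linear order is the reflexive one; \<^const>\<open>linear_order_on\<close> includes
  \<open>vorder G \<subseteq> verts G \<times> verts G\<close>, so equality of such records is equality of ordered graphs.\<close>

definition ordered_graph :: "'a ordered_graph \<Rightarrow> bool" where
  "ordered_graph G \<longleftrightarrow>
     simple_graph (verts G) (edges G) \<and> linear_order_on (verts G) (vorder G)"

definition order_of_list :: "'a list \<Rightarrow> 'a rel" where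
  "order_of_list vs = {(vs ! i, vs ! j) | i j. i \<le> j \<and> j < length vs}"

text \<open>Each edge is listed exactly once, in one of its two orientations.\<close>

definition explicit_representation ::
    "'a ordered_graph \<Rightarrow> 'a list \<Rightarrow> ('a \<times> 'a) list \<Rightarrow> bool" where
  "explicit_representation G vs es \<longleftrightarrow>
     distinct vs \<and> verts G = set vs \<and> vorder G = order_of_list vs \<and>
     distinct (map (\<lambda>(u, v). {u, v}) es) \<and> edges G = set (map (\<lambda>(u, v). {u, v}) es)"


section \<open>Delayed structured trees\<close>

text \<open>\<open>tarcs\<close> consists of the pairs (parent, child), \<open>lorder\<close> is the order on the leaves, and
  \<open>gedges T x\<close> is the edge set of the graph \<open>G\<^sub>x\<close>, whose vertex set is the set of
  grandchildren of \<open>x\<close>.\<close>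

record 'b structured_tree =
  nodes :: "'b set"
  root :: 'b
  tarcs :: "'b rel"
  lorder :: "'b rel"
  gedges :: "'b \<Rightarrow> 'b set set"

definition rooted_tree :: "('b, 'z) structured_tree_scheme \<Rightarrow> bool" where
  "rooted_tree T \<longleftrightarrow>
     finite (nodes T) \<and> root T \<in> nodes T \<and> tarcs T \<subseteq> nodes T \<times> nodes T \<and>
     (\<forall>p. (p, root T) \<notin> tarcs T) \<and>
     (\<forall>x \<in> nodes T - {root T}. \<exists>!p. (p, x) \<in> tarcs T) \<and>
     (\<forall>x \<in> nodes T. (root T, x) \<in> (tarcs T)\<^sup>*)"

definition children :: "('b, 'z) structured_tree_scheme \<Rightarrow> 'b \<Rightarrow> 'b set" where
  "children T x = {y. (x, y) \<in> tarcs T}"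

definition grandchildren :: "('b, 'z) structured_tree_scheme \<Rightarrow> 'b \<Rightarrow> 'b set" where
  "grandchildren T x = (\<Union>y \<in> children T x. children T y)"

definition ancestor :: "('b, 'z) structured_tree_scheme \<Rightarrow> 'b \<Rightarrow> 'b \<Rightarrow> bool" where
  "ancestor T x y \<longleftrightarrow> x \<in> nodes T \<and> y \<in> nodes T \<and> (x, y) \<in> (tarcs T)\<^sup>*"

definition leaves :: "('b, 'z) structured_tree_scheme \<Rightarrow> 'b set" where
  "leaves T = {l \<in> nodes T. children T l = {}}"

definition leaves_below :: "('b, 'z) structured_tree_scheme \<Rightarrow> 'b \<Rightarrow> 'b set" where
  "leaves_below T x = {l \<in> leaves T. ancestor T x l}"

definition ordered_tree :: "('b, 'z) structured_tree_scheme \<Rightarrow> bool" where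
  "ordered_tree T \<longleftrightarrow>
     rooted_tree T \<and> linear_order_on (leaves T) (lorder T) \<and>
     (\<forall>x \<in> nodes T. \<forall>a \<in> leaves_below T x. \<forall>b \<in> leaves_below T x. \<forall>c \<in> leaves T.
        (a, c) \<in> lorder T \<and> (c, b) \<in> lorder T \<longrightarrow> c \<in> leaves_below T x)"

definition node_less :: "('b, 'z) structured_tree_scheme \<Rightarrow> 'b \<Rightarrow> 'b \<Rightarrow> bool" where
  "node_less T x y \<longleftrightarrow>
     \<not> ancestor T x y \<and> \<not> ancestor T y x \<and>
     (\<forall>u \<in> leaves_below T x. \<forall>v \<in> leaves_below T y. (u, v) \<in> lorder T \<and> u \<noteq> v)"

definition consecutive_children ::
    "('b, 'z) structured_tree_scheme \<Rightarrow> 'b \<Rightarrow> 'b \<Rightarrow> 'b \<Rightarrow> bool" where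
  "consecutive_children T x x1 x2 \<longleftrightarrow>
     x1 \<in> children T x \<and> x2 \<in> children T x \<and> node_less T x1 x2 \<and>
     \<not> (\<exists>y \<in> children T x. node_less T x1 y \<and> node_less T y x2)"

definition delayed_structured_tree :: "('b, 'z) structured_tree_scheme \<Rightarrow> bool" where
  "delayed_structured_tree T \<longleftrightarrow>
     ordered_tree T \<and>
     (\<forall>l \<in> leaves T. \<exists>p \<in> nodes T. children T p = {l}) \<and>
     (\<forall>x \<in> nodes T. simple_graph (grandchildren T x) (gedges T x))"

definition closest_common_ancestor ::
    "('b, 'z) structured_tree_scheme \<Rightarrow> 'b \<Rightarrow> 'b \<Rightarrow> 'b \<Rightarrow> bool" where
  "closest_common_ancestor T z u v \<longleftrightarrow>
     ancestor T z u \<and> ancestor T z v \<and>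
     (\<forall>w. ancestor T w u \<and> ancestor T w v \<longrightarrow> ancestor T w z)"

definition realization :: "('b, 'z) structured_tree_scheme \<Rightarrow> 'b ordered_graph" where
  "realization T =
     \<lparr>verts = leaves T,
      edges = {{u, v} | u v. u \<in> leaves T \<and> v \<in> leaves T \<and> u \<noteq> v \<and>
        (\<exists>z u' v'. closest_common_ancestor T z u v \<and>
           u' \<in> grandchildren T z \<and> ancestor T u' u \<and>
           v' \<in> grandchildren T z \<and> ancestor T v' v \<and> {u', v'} \<in> gedges T z)},
      vorder = lorder T\<rparr>"

text \<open>Leaves are identified with vertices, so the leaves of a decomposition of \<open>G\<close> are the
  vertices of \<open>G\<close> themselves.\<close>

definition delayed_decomposition ::
    "('b, 'z) structured_tree_scheme \<Rightarrow> 'b ordered_graph \<Rightarrow> bool" where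
  "delayed_decomposition T G \<longleftrightarrow> delayed_structured_tree T \<and> realization T = G"

definition distinguishing ::
    "('b, 'z) structured_tree_scheme \<Rightarrow> 'b ordered_graph \<Rightarrow> bool" where
  "distinguishing T G \<longleftrightarrow>
     (\<forall>x \<in> nodes T. card (children T x) \<ge> 3 \<longrightarrow>
       (\<forall>x1 x2. consecutive_children T x x1 x2 \<longrightarrow>
         (\<exists>v \<in> verts G - leaves_below T x.
           (\<forall>u \<in> leaves_below T x1. {v, u} \<in> edges G) \<and>
             (\<forall>u \<in> leaves_below T x2. {v, u} \<notin> edges G) \<or>
           (\<forall>u \<in> leaves_below T x2. {v, u} \<in> edges G) \<and>
             (\<forall>u \<in> leaves_below T x1. {v, u} \<notin> edges G))))"


section \<open>Algorithms: a word RAM with unit-cost operations\<close>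

text \<open>Programs are written in a small structured language with finitely many registers and arrays
  of natural numbers. Every register access, array access, constant, arithmetic operation and
  command costs one unit of time. An execution is legal for the bound \<open>B\<close> only if every value that
  is computed, in particular every array index, is less than \<open>B\<close>; with \<open>B\<close> polynomial
  in the input size this is the usual restriction to words of logarithmic length.\<close>

datatype binop = Add | Sub | Mul | Div | Less | Equal

datatype aexp =
    Const nat
  | Reg string
  | Load string aexp
  | Bin binop aexp aexp

datatype com =
    Skip
  | Assign string aexp
  | Store string aexp aexp
  | Seq com com
  | If aexp com com
  | While aexp com

record state =
  reg :: "string \<Rightarrow> nat"
  arr :: "string \<Rightarrow> nat \<Rightarrow> nat"

text \<open>Subtraction is truncated at \<open>0\<close>, division by \<open>0\<close> yields \<open>0\<close>, and comparisons
  yield \<open>1\<close> (true) or \<open>0\<close> (false).\<close>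

fun binop_val :: "binop \<Rightarrow> nat \<Rightarrow> nat \<Rightarrow> nat" where
  "binop_val Add x y = x + y"
| "binop_val Sub x y = x - y"
| "binop_val Mul x y = x * y"
| "binop_val Div x y = x div y"
| "binop_val Less x y = (if x < y then 1 else 0)"
| "binop_val Equal x y = (if x = y then 1 else 0)"

fun aval :: "aexp \<Rightarrow> state \<Rightarrow> nat" where
  "aval (Const c) s = c"
| "aval (Reg x) s = reg s x"
| "aval (Load a e) s = arr s a (aval e s)"
| "aval (Bin f e1 e2) s = binop_val f (aval e1 s) (aval e2 s)"

fun fits :: "nat \<Rightarrow> aexp \<Rightarrow> state \<Rightarrow> bool" where
  "fits B (Const c) s \<longleftrightarrow> c < B"
| "fits B (Reg x) s \<longleftrightarrow> reg s x < B"
| "fits B (Load a e) s \<longleftrightarrow> fits B e s \<and> arr s a (aval e s) < B"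
| "fits B (Bin f e1 e2) s \<longleftrightarrow>
     fits B e1 s \<and> fits B e2 s \<and> binop_val f (aval e1 s) (aval e2 s) < B"

fun cost :: "aexp \<Rightarrow> nat" where
  "cost (Const c) = 1"
| "cost (Reg x) = 1"
| "cost (Load a e) = cost e + 1"
| "cost (Bin f e1 e2) = cost e1 + cost e2 + 1"

text \<open>\<open>exec B c s t s'\<close>: started in state \<open>s\<close>, command \<open>c\<close> terminates after \<open>t\<close> time units in
  state \<open>s'\<close>, all values staying below \<open>B\<close>. A run that violates the bound does not exist.
  The language is deterministic, see \<open>exec_deterministic\<close>.\<close>

inductive exec :: "nat \<Rightarrow> com \<Rightarrow> state \<Rightarrow> nat \<Rightarrow> state \<Rightarrow> bool" for B where
  Skip: "exec B Skip s 1 s"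
| Assign: "fits B e s \<Longrightarrow>
    exec B (Assign x e) s (cost e + 1) (s\<lparr>reg := (reg s)(x := aval e s)\<rparr>)"
| Store: "fits B i s \<Longrightarrow> fits B e s \<Longrightarrow>
    exec B (Store a i e) s (cost i + cost e + 1)
      (s\<lparr>arr := (arr s)(a := (arr s a)(aval i s := aval e s))\<rparr>)"
| Seq: "exec B c1 s t1 s1 \<Longrightarrow> exec B c2 s1 t2 s2 \<Longrightarrow> exec B (Seq c1 c2) s (t1 + t2) s2"
| IfTrue: "fits B e s \<Longrightarrow> aval e s \<noteq> 0 \<Longrightarrow> exec B c1 s t s' \<Longrightarrow>
    exec B (If e c1 c2) s (cost e + 1 + t) s'"
| IfFalse: "fits B e s \<Longrightarrow> aval e s = 0 \<Longrightarrow> exec B c2 s t s' \<Longrightarrow>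
    exec B (If e c1 c2) s (cost e + 1 + t) s'"
| WhileFalse: "fits B e s \<Longrightarrow> aval e s = 0 \<Longrightarrow> exec B (While e c) s (cost e + 1) s"
| WhileTrue: "fits B e s \<Longrightarrow> aval e s \<noteq> 0 \<Longrightarrow> exec B c s t1 s1 \<Longrightarrow>
    exec B (While e c) s1 t2 s2 \<Longrightarrow> exec B (While e c) s (cost e + 1 + t1 + t2) s2"

inductive_cases SkipE: "exec B Skip s t s'"
inductive_cases AssignE: "exec B (Assign x e) s t s'"
inductive_cases StoreE: "exec B (Store a i e) s t s'"
inductive_cases SeqE: "exec B (Seq c1 c2) s t s'"
inductive_cases IfE: "exec B (If e c1 c2) s t s'"
inductive_cases WhileE: "exec B (While e c) s t s'"

lemma exec_deterministic:
  "exec B c s t s' \<Longrightarrow> exec B c s t2 s2 \<Longrightarrow> t2 = t \<and> s2 = s'"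
proof (induction arbitrary: t2 s2 rule: exec.induct)
  case Skip
  then show ?case by (elim SkipE) simp
next
  case Assign
  then show ?case by (elim AssignE) simp
next
  case Store
  then show ?case by (elim StoreE) simp
next
  case (Seq c1 s t1 s1 c2 u s')
  from Seq.prems obtain v1 r1 v2 where
    "exec B c1 s v1 r1" "exec B c2 r1 v2 s2" "t2 = v1 + v2" by (rule SeqE)
  moreover from Seq.IH(1)[OF this(1)] have "v1 = t1" "r1 = s1" by simp_all
  ultimately show ?case using Seq.IH(2)[of v2 s2] by simp
next
  case (IfTrue e s c1 t s' c2)
  from IfTrue.prems IfTrue.hyps obtain v where "exec B c1 s v s2" "t2 = cost e + 1 + v"
    by (auto elim: IfE)
  with IfTrue.IH[of v s2] show ?case by simp
next
  case (IfFalse e s c2 t s' c1)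
  from IfFalse.prems IfFalse.hyps obtain v where "exec B c2 s v s2" "t2 = cost e + 1 + v"
    by (auto elim: IfE)
  with IfFalse.IH[of v s2] show ?case by simp
next
  case WhileFalse
  from WhileFalse.prems show ?case by (rule WhileE) (use WhileFalse.hyps in simp_all)
next
  case (WhileTrue e s c t1 s1 u s')
  from WhileTrue.prems obtain v1 r1 v2 where
    "exec B c s v1 r1" "exec B (While e c) r1 v2 s2" "t2 = cost e + 1 + v1 + v2"
    by (rule WhileE) (use WhileTrue.hyps in simp_all)
  moreover from WhileTrue.IH(1)[OF this(1)] have "v1 = t1" "r1 = s1" by simp_all
  ultimately show ?case using WhileTrue.IH(2)[of v2 s2] by simp
qed

text \<open>Input: the vertices are machine words, listed in increasing order in the array
  \<open>order\<close>; the \<open>j\<close>-th edge joins \<open>src[j]\<close> and \<open>tgt[j]\<close>. All other memory is \<open>0\<close>.\<close>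

definition list_arr :: "nat list \<Rightarrow> nat \<Rightarrow> nat" where
  "list_arr xs i = (if i < length xs then xs ! i else 0)"

definition input_state :: "nat list \<Rightarrow> (nat \<times> nat) list \<Rightarrow> state" where
  "input_state vs es =
     \<lparr>reg = (\<lambda>_. 0)(''n'' := length vs, ''m'' := length es),
      arr = (\<lambda>_ _. 0)(''order'' := list_arr vs,
        ''src'' := list_arr (map fst es), ''tgt'' := list_arr (map snd es))\<rparr>"

text \<open>Output: the nodes are \<open>0, \<dots>, nodes - 1\<close>, given with their parents (the entry of the root is
  ignored); the leaves are listed in increasing order; the graphs \<open>G\<^sub>x\<close> are given as one list of
  \<open>gedges\<close> triples \<open>(x, u, v)\<close>, each meaning that \<open>uv\<close> is an edge of \<open>G\<^sub>x\<close>.\<close>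

definition output_tree :: "state \<Rightarrow> nat structured_tree" where
  "output_tree s =
     \<lparr>nodes = {0..<reg s ''nodes''},
      root = reg s ''root'',
      tarcs = {(arr s ''parent'' y, y) | y. y < reg s ''nodes'' \<and> y \<noteq> reg s ''root''},
      lorder = order_of_list (map (arr s ''leaf'') [0..<reg s ''leaves'']),
      gedges = (\<lambda>x. {{arr s ''gsrc'' i, arr s ''gtgt'' i} | i.
        i < reg s ''gedges'' \<and> arr s ''gnode'' i = x})\<rparr>"

end

theory Submission
  imports Defs
begin

text \<open>Let $D(k)$ be the set of vertices adjacent to exactly one of the vertices at positions $k-1$ and
  $k$, these two excluded. Nodes of the tree are intervals of positions. An interval $[a, b)$ is cut at every $k$ for
  which $D(k)$ has an element outside $[a, b)$, and at $a + 1$ if there is no such $k$; its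
  children are the pieces. If there are three or more of them, every cut is witnessed by an outside
  vertex, which is distinguishing: an outside vertex cannot change its adjacency inside a child, as
  the child would have been cut there. For the same reason adjacency between vertices that separate
  below $z$ depends only on their ancestors among the grandchildren of $z$, so the decomposition is
  delayed.

  For linear time, $D(k)$ is only needed through its least and greatest element, and all of these
  extrema are found by one pass over the adjacency lists. A cut inside any range is then found by
  two range minimum queries, which take constant time after linear preprocessing. A third such
  structure, over the nodes that make the cuts, locates the node and the grandchildren which an
  edge belongs to.\<close>

section \<open>Program logic\<close>

text \<open>Grandchildren are needed because cuts are demanded only by vertices outside the node: a
  vertex in a sibling of a child \<open>y\<close> of \<open>z\<close> may still distinguish vertices
  of \<open>y\<close>. It lies outside \<open>y\<close>, however, so the children of
  \<open>y\<close> are cut against it, and one level further down the adjacency is constant. The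
  default cut \<open>a + 1\<close> guarantees progress and leaves two children, for which nothing
  has to be witnessed. The obstacle to linear time is the depth of the tree, which can be linear: no
  interval may be scanned when it is split. Every search for a cut takes constant time instead and
  either yields a new cut or completes a child. Each position \<open>0 < k < n\<close> is a cut of
  exactly one node, so there are fewer than \<open>n\<close> cuts and, a node with \<open>c\<close>
  cuts having \<open>c + 1 \<le> 2 * c\<close> children, linearly many nodes. For the same reason
  arrays over positions can record, for every cut, the node that made it and the child that ends
  there. Storing node and position in one number \<open>w * n + k\<close> makes the values
  quadratic, which a polynomial word bound permits.\<close>

definition runs :: "nat \<Rightarrow> com \<Rightarrow> state \<Rightarrow> (state \<Rightarrow> nat \<Rightarrow> bool) \<Rightarrow> bool" where
  "runs B c s Q \<longleftrightarrow> (\<exists>t s'. exec B c s t s' \<and> Q s' t)"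

lemma runs_mono:
  assumes "runs B c s Q" "\<And>s' t. Q s' t \<Longrightarrow> Q' s' t"
  shows "runs B c s Q'"
  using assms unfolding runs_def by blast

lemma exec_Skip_iff: "exec B Skip s t s' \<longleftrightarrow> t = 1 \<and> s' = s"
  using exec.Skip by (metis SkipE)

lemma exec_Assign_iff:
  "exec B (Assign x e) s t s' \<longleftrightarrow>
     fits B e s \<and> t = cost e + 1 \<and> s' = s\<lparr>reg := (reg s)(x := aval e s)\<rparr>"
  using exec.Assign by (metis AssignE)

lemma exec_Store_iff:
  "exec B (Store a i e) s t s' \<longleftrightarrow>
     fits B i s \<and> fits B e s \<and> t = cost i + cost e + 1 \<and>
     s' = s\<lparr>arr := (arr s)(a := (arr s a)(aval i s := aval e s))\<rparr>"
  using exec.Store by (metis StoreE)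

lemma exec_Seq_iff:
  "exec B (Seq c1 c2) s t s' \<longleftrightarrow>
     (\<exists>t1 s1 t2. exec B c1 s t1 s1 \<and> exec B c2 s1 t2 s' \<and> t = t1 + t2)"
  using exec.Seq by (metis SeqE)

lemma exec_If_iff:
  "exec B (If e c1 c2) s t s' \<longleftrightarrow>
     fits B e s \<and> (\<exists>u. exec B (if aval e s \<noteq> 0 then c1 else c2) s u s' \<and> t = cost e + 1 + u)"
proof
  assume "exec B (If e c1 c2) s t s'"
  then show "fits B e s \<and>
    (\<exists>u. exec B (if aval e s \<noteq> 0 then c1 else c2) s u s' \<and> t = cost e + 1 + u)"
    by (rule IfE) auto
next
  assume "fits B e s \<and>
    (\<exists>u. exec B (if aval e s \<noteq> 0 then c1 else c2) s u s' \<and> t = cost e + 1 + u)"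
  then show "exec B (If e c1 c2) s t s'"
    using exec.IfTrue exec.IfFalse by (metis (full_types))
qed

lemma runs_Skip: "runs B Skip s Q \<longleftrightarrow> Q s 1"
  by (auto simp: runs_def exec_Skip_iff)

lemma runs_Assign:
  "runs B (Assign x e) s Q \<longleftrightarrow>
     fits B e s \<and> Q (s\<lparr>reg := (reg s)(x := aval e s)\<rparr>) (cost e + 1)"
  by (auto simp: runs_def exec_Assign_iff)

lemma runs_Store:
  "runs B (Store a i e) s Q \<longleftrightarrow>
     fits B i s \<and> fits B e s \<and>
     Q (s\<lparr>arr := (arr s)(a := (arr s a)(aval i s := aval e s))\<rparr>) (cost i + cost e + 1)"
  by (auto simp: runs_def exec_Store_iff)

lemma runs_Seq:
  "runs B (Seq c1 c2) s Q \<longleftrightarrow>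
     runs B c1 s (\<lambda>s1 t1. runs B c2 s1 (\<lambda>s2 t2. Q s2 (t1 + t2)))"
  unfolding runs_def exec_Seq_iff by blast

lemma runs_If:
  "runs B (If e c1 c2) s Q \<longleftrightarrow> fits B e s \<and>
     (if aval e s \<noteq> 0 then runs B c1 s (\<lambda>s' t. Q s' (cost e + 1 + t))
      else runs B c2 s (\<lambda>s' t. Q s' (cost e + 1 + t)))"
  unfolding runs_def exec_If_iff by (cases "aval e s = 0") (simp_all, blast+)

lemmas runs_simps = runs_Skip runs_Assign runs_Store runs_Seq runs_If

lemma runs_SeqI:
  assumes "runs B c1 s R"
    and "\<And>s1 t1. R s1 t1 \<Longrightarrow> runs B c2 s1 (\<lambda>s2 t2. Q s2 (t1 + t2))"
  shows "runs B (Seq c1 c2) s Q"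
  unfolding runs_Seq using assms(1) by (rule runs_mono) (rule assms(2))

fun wregs :: "com \<Rightarrow> string set" where
  "wregs (Assign x e) = {x}"
| "wregs (Seq c1 c2) = wregs c1 \<union> wregs c2"
| "wregs (If e c1 c2) = wregs c1 \<union> wregs c2"
| "wregs (While e c) = wregs c"
| "wregs _ = {}"

fun warrs :: "com \<Rightarrow> string set" where
  "warrs (Store a i e) = {a}"
| "warrs (Seq c1 c2) = warrs c1 \<union> warrs c2"
| "warrs (If e c1 c2) = warrs c1 \<union> warrs c2"
| "warrs (While e c) = warrs c"
| "warrs _ = {}"

text \<open>The frame condition, read off the syntax of \<open>c\<close>. Postconditions and loop
  invariants then state only what changes; that the rest is preserved comes from
  \<open>agree_reg\<close> and \<open>agree_arr\<close> together with the simplified write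
  sets.\<close>

definition agree :: "com \<Rightarrow> state \<Rightarrow> state \<Rightarrow> bool" where
  "agree c s s' \<longleftrightarrow>
     (\<forall>x. x \<notin> wregs c \<longrightarrow> reg s' x = reg s x) \<and> (\<forall>a. a \<notin> warrs c \<longrightarrow> arr s' a = arr s a)"

lemma agree_refl: "agree c s s"
  by (simp add: agree_def)

lemma agree_trans: "agree c s s' \<Longrightarrow> agree c s' s'' \<Longrightarrow> agree c s s''"
  by (simp add: agree_def)

lemma agree_reg: "agree c s s' \<Longrightarrow> x \<notin> wregs c \<Longrightarrow> reg s' x = reg s x"
  by (simp add: agree_def)

lemma agree_arr: "agree c s s' \<Longrightarrow> a \<notin> warrs c \<Longrightarrow> arr s' a = arr s a"
  by (simp add: agree_def)

lemma exec_agree: "exec B c s t s' \<Longrightarrow> agree c s s'"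
  by (induction rule: exec.induct) (auto simp: agree_def)

lemma runs_agree: "runs B c s Q \<Longrightarrow> runs B c s (\<lambda>s' t. Q s' t \<and> agree c s s')"
  unfolding runs_def using exec_agree by blast

text \<open>The composition rule used nearly everywhere: the second command may rely on the frame of
  the first in addition to \<open>R\<close>. Times add up inside the postcondition, which is why
  later goals carry sums such as \<open>t1 + (t2 + t3)\<close>.\<close>

lemma runs_SeqF:
  assumes "runs B c1 s R"
    and "\<And>s1 t1. R s1 t1 \<Longrightarrow> agree c1 s s1 \<Longrightarrow> runs B c2 s1 (\<lambda>s2 t2. Q s2 (t1 + t2))"
  shows "runs B (Seq c1 c2) s Q"
  using runs_agree[OF assms(1)] by (rule runs_SeqI) (use assms(2) in blast)

text \<open>Termination comes for free: every iteration takes time, and the invariant bounds the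
  elapsed time \<open>t\<close>.\<close>

lemma runs_While:
  assumes init: "I s 0"
    and fit: "\<And>s' t. I s' t \<Longrightarrow> agree c s s' \<Longrightarrow> fits B e s'"
    and body: "\<And>s' t. I s' t \<Longrightarrow> agree c s s' \<Longrightarrow> aval e s' \<noteq> 0 \<Longrightarrow>
      runs B c s' (\<lambda>s'' t'. I s'' (t + (cost e + 1) + t'))"
    and exit: "\<And>s' t. I s' t \<Longrightarrow> agree c s s' \<Longrightarrow> aval e s' = 0 \<Longrightarrow> Q s' (t + (cost e + 1))"
    and bound: "\<And>s' t. I s' t \<Longrightarrow> t \<le> T"
  shows "runs B (While e c) s Q"
proof -
  have "\<exists>u s2. exec B (While e c) s1 u s2 \<and> Q s2 (t + u)"
    if "I s1 t" "agree c s s1" for s1 t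
    using that
  proof (induction "T - t" arbitrary: s1 t rule: less_induct)
    case less
    show ?case
    proof (cases "aval e s1 = 0")
      case True
      have "exec B (While e c) s1 (cost e + 1) s1"
        using fit[OF less.prems] True by (rule exec.WhileFalse)
      moreover have "Q s1 (t + (cost e + 1))" using exit[OF less.prems True] .
      ultimately show ?thesis by blast
    next
      case False
      from body[OF less.prems False] obtain u s2
        where ex: "exec B c s1 u s2" and I2: "I s2 (t + (cost e + 1) + u)"
        unfolding runs_def by blast
      have a2: "agree c s s2" using less.prems(2) exec_agree[OF ex] by (rule agree_trans)
      have "t + (cost e + 1) + u \<le> T" using bound[OF I2] .
      then have "T - (t + (cost e + 1) + u) < T - t" by linarith
      from less.hyps[OF this I2 a2] obtain w s3
        where "exec B (While e c) s2 w s3" "Q s3 (t + (cost e + 1) + u + w)" by blast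
      moreover from exec.WhileTrue[OF fit[OF less.prems] False ex this(1)]
      have "exec B (While e c) s1 (cost e + 1 + u + w) s3" .
      ultimately show ?thesis by (metis add.assoc)
    qed
  qed
  from this[OF init agree_refl] show ?thesis unfolding runs_def by simp
qed

notation Seq (infixr \<open>;;\<close> 60)
notation Assign (infix \<open>::=\<close> 65)
abbreviation eadd (infixl \<open>.+\<close> 85) where "a .+ b \<equiv> Bin Add a b"
abbreviation esub (infixl \<open>.-\<close> 85) where "a .- b \<equiv> Bin Sub a b"
abbreviation emul (infixl \<open>.*\<close> 90) where "a .* b \<equiv> Bin Mul a b"
abbreviation ediv (infixl \<open>.div\<close> 90) where "a .div b \<equiv> Bin Div a b"
abbreviation elt (infix \<open>.<\<close> 80) where "a .< b \<equiv> Bin Less a b"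
abbreviation eeq (infix \<open>.=\<close> 80) where "a .= b \<equiv> Bin Equal a b"
abbreviation load (\<open>_.[_]\<close> [1000, 0] 1000) where "load a e \<equiv> Load a e"
abbreviation store (\<open>_.[_] \<leftarrow> _\<close> [1000, 0, 66] 65) where "store a i e \<equiv> Store a i e"

section \<open>Constant-time range minimum queries\<close>

definition argmin_on :: "(nat \<Rightarrow> nat) \<Rightarrow> nat \<Rightarrow> nat \<Rightarrow> nat \<Rightarrow> bool" where
  "argmin_on A l r c \<longleftrightarrow> l \<le> c \<and> c < r \<and> (\<forall>i. l \<le> i \<and> i < r \<longrightarrow> A c \<le> A i)"

lemma ex_argmin_on: "l < r \<Longrightarrow> \<exists>c. argmin_on A l r c"
proof (induction r)
  case (Suc r)
  show ?case
  proof (cases "l < r")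
    case True
    then obtain c where c: "argmin_on A l r c" using Suc.IH by blast
    show ?thesis
    proof (cases "A r < A c")
      case True
      have "argmin_on A l (Suc r) r"
        using c True by (auto simp: argmin_on_def less_Suc_eq)
      then show ?thesis by blast
    next
      case False
      have "argmin_on A l (Suc r) c" using c False by (auto simp: argmin_on_def less_Suc_eq)
      then show ?thesis by blast
    qed
  next
    case False
    then have "argmin_on A l (Suc r) l" using Suc.prems by (auto simp: argmin_on_def less_Suc_eq)
    then show ?thesis by blast
  qed
qed simp

text \<open>The ranges may overlap, which is what a sparse table needs: a minimum does not mind if
  an element is considered twice. Of two equal values the left one is kept, in accordance with the
  strict test in the programs.\<close>

lemma argmin_on_join:
  assumes "argmin_on A l r c" "argmin_on A l' r' d" "l \<le> l'" "l' \<le> r" "r \<le> r'"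
  shows "argmin_on A l r' (if A d < A c then d else c)"
proof -
  have "A c \<le> A i \<or> A d \<le> A i" if "l \<le> i" "i < r'" for i
    using assms(1,2,4) that by (cases "i < r") (auto simp: argmin_on_def)
  then have "A (if A d < A c then d else c) \<le> A i" if "l \<le> i" "i < r'" for i
    using that by fastforce
  then show ?thesis using assms by (auto simp: argmin_on_def)
qed

section \<open>Suffix minima of a block, encoded as bit masks\<close>

definition sufmin :: "(nat \<Rightarrow> nat) \<Rightarrow> nat \<Rightarrow> nat \<Rightarrow> nat set" where
  "sufmin A base j = {k. base \<le> k \<and> k < j \<and> (\<forall>i. k \<le> i \<and> i < j \<longrightarrow> A k \<le> A i)}"

lemma finite_sufmin [simp]: "finite (sufmin A base j)"
  unfolding sufmin_def by (rule finite_subset[of _ "{..<j}"]) auto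

lemma sufmin_empty [simp]: "sufmin A base base = {}"
  by (auto simp: sufmin_def)

lemma argmin_on_sufmin: "argmin_on A l j c \<Longrightarrow> base \<le> l \<Longrightarrow> c \<in> sufmin A base j"
  by (auto simp: argmin_on_def sufmin_def)

text \<open>\<open>sufmin A base j\<close> is the content of the monotone stack after scanning the
  positions from \<open>base\<close> to \<open>j - 1\<close>. Any minimizer \<open>d\<close> of
  \<open>[l, j)\<close> is itself a suffix minimum, so the first suffix minimum
  \<open>c \<ge> l\<close> satisfies \<open>c \<le> d\<close> and therefore
  \<open>A c \<le> A d\<close>.\<close>

lemma argmin_on_first_sufmin:
  assumes "c \<in> sufmin A base j" "l \<le> c" "base \<le> l"
    and least: "\<And>k. l \<le> k \<Longrightarrow> k < c \<Longrightarrow> k \<notin> sufmin A base j"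
  shows "argmin_on A l j c"
proof -
  have cj: "c < j" using assms(1) by (simp add: sufmin_def)
  then obtain d where d: "argmin_on A l j d" using ex_argmin_on[of l j A] assms(2) by auto
  have "d \<in> sufmin A base j" using argmin_on_sufmin[OF d assms(3)] .
  then have "c \<le> d" using least[of d] d by (meson argmin_on_def not_le)
  then have "A c \<le> A d" using assms(1) d by (auto simp: sufmin_def argmin_on_def)
  then show ?thesis using d assms(2) cj unfolding argmin_on_def by (meson le_trans)
qed

text \<open>The pop condition of the monotone stack when \<open>i\<close> is pushed.
  \<open>j\<close> stands for the stack with top \<open>j - 1\<close>: \<open>low\<close> says that
  nothing surviving has been popped, \<open>cap\<close> that the rest is the stack of the prefix,
  and \<open>stop\<close> that its top survives. Values increase weakly along the stack, so all of
  the rest survives with its top.\<close>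

lemma sufmin_step:
  assumes "base \<le> j" "j \<le> i"
    and low: "\<And>k. k \<in> sufmin A base i \<Longrightarrow> A k \<le> A i \<Longrightarrow> k < j"
    and cap: "sufmin A base i \<inter> {..<j} = sufmin A base j"
    and stop: "j = base \<or> A (j - 1) \<le> A i"
  shows "sufmin A base (Suc i) = insert i (sufmin A base j)"
proof (rule set_eqI)
  fix k
  have suc: "k \<in> sufmin A base (Suc i) \<longleftrightarrow> k = i \<or> (k \<in> sufmin A base i \<and> A k \<le> A i)"
    using assms(1,2) unfolding sufmin_def
    by (auto simp: less_Suc_eq)
  have "k \<in> sufmin A base i \<and> A k \<le> A i \<longleftrightarrow> k \<in> sufmin A base j"
  proof
    assume "k \<in> sufmin A base i \<and> A k \<le> A i"
    then show "k \<in> sufmin A base j" using low cap by auto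
  next
    assume k: "k \<in> sufmin A base j"
    then have "base \<le> k" "k < j" "A k \<le> A (j - 1)" by (auto simp: sufmin_def)
    then show "k \<in> sufmin A base i \<and> A k \<le> A i" using k cap stop by auto
  qed
  then show "k \<in> sufmin A base (Suc i) \<longleftrightarrow> k \<in> insert i (sufmin A base j)" using suc by auto
qed

text \<open>Inserting the exponents in increasing order makes every addition free of carries: it
  sets a bit that is still clear.\<close>

lemma bit_sum_pow2:
  fixes S :: "nat set"
  assumes "finite S"
  shows "bit (\<Sum>k\<in>S. 2 ^ k :: nat) x \<longleftrightarrow> x \<in> S"
  using assms
proof (induction S arbitrary: x rule: finite_linorder_max_induct)
  case empty
  then show ?case by simp
next
  case (insert b S)
  have nb: "\<not> bit (\<Sum>k\<in>S. 2 ^ k :: nat) b" using insert by auto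
  have "(\<Sum>k\<in>insert b S. 2 ^ k :: nat) = set_bit b (\<Sum>k\<in>S. 2 ^ k)"
    using insert.hyps nb by (subst sum.insert) (auto simp: set_bit_eq)
  then show ?case using insert.IH by (auto simp: bit_set_bit_iff)
qed

lemma sum_pow2_less: "finite S \<Longrightarrow> (\<And>k. k \<in> S \<Longrightarrow> k < b) \<Longrightarrow> (\<Sum>k\<in>S. 2 ^ k :: nat) < 2 ^ b"
proof -
  assume "finite S" "\<And>k. k \<in> S \<Longrightarrow> k < b"
  then have "(\<Sum>k\<in>S. 2 ^ k :: nat) \<le> (\<Sum>k\<in>{..<b}. 2 ^ k)" by (intro sum_mono2) auto
  also have "\<dots> = 2 ^ b - 1" by (induction b) auto
  also have "\<dots> < 2 ^ b" by simp
  finally show ?thesis .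
qed

text \<open>In blocks of logarithmic length these masks are small enough to be indices of a table of lowest
  bits, so a query inside one block is a table lookup.\<close>

definition mask :: "(nat \<Rightarrow> nat) \<Rightarrow> nat \<Rightarrow> nat \<Rightarrow> nat" where
  "mask A base j = (\<Sum>k\<in>sufmin A base j. 2 ^ (k - base))"

lemma mask_image: "mask A base j = (\<Sum>k\<in>(\<lambda>k. k - base) ` sufmin A base j. 2 ^ k)"
proof -
  have "inj_on (\<lambda>k. k - base) (sufmin A base j)" by (auto simp: sufmin_def inj_on_def)
  then show ?thesis by (simp add: mask_def sum.reindex)
qed

lemma bit_mask: "bit (mask A base j) x \<longleftrightarrow> base + x \<in> sufmin A base j"
proof -
  have "bit (mask A base j) x \<longleftrightarrow> x \<in> (\<lambda>k. k - base) ` sufmin A base j"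
    unfolding mask_image by (rule bit_sum_pow2) simp
  also have "\<dots> \<longleftrightarrow> base + x \<in> sufmin A base j"
    by (auto simp: image_iff sufmin_def) (metis add_diff_cancel_left' le_add1)
  finally show ?thesis .
qed

lemma mask_less: "j \<le> base + b \<Longrightarrow> mask A base j < 2 ^ b"
  unfolding mask_image by (rule sum_pow2_less) (auto simp: sufmin_def)

lemma mask_empty [simp]: "mask A base base = 0"
  by (simp add: mask_def)

lemma mask_insert:
  assumes "sufmin A base (Suc i) = insert i (sufmin A base j)" "j \<le> i"
  shows "mask A base (Suc i) = mask A base j + 2 ^ (i - base)"
proof -
  have "i \<notin> sufmin A base j" using assms(2) by (auto simp: sufmin_def)
  then show ?thesis unfolding mask_def assms(1) by (subst sum.insert) auto
qed

text \<open>A relation, so that a table can be specified at nonzero words only; \<open>0\<close> has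
  no lowest bit.\<close>

definition lowbit :: "nat \<Rightarrow> nat \<Rightarrow> bool" where
  "lowbit w t \<longleftrightarrow> bit w t \<and> (\<forall>u<t. \<not> bit w u)"

lemma lowbit_less: "lowbit w t \<Longrightarrow> t < w"
proof -
  assume "lowbit w t"
  then have "bit w t" by (simp add: lowbit_def)
  then have "w div 2 ^ t \<noteq> 0" by (metis bit_iff_odd even_zero)
  then have "2 ^ t \<le> w" by (meson div_less not_le)
  then show "t < w" by (meson less_exp order_less_le_trans)
qed

lemma lowbit_double: "lowbit h t \<Longrightarrow> lowbit (2 * h) (Suc t)"
  unfolding lowbit_def by (auto simp: bit_double_iff)

lemma lowbit_odd: "odd w \<Longrightarrow> lowbit w 0"
  by (simp add: lowbit_def bit_0)

text \<open>Dividing by \<open>2 ^ (l - base)\<close> shifts the suffix minima before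
  \<open>l\<close> out of the mask; the lowest bit that remains is the first suffix minimum at or
  after \<open>l\<close>.\<close>

lemma argmin_on_lowbit:
  assumes "base \<le> l" "lowbit (mask A base j div 2 ^ (l - base)) t"
  shows "argmin_on A l j (l + t)"
proof -
  have bit: "bit (mask A base j div 2 ^ (l - base)) x \<longleftrightarrow> l + x \<in> sufmin A base j" for x
    using assms(1) by (simp add: bit_mask flip: drop_bit_eq_div add: bit_drop_bit_eq)
  show ?thesis
  proof (rule argmin_on_first_sufmin[OF _ _ assms(1)])
    show "l + t \<in> sufmin A base j" using assms(2) bit by (simp add: lowbit_def)
    show "k \<notin> sufmin A base j" if "l \<le> k" "k < l + t" for k
      using assms(2) bit[of "k - l"] that by (auto simp: lowbit_def)
  qed simp
qed

text \<open>A minimizer of the nonempty range is a suffix minimum, so its bit survives the shift;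
  the table of lowest bits is thus never consulted at \<open>0\<close>.\<close>

lemma mask_div_pos:
  assumes "base \<le> l" "l < j"
  shows "0 < mask A base j div 2 ^ (l - base)"
proof -
  obtain c where c: "argmin_on A l j c" using ex_argmin_on assms(2) by blast
  have "base + (c - base) \<in> sufmin A base j"
    using argmin_on_sufmin[OF c assms(1)] c assms(1) by (simp add: argmin_on_def)
  then have "bit (mask A base j div 2 ^ (l - base)) (c - l)"
    using c assms(1) by (simp add: bit_mask argmin_on_def flip: drop_bit_eq_div add: bit_drop_bit_eq)
  then show ?thesis by (metis bit_0_eq bot_apply bot_bool_def gr0I)
qed

section \<open>Block length and tables of binary logarithms and lowest bits\<close>

definition pow_step :: com where
  "pow_step =
     ''b'' ::= Reg ''b'' .+ Const 1 ;; ''p'' ::= Reg ''p'' .+ Reg ''p'' ;;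
        ''pw''.[Reg ''b''] \<leftarrow> Reg ''p''"

definition pow_loop :: com where
  "pow_loop = While (Reg ''p'' .< Reg ''n'' .+ Const 1) pow_step"

definition bit_step :: com where
  "bit_step =
     ''h'' ::= Reg ''x'' .div Const 2 ;;
        ''len''.[Reg ''x''] \<leftarrow> ''len''.[Reg ''h''] .+ Const 1 ;;
        If (Reg ''h'' .+ Reg ''h'' .= Reg ''x'')
          (''lb''.[Reg ''x''] \<leftarrow> ''lb''.[Reg ''h''] .+ Const 1)
          (''lb''.[Reg ''x''] \<leftarrow> Const 0) ;;
        ''x'' ::= Reg ''x'' .+ Const 1"

definition bit_loop :: com where
  "bit_loop = While (Reg ''x'' .< Reg ''p'') bit_step"

definition tables :: com where
  "tables =
     (''b'' ::= Const 0 ;; ''p'' ::= Const 1 ;; ''pw''.[Const 0] \<leftarrow> Const 1) ;; pow_loop ;;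
     (''K'' ::= Reg ''n'' .div Reg ''b'' ;; ''x'' ::= Const 1) ;; bit_loop"

lemma tables_writes:
  "wregs pow_loop = {''b'', ''p''}" "warrs pow_loop = {''pw''}"
  "wregs bit_loop = {''h'', ''x''}" "warrs bit_loop = {''len'', ''lb''}"
  "wregs tables = {''b'', ''p'', ''K'', ''x'', ''h''}" "warrs tables = {''pw'', ''len'', ''lb''}"
  by (auto simp: pow_loop_def bit_loop_def pow_step_def bit_step_def tables_def)

text \<open>The number of binary digits, so that \<open>l - 1\<close> is the binary logarithm
  rounded down. The clause \<open>l \<le> x\<close> serves the word bound: it keeps the table
  entries small.\<close>

definition bitlen :: "nat \<Rightarrow> nat \<Rightarrow> bool" where
  "bitlen x l \<longleftrightarrow> 0 < l \<and> l \<le> x \<and> 2 ^ (l - 1) \<le> x \<and> x < 2 ^ l"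

text \<open>The block length \<open>b\<close> is logarithmic from both sides:
  \<open>n < 2 ^ b\<close> leaves room for every row of the sparse table that a query can ask for,
  and \<open>2 ^ b \<le> 2 * n\<close> keeps the tables indexed by masks of linear size.\<close>

definition tables_ok :: "nat \<Rightarrow> state \<Rightarrow> bool" where
  "tables_ok n s \<longleftrightarrow>
     reg s ''n'' = n \<and> 0 < reg s ''b'' \<and> reg s ''b'' \<le> n \<and> n < 2 ^ reg s ''b'' \<and>
     2 ^ reg s ''b'' \<le> 2 * n \<and> reg s ''K'' = n div reg s ''b'' \<and>
     (\<forall>j \<le> reg s ''b''. arr s ''pw'' j = 2 ^ j) \<and>
     (\<forall>w. 0 < w \<and> w < 2 ^ reg s ''b'' \<longrightarrow> lowbit w (arr s ''lb'' w)) \<and>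
     (\<forall>w. 0 < w \<and> w < 2 ^ reg s ''b'' \<longrightarrow> bitlen w (arr s ''len'' w))"

lemma bitlen_1: "bitlen (Suc 0) (Suc 0)"
  by (simp add: bitlen_def)

lemma bitlen_step:
  assumes "0 < x div 2" "bitlen (x div 2) l"
  shows "bitlen x (Suc l)"
proof -
  obtain l' where l: "l = Suc l'" using assms(2) by (cases l) (auto simp: bitlen_def)
  show ?thesis using assms(2) unfolding bitlen_def l by (auto; linarith)
qed

lemma lowbit_half: "x div 2 + x div 2 = x \<Longrightarrow> lowbit (x div 2) t \<Longrightarrow> lowbit x (Suc t)"
  by (metis lowbit_double mult_2)

lemma lowbit_0: "x div 2 + x div 2 \<noteq> x \<Longrightarrow> lowbit x 0"
  by (rule lowbit_odd) presburger

text \<open>\<open>p\<close> doubles until it exceeds \<open>n\<close>, so it ends between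
  \<open>n + 1\<close> and \<open>2 * n\<close>. The time bound is crude on purpose:
  \<open>b \<le> n\<close> is enough for a linear total.\<close>

lemma runs_pow_loop:
  assumes B: "64 * n + 64 \<le> B" and n: "0 < n" "reg s ''n'' = n"
    and s: "reg s ''b'' = 0" "reg s ''p'' = 1" "arr s ''pw'' 0 = 1"
  shows "runs B pow_loop s
    (\<lambda>s' t. t \<le> 30 * n + 30 \<and> 0 < reg s' ''b'' \<and> reg s' ''b'' \<le> n \<and> n < 2 ^ reg s' ''b'' \<and>
       2 ^ reg s' ''b'' \<le> 2 * n \<and> reg s' ''p'' = 2 ^ reg s' ''b'' \<and>
       (\<forall>j \<le> reg s' ''b''. arr s' ''pw'' j = 2 ^ j))" (is "runs B _ s ?Q")
  unfolding pow_loop_def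
proof (rule runs_While[where T = "30 * n + 10" and I = "\<lambda>s' t. t \<le> 20 * reg s' ''b'' \<and>
    reg s' ''b'' \<le> n \<and> (0 < reg s' ''b'' \<longrightarrow> 2 ^ reg s' ''b'' \<le> 2 * n) \<and>
    reg s' ''p'' = 2 ^ reg s' ''b'' \<and> (\<forall>j \<le> reg s' ''b''. arr s' ''pw'' j = 2 ^ j)"])
  fix s' t
  assume I: "t \<le> 20 * reg s' ''b'' \<and>
    reg s' ''b'' \<le> n \<and> (0 < reg s' ''b'' \<longrightarrow> 2 ^ reg s' ''b'' \<le> 2 * n) \<and>
    reg s' ''p'' = 2 ^ reg s' ''b'' \<and> (\<forall>j \<le> reg s' ''b''. arr s' ''pw'' j = 2 ^ j)"
    and ag: "agree pow_step s s'"
  have nr: "reg s' ''n'' = n" using agree_reg[OF ag, of "''n''"] n by (simp add: pow_step_def)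
  have p: "(2::nat) ^ reg s' ''b'' \<le> 2 * n" using I n by (cases "reg s' ''b''") auto
  show "fits B (Reg ''p'' .< Reg ''n'' .+ Const 1) s'" using B I nr p by simp
  show "?Q s' (t + (cost (Reg ''p'' .< Reg ''n'' .+ Const 1) + 1))" if "aval (Reg ''p'' .< Reg ''n'' .+ Const 1) s' = 0"
  proof -
    have "n < 2 ^ reg s' ''b''" using that I nr by (simp split: if_splits)
    moreover from this n have "0 < reg s' ''b''" by (cases "reg s' ''b''") auto
    ultimately show ?thesis using I by simp
  qed
  assume "aval (Reg ''p'' .< Reg ''n'' .+ Const 1) s' \<noteq> 0"
  then have "2 ^ reg s' ''b'' \<le> n" using I nr by (simp split: if_splits)
  moreover from this have "reg s' ''b'' < n" by (meson less_exp order_less_le_trans)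
  ultimately show "runs B pow_step s' (\<lambda>s'' t'. t + (cost (Reg ''p'' .< Reg ''n'' .+ Const 1) + 1) + t' \<le> 20 * reg s'' ''b'' \<and>
    reg s'' ''b'' \<le> n \<and> (0 < reg s'' ''b'' \<longrightarrow> 2 ^ reg s'' ''b'' \<le> 2 * n) \<and>
    reg s'' ''p'' = 2 ^ reg s'' ''b'' \<and> (\<forall>j \<le> reg s'' ''b''. arr s'' ''pw'' j = 2 ^ j))"
    using B I by (simp add: pow_step_def runs_simps le_Suc_eq)
qed (use s n in auto)

text \<open>Both tables follow from the entry at \<open>h = x div 2\<close>: one more digit, and for
  even \<open>x\<close> one more trailing zero.\<close>

lemma runs_bit_loop:
  assumes B: "64 * n + 64 \<le> B"
    and s: "reg s ''p'' = P" "reg s ''x'' = 1" "arr s ''len'' 0 = 0" "0 < P" "P \<le> 2 * n"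
  shows "runs B bit_loop s
    (\<lambda>s' t. t \<le> 80 * n + 30 \<and>
     (\<forall>w. 0 < w \<and> w < P \<longrightarrow> lowbit w (arr s' ''lb'' w)) \<and>
     (\<forall>w. 0 < w \<and> w < P \<longrightarrow> bitlen w (arr s' ''len'' w)))" (is "runs B _ s ?Q")
  unfolding bit_loop_def
proof (rule runs_While[where T = "80 * n" and I = "\<lambda>s' t. t + 40 \<le> 40 * reg s' ''x'' \<and>
    reg s' ''x'' \<le> P \<and> 0 < reg s' ''x'' \<and> arr s' ''len'' 0 = 0 \<and>
     (\<forall>w. 0 < w \<and> w < reg s' ''x'' \<longrightarrow> lowbit w (arr s' ''lb'' w)) \<and>
     (\<forall>w. 0 < w \<and> w < reg s' ''x'' \<longrightarrow> bitlen w (arr s' ''len'' w))"])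
  fix s' t
  let ?I = "\<lambda>s' t. t + 40 \<le> 40 * reg s' ''x'' \<and>
    reg s' ''x'' \<le> P \<and> 0 < reg s' ''x'' \<and> arr s' ''len'' 0 = 0 \<and>
     (\<forall>w. 0 < w \<and> w < reg s' ''x'' \<longrightarrow> lowbit w (arr s' ''lb'' w)) \<and>
     (\<forall>w. 0 < w \<and> w < reg s' ''x'' \<longrightarrow> bitlen w (arr s' ''len'' w))"
  assume I: "?I s' t" and ag: "agree bit_step s s'"
  have pr: "reg s' ''p'' = P" using agree_reg[OF ag, of "''p''"] s by (simp add: bit_step_def)
  show "fits B (Reg ''x'' .< Reg ''p'') s'" using B I pr s by simp
  show "?Q s' (t + (cost (Reg ''x'' .< Reg ''p'') + 1))" if "aval (Reg ''x'' .< Reg ''p'') s' = 0"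
    using that pr I s by (simp split: if_splits)
  assume "aval (Reg ''x'' .< Reg ''p'') s' \<noteq> 0"
  then have x: "reg s' ''x'' < P" using pr by (simp split: if_splits)
  define h where "h = reg s' ''x'' div 2"
  have h: "h < reg s' ''x''" using I by (simp add: h_def)
  have len: "arr s' ''len'' h \<le> h" using I h by (cases "h = 0") (auto simp: bitlen_def)
  have lb: "arr s' ''lb'' h \<le> h" if "h + h = reg s' ''x''"
    using I h that lowbit_less[of h "arr s' ''lb'' h"] by (cases "h = 0") auto
  \<comment> \<open>At \<open>h = 0\<close> the initial memory content \<open>0\<close> serves as
    the number of digits, which gives \<open>1\<close> for \<open>x = 1\<close>.\<close>
  have bl: "bitlen (reg s' ''x'') (Suc (arr s' ''len'' h))"
  proof (cases "h = 0")
    case True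
    then have "reg s' ''x'' = 1" using I by (simp add: h_def div_eq_0_iff)
    then show ?thesis using True I bitlen_1 by simp
  next
    case False
    then show ?thesis using bitlen_step[of "reg s' ''x''"] I h by (simp add: h_def)
  qed
  have lb1: "lowbit (reg s' ''x'') (Suc (arr s' ''lb'' h))" if "h + h = reg s' ''x''"
    using lowbit_half[of "reg s' ''x''" "arr s' ''lb'' h"] I that h by (cases "h = 0") (auto simp: h_def)
  have lb0: "lowbit (reg s' ''x'') 0" if "h + h \<noteq> reg s' ''x''"
    using lowbit_0[of "reg s' ''x''"] that by (simp add: h_def)
  have hB: "h + h < B" "h < B" "Suc (arr s' ''len'' h) < B" "arr s' ''len'' h < B" "Suc (reg s' ''x'') < B"
    "h + h = reg s' ''x'' \<Longrightarrow> Suc (arr s' ''lb'' h) < B" "reg s' ''x'' < B" "2 < B" "Suc 0 < B" "0 < B"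
    using B h x s len lb by auto
  show "runs B bit_step s' (\<lambda>s'' t'. ?I s'' (t + (cost (Reg ''x'' .< Reg ''p'') + 1) + t'))"
    using hB I x bl lb1 lb0 by (auto simp: bit_step_def runs_simps less_Suc_eq simp flip: h_def)
qed (use s in auto)

lemma runs_tables:
  assumes B: "64 * n + 64 \<le> B" and n: "0 < n" "reg s ''n'' = n" and s: "arr s ''len'' 0 = 0"
  shows "runs B tables s (\<lambda>s' t. t \<le> 200 * n + 200 \<and> tables_ok n s')"
proof -
  let ?Q = "\<lambda>s' t. t \<le> 200 * n + 200 \<and> tables_ok n s'"
  show ?thesis
    unfolding tables_def
  proof (rule runs_SeqF[where R = "\<lambda>s' t. t = 7 \<and> reg s' ''b'' = 0 \<and> reg s' ''p'' = 1 \<and>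
      arr s' ''pw'' 0 = 1"])
    fix s1 and t1 :: nat assume 1: "t1 = 7 \<and> reg s1 ''b'' = 0 \<and> reg s1 ''p'' = 1 \<and> arr s1 ''pw'' 0 = 1"
      and "agree (''b'' ::= Const 0 ;; ''p'' ::= Const 1 ;; ''pw''.[Const 0] \<leftarrow> Const 1) s s1"
    then have s1: "reg s1 ''n'' = n" "arr s1 ''len'' 0 = 0" using n s by (simp_all add: agree_def)
    show "runs B (pow_loop ;; (''K'' ::= Reg ''n'' .div Reg ''b'' ;; ''x'' ::= Const 1) ;; bit_loop)
      s1 (\<lambda>s2 t2. ?Q s2 (t1 + t2))"
    proof (rule runs_SeqF[OF runs_pow_loop[OF B n(1)]])
      fix s2 t2 assume 2: "t2 \<le> 30 * n + 30 \<and> 0 < reg s2 ''b'' \<and> reg s2 ''b'' \<le> n \<and>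
       n < 2 ^ reg s2 ''b'' \<and> 2 ^ reg s2 ''b'' \<le> 2 * n \<and> reg s2 ''p'' = 2 ^ reg s2 ''b'' \<and>
       (\<forall>j \<le> reg s2 ''b''. arr s2 ''pw'' j = 2 ^ j)" and "agree pow_loop s1 s2"
      then have s2: "reg s2 ''n'' = n" "arr s2 ''len'' 0 = 0"
        using s1 by (simp_all add: agree_def tables_writes)
      have d: "n div reg s2 ''b'' < B" by (rule le_less_trans[OF div_le_dividend]) (use B in simp)
      show "runs B ((''K'' ::= Reg ''n'' .div Reg ''b'' ;; ''x'' ::= Const 1) ;; bit_loop)
        s2 (\<lambda>s3 t3. ?Q s3 (t1 + (t2 + t3)))"
      proof (rule runs_SeqF[where R = "\<lambda>s' t. t = 6 \<and> reg s' ''K'' = n div reg s2 ''b'' \<and> reg s' ''x'' = 1"])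
        fix s3 and t3 :: nat
        assume 3: "t3 = 6 \<and> reg s3 ''K'' = n div reg s2 ''b'' \<and> reg s3 ''x'' = 1"
          "agree (''K'' ::= Reg ''n'' .div Reg ''b'' ;; ''x'' ::= Const 1) s2 s3"
        then have s3: "reg s3 ''n'' = n" "arr s3 = arr s2" "reg s3 ''b'' = reg s2 ''b''"
          "reg s3 ''p'' = reg s2 ''p''"
          using s2 by (auto simp: agree_def)
        show "runs B bit_loop s3 (\<lambda>s4 t4. ?Q s4 (t1 + (t2 + (t3 + t4))))"
          by (rule runs_mono[OF runs_agree[OF runs_bit_loop[OF B refl]]])
            (use 1 2 3 s2 s3 in \<open>auto simp: agree_def tables_ok_def tables_writes\<close>)
      qed (use B s2 2 d in \<open>auto simp: runs_simps intro: le_less_trans\<close>)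
    qed (use 1 s1 in auto)
  qed (use B in \<open>auto simp: runs_simps\<close>)
qed

section \<open>Computing the masks by one scan with a monotone stack\<close>

definition prev_ok :: "(nat \<Rightarrow> nat) \<Rightarrow> (nat \<Rightarrow> nat) \<Rightarrow> nat \<Rightarrow> nat \<Rightarrow> bool" where
  "prev_ok A P base i \<longleftrightarrow> (\<forall>x. base \<le> x \<and> x < i \<longrightarrow>
     base \<le> P x \<and> P x \<le> x \<and> sufmin A base (Suc x) = insert x (sufmin A base (P x)))"

text \<open>The product is a conjunction in which both factors are always evaluated. Truncated
  subtraction keeps the index \<open>j - 1\<close> legal even when the stack is empty.\<close>

definition pop_loop :: "string \<Rightarrow> com" where
  "pop_loop A =
     While ((Reg ''base'' .< Reg ''j'') .* (A.[Reg ''i''] .< A.[Reg ''j'' .- Const 1]))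
       (''j'' ::= ''prv''.[Reg ''j'' .- Const 1])"

definition mask_step :: "string \<Rightarrow> string \<Rightarrow> com" where
  "mask_step A M =
     (If (Reg ''base'' .+ Reg ''b'' .= Reg ''i'') (''base'' ::= Reg ''i'') Skip ;;
      ''j'' ::= Reg ''i'') ;;
     pop_loop A ;;
     (''prv''.[Reg ''i''] \<leftarrow> Reg ''j'' ;;
      If (Reg ''base'' .< Reg ''j'')
        (M.[Reg ''i''] \<leftarrow> M.[Reg ''j'' .- Const 1] .+ ''pw''.[Reg ''i'' .- Reg ''base''])
        (M.[Reg ''i''] \<leftarrow> ''pw''.[Reg ''i'' .- Reg ''base'']) ;;
      ''i'' ::= Reg ''i'' .+ Const 1)"

definition mask_loop :: "string \<Rightarrow> string \<Rightarrow> com" where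
  "mask_loop A M = While (Reg ''i'' .< Reg ''n'') (mask_step A M)"

definition sparse_step :: "string \<Rightarrow> string \<Rightarrow> string \<Rightarrow> com" where
  "sparse_step A M S =
     If (Reg ''k'' .= Reg ''K'') (''k'' ::= Const 0 ;; ''j'' ::= Reg ''j'' .+ Const 1) Skip ;;
     If (Reg ''j'' .= Const 0)
       (''c'' ::= Reg ''k'' .* Reg ''b'' .+
          ''lb''.[M.[Reg ''k'' .* Reg ''b'' .+ Reg ''b'' .- Const 1]])
       (''c'' ::= S.[Reg ''x'' .- Reg ''K''] ;;
        If (Reg ''k'' .+ ''pw''.[Reg ''j'' .- Const 1] .< Reg ''K'')
          (''d'' ::= S.[Reg ''x'' .- Reg ''K'' .+ ''pw''.[Reg ''j'' .- Const 1]] ;;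
           If (A.[Reg ''d''] .< A.[Reg ''c'']) (''c'' ::= Reg ''d'') Skip)
          Skip) ;;
     S.[Reg ''x''] \<leftarrow> Reg ''c'' ;;
     ''x'' ::= Reg ''x'' .+ Const 1 ;; ''k'' ::= Reg ''k'' .+ Const 1"

definition sparse_loop :: "string \<Rightarrow> string \<Rightarrow> string \<Rightarrow> com" where
  "sparse_loop A M S = While (Reg ''x'' .< Reg ''b'' .* Reg ''K'') (sparse_step A M S)"

definition rmq_build :: "string \<Rightarrow> string \<Rightarrow> string \<Rightarrow> com" where
  "rmq_build A M S =
     (''i'' ::= Const 0 ;; ''base'' ::= Const 0) ;; mask_loop A M ;;
     (''x'' ::= Const 0 ;; ''k'' ::= Const 0 ;; ''j'' ::= Const 0) ;; sparse_loop A M S"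

lemma rmq_writes [simp]:
  "wregs (pop_loop A) = {''j''}" "warrs (pop_loop A) = {}"
  "wregs (mask_step A M) = {''base'', ''i'', ''j''}" "warrs (mask_step A M) = {''prv'', M}"
  "wregs (mask_loop A M) = {''base'', ''i'', ''j''}" "warrs (mask_loop A M) = {''prv'', M}"
  "wregs (sparse_step A M S) = {''k'', ''j'', ''c'', ''d'', ''x''}" "warrs (sparse_step A M S) = {S}"
  "wregs (sparse_loop A M S) = {''k'', ''j'', ''c'', ''d'', ''x''}" "warrs (sparse_loop A M S) = {S}"
  "wregs (rmq_build A M S) = {''base'', ''i'', ''j'', ''k'', ''c'', ''d'', ''x''}"
  "warrs (rmq_build A M S) = {''prv'', M, S}"
  by (auto simp: pop_loop_def mask_step_def mask_loop_def sparse_step_def sparse_loop_def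
      rmq_build_def)

text \<open>The stack is a linked list: \<open>P x\<close> is the prefix whose stack lies below
  \<open>x\<close>, so a pop replaces \<open>j\<close> by \<open>P (j - 1)\<close>. The hypotheses
  of \<open>sufmin_step\<close> other than \<open>stop\<close> survive the pop, since the value at
  the discarded entry \<open>j - 1\<close> exceeds \<open>A i\<close>.\<close>

lemma prev_ok_step:
  assumes ok: "prev_ok A P base i" and "base < j" "j \<le> i"
    and low: "\<And>k. k \<in> sufmin A base i \<Longrightarrow> A k \<le> A i \<Longrightarrow> k < j"
    and cap: "sufmin A base i \<inter> {..<j} = sufmin A base j" and gt: "A i < A (j - 1)"
  defines "j' \<equiv> P (j - 1)"
  shows "base \<le> j'" "j' < j" "\<And>k. k \<in> sufmin A base i \<Longrightarrow> A k \<le> A i \<Longrightarrow> k < j'"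
    "sufmin A base i \<inter> {..<j'} = sufmin A base j'"
    "card (sufmin A base j) = Suc (card (sufmin A base j'))"
proof -
  have P: "base \<le> j'" "j' \<le> j - 1" and eq: "sufmin A base j = insert (j - 1) (sufmin A base j')"
    using ok[unfolded prev_ok_def, rule_format, of "j - 1"] assms(2,3) unfolding j'_def
    by (cases j; simp)+
  show "base \<le> j'" "j' < j" using P assms(2) by auto
  have sub: "sufmin A base j' \<subseteq> {..<j'}" by (auto simp: sufmin_def)
  show "k < j'" if "k \<in> sufmin A base i" "A k \<le> A i" for k
  proof -
    have "k \<in> sufmin A base j" using low[OF that] cap that by auto
    moreover have "k \<noteq> j - 1" using gt that by auto
    ultimately show ?thesis using eq sub by auto
  qed
  have "sufmin A base i \<inter> {..<j'} = (sufmin A base i \<inter> {..<j}) \<inter> {..<j'}" using P by auto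
  also have "\<dots> = sufmin A base j'" unfolding cap eq using P sub by auto
  finally show "sufmin A base i \<inter> {..<j'} = sufmin A base j'" .
  have "j - 1 \<notin> sufmin A base j'" using sub P by auto
  then show "card (sufmin A base j) = Suc (card (sufmin A base j'))" unfolding eq by simp
qed

text \<open>Amortized: every iteration removes one stack entry, which pays 20 units. The additive 20
  covers the final evaluation of the guard.\<close>

lemma runs_pop_loop:
  assumes B: "64 * n + 64 \<le> B" and A: "\<And>x. x < n \<Longrightarrow> arr s A x < B"
    and s: "reg s ''i'' = i" "i < n" "reg s ''base'' = base" "base \<le> i" "reg s ''j'' = i"
    and ok: "prev_ok (arr s A) (arr s ''prv'') base i"
  shows "runs B (pop_loop A) s (\<lambda>s' t. base \<le> reg s' ''j'' \<and> reg s' ''j'' \<le> i \<and>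
     sufmin (arr s A) base (Suc i) = insert i (sufmin (arr s A) base (reg s' ''j'')) \<and>
     t + 20 * card (sufmin (arr s A) base (reg s' ''j'')) \<le> 20 * card (sufmin (arr s A) base i) + 20)"
  (is "runs B _ s ?Q")
proof -
  let ?S = "sufmin (arr s A) base"
  let ?I = "\<lambda>s' t. base \<le> reg s' ''j'' \<and> reg s' ''j'' \<le> i \<and>
    (\<forall>k \<in> ?S i. arr s A k \<le> arr s A i \<longrightarrow> k < reg s' ''j'') \<and>
    ?S i \<inter> {..<reg s' ''j''} = ?S (reg s' ''j'') \<and>
    t + 20 * card (?S (reg s' ''j'')) \<le> 20 * card (?S i)"
  let ?c = "''j'' ::= ''prv''.[Reg ''j'' .- Const 1]"
  show ?thesis unfolding pop_loop_def
  proof (rule runs_While[where I = ?I and T = "20 * card (?S i)"])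
    show "?I s 0" using s by (auto simp: sufmin_def)
  next
    fix s' t assume I: "?I s' t" and ag: "agree ?c s s'"
    have r: "reg s' ''i'' = i" "reg s' ''base'' = base" "arr s' = arr s"
      using ag s by (auto simp: agree_def)
    have j: "reg s' ''j'' - Suc 0 < n" "reg s' ''j'' < B" "base < B" "i < B"
      using I s B by auto
    show "fits B ((Reg ''base'' .< Reg ''j'') .* (A.[Reg ''i''] .< A.[Reg ''j'' .- Const 1])) s'"
      using r j A s B by simp
    show "?Q s' (t + (cost ((Reg ''base'' .< Reg ''j'') .* (A.[Reg ''i''] .< A.[Reg ''j'' .- Const 1])) + 1))"
      if "aval ((Reg ''base'' .< Reg ''j'') .* (A.[Reg ''i''] .< A.[Reg ''j'' .- Const 1])) s' = 0"
    proof -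
      have "reg s' ''j'' = base \<or> arr s A (reg s' ''j'' - 1) \<le> arr s A i"
        using that r I by (auto split: if_splits)
      then show ?thesis using I sufmin_step[of base "reg s' ''j''" i "arr s A"] by auto
    qed
    assume "aval ((Reg ''base'' .< Reg ''j'') .* (A.[Reg ''i''] .< A.[Reg ''j'' .- Const 1])) s' \<noteq> 0"
    then have g: "base < reg s' ''j''" "arr s A i < arr s A (reg s' ''j'' - 1)"
      using r by (auto split: if_splits)
    note st = prev_ok_step[OF ok g(1) _ _ _ g(2)]
    have st1: "base \<le> arr s ''prv'' (reg s' ''j'' - 1)" "arr s ''prv'' (reg s' ''j'' - 1) < reg s' ''j''"
     "\<forall>k \<in> ?S i. arr s A k \<le> arr s A i \<longrightarrow> k < arr s ''prv'' (reg s' ''j'' - 1)"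
     "?S i \<inter> {..<arr s ''prv'' (reg s' ''j'' - 1)} = ?S (arr s ''prv'' (reg s' ''j'' - 1))"
     "card (?S (reg s' ''j'')) = Suc (card (?S (arr s ''prv'' (reg s' ''j'' - 1))))"
      using st I by auto
    then show "runs B ?c s' (\<lambda>s'' t'. ?I s'' (t + (cost ((Reg ''base'' .< Reg ''j'') .* (A.[Reg ''i''] .< A.[Reg ''j'' .- Const 1])) + 1) + t'))"
      using I r j B by (simp add: runs_simps)
  qed (use s in auto)
qed

lemma div_block: "q * b \<le> x \<Longrightarrow> x < q * b + b \<Longrightarrow> x div b = (q::nat)"
  by (rule div_nat_eqI) (auto simp: mult.commute)

text \<open>The budget is 200 per position, of which 20 stay deposited on each stack entry, so a
  long sequence of pops is paid for by earlier pushes. The stack belongs to the current block only;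
  moving \<open>base\<close> to \<open>i\<close> at a block border empties it.\<close>

lemma runs_mask_loop:
  assumes B: "64 * n + 64 \<le> B" and A: "\<And>x. x < n \<Longrightarrow> arr s A x < B"
    and s: "reg s ''i'' = 0" "reg s ''base'' = 0" and tab: "tables_ok n s"
    and names: "M \<noteq> A" "M \<noteq> ''prv''" "M \<noteq> ''pw''" "A \<noteq> ''prv''"
  shows "runs B (mask_loop A M) s (\<lambda>s' t. t \<le> 200 * n + 20 \<and>
    (\<forall>x<n. arr s' M x = mask (arr s A) (x div reg s ''b'' * reg s ''b'') (Suc x)))"
  (is "runs B _ s ?Q")
proof -
  let ?b = "reg s ''b''"
  let ?A = "arr s A"
  let ?I = "\<lambda>s' t. reg s' ''i'' \<le> n \<and> reg s' ''base'' \<le> reg s' ''i'' \<and>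
    reg s' ''i'' \<le> reg s' ''base'' + ?b \<and> (\<exists>q. reg s' ''base'' = q * ?b) \<and>
    prev_ok ?A (arr s' ''prv'') (reg s' ''base'') (reg s' ''i'') \<and>
    (\<forall>x<reg s' ''i''. arr s' M x = mask ?A (x div ?b * ?b) (Suc x)) \<and>
    t + 20 * card (sufmin ?A (reg s' ''base'') (reg s' ''i'')) \<le> 200 * reg s' ''i''"
  show ?thesis unfolding mask_loop_def
  proof (rule runs_While[where I = ?I and T = "200 * n"])
    show "?I s 0" using s by (auto simp: prev_ok_def)
  next
    fix s' t assume I: "?I s' t" and ag: "agree (mask_step A M) s s'"
    have r: "reg s' ''n'' = n" "reg s' ''b'' = ?b" "arr s' A = ?A" "arr s' ''pw'' = arr s ''pw''"
      using ag s tab names by (auto simp: agree_def tables_ok_def)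
    have b: "0 < ?b" "?b \<le> n" "2 ^ ?b \<le> 2 * n" and pw: "\<And>j. j \<le> ?b \<Longrightarrow> arr s ''pw'' j = 2 ^ j"
      using tab by (auto simp: tables_ok_def)
    show "fits B (Reg ''i'' .< Reg ''n'') s'" using I r B by simp
    show "?Q s' (t + (cost (Reg ''i'' .< Reg ''n'') + 1))" if "aval (Reg ''i'' .< Reg ''n'') s' = 0"
      using that I r by (auto split: if_splits)
    assume "aval (Reg ''i'' .< Reg ''n'') s' \<noteq> 0"
    then have i: "reg s' ''i'' < n" using r by (simp split: if_splits)
    define i where "i = reg s' ''i''"
    define bs where "bs = i div ?b * ?b"
    have bsi: "bs \<le> i" "i < bs + ?b" using b(1) dividend_less_div_times[of ?b i]
      unfolding bs_def by (simp_all add: add.commute)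
    have step1: "runs B (If (Reg ''base'' .+ Reg ''b'' .= Reg ''i'') (''base'' ::= Reg ''i'') Skip ;;
      ''j'' ::= Reg ''i'') s' (\<lambda>s1 t1. t1 \<le> 12 \<and> reg s1 ''i'' = i \<and> reg s1 ''j'' = i \<and>
        reg s1 ''base'' = bs \<and> prev_ok ?A (arr s' ''prv'') bs i \<and> arr s1 = arr s' \<and>
        20 * card (sufmin ?A bs i) + t \<le> 200 * i)"
    proof -
      obtain q where q: "reg s' ''base'' = q * ?b" using I by auto
      have 1: "bs = i \<and> prev_ok ?A (arr s' ''prv'') bs i" if "reg s' ''base'' + ?b = i"
      proof -
        have "i = Suc q * ?b" using q that by simp
        then have "bs = i" unfolding bs_def using b(1) by simp
        then show ?thesis by (auto simp: prev_ok_def)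
      qed
      have 2: "bs = reg s' ''base''" if "reg s' ''base'' + ?b \<noteq> i"
        using div_block[of q ?b i] I q that unfolding bs_def i_def by auto
      show ?thesis using I 1 2 r B b i unfolding i_def[symmetric]
        by (cases "reg s' ''base'' + ?b = i") (auto simp: runs_simps i_def[symmetric])
    qed
    show "runs B (mask_step A M) s' (\<lambda>s'' t'. ?I s'' (t + (cost (Reg ''i'' .< Reg ''n'') + 1) + t'))"
      unfolding mask_step_def
    proof (rule runs_SeqF[OF step1])
      fix s1 :: state and t1 :: nat
      assume 1: "t1 \<le> 12 \<and> reg s1 ''i'' = i \<and> reg s1 ''j'' = i \<and>
        reg s1 ''base'' = bs \<and> prev_ok ?A (arr s' ''prv'') bs i \<and> arr s1 = arr s' \<and>
        20 * card (sufmin ?A bs i) + t \<le> 200 * i"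
      assume "agree (If (Reg ''base'' .+ Reg ''b'' .= Reg ''i'') (''base'' ::= Reg ''i'') Skip ;;
        ''j'' ::= Reg ''i'') s' s1"
      then have r1: "reg s1 ''n'' = n" "reg s1 ''b'' = ?b" using r by (auto simp: agree_def)
      let ?R = "\<lambda>s' t. bs \<le> reg s' ''j'' \<and> reg s' ''j'' \<le> i \<and>
        sufmin ?A bs (Suc i) = insert i (sufmin ?A bs (reg s' ''j'')) \<and>
        t + 20 * card (sufmin ?A bs (reg s' ''j'')) \<le> 20 * card (sufmin ?A bs i) + 20"
      have pop: "runs B (pop_loop A) s1 ?R"
        using runs_pop_loop[of n B s1 A i bs] B A 1 r i bsi by (simp add: i_def)
      show "runs B (pop_loop A ;;
        (''prv''.[Reg ''i''] \<leftarrow> Reg ''j'' ;;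
         If (Reg ''base'' .< Reg ''j'')
          (M.[Reg ''i''] \<leftarrow> M.[Reg ''j'' .- Const 1] .+ ''pw''.[Reg ''i'' .- Reg ''base''])
          (M.[Reg ''i''] \<leftarrow> ''pw''.[Reg ''i'' .- Reg ''base'']) ;;
         ''i'' ::= Reg ''i'' .+ Const 1)) s1
       (\<lambda>s2 t2. ?I s2 (t + (cost (Reg ''i'' .< Reg ''n'') + 1) + (t1 + t2)))"
      proof (rule runs_SeqF[OF pop])
        fix s2 t2 assume 2: "?R s2 t2" and "agree (pop_loop A) s1 s2"
        then have r2: "reg s2 ''n'' = n" "reg s2 ''b'' = ?b" "reg s2 ''base'' = bs" "reg s2 ''i'' = i"
          "arr s2 = arr s'"
          using 1 r1 by (auto simp: agree_def)
        define j where "j = reg s2 ''j''"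
        have j: "bs \<le> j" "j \<le> i" and eq: "sufmin ?A bs (Suc i) = insert i (sufmin ?A bs j)"
          using 2 by (auto simp: j_def)
        have "i \<notin> sufmin ?A bs j" using j by (auto simp: sufmin_def)
        then have card: "card (sufmin ?A bs (Suc i)) = Suc (card (sufmin ?A bs j))"
          unfolding eq by simp
        have mi: "mask ?A bs (Suc i) = mask ?A bs j + 2 ^ (i - bs)" by (rule mask_insert[OF eq j(2)])
        \<comment> \<open>The mask of the remaining stack is already stored at its top
          \<open>j - 1\<close>, which lies in the same block as \<open>i\<close>; only the bit of
          \<open>i\<close> has to be added.\<close>
        have mj: "arr s' M (j - Suc 0) = mask ?A bs j" if "bs < j"
        proof -
          have "(j - 1) div ?b = i div ?b"
            by (rule div_block) (use that j bsi in \<open>auto simp: bs_def\<close>)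
          then show ?thesis using I that j by (auto simp: bs_def i_def)
        qed
        have mB: "mask ?A bs (Suc i) < 2 ^ ?b" using mask_less[of "Suc i" bs ?b ?A] bsi by simp
        have pwi: "arr s' ''pw'' (i - bs) = 2 ^ (i - bs)" using pw[of "i - bs"] r bsi by simp
        have ok: "prev_ok ?A ((arr s' ''prv'')(i := j)) bs (Suc i)"
          using 1 j eq by (auto simp: prev_ok_def less_Suc_eq)
        have mm: "mask ?A bs j + 2 ^ (i - bs) < B" "(2::nat) ^ (i - bs) < B" "mask ?A bs j < B"
          using mB mi b B by - linarith+
        have m0: "mask ?A bs j = 0" if "\<not> bs < j" using that j by (simp add: le_antisym)
        have bq: "\<exists>q. bs = q * ?b" by (auto simp: bs_def)
        have ne: "reg s2 ''j'' = j" by (simp add: j_def)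
        have iB: "Suc i < B" "i < B" "j < B" "bs < B" "i < n" "Suc 0 < B" "0 < B"
          using i j bsi B unfolding i_def[symmetric] by auto
        have all: "\<forall>x<Suc i. ((arr s' M)(i := mask ?A bs (Suc i))) x = mask ?A (x div ?b * ?b) (Suc x)"
          using I by (auto simp: less_Suc_eq i_def[symmetric] bs_def)
        show "runs B (''prv''.[Reg ''i''] \<leftarrow> Reg ''j'' ;;
         If (Reg ''base'' .< Reg ''j'')
          (M.[Reg ''i''] \<leftarrow> M.[Reg ''j'' .- Const 1] .+ ''pw''.[Reg ''i'' .- Reg ''base''])
          (M.[Reg ''i''] \<leftarrow> ''pw''.[Reg ''i'' .- Reg ''base'']) ;;
         ''i'' ::= Reg ''i'' .+ Const 1) s2
         (\<lambda>s3 t3. ?I s3 (t + (cost (Reg ''i'' .< Reg ''n'') + 1) + (t1 + (t2 + t3))))"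
        proof (cases "bs < j")
          case True
          show ?thesis
            using True r2 ne iB mj mi pwi mm ok all 1 2 card bsi names bq
            by (auto simp: runs_simps mj pwi mi bs_def[symmetric])
        next
          case False
          have jb: "j = bs" using False j by simp
          show ?thesis
            using iB mm ok all 1 2 card bsi bq names m0 mi unfolding jb
            by (auto simp add: runs_simps r2 ne[unfolded jb] pwi)
        qed
      qed
    qed
  qed auto
qed

text \<open>Entry $y = jK + k$ of the flattened sparse table is for the blocks $k, \dots, k + 2^j - 1$,
  clipped at the number \<open>K\<close> of full blocks.\<close>

definition sparse_ok :: "(nat \<Rightarrow> nat) \<Rightarrow> nat \<Rightarrow> nat \<Rightarrow> nat \<Rightarrow> nat \<Rightarrow> bool" where
  "sparse_ok A b K y v \<longleftrightarrow> argmin_on A (y mod K * b) (min (y mod K + 2 ^ (y div K)) K * b) v"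

section \<open>Sparse table over the block minima\<close>

lemma sparse_ok_0:
  "k < K \<Longrightarrow> argmin_on A (k * b) (k * b + b) v \<Longrightarrow> sparse_ok A b K k v"
  by (simp add: sparse_ok_def min_def Suc_le_eq add.commute)

lemma div_mod_row:
  fixes j K k :: nat
  assumes "k < K"
  shows "(j * K + k) div K = j" "(j * K + k) mod K = k"
  using assms by simp_all

text \<open>The window already reaches the last full block, so doubling its length adds
  nothing.\<close>

lemma sparse_ok_clip:
  assumes "k < K" "sparse_ok A b K (j * K + k) c" "\<not> k + 2 ^ j < K"
  shows "sparse_ok A b K (Suc j * K + k) c"
proof -
  have "min (k + 2 ^ j) K = K" "min (k + 2 ^ Suc j) K = K" using assms(3) by auto
  then show ?thesis using assms(1,2) unfolding sparse_ok_def div_mod_row[OF assms(1)] by simp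
qed

text \<open>The two halves abut. The right one may itself be clipped, and clipping it gives the same
  end as clipping the doubled window.\<close>

lemma sparse_ok_join:
  assumes "k + 2 ^ j < K" "sparse_ok A b K (j * K + k) c" "sparse_ok A b K (j * K + (k + 2 ^ j)) d"
  shows "sparse_ok A b K (Suc j * K + k) (if A d < A c then d else c)"
proof -
  have k: "k < K" using assms(1) by simp
  have 1: "min (k + 2 ^ j) K = k + 2 ^ j" using assms(1) by simp
  have 2: "min (k + 2 ^ j + 2 ^ j) K = min (k + 2 ^ Suc j) K" by simp
  show ?thesis
    using argmin_on_join[of A "k * b" "(k + 2 ^ j) * b" c "(k + 2 ^ j) * b"
        "min (k + 2 ^ Suc j) K * b" d] assms(2,3)
    unfolding sparse_ok_def div_mod_row[OF k] div_mod_row[OF assms(1)] 1 2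
    by (simp add: mult_le_mono1 assms(1) less_imp_le)
qed

lemma sparse_okD:
  assumes "sparse_ok A b K y v" "b * K \<le> n"
  shows "v < n"
proof -
  have "v < min (y mod K + 2 ^ (y div K)) K * b" using assms(1) by (simp add: sparse_ok_def argmin_on_def)
  also have "\<dots> \<le> K * b" by (rule mult_le_mono1) simp
  also have "\<dots> \<le> n" using assms(2) by (simp add: mult.commute)
  finally show ?thesis .
qed

text \<open>The table has \<open>b\<close> rows of \<open>K = n div b\<close> entries, hence at most
  \<open>n\<close> entries in all; this is what the logarithmic block length buys. A single loop
  runs through the flat index \<open>x\<close>, with row \<open>j\<close> and column
  \<open>k\<close> as counters.\<close>

lemma runs_sparse_loop:
  assumes B: "64 * n + 64 \<le> B" and A: "\<And>x. x < n \<Longrightarrow> arr s A x < B"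
    and s: "reg s ''x'' = 0" "reg s ''k'' = 0" "reg s ''j'' = 0" and tab: "tables_ok n s"
    and M: "\<And>x. x < n \<Longrightarrow>
      arr s M x = mask (arr s A) (x div reg s ''b'' * reg s ''b'') (Suc x)"
    and names: "S \<noteq> A" "S \<noteq> M" "S \<noteq> ''pw''" "S \<noteq> ''lb''"
  shows "runs B (sparse_loop A M S) s (\<lambda>s' t. t \<le> 200 * n + 20 \<and>
    (\<forall>y < reg s ''b'' * reg s ''K''. sparse_ok (arr s A) (reg s ''b'') (reg s ''K'') y (arr s' S y)))"
  (is "runs B _ s ?Q")
proof -
  let ?b = "reg s ''b''"
  let ?K = "reg s ''K''"
  let ?A = "arr s A"
  let ?g = "Reg ''x'' .< Reg ''b'' .* Reg ''K''"
  have tb: "0 < ?b" "?b \<le> n" "2 ^ ?b \<le> 2 * n" "n < 2 ^ ?b" "?K = n div ?b"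
    and pw: "\<And>j. j \<le> ?b \<Longrightarrow> arr s ''pw'' j = 2 ^ j"
    and lb: "\<And>w. 0 < w \<Longrightarrow> w < 2 ^ ?b \<Longrightarrow> lowbit w (arr s ''lb'' w)"
    using tab by (auto simp: tables_ok_def)
  have bK: "?b * ?K \<le> n" using tb(5) by simp
  have KN: "?K \<le> n" using tb(5) by simp
  let ?ok = "sparse_ok ?A ?b ?K"
  let ?I = "\<lambda>s' t. reg s' ''x'' = reg s' ''j'' * ?K + reg s' ''k'' \<and> reg s' ''k'' \<le> ?K \<and>
    reg s' ''x'' \<le> ?b * ?K \<and> (\<forall>y < reg s' ''x''. ?ok y (arr s' S y)) \<and> t \<le> 100 * reg s' ''x''"
  show ?thesis unfolding sparse_loop_def
  proof (rule runs_While[where I = ?I and T = "100 * n"])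
    show "?I s 0" using s by auto
    show "t \<le> 100 * n" if "?I s' t" for s' t using that bK by auto
  next
    fix s' t assume I: "?I s' t" and ag: "agree (sparse_step A M S) s s'"
    have r: "reg s' ''n'' = n" "reg s' ''b'' = ?b" "reg s' ''K'' = ?K" "arr s' A = ?A"
      "arr s' ''pw'' = arr s ''pw''" "arr s' ''lb'' = arr s ''lb''" "arr s' M = arr s M"
      using ag s tab names by (auto simp: agree_def tables_ok_def)
    have kB: "?b < B" "?K < B" "?b * ?K < B" "2 ^ ?b < B" "Suc 0 < B" "0 < B" "n < B"
    proof -
    have "?K \<le> n" using tb(5) by simp
    then show "?b < B" "?K < B" "?b * ?K < B" "2 ^ ?b < B" "Suc 0 < B" "0 < B" "n < B"
      using tb(2,3) B bK by - linarith+
  qed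
    show "fits B ?g s'" using I r kB by simp
    show "?Q s' (t + (cost ?g + 1))" if "aval ?g s' = 0"
      using that I r bK by (auto split: if_splits)
    assume "aval ?g s' \<noteq> 0"
    then have x: "reg s' ''x'' < ?b * ?K" using r by (simp split: if_splits)
    define j k where "j = (if reg s' ''k'' = ?K then Suc (reg s' ''j'') else reg s' ''j'')"
      and "k = (if reg s' ''k'' = ?K then 0 else reg s' ''k'')"
    define x where "x = reg s' ''x''"
    have K0: "0 < ?K" using x by (cases "?K = 0") auto
    have k: "k < ?K" and xjk: "x = j * ?K + k" using I K0 by (auto simp: j_def k_def x_def)
    have jb: "j < ?b"
    proof (rule ccontr)
      assume "\<not> j < ?b"
      then have "?b * ?K \<le> j * ?K" by simp
      then show False using x xjk unfolding x_def[symmetric] by linarith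
    qed
    have step1: "runs B (If (Reg ''k'' .= Reg ''K'') (''k'' ::= Const 0 ;; ''j'' ::= Reg ''j'' .+ Const 1) Skip)
      s' (\<lambda>s1 t1. t1 \<le> 12 \<and> reg s1 ''j'' = j \<and> reg s1 ''k'' = k \<and> arr s1 = arr s')"
      using r kB I jb by (auto simp: runs_simps j_def k_def split: if_splits)
    let ?c0 = "''c'' ::= Reg ''k'' .* Reg ''b'' .+
      ''lb''.[M.[Reg ''k'' .* Reg ''b'' .+ Reg ''b'' .- Const 1]]"
    let ?c1 = "''c'' ::= S.[Reg ''x'' .- Reg ''K''] ;;
        If (Reg ''k'' .+ ''pw''.[Reg ''j'' .- Const 1] .< Reg ''K'')
          (''d'' ::= S.[Reg ''x'' .- Reg ''K'' .+ ''pw''.[Reg ''j'' .- Const 1]] ;;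
           If (A.[Reg ''d''] .< A.[Reg ''c'']) (''c'' ::= Reg ''d'') Skip)
          Skip"
    have kb: "k * ?b + ?b \<le> n"
    proof -
      have "Suc k * ?b \<le> ?K * ?b" using k by (intro mult_le_mono1) simp
      then show ?thesis using bK by (simp add: mult.commute)
    qed
    have xB: "x < n" using x bK x_def by simp
    show "runs B (sparse_step A M S) s' (\<lambda>s'' t'. ?I s'' (t + (cost ?g + 1) + t'))"
      unfolding sparse_step_def
    proof (rule runs_SeqF[OF step1])
      fix s1 :: state and t1 :: nat
      assume 1: "t1 \<le> 12 \<and> reg s1 ''j'' = j \<and> reg s1 ''k'' = k \<and> arr s1 = arr s'"
      assume "agree (If (Reg ''k'' .= Reg ''K'') (''k'' ::= Const 0 ;; ''j'' ::= Reg ''j'' .+ Const 1) Skip) s' s1"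
      then have r1: "reg s1 ''b'' = ?b" "reg s1 ''K'' = ?K" "reg s1 ''x'' = x"
        using r by (auto simp: agree_def x_def)
      have step2: "runs B (If (Reg ''j'' .= Const 0) ?c0 ?c1) s1
        (\<lambda>s2 t2. t2 \<le> 60 \<and> ?ok x (reg s2 ''c''))"
      proof (cases j)
        case 0
        \<comment> \<open>\<open>?e\<close> is the last position of block \<open>k\<close>. Its mask
          describes the whole block, so the lowest bit of the unshifted mask gives the
          minimizer.\<close>
        let ?e = "k * ?b + ?b - Suc 0"
        have e: "?e < n" "?e div ?b = k" "Suc ?e = k * ?b + ?b"
          using kb tb(1) by (auto intro!: div_block)
        have m: "arr s' M ?e = mask ?A (k * ?b) (k * ?b + ?b)"
          using M[OF e(1)] e r by simp
        define w where "w = mask ?A (k * ?b) (k * ?b + ?b)"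
        have w: "0 < w" "w < 2 ^ ?b"
          using mask_div_pos[of "k * ?b" "k * ?b" "k * ?b + ?b" ?A] mask_less[of "k * ?b + ?b" "k * ?b" ?b ?A] tb(1)
          by (auto simp: w_def)
        have l: "lowbit w (arr s ''lb'' w)" using lb w by blast
        have am: "argmin_on ?A (k * ?b) (k * ?b + ?b) (k * ?b + arr s ''lb'' w)"
          by (rule argmin_on_lowbit[of "k * ?b"]) (use l in \<open>auto simp: w_def\<close>)
        then have "k * ?b + arr s ''lb'' w < n" using kb by (simp add: argmin_on_def)
        moreover have "?ok x (k * ?b + arr s ''lb'' w)"
          using sparse_ok_0[OF k am] xjk 0 by simp
        moreover have "k * ?b < B" "k < B" "?e < B" "k * ?b + ?b < B" "w < B" "arr s ''lb'' w < B"
          using kb kB k w \<open>k * ?b + arr s ''lb'' w < n\<close> by - linarith+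
        ultimately show ?thesis
          using 0 1 r r1 kB m by (simp add: runs_simps w_def[symmetric])
      next
        case (Suc i)
        \<comment> \<open>The same block in the previous row is \<open>K\<close> entries back in the
          flat table.\<close>
        have xk: "x - ?K = i * ?K + k" using xjk Suc by simp
        have ib: "i < ?b" using jb Suc by simp
        have x1: "x - ?K < x" using xk xjk Suc K0 by simp
        let ?c = "arr s' S (i * ?K + k)"
        have c: "?ok (i * ?K + k) ?c" using I x1 xk by (auto simp: x_def[symmetric])
        then have cn: "?c < n" using bK by (rule sparse_okD)
        have pwi: "arr s ''pw'' i = 2 ^ i" using pw ib by simp
        have pB: "(2::nat) ^ i < B" using ib kB(4) power_strict_increasing[of i ?b "2::nat"] by linarith
        have iB: "x < B" "x - ?K < B" "k + 2 ^ i < B" "k < B" "i < B" "Suc i < B" "x - ?K + 2 ^ i < B"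
          "?c < B" "?K < B"
          using ib pB xB k kB tb(2,3) KN B cn power_strict_increasing[of i ?b "2::nat"] by linarith+
        show ?thesis
        proof (cases "k + 2 ^ i < ?K")
          case False
          have "?ok x ?c" using sparse_ok_clip[OF k c False] xjk Suc by simp
          then show ?thesis
            using False 1 iB pB by (simp add: runs_simps r r1 pwi xk Suc)
        next
          case True
          let ?d = "arr s' S (i * ?K + (k + 2 ^ i))"
          have "i * ?K + (k + 2 ^ i) < x" using True xjk Suc by simp
          then have d: "?ok (i * ?K + (k + 2 ^ i)) ?d" using I by (auto simp: x_def[symmetric])
          then have dn: "?d < n" using bK by (rule sparse_okD)
          have dB: "?d < B" "i * ?K + (k + 2 ^ i) < B"
            using dn kB \<open>i * ?K + (k + 2 ^ i) < x\<close> iB by linarith+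
          have "?ok x (if ?A ?d < ?A ?c then ?d else ?c)"
            using sparse_ok_join[OF True c d] xjk Suc by simp
          then show ?thesis
            using True 1 iB pB A[OF dn] A[OF cn] dB \<open>i * ?K + (k + 2 ^ i) < x\<close>
            by (simp add: runs_simps r r1 pwi xk Suc add.assoc split: if_splits)
        qed
      qed
      show "runs B (If (Reg ''j'' .= Const 0) ?c0 ?c1 ;; S.[Reg ''x''] \<leftarrow> Reg ''c'' ;;
          ''x'' ::= Reg ''x'' .+ Const 1 ;; ''k'' ::= Reg ''k'' .+ Const 1) s1
        (\<lambda>s2 t2. ?I s2 (t + (cost ?g + 1) + (t1 + t2)))"
      proof (rule runs_SeqF[OF step2])
        fix s2 :: state and t2 :: nat
        assume 2: "t2 \<le> 60 \<and> ?ok x (reg s2 ''c'')"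
        assume "agree (If (Reg ''j'' .= Const 0) ?c0 ?c1) s1 s2"
        then have r2: "reg s2 ''b'' = ?b" "reg s2 ''K'' = ?K" "reg s2 ''x'' = x" "reg s2 ''j'' = j"
          "reg s2 ''k'' = k" "arr s2 = arr s'"
          using r1 1 by (auto simp: agree_def)
        have c: "reg s2 ''c'' < B" using sparse_okD[OF conjunct2[OF 2] bK] B by linarith
        have all: "\<forall>y<Suc x. ?ok y (if y = x then reg s2 ''c'' else arr s' S y)"
          using I 2 by (simp add: x_def less_Suc_eq)
        have xB': "Suc x < B" "Suc k < B" "Suc x \<le> ?b * ?K" "Suc k \<le> ?K"
          using xB B k KN x by (simp_all add: x_def)
        have xt: "t \<le> 100 * x" using I by (simp add: x_def)
        show "runs B (S.[Reg ''x''] \<leftarrow> Reg ''c'' ;;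
          ''x'' ::= Reg ''x'' .+ Const 1 ;; ''k'' ::= Reg ''k'' .+ Const 1) s2
          (\<lambda>s3 t3. ?I s3 (t + (cost ?g + 1) + (t1 + (t2 + t3))))"
          using 1 2 all xB' c xt kB by (simp add: runs_simps r2 xjk[symmetric])
      qed
    qed
  qed
qed

definition rmq_ok :: "nat \<Rightarrow> string \<Rightarrow> string \<Rightarrow> string \<Rightarrow> state \<Rightarrow> bool" where
  "rmq_ok n A M S s \<longleftrightarrow>
     (\<forall>x<n. arr s M x = mask (arr s A) (x div reg s ''b'' * reg s ''b'') (Suc x)) \<and>
     (\<forall>y < reg s ''b'' * reg s ''K''. sparse_ok (arr s A) (reg s ''b'') (reg s ''K'') y (arr s S y))"

lemma runs_rmq_build:
  assumes B: "64 * n + 64 \<le> B" and A: "\<And>x. x < n \<Longrightarrow> arr s A x < B" and tab: "tables_ok n s"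
    and names: "distinct [A, M, S, ''prv'', ''pw'', ''lb'', ''len'']"
  shows "runs B (rmq_build A M S) s (\<lambda>s' t. t \<le> 500 * n + 100 \<and> rmq_ok n A M S s')"
  unfolding rmq_build_def
proof (rule runs_SeqF[where R = "\<lambda>s' t. t = 4 \<and> reg s' ''i'' = 0 \<and> reg s' ''base'' = 0"])
  show "runs B (''i'' ::= Const 0 ;; ''base'' ::= Const 0) s
    (\<lambda>s' t. t = 4 \<and> reg s' ''i'' = 0 \<and> reg s' ''base'' = 0)"
    using B by (auto simp: runs_simps)
next
  fix s1 :: state and t1 :: nat
  assume 1: "t1 = 4 \<and> reg s1 ''i'' = 0 \<and> reg s1 ''base'' = 0"
    and "agree (''i'' ::= Const 0 ;; ''base'' ::= Const 0) s s1"
  then have s1: "arr s1 = arr s" "tables_ok n s1" "reg s1 ''b'' = reg s ''b''"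
    "reg s1 ''K'' = reg s ''K''"
    using tab by (auto simp: agree_def tables_ok_def)
  show "runs B (mask_loop A M ;; (''x'' ::= Const 0 ;; ''k'' ::= Const 0 ;; ''j'' ::= Const 0) ;;
      sparse_loop A M S) s1 (\<lambda>s2 t2. t1 + t2 \<le> 500 * n + 100 \<and> rmq_ok n A M S s2)"
  proof (rule runs_SeqF[OF runs_mask_loop[OF B, where A = A]])
    fix s2 t2
    assume 2: "t2 \<le> 200 * n + 20 \<and> (\<forall>x<n. arr s2 M x =
      mask (arr s1 A) (x div reg s1 ''b'' * reg s1 ''b'') (Suc x))" and ag: "agree (mask_loop A M) s1 s2"
    have "arr s2 A = arr s1 A" "arr s2 ''pw'' = arr s1 ''pw''" "arr s2 ''lb'' = arr s1 ''lb''"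
      "arr s2 ''len'' = arr s1 ''len''"
      by (rule agree_arr[OF ag], use names in auto)+
    moreover have "reg s2 ''b'' = reg s1 ''b''" "reg s2 ''K'' = reg s1 ''K''" "reg s2 ''n'' = reg s1 ''n''"
      by (rule agree_reg[OF ag], simp)+
    ultimately have s2: "arr s2 A = arr s A" "tables_ok n s2" "reg s2 ''b'' = reg s ''b''"
      "reg s2 ''K'' = reg s ''K''"
      using s1 by (simp_all add: tables_ok_def)
    show "runs B ((''x'' ::= Const 0 ;; ''k'' ::= Const 0 ;; ''j'' ::= Const 0) ;; sparse_loop A M S)
      s2 (\<lambda>s3 t3. t1 + (t2 + t3) \<le> 500 * n + 100 \<and> rmq_ok n A M S s3)"
    proof (rule runs_SeqF[where R = "\<lambda>s' t. t = 6 \<and> reg s' ''x'' = 0 \<and> reg s' ''k'' = 0 \<and> reg s' ''j'' = 0"])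
      show "runs B (''x'' ::= Const 0 ;; ''k'' ::= Const 0 ;; ''j'' ::= Const 0) s2
        (\<lambda>s' t. t = 6 \<and> reg s' ''x'' = 0 \<and> reg s' ''k'' = 0 \<and> reg s' ''j'' = 0)"
        using B by (auto simp: runs_simps)
    next
      fix s3 :: state and t3 :: nat
      assume 3: "t3 = 6 \<and> reg s3 ''x'' = 0 \<and> reg s3 ''k'' = 0 \<and> reg s3 ''j'' = 0"
        and "agree (''x'' ::= Const 0 ;; ''k'' ::= Const 0 ;; ''j'' ::= Const 0) s2 s3"
      then have s3: "arr s3 = arr s2" "tables_ok n s3" "reg s3 ''b'' = reg s ''b''"
        "reg s3 ''K'' = reg s ''K''"
        using s2 by (auto simp: agree_def tables_ok_def)
      show "runs B (sparse_loop A M S) s3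
        (\<lambda>s4 t4. t1 + (t2 + (t3 + t4)) \<le> 500 * n + 100 \<and> rmq_ok n A M S s4)"
        by (rule runs_mono[OF runs_agree[OF runs_sparse_loop[OF B, where A = A and M = M]]])
          (use 1 2 3 s1 s2 s3 A names in \<open>auto simp: agree_def rmq_ok_def\<close>)
    qed
  qed (use 1 s1 A names in auto)
qed

section \<open>Answering a range minimum query\<close>

definition better :: "string \<Rightarrow> com" where
  "better A = If (A.[Reg ''qc''] .< A.[Reg ''qi'']) (''qi'' ::= Reg ''qc'') Skip"

text \<open>Meant for \<open>l\<close> and \<open>r\<close> in the same block. The argument of
  \<open>''pw''\<close> is the offset of \<open>l\<close> in that block, expressed by division and
  multiplication.\<close>

abbreviation inblock :: "string \<Rightarrow> aexp \<Rightarrow> aexp \<Rightarrow> aexp" where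
  "inblock M l r \<equiv> l .+ ''lb''.[M.[r] .div ''pw''.[l .- (l .div Reg ''b'' .* Reg ''b'')]]"

definition rmq_mid :: "string \<Rightarrow> string \<Rightarrow> com" where
  "rmq_mid A S =
     If (Reg ''kl'' .+ Const 1 .< Reg ''kr'')
       (''qj'' ::= ''len''.[Reg ''kr'' .- Reg ''kl'' .- Const 1] .- Const 1 ;;
        (''qc'' ::= S.[Reg ''qj'' .* Reg ''K'' .+ Reg ''kl'' .+ Const 1] ;; better A) ;;
        (''qc'' ::= S.[Reg ''qj'' .* Reg ''K'' .+ Reg ''kr'' .- ''pw''.[Reg ''qj'']] ;; better A))
       Skip"

definition rmq_query :: "string \<Rightarrow> string \<Rightarrow> string \<Rightarrow> com" where
  "rmq_query A M S =
     (''kl'' ::= Reg ''ql'' .div Reg ''b'' ;; ''kr'' ::= Reg ''qr'' .div Reg ''b'') ;;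
     If (Reg ''kl'' .= Reg ''kr'')
       (''qi'' ::= inblock M (Reg ''ql'') (Reg ''qr''))
       (''qi'' ::= inblock M (Reg ''ql'') (Reg ''kl'' .* Reg ''b'' .+ Reg ''b'' .- Const 1) ;;
        rmq_mid A S ;;
        (''qc'' ::= inblock M (Reg ''kr'' .* Reg ''b'') (Reg ''qr'') ;; better A))"

lemma better_writes [simp]: "wregs (better A) = {''qi''}" "warrs (better A) = {}"
  by (auto simp: better_def)

lemma rmq_mid_writes [simp]:
  "wregs (rmq_mid A S) = {''qj'', ''qc'', ''qi''}" "warrs (rmq_mid A S) = {}"
  by (auto simp: rmq_mid_def)

lemma rmq_query_writes [simp]:
  "wregs (rmq_query A M S) = {''kl'', ''kr'', ''qj'', ''qc'', ''qi''}" "warrs (rmq_query A M S) = {}"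
  by (auto simp: rmq_query_def)

lemma runs_IfT:
  assumes "fits B e s" "aval e s \<noteq> 0" "runs B c1 s (\<lambda>s' t. Q s' (cost e + 1 + t))"
  shows "runs B (If e c1 c2) s Q"
  using assms by (simp add: runs_If)

lemma runs_IfF:
  assumes "fits B e s" "aval e s = 0" "runs B c2 s (\<lambda>s' t. Q s' (cost e + 1 + t))"
  shows "runs B (If e c1 c2) s Q"
  using assms by (simp add: runs_If)

lemma runs_better:
  assumes "64 * n + 64 \<le> B" "\<And>x. x < n \<Longrightarrow> arr s A x < B" "reg s ''qi'' < n" "reg s ''qc'' < n"
  shows "runs B (better A) s (\<lambda>s' t. t \<le> 10 \<and>
    reg s' ''qi'' = (if arr s A (reg s ''qc'') < arr s A (reg s ''qi'') then reg s ''qc'' else reg s ''qi''))"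
  using assms by (auto simp: better_def runs_simps)

text \<open>The mask stored at \<open>r\<close> describes the block of \<open>r\<close> up to
  \<open>r\<close>; as \<open>l\<close> lies in the same block, shifting by the offset of
  \<open>l\<close> leaves the range from \<open>l\<close> to \<open>r\<close>. The other conclusions
  are word bounds for evaluating \<open>inblock\<close>.\<close>

lemma argmin_inblock:
  assumes B: "64 * n + 64 \<le> B" and tab: "tables_ok n s" and rmq: "rmq_ok n A M S s"
    and l: "l \<le> r" "r < n" "l div reg s ''b'' = r div reg s ''b''"
  defines "w \<equiv> arr s M r div arr s ''pw'' (l - l div reg s ''b'' * reg s ''b'')"
  shows "argmin_on (arr s A) l (Suc r) (l + arr s ''lb'' w)" "arr s M r < B" "w < B"
    "arr s ''pw'' (l - l div reg s ''b'' * reg s ''b'') < B"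
proof -
  let ?b = "reg s ''b''"
  let ?base = "l div ?b * ?b"
  have tb: "0 < ?b" "2 ^ ?b \<le> 2 * n" and pw: "\<And>j. j \<le> ?b \<Longrightarrow> arr s ''pw'' j = 2 ^ j"
    and lb: "\<And>w. 0 < w \<Longrightarrow> w < 2 ^ ?b \<Longrightarrow> lowbit w (arr s ''lb'' w)"
    using tab by (auto simp: tables_ok_def)
  have m: "arr s M r = mask (arr s A) ?base (Suc r)" using rmq l by (simp add: rmq_ok_def)
  have rb: "Suc r \<le> ?base + ?b"
    unfolding l(3) using dividend_less_div_times[OF tb(1), of r] by (simp add: Suc_le_eq add.commute)
  have lb': "?base \<le> l" "l - ?base \<le> ?b" using rb l(1) by auto
  have wm: "w = mask (arr s A) ?base (Suc r) div 2 ^ (l - ?base)"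
    unfolding w_def m using pw lb' by simp
  have mb: "mask (arr s A) ?base (Suc r) < 2 ^ ?b" using mask_less[OF rb] .
  have w: "0 < w" "w < 2 ^ ?b"
    using mask_div_pos[OF lb'(1), of "Suc r" "arr s A"] l(1) le_less_trans[OF div_le_dividend mb]
    by (auto simp: wm)
  show "argmin_on (arr s A) l (Suc r) (l + arr s ''lb'' w)"
    using lb[OF w] by (intro argmin_on_lowbit[OF lb'(1)]) (simp add: wm[symmetric])
  show "arr s M r < B" using mb m tb B by linarith
  show "w < B" using w tb B by linarith
  have "arr s ''pw'' (l - ?base) \<le> 2 ^ ?b" using pw lb'(2) by (simp add: power_increasing)
  then show "arr s ''pw'' (l - ?base) < B" using tb B by linarith
qed

text \<open>Strictly between blocks \<open>kl\<close> and \<open>kr\<close> lie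
  \<open>g = kr - kl - 1\<close> full blocks. If \<open>2 ^ j \<le> g < 2 ^ (j + 1)\<close>, two
  windows of length \<open>2 ^ j\<close>, one at each end, cover them, and the minimizer in
  \<open>qi\<close> is extended by one window after the other.\<close>

lemma runs_rmq_mid:
  assumes B: "64 * n + 64 \<le> B" and A: "\<And>x. x < n \<Longrightarrow> arr s A x < B" and tab: "tables_ok n s"
    and rmq: "rmq_ok n A M S s"
    and s: "reg s ''kl'' = kl" "reg s ''kr'' = kr" "kl < kr" "kr \<le> reg s ''K''"
      "argmin_on (arr s A) l (Suc kl * reg s ''b'') (reg s ''qi'')" "l < Suc kl * reg s ''b''"
  shows "runs B (rmq_mid A S) s (\<lambda>s' t. t \<le> 70 \<and>
    argmin_on (arr s A) l (kr * reg s ''b'') (reg s' ''qi''))" (is "runs B _ s ?Q")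
proof -
  let ?b = "reg s ''b''"
  let ?K = "reg s ''K''"
  let ?A = "arr s A"
  have tb: "0 < ?b" "?b \<le> n" "n < 2 ^ ?b" "2 ^ ?b \<le> 2 * n" "?K = n div ?b"
    and pw: "\<And>j. j \<le> ?b \<Longrightarrow> arr s ''pw'' j = 2 ^ j"
    using tab by (auto simp: tables_ok_def)
  have bK: "?b * ?K \<le> n" and KN: "?K \<le> n" using tb(5) by simp_all
  have krb: "kr * ?b \<le> n"
    using mult_le_mono1[OF s(4), of ?b] bK unfolding mult.commute[of ?b] by (rule le_trans)
  have kB: "Suc kl < B" "kr < B" "kl < B" "Suc 0 < B" "kr - Suc 0 < B" "?K < B" using s KN B by linarith+
  show ?thesis
  proof (cases "Suc kl < kr")
    case False
    then have "Suc kl = kr" using s by simp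
    then show ?thesis using s kB by (auto simp: rmq_mid_def runs_simps)
  next
    case True
    define g where "g = kr - kl - 1"
    define j where "j = arr s ''len'' g - 1"
    have g: "0 < g" "g < 2 ^ ?b" "g < n"
      using True s KN tb(3) by (auto simp: g_def)
    then have bl: "bitlen g (arr s ''len'' g)" using tab by (simp add: tables_ok_def)
    then have j: "2 ^ j \<le> g" "g < 2 ^ Suc j" "arr s ''len'' g = Suc j" "Suc j \<le> g"
      by (auto simp: bitlen_def j_def)
    have "(2::nat) ^ j < 2 ^ ?b" using j(1) g(2) by linarith
    then have jb: "j < ?b" by simp
    let ?x = "j * ?K + Suc kl"
    let ?y = "j * ?K + (kr - 2 ^ j)"
    let ?c = "arr s S ?x"
    let ?d = "arr s S ?y"
    have jK: "Suc j * ?K \<le> n" using mult_le_mono1[of "Suc j" ?b ?K] jb bK by linarith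
    have kk: "Suc kl < ?K" "kr - 2 ^ j < ?K"
    proof -
      show "Suc kl < ?K" using True s(4) by simp
      have "0 < (2::nat) ^ j" by simp
      then show "kr - 2 ^ j < ?K" using s(3,4) by linarith
    qed
    have xy: "?x < ?b * ?K" "?y < ?b * ?K"
    proof -
      have "Suc j * ?K \<le> ?b * ?K" using jb by (intro mult_le_mono1) simp
      then have "j * ?K + ?K \<le> ?b * ?K" by simp
      then show "?x < ?b * ?K" "?y < ?b * ?K" using kk by linarith+
    qed
    have p: "Suc kl + 2 ^ j \<le> kr" "kr - 2 ^ j \<le> Suc kl + 2 ^ j" "kr - 2 ^ j + 2 ^ j = kr"
      using j(1,2) True by (auto simp: g_def)
    have c: "argmin_on ?A (Suc kl * ?b) ((Suc kl + 2 ^ j) * ?b) ?c"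
    proof -
      have "min (Suc kl + 2 ^ j) ?K = Suc kl + 2 ^ j" using p s(4) by simp
      then show ?thesis using rmq xy(1) unfolding rmq_ok_def sparse_ok_def
        by (metis div_mod_row[OF kk(1)])
    qed
    have d: "argmin_on ?A ((kr - 2 ^ j) * ?b) (kr * ?b) ?d"
    proof -
      have "min (kr - 2 ^ j + 2 ^ j) ?K = kr" using p s(4) by simp
      then show ?thesis using rmq xy(2) unfolding rmq_ok_def sparse_ok_def
        by (metis div_mod_row[OF kk(2)])
    qed
    let ?q1 = "if ?A ?c < ?A (reg s ''qi'') then ?c else reg s ''qi''"
    let ?q2 = "if ?A ?d < ?A ?q1 then ?d else ?q1"
    have p': "(Suc kl + 2 ^ j) * ?b \<le> kr * ?b" "(kr - 2 ^ j) * ?b \<le> (Suc kl + 2 ^ j) * ?b"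
      "Suc kl * ?b \<le> (Suc kl + 2 ^ j) * ?b" "Suc kl * ?b \<le> (kr - 2 ^ j) * ?b"
      using p j True by (auto simp del: mult_Suc intro!: mult_le_mono1 simp: g_def)
    have a1: "argmin_on ?A l ((Suc kl + 2 ^ j) * ?b) ?q1"
      using argmin_on_join[OF s(5) c] s(6) p' by simp
    have a2: "argmin_on ?A l (kr * ?b) ?q2"
      using argmin_on_join[OF a1 d] p' s(6) by simp
    have cn: "?c < n" "?d < n" "reg s ''qi'' < n" "?q1 < n"
      using c d s(5) a1 p' krb by (auto simp: argmin_on_def)
    have xB: "j * ?K < B" "?x < B" "?y < B" "j < B" "Suc j < B" "g < B" "j * ?K + kr < B"
      "j * ?K + kl < B" "2 ^ j < B" "?c < B" "?d < B"
      using jK B KN s kk j g cn jb tb by (auto simp: g_def)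
    have pwj: "arr s ''pw'' j = 2 ^ j" using pw jb by simp
    have yy: "j * ?K + kr - 2 ^ j = ?y" using p by simp
    have g': "kr - Suc kl = g" by (simp add: g_def)
    have krl: "kr - kl < B" using kB by simp
    let ?pj = "''qj'' ::= ''len''.[Reg ''kr'' .- Reg ''kl'' .- Const 1] .- Const 1"
    let ?pc = "''qc'' ::= S.[Reg ''qj'' .* Reg ''K'' .+ Reg ''kl'' .+ Const 1]"
    let ?pd = "''qc'' ::= S.[Reg ''qj'' .* Reg ''K'' .+ Reg ''kr'' .- ''pw''.[Reg ''qj'']]"
    have "runs B (?pj ;; (?pc ;; better A) ;; (?pd ;; better A)) s (\<lambda>s' t. ?Q s' (6 + t))"
    proof (rule runs_SeqF[where R = "\<lambda>s' t. t \<le> 10 \<and> reg s' ''qj'' = j"])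
      show "runs B ?pj s (\<lambda>s' t. t \<le> 10 \<and> reg s' ''qj'' = j)"
        using xB kB krl by (simp add: runs_simps s(1,2) g' j(3))
    next
      fix s1 :: state and t1 :: nat
      assume 1: "t1 \<le> 10 \<and> reg s1 ''qj'' = j" and ag: "agree ?pj s s1"
      have r1: "reg s1 ''qj'' = j" "reg s1 ''K'' = ?K" "reg s1 ''kl'' = kl" "reg s1 ''kr'' = kr"
        "reg s1 ''qi'' = reg s ''qi''" "arr s1 = arr s"
        by (simp_all add: agree_reg[OF ag] agree_arr[OF ag] 1 s fun_eq_iff)
      have step1: "runs B (?pc ;; better A) s1 (\<lambda>s' t. t \<le> 20 \<and> reg s' ''qi'' = ?q1)"
      proof (rule runs_SeqF[where R = "\<lambda>s' t. t \<le> 10 \<and> reg s' ''qc'' = ?c"])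
        show "runs B ?pc s1 (\<lambda>s' t. t \<le> 10 \<and> reg s' ''qc'' = ?c)"
          using xB kB by (simp add: runs_simps r1)
      next
        fix s2 :: state and t2 :: nat
        assume 2: "t2 \<le> 10 \<and> reg s2 ''qc'' = ?c" and ag: "agree ?pc s1 s2"
        have r2: "reg s2 ''qi'' = reg s ''qi''" "arr s2 = arr s" "reg s2 ''qc'' = ?c"
          by (simp_all add: agree_reg[OF ag] agree_arr[OF ag] 2 r1 fun_eq_iff)
        show "runs B (better A) s2 (\<lambda>s' t. t2 + t \<le> 20 \<and> reg s' ''qi'' = ?q1)"
          by (rule runs_mono[OF runs_better[OF B]]) (use 2 A cn in \<open>simp_all add: r2\<close>)
      qed
      show "runs B ((?pc ;; better A) ;; (?pd ;; better A)) s1 (\<lambda>s' t. ?Q s' (6 + (t1 + t)))"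
      proof (rule runs_SeqF[OF step1])
        fix s2 :: state and t2 :: nat
        assume 2: "t2 \<le> 20 \<and> reg s2 ''qi'' = ?q1" and ag: "agree (?pc ;; better A) s1 s2"
        have r2: "reg s2 ''qj'' = j" "reg s2 ''K'' = ?K" "reg s2 ''kr'' = kr" "arr s2 = arr s"
          by (simp_all add: agree_reg[OF ag] agree_arr[OF ag] r1 fun_eq_iff)
        show "runs B (?pd ;; better A) s2 (\<lambda>s' t. ?Q s' (6 + (t1 + (t2 + t))))"
        proof (rule runs_SeqF[where R = "\<lambda>s' t. t \<le> 12 \<and> reg s' ''qc'' = ?d"])
          show "runs B ?pd s2 (\<lambda>s' t. t \<le> 12 \<and> reg s' ''qc'' = ?d)"
            using xB kB by (simp add: runs_simps r2 pwj yy)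
        next
          fix s3 :: state and t3 :: nat
          assume 3: "t3 \<le> 12 \<and> reg s3 ''qc'' = ?d" and ag: "agree ?pd s2 s3"
          have r3: "reg s3 ''qi'' = ?q1" "arr s3 = arr s" "reg s3 ''qc'' = ?d"
            by (simp_all only: agree_reg[OF ag, of "''qi''"] 2 3)
              (simp_all add: agree_arr[OF ag] agree_reg[OF ag] 2 3 r2 fun_eq_iff)
          show "runs B (better A) s3 (\<lambda>s' t. ?Q s' (6 + (t1 + (t2 + (t3 + t)))))"
          proof (rule runs_mono[OF runs_better[OF B]])
            show "reg s3 ''qi'' < n" unfolding r3 by (rule cn(4))
            show "reg s3 ''qc'' < n" unfolding r3 by (rule cn(2))
            show "arr s3 A x < B" if "x < n" for x using A that r3 by simp
            fix s' :: state and t :: nat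
            assume "t \<le> 10 \<and> reg s' ''qi'' = (if arr s3 A (reg s3 ''qc'') < arr s3 A (reg s3 ''qi'')
              then reg s3 ''qc'' else reg s3 ''qi'')"
            then show "?Q s' (6 + (t1 + (t2 + (t3 + t))))"
              unfolding r3 using a2 1 2 3 by simp
          qed
        qed
      qed
    qed
    then show ?thesis unfolding rmq_mid_def
      using kB True by (intro runs_IfT) (simp_all add: s(1,2))
  qed
qed

text \<open>The range is split into the rest of the block of \<open>l\<close>, the full blocks in
  between, and the beginning of the block of \<open>r\<close>. The last block may be incomplete, but
  only its beginning is looked at and never through the sparse table. \<open>qr\<close> holds the
  last position of the range, hence \<open>Suc r\<close>.\<close>

lemma runs_rmq_query:
  assumes B: "64 * n + 64 \<le> B" and A: "\<And>x. x < n \<Longrightarrow> arr s A x < B" and tab: "tables_ok n s"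
    and rmq: "rmq_ok n A M S s" and s: "reg s ''ql'' = l" "reg s ''qr'' = r" "l \<le> r" "r < n"
  shows "runs B (rmq_query A M S) s (\<lambda>s' t. t \<le> 200 \<and>
    argmin_on (arr s A) l (Suc r) (reg s' ''qi''))" (is "runs B _ s ?Q")
proof -
  let ?b = "reg s ''b''"
  let ?A = "arr s A"
  define kl kr where "kl = l div ?b" and "kr = r div ?b"
  note k_def = kl_def[symmetric] kr_def[symmetric]
  have tb: "0 < ?b" "?b \<le> n" "reg s ''K'' = n div ?b" using tab by (auto simp: tables_ok_def)
  have klr: "kl \<le> kr" unfolding kl_def kr_def using s(3) by (rule div_le_mono)
  have krn: "kr * ?b \<le> r" "kl * ?b \<le> l" by (simp_all add: kl_def kr_def)
  have kB: "l < B" "r < B" "?b < B" "kl < B" "kr < B" "kl * ?b < B" "kr * ?b < B" "kl * ?b + ?b < B"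
    "Suc 0 < B" "0 < B"
    using s B krn tb le_less_trans[OF div_le_dividend[of l ?b], of B]
      le_less_trans[OF div_le_dividend[of r ?b], of B] unfolding k_def by linarith+
  have step1: "runs B (''kl'' ::= Reg ''ql'' .div Reg ''b'' ;; ''kr'' ::= Reg ''qr'' .div Reg ''b'') s
    (\<lambda>s' t. t = 8 \<and> reg s' ''kl'' = kl \<and> reg s' ''kr'' = kr)"
    using kB by (simp add: runs_simps s k_def)
  let ?c1 = "''qi'' ::= inblock M (Reg ''ql'') (Reg ''kl'' .* Reg ''b'' .+ Reg ''b'' .- Const 1)"
  let ?c2 = "''qc'' ::= inblock M (Reg ''kr'' .* Reg ''b'') (Reg ''qr'')"
  show ?thesis unfolding rmq_query_def
  proof (rule runs_SeqF[OF step1])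
    fix s1 :: state and t1 :: nat
    assume 1: "t1 = 8 \<and> reg s1 ''kl'' = kl \<and> reg s1 ''kr'' = kr"
      and ag: "agree (''kl'' ::= Reg ''ql'' .div Reg ''b'' ;; ''kr'' ::= Reg ''qr'' .div Reg ''b'') s s1"
    have r1: "reg s1 ''b'' = ?b" "reg s1 ''K'' = reg s ''K''" "reg s1 ''ql'' = l" "reg s1 ''qr'' = r"
      "reg s1 ''n'' = reg s ''n''" "arr s1 = arr s"
      using ag s by (simp_all add: agree_def fun_eq_iff)
    show "runs B (If (Reg ''kl'' .= Reg ''kr'') (''qi'' ::= inblock M (Reg ''ql'') (Reg ''qr''))
       (?c1 ;; rmq_mid A S ;; (?c2 ;; better A))) s1 (\<lambda>s2 t2. ?Q s2 (t1 + t2))"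
    proof (cases "kl = kr")
      case True
      note ib = argmin_inblock[OF B tab rmq s(3,4) True[unfolded kl_def kr_def], unfolded k_def]
      have "l + arr s ''lb'' (arr s M r div arr s ''pw'' (l - kl * ?b)) < B"
        using ib(1) s B by (simp add: argmin_on_def)
      then show ?thesis using ib kB 1 True by (simp add: runs_simps r1 k_def)
    next
      case False
      then have lr: "kl < kr" using klr by simp
      have e: "Suc kl * ?b \<le> kr * ?b" by (rule mult_le_mono1) (use lr in simp)
      have le: "l < Suc kl * ?b" using dividend_less_div_times[OF tb(1), of l] by (simp add: kl_def)
      \<comment> \<open>The last position of the block of \<open>l\<close>; the full blocks start at
        \<open>Suc ?e\<close>.\<close>
      let ?e = "kl * ?b + ?b - 1"
      have e4: "Suc ?e = Suc kl * ?b" using tb(1) by simp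
      have e1: "l \<le> ?e" "?e < n" "l div ?b = ?e div ?b"
      proof -
        show "l \<le> ?e" using le e4 by auto
        have "Suc ?e \<le> r" unfolding e4 using e krn(1) by (rule le_trans)
        then show "?e < n" using s(4) by simp
        show "l div ?b = ?e div ?b" unfolding k_def by (rule div_block[symmetric]) (use tb(1) in auto)
      qed
      note ib1 = argmin_inblock[OF B tab rmq e1, unfolded k_def]
      let ?q1 = "l + arr s ''lb'' (arr s M ?e div arr s ''pw'' (l - kl * ?b))"
      have q1B: "?q1 < B" using ib1(1) e1 B unfolding argmin_on_def by linarith
      have kr2: "r div ?b = kr * ?b div ?b" using tb(1) by (simp add: kr_def)
      have pw0: "arr s ''pw'' 0 = 1" using tab by (simp add: tables_ok_def)
      note ib2 = argmin_inblock[OF B tab rmq krn(1) s(4) kr2[symmetric], unfolded k_def]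
      let ?q3 = "kr * ?b + arr s ''lb'' (arr s M r div arr s ''pw'' (kr * ?b - kr * ?b div ?b * ?b))"
      have q3: "?q3 < Suc r" using ib2(1) by (simp add: argmin_on_def)
      have step2: "runs B ?c1 s1 (\<lambda>s' t. t \<le> 30 \<and> reg s' ''qi'' = ?q1)"
        using ib1 q1B kB 1 e1(2) B by (simp add: runs_simps r1 k_def)
      have "runs B (?c1 ;; rmq_mid A S ;; (?c2 ;; better A)) s1 (\<lambda>s2 t2. ?Q s2 (12 + t2))"
      proof (rule runs_SeqF[OF step2])
        fix s2 :: state and t2 :: nat
        assume 2: "t2 \<le> 30 \<and> reg s2 ''qi'' = ?q1" and ag: "agree ?c1 s1 s2"
        have r2: "reg s2 ''b'' = ?b" "reg s2 ''K'' = reg s ''K''" "reg s2 ''qr'' = r"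
          "reg s2 ''n'' = reg s ''n''" "reg s2 ''kl'' = kl" "reg s2 ''kr'' = kr" "arr s2 = arr s"
          by (simp_all add: agree_reg[OF ag] agree_arr[OF ag] r1 1 fun_eq_iff)
        have ok2: "tables_ok n s2" "rmq_ok n A M S s2"
          using tab rmq r2 by (simp_all add: tables_ok_def rmq_ok_def)
        have krK: "kr \<le> reg s2 ''K''" using s(4) r2 tb by (simp add: div_le_mono kr_def)
        have mid: "runs B (rmq_mid A S) s2 (\<lambda>s' t. t \<le> 70 \<and>
          argmin_on (arr s2 A) l (kr * reg s2 ''b'') (reg s' ''qi''))"
          by (rule runs_rmq_mid[OF B _ ok2, where kl = kl])
            (use r2 A krK lr le ib1(1) 2 e4 in auto)
        show "runs B (rmq_mid A S ;; (?c2 ;; better A)) s2 (\<lambda>s3 t3. ?Q s3 (12 + (t2 + t3)))"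
        proof (rule runs_SeqF[OF mid])
          fix s3 :: state and t3 :: nat
          assume 3: "t3 \<le> 70 \<and> argmin_on (arr s2 A) l (kr * reg s2 ''b'') (reg s3 ''qi'')"
            and ag: "agree (rmq_mid A S) s2 s3"
          have r3: "reg s3 ''b'' = ?b" "reg s3 ''K'' = reg s ''K''" "reg s3 ''qr'' = r"
            "reg s3 ''kr'' = kr" "arr s3 = arr s"
            using ag r2 by (simp_all add: agree_def fun_eq_iff)
          have am: "argmin_on ?A l (kr * ?b) (reg s3 ''qi'')" using 3 r2 by simp
          have step4: "runs B ?c2 s3 (\<lambda>s' t. t \<le> 30 \<and> reg s' ''qc'' = ?q3)"
            using ib2 q3 kB s(4) B tb(1) by (simp add: runs_simps r3)
          show "runs B (?c2 ;; better A) s3 (\<lambda>s4 t4. ?Q s4 (12 + (t2 + (t3 + t4))))"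
          proof (rule runs_SeqF[OF step4])
            fix s4 :: state and t4 :: nat
            assume 4: "t4 \<le> 30 \<and> reg s4 ''qc'' = ?q3" and ag: "agree ?c2 s3 s4"
            have r4: "reg s4 ''qi'' = reg s3 ''qi''" "arr s4 = arr s"
              using ag r3 by (simp_all add: agree_def fun_eq_iff)
            have j: "argmin_on ?A l (Suc r) (if ?A ?q3 < ?A (reg s3 ''qi'') then ?q3 else reg s3 ''qi'')"
              by (rule argmin_on_join[OF am ib2(1)]) (use e le s krn in auto)
            have qn: "reg s3 ''qi'' < n" using am krn s by (simp add: argmin_on_def)
            show "runs B (better A) s4 (\<lambda>s5 t5. ?Q s5 (12 + (t2 + (t3 + (t4 + t5)))))"
              by (rule runs_mono[OF runs_better[OF B]])
                (use j 2 3 4 r4 A q3 qn s(4) in \<open>auto simp del: mult_Suc\<close>)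
          qed
        qed
      qed
      then show ?thesis using 1 kB False by (simp add: runs_If)
    qed
  qed
qed

section \<open>Trees of nested intervals\<close>

definition points :: "(nat \<Rightarrow> nat \<Rightarrow> nat set) \<Rightarrow> nat \<Rightarrow> nat \<Rightarrow> nat set" where
  "points C a b = insert a (insert b (C a b))"

definition segment :: "(nat \<Rightarrow> nat \<Rightarrow> nat set) \<Rightarrow> nat \<Rightarrow> nat \<Rightarrow> nat \<Rightarrow> nat \<Rightarrow> bool" where
  "segment C a b l r \<longleftrightarrow> l \<in> points C a b \<and> r \<in> points C a b \<and> l < r \<and>
     (\<forall>k \<in> points C a b. \<not> (l < k \<and> k < r))"

text \<open>The piece around \<open>p\<close> runs from the greatest point at most \<open>p\<close>
  to the least point beyond it; both exist because \<open>a\<close> and \<open>b\<close> are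
  points.\<close>

lemma segment_cover:
  assumes "a \<le> p" "p < b" "C a b \<subseteq> {a<..<b}"
  shows "\<exists>l r. segment C a b l r \<and> l \<le> p \<and> p < r"
proof -
  let ?P = "points C a b"
  have fin: "finite ?P" using assms(3) finite_subset[of "C a b" "{a<..<b}"] by (simp add: points_def)
  define l r where "l = Max {k \<in> ?P. k \<le> p}" and "r = Min {k \<in> ?P. p < k}"
  have "a \<in> {k \<in> ?P. k \<le> p}" "b \<in> {k \<in> ?P. p < k}" using assms by (auto simp: points_def)
  then have ne: "{k \<in> ?P. k \<le> p} \<noteq> {}" "{k \<in> ?P. p < k} \<noteq> {}" by blast+
  have l: "l \<in> ?P" "l \<le> p" using Max_in[OF _ ne(1)] fin by (auto simp: l_def)
  have r: "r \<in> ?P" "p < r" using Min_in[OF _ ne(2)] fin by (auto simp: r_def)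
  have "\<not> (l < k \<and> k < r)" if "k \<in> ?P" for k
  proof (cases "k \<le> p")
    case True
    then have "k \<le> l" unfolding l_def using that fin by (intro Max_ge) auto
    then show ?thesis by simp
  next
    case False
    then have "r \<le> k" unfolding r_def using that fin by (intro Min_le) auto
    then show ?thesis by simp
  qed
  then show ?thesis using l r unfolding segment_def by (meson le_less_trans)
qed

text \<open>An interior cut cannot lie strictly inside a piece, so the piece misses part of
  \<open>[a, b)\<close>. This strict decrease is what keeps a node from containing its own
  parent.\<close>

lemma segment_proper:
  assumes "segment C a b l r" "C a b \<subseteq> {a<..<b}" "C a b \<noteq> {}"
  shows "a \<le> l" "r \<le> b" "r - l < b - a"
proof -
  have *: "l \<in> {a..b}" "r \<in> {a..b}" using assms by (auto simp: segment_def points_def)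
  then show "a \<le> l" "r \<le> b" by auto
  obtain k where k: "k \<in> C a b" using assms(3) by blast
  then have "\<not> (l < k \<and> k < r)" "a < k" "k < b" using assms by (auto simp: segment_def points_def)
  moreover have "l < r" using assms by (simp add: segment_def)
  ultimately show "r - l < b - a" using * by auto
qed

lemma segment_inside:
  "segment C a b l r \<Longrightarrow> l < k \<Longrightarrow> k < r \<Longrightarrow> k \<notin> C a b"
  by (auto simp: segment_def points_def)

text \<open>Nodes below \<open>n\<close> are the leaves, that is, the vertices. The others stand for the intervals
  $[L\,y, R\,y)$ of positions and are numbered in the order of creation, starting with the root \<open>n\<close>.\<close>

locale interval_tree =
  fixes n N :: nat and vs :: "nat list" and pos pr L R :: "nat \<Rightarrow> nat"
    and C :: "nat \<Rightarrow> nat \<Rightarrow> nat set"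
  assumes n: "0 < n" and nN: "n < N"
    and vs: "\<And>i. i < n \<Longrightarrow> vs ! i < n" "\<And>i. i < n \<Longrightarrow> pos (vs ! i) = i"
      "\<And>v. v < n \<Longrightarrow> pos v < n" "\<And>v. v < n \<Longrightarrow> vs ! pos v = v"
    and C_sub: "\<And>a b. Suc a < b \<Longrightarrow> C a b \<subseteq> {a<..<b}"
    and C_ne: "\<And>a b. Suc a < b \<Longrightarrow> C a b \<noteq> {}"
    and root: "L n = 0" "R n = n"
    and LR: "\<And>y. n \<le> y \<Longrightarrow> y < N \<Longrightarrow> L y < R y \<and> R y \<le> n"
    and pr: "\<And>y. n < y \<Longrightarrow> y < N \<Longrightarrow> n \<le> pr y \<and> pr y < y \<and> Suc (L (pr y)) < R (pr y) \<and>
      segment C (L (pr y)) (R (pr y)) (L y) (R y)"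
    and ex_child: "\<And>w l r. n \<le> w \<Longrightarrow> w < N \<Longrightarrow> Suc (L w) < R w \<Longrightarrow>
      segment C (L w) (R w) l r \<Longrightarrow> \<exists>y. n < y \<and> y < N \<and> pr y = w \<and> L y = l \<and> R y = r"
    and laminar: "\<And>y y'. n \<le> y \<Longrightarrow> y < y' \<Longrightarrow> y' < N \<Longrightarrow>
      R y \<le> L y' \<or> R y' \<le> L y \<or> L y \<le> L (pr y') \<and> R (pr y') \<le> R y"
    and pr_leaf: "\<And>w. n \<le> w \<Longrightarrow> w < N \<Longrightarrow> R w = Suc (L w) \<Longrightarrow> pr (vs ! L w) = w"
begin

lemma pr_proper:
  assumes "n < y" "y < N"
  shows "L (pr y) \<le> L y" "R y \<le> R (pr y)" "R y - L y < R (pr y) - L (pr y)"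
proof -
  have "Suc (L (pr y)) < R (pr y)" "segment C (L (pr y)) (R (pr y)) (L y) (R y)"
    using pr[OF assms] by auto
  then show "L (pr y) \<le> L y" "R y \<le> R (pr y)" "R y - L y < R (pr y) - L (pr y)"
    using segment_proper C_sub C_ne by meson+
qed

section \<open>Children, ancestors and separating nodes in terms of positions\<close>

definition covers :: "nat \<Rightarrow> nat \<Rightarrow> bool" where
  "covers x p \<longleftrightarrow> (if x < n then x = vs ! p else L x \<le> p \<and> p < R x)"

text \<open>Children are addressed by the positions they cover, so that statements about pairs of
  leaves become statements about pairs of positions. Leaves have no interval of their own: for them
  \<open>covers\<close> compares vertices, and \<open>L\<close> and \<open>R\<close> are not
  consulted.\<close>

definition child :: "nat \<Rightarrow> nat \<Rightarrow> nat \<Rightarrow> bool" where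
  "child x p y \<longleftrightarrow> y < N \<and> y \<noteq> n \<and> pr y = x \<and> covers y p"

lemma internal_child:
  assumes "n \<le> x" "x < N" "Suc (L x) < R x" "L x \<le> p" "p < R x"
  shows "\<exists>y. n < y \<and> child x p y"
proof -
  obtain l r where lr: "segment C (L x) (R x) l r" "l \<le> p" "p < r"
    using segment_cover[of "L x" p "R x" C] assms(4,5) C_sub[OF assms(3)] by blast
  obtain y where y: "n < y" "y < N" "pr y = x" "L y = l" "R y = r"
    using ex_child[OF assms(1-3) lr(1)] by blast
  have "child x p y" unfolding child_def covers_def using y lr(2,3) by simp
  then show ?thesis using y(1) by blast
qed

text \<open>Of the nodes covering \<open>p\<close> take the one created last. Were it wider than one
  position, it would have a child covering \<open>p\<close>, created later.\<close>

lemma ex_singleton: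
  assumes "p < n"
  shows "\<exists>w. n \<le> w \<and> w < N \<and> L w = p \<and> R w = Suc p"
proof -
  let ?S = "{y. n \<le> y \<and> y < N \<and> L y \<le> p \<and> p < R y}"
  have fin: "finite ?S" by (rule finite_subset[of _ "{..<N}"]) auto
  have "n \<in> ?S" using root nN assms by simp
  then have ne: "?S \<noteq> {}" by blast
  define w where "w = Max ?S"
  have "w \<in> ?S" unfolding w_def by (rule Max_in[OF fin ne])
  then have w: "n \<le> w" "w < N" "L w \<le> p" "p < R w" by auto
  have "\<not> Suc (L w) < R w"
  proof
    assume "Suc (L w) < R w"
    then obtain y where y: "n < y" "child w p y" using internal_child w by blast
    then have "y \<in> ?S" "w < y" using pr[of y] by (auto simp: child_def covers_def)
    then show False using Max_ge[OF fin, of y] unfolding w_def by linarith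
  qed
  then have "L w = p" "R w = Suc p" using w by auto
  then show ?thesis using w by blast
qed

lemma leaf_parent:
  assumes "v < n"
  shows "n \<le> pr v" "pr v < N" "L (pr v) = pos v" "R (pr v) = Suc (pos v)"
proof -
  obtain w where w: "n \<le> w" "w < N" "L w = pos v" "R w = Suc (pos v)"
    using ex_singleton[OF vs(3)[OF assms]] by blast
  then have "pr v = w" using pr_leaf[of w] vs(4)[OF assms] by simp
  then show "n \<le> pr v" "pr v < N" "L (pr v) = pos v" "R (pr v) = Suc (pos v)" using w by auto
qed

lemma pr_internal: "y < N \<Longrightarrow> y \<noteq> n \<Longrightarrow> n \<le> pr y \<and> pr y < N"
  using leaf_parent(1,2)[of y] pr[of y] by (meson le_less_trans less_imp_le linorder_neqE_nat order_less_trans)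

lemma ex_child_at:
  assumes "n \<le> x" "x < N" "L x \<le> p" "p < R x"
  shows "\<exists>y. child x p y"
proof (cases "Suc (L x) < R x")
  case True
  then show ?thesis using internal_child assms by blast
next
  case False
  then have x: "L x = p" "R x = Suc (L x)" using assms by linarith+
  have p: "p < n" using LR[OF assms(1,2)] assms by linarith
  have "pr (vs ! p) = x" using pr_leaf[OF assms(1,2) x(2)] unfolding x(1) .
  then have "child x p (vs ! p)"
    using vs(1)[OF p] nN by (simp add: child_def covers_def)
  then show ?thesis by blast
qed

lemma child_covers:
  assumes "child x p y" "p < n"
  shows "n \<le> x" "x < N" "L x \<le> p" "p < R x"
proof -
  have y: "y < N" "y \<noteq> n" "pr y = x" "covers y p" using assms by (auto simp: child_def)
  show "n \<le> x" "x < N" using pr_internal[OF y(1,2)] y(3) by auto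
  have "L x \<le> p \<and> p < R x"
  proof (cases "y < n")
    case True
    then have "pos y = p" using y(4) vs(2)[OF assms(2)] by (simp add: covers_def)
    then show ?thesis using leaf_parent[OF True] y(3) by simp
  next
    case False
    then have "L y \<le> p" "p < R y" using y(4) by (simp_all add: covers_def)
    moreover have "n < y" using False y(2) by simp
    ultimately show ?thesis using pr_proper[of y] y(1,3) by auto
  qed
  then show "L x \<le> p" "p < R x" by simp_all
qed

text \<open>If two sibling intervals met, \<open>laminar\<close> would make the older one contain
  their common parent, contradicting \<open>pr_proper\<close>. A leaf and an interval are never
  siblings: the parent of a leaf is a singleton, that of an interval is not.\<close>

lemma child_unique:
  assumes "child x p y" "child x p z" "p < n"
  shows "y = z"
proof -
  have no: False if "n < a" "a < b" "b < N" "pr a = x" "pr b = x" "covers a p" "covers b p" for a b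
    using laminar[of a b] pr_proper[of a] that by (auto simp: covers_def)
  have sing: False if "a < n" "n < b" "child x p a" "child x p b" for a b
    using leaf_parent[of a] pr[of b] that by (auto simp: child_def)
  have ne: "y \<noteq> n" "z \<noteq> n" using assms by (auto simp: child_def)
  consider "y < n" "z < n" | "y < n" "n < z" | "n < y" "z < n" | "n < y" "n < z"
    using ne by linarith
  then show ?thesis
  proof cases
    case 1
    then show ?thesis using assms by (simp add: child_def covers_def)
  next
    case 2
    then show ?thesis using sing assms by blast
  next
    case 3
    then show ?thesis using sing assms by blast
  next
    case 4
    then show ?thesis using assms no[of y z] no[of z y] unfolding child_def by (cases y z rule: linorder_cases) auto
  qed
qed

lemma child_cases:
  assumes "y < N" "y \<noteq> n"
  obtains p where "p < n" "child (pr y) p y"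
proof (cases "y < n")
  case True
  then have "child (pr y) (pos y) y" using assms vs by (auto simp: child_def covers_def)
  then show ?thesis using that vs(3)[OF True] by blast
next
  case False
  then have "L y < n" "child (pr y) (L y) y"
    using assms LR[of y] by (auto simp: child_def covers_def)
  then show ?thesis using that by blast
qed

definition arcs :: "nat rel" where
  "arcs = {(pr y, y) | y. y < N \<and> y \<noteq> n}"

lemma arcs_covers:
  assumes "(x, y) \<in> arcs" "covers y p" "p < n"
  shows "covers x p"
proof -
  have "child x p y" using assms by (auto simp: arcs_def child_def)
  then show ?thesis using child_covers[of x p y] assms(3) by (simp add: covers_def)
qed

lemma rtrancl_covers:
  assumes "(x, y) \<in> arcs\<^sup>*" "covers y p" "p < n"
  shows "covers x p"
  using assms by (induction rule: converse_rtrancl_induct) (auto dest: arcs_covers)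

text \<open>Induction along parents. The third alternative of \<open>laminar\<close> is tailored to
  it: an older node that meets a younger one contains even the parent of the younger one, so the
  induction hypothesis applies to \<open>pr y\<close>.\<close>

lemma nested_ancestor:
  assumes "n \<le> x" "x < N" "n \<le> y" "y < N" "L x \<le> L y" "R y \<le> R x"
  shows "(x, y) \<in> arcs\<^sup>*"
  using assms(3-)
proof (induction y rule: less_induct)
  case (less y)
  show ?case
  proof (cases "x = y")
    case False
    have "L y < R y" using LR less.prems by auto
    \<comment> \<open>A containing node is older: otherwise \<open>y\<close> would contain the
      parent of \<open>x\<close> and so be longer than \<open>x\<close>.\<close>
    have "x < y"
    proof (rule ccontr)
      assume "\<not> x < y"
      then have "y < x" using False by simp
      then show False
        using laminar[of y x] LR[of x] LR[of y] pr_proper[of x] less.prems assms by auto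
    qed
    then have y: "n < y" using assms by simp
    have sub: "L x \<le> L (pr y)" "R (pr y) \<le> R x"
      using laminar[of x y] \<open>x < y\<close> \<open>L y < R y\<close> less.prems assms by auto
    have "(x, pr y) \<in> arcs\<^sup>*" using less.IH[of "pr y"] pr[OF y] less.prems sub by auto
    moreover have "(pr y, y) \<in> arcs" using y less.prems by (auto simp: arcs_def)
    ultimately show ?thesis by (rule rtrancl_into_rtrancl)
  qed simp
qed

lemma covers_ancestor:
  assumes "n \<le> x" "x < N" "v < n" "covers x (pos v)"
  shows "(x, v) \<in> arcs\<^sup>*"
proof -
  have "(x, pr v) \<in> arcs\<^sup>*"
    using leaf_parent[OF assms(3)] assms by (intro nested_ancestor) (auto simp: covers_def)
  moreover have "(pr v, v) \<in> arcs" using assms nN by (auto simp: arcs_def)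
  ultimately show ?thesis by (rule rtrancl_into_rtrancl)
qed

lemma rtrancl_leaf: "(x, y) \<in> arcs\<^sup>* \<Longrightarrow> x < n \<Longrightarrow> y = x"
  by (erule converse_rtranclE) (use pr_internal in \<open>force simp: arcs_def\<close>)+

text \<open>Nodes \<open>u\<close>, \<open>v\<close> carry the edge of \<open>G\<^sub>z\<close> that decides the adjacency of the positions
  \<open>p\<close> and \<open>q\<close>.\<close>

definition meets :: "nat \<Rightarrow> nat \<Rightarrow> nat \<Rightarrow> nat \<Rightarrow> nat \<Rightarrow> bool" where
  "meets z p q u v \<longleftrightarrow> (\<exists>y y'. child z p y \<and> child z q y' \<and> y \<noteq> y' \<and> child y p u \<and> child y' q v)"

lemma child_not_n: "child x p y \<Longrightarrow> child y q z \<Longrightarrow> q < n \<Longrightarrow> n < y"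
  using child_covers[of y q z] by (auto simp: child_def)

text \<open>\<open>z\<close> is the lowest node covering both positions. A covering node
  \<open>w\<close> is comparable with \<open>z\<close> by laminarity; were it properly below, it
  would lie under one child of \<open>z\<close> covering both \<open>p\<close> and \<open>q\<close>,
  which \<open>child_unique\<close> excludes.\<close>

lemma separates_lowest:
  assumes "child z p y" "child z q y'" "y \<noteq> y'" "p < n" "q < n"
    and w: "n \<le> w" "w < N" "covers w p" "covers w q"
  shows "(w, z) \<in> arcs\<^sup>*"
proof -
  note cz = child_covers[OF assms(1,4)] child_covers[OF assms(2,5)]
  show ?thesis
  proof (cases "w = z")
    case False
    consider "w < z" | "z < w" using False by linarith
    then show ?thesis
    proof cases
      case 1
      have "L w \<le> L z" "R z \<le> R w"
        using laminar[of w z] pr_proper[of z] 1 w cz by (auto simp: covers_def)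
      then show ?thesis using w cz by (intro nested_ancestor) auto
    next
      case 2
      have "L z \<le> L w" "R w \<le> R z"
        using laminar[of z w] pr_proper[of w] 2 w cz by (auto simp: covers_def)
      then have "(z, w) \<in> arcs\<^sup>*" using w cz by (intro nested_ancestor) auto
      then obtain x where "(z, x) \<in> arcs" "(x, w) \<in> arcs\<^sup>*"
        using False by (metis converse_rtranclE)
      then have "child z p x" "child z q x"
        using rtrancl_covers w assms by (auto simp: child_def arcs_def)
      then show ?thesis using child_unique assms by blast
    qed
  qed simp
qed

text \<open>Among the interval nodes, indices grow downwards along the tree.\<close>

lemma rtrancl_antisym:
  assumes "(x, y) \<in> arcs\<^sup>*" "(y, x) \<in> arcs\<^sup>*" "n \<le> x" "n \<le> y"
  shows "x = y"
proof -
  have *: "a \<le> b" if "(a, b) \<in> arcs\<^sup>*" "n \<le> b" for a b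
    using that
  proof (induction rule: converse_rtrancl_induct)
    case (step a c)
    have "\<not> c < n" using rtrancl_leaf[of c b] step by auto
    then have "a < c" using pr[of c] step.hyps by (auto simp: arcs_def)
    then show ?case using step by auto
  qed simp
  show ?thesis using *[OF assms(1,4)] *[OF assms(2,3)] by simp
qed

text \<open>Each of \<open>z\<close> and \<open>z'\<close> is an ancestor of the other by
  \<open>separates_lowest\<close>; the nodes below are then determined by the positions.\<close>

lemma meets_unique:
  assumes "meets z p q u v" "meets z' p q u' v'" "p < n" "q < n"
  shows "z = z' \<and> u = u' \<and> v = v'"
proof -
  obtain y1 y2 where 1: "child z p y1" "child z q y2" "y1 \<noteq> y2" "child y1 p u" "child y2 q v"
    using assms(1) by (auto simp: meets_def)
  obtain x1 x2 where 2: "child z' p x1" "child z' q x2" "x1 \<noteq> x2" "child x1 p u'" "child x2 q v'"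
    using assms(2) by (auto simp: meets_def)
  have c: "n \<le> z" "z < N" "covers z p" "covers z q" "n \<le> z'" "z' < N" "covers z' p" "covers z' q"
    using child_covers[OF 1(1) assms(3)] child_covers[OF 1(2) assms(4)]
      child_covers[OF 2(1) assms(3)] child_covers[OF 2(2) assms(4)] by (auto simp: covers_def)
  have z: "z = z'"
    using separates_lowest[OF 1(1-3) assms(3,4) c(5-8)] separates_lowest[OF 2(1-3) assms(3,4) c(1-4)]
      rtrancl_antisym c by blast
  then have "y1 = x1" "y2 = x2" using child_unique 1 2 assms by blast+
  then show ?thesis using z child_unique 1 2 assms by blast
qed

lemma meets_sym: "meets z p q u v \<Longrightarrow> meets z q p v u"
  by (auto simp: meets_def)

text \<open>\<open>z\<close> is the node created last among those covering both positions: a child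
  covering both would have been created later still.\<close>

lemma ex_meets:
  assumes "p < n" "q < n" "p \<noteq> q"
  shows "\<exists>z u v. meets z p q u v"
proof -
  let ?S = "{y. n \<le> y \<and> y < N \<and> covers y p \<and> covers y q}"
  have fin: "finite ?S" by (rule finite_subset[of _ "{..<N}"]) auto
  have "n \<in> ?S" using root nN assms by (simp add: covers_def)
  then have ne: "?S \<noteq> {}" by blast
  define z where "z = Max ?S"
  have "z \<in> ?S" unfolding z_def by (rule Max_in[OF fin ne])
  then have z: "n \<le> z" "z < N" "L z \<le> p" "p < R z" "L z \<le> q" "q < R z" by (auto simp: covers_def)
  then have "Suc (L z) < R z" using assms(3) by linarith
  then obtain y y' where y: "n < y" "child z p y" "n < y'" "child z q y'"
    using internal_child z by meson
  have "y \<noteq> y'"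
  proof
    assume "y = y'"
    then have "y \<in> ?S" "z < y" using y pr[of y] by (auto simp: child_def)
    then show False using Max_ge[OF fin, of y] unfolding z_def by linarith
  qed
  moreover obtain u where "child y p u"
    using ex_child_at[of y p] y by (auto simp: child_def covers_def)
  moreover obtain v where "child y' q v"
    using ex_child_at[of y' q] y by (auto simp: child_def covers_def)
  ultimately show ?thesis using y unfolding meets_def by blast
qed

end

section \<open>Correctness of the tree, for any cuts that are homogeneous and distinguishing\<close>

locale decomposition = interval_tree +
  fixes G :: "nat ordered_graph" and GE :: "nat \<Rightarrow> nat set set" and E :: "nat \<Rightarrow> nat \<Rightarrow> bool"
  defines "E \<equiv> \<lambda>p q. {vs ! p, vs ! q} \<in> edges G"
  assumes G: "ordered_graph G" "verts G = {0..<n}" "vorder G = order_of_list vs" "length vs = n"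
    and hom: "\<And>a b k v. Suc a < b \<Longrightarrow> b \<le> n \<Longrightarrow> a < k \<Longrightarrow> k < b \<Longrightarrow> k \<notin> C a b \<Longrightarrow>
      v < n \<Longrightarrow> v < a \<or> b \<le> v \<Longrightarrow> E v (k - 1) = E v k"
    and dist: "\<And>a b k. Suc a < b \<Longrightarrow> b \<le> n \<Longrightarrow> k \<in> C a b \<Longrightarrow> 2 \<le> card (C a b) \<Longrightarrow>
      \<exists>v<n. (v < a \<or> b \<le> v) \<and> E v (k - 1) \<noteq> E v k"
    and GE: "\<And>x. GE x = {{u, v} | u v. \<exists>p q. p < n \<and> q < n \<and> E p q \<and> meets x p q u v}"
begin

definition T :: "nat structured_tree" where
  "T = \<lparr>nodes = {0..<N}, root = n, tarcs = arcs, lorder = order_of_list vs, gedges = GE\<rparr>"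

lemma T_simps [simp]:
  "nodes T = {0..<N}" "root T = n" "tarcs T = arcs" "lorder T = order_of_list vs" "gedges T = GE"
  by (simp_all add: T_def)

lemma E_sym: "E p q = E q p"
  by (simp add: E_def insert_commute)

lemma pos_inj: "u < n \<Longrightarrow> v < n \<Longrightarrow> pos u = pos v \<Longrightarrow> u = v"
  using vs(4) by metis

lemma in_order: "(u, v) \<in> order_of_list vs \<longleftrightarrow> u < n \<and> v < n \<and> pos u \<le> pos v"
proof
  assume "(u, v) \<in> order_of_list vs"
  then obtain i j where "i \<le> j" "j < n" "u = vs ! i" "v = vs ! j"
    using G(4) by (auto simp: order_of_list_def)
  then show "u < n \<and> v < n \<and> pos u \<le> pos v" using vs by simp
next
  assume "u < n \<and> v < n \<and> pos u \<le> pos v"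
  then show "(u, v) \<in> order_of_list vs" using vs(3,4) G(4) unfolding order_of_list_def by force
qed

lemma children_T: "children T x = {y. y < N \<and> y \<noteq> n \<and> pr y = x}"
  by (auto simp: children_def arcs_def)

lemma leaves_T: "leaves T = {0..<n}"
proof -
  have "children T x = {}" if "x < n" for x
    using pr_internal that by (fastforce simp: children_T)
  moreover have "children T x \<noteq> {}" if "n \<le> x" "x < N" for x
    using ex_child_at[OF that, of "L x"] LR[OF that] by (auto simp: children_T child_def)
  ultimately show ?thesis using nN by (auto simp: leaves_def not_le[symmetric])
qed

lemma ancestor_leaf: "v < n \<Longrightarrow> n \<le> x \<Longrightarrow> ancestor T x v \<longleftrightarrow> x < N \<and> L x \<le> pos v \<and> pos v < R x"
proof -
  assume v: "v < n" and x: "n \<le> x"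
  have "covers v (pos v)" using v vs by (simp add: covers_def)
  then have "(x, v) \<in> arcs\<^sup>* \<Longrightarrow> covers x (pos v)" using rtrancl_covers vs(3) v by blast
  then show ?thesis
    using covers_ancestor[of x v] v x nN by (auto simp: ancestor_def covers_def)
qed

lemma leaves_below_T: "n \<le> x \<Longrightarrow> x < N \<Longrightarrow> leaves_below T x = {v. v < n \<and> L x \<le> pos v \<and> pos v < R x}"
  using ancestor_leaf by (auto simp: leaves_below_def leaves_T)

lemma leaves_below_leaf: "x < n \<Longrightarrow> leaves_below T x = {x}"
  using nN rtrancl_leaf by (auto simp: leaves_below_def leaves_T ancestor_def)

lemma root_ancestor: "x < N \<Longrightarrow> (n, x) \<in> arcs\<^sup>*"
proof -
  have *: "(n, y) \<in> arcs\<^sup>*" if "n \<le> y" "y < N" for y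
    using nested_ancestor[of n y] that nN root LR[OF that] by simp
  assume x: "x < N"
  show ?thesis
  proof (cases "x < n")
    case True
    then have "(pr x, x) \<in> arcs" "(n, pr x) \<in> arcs\<^sup>*" using x * leaf_parent[OF True] by (auto simp: arcs_def)
    then show ?thesis by (meson rtrancl_into_rtrancl)
  qed (use x * in simp)
qed

lemma rooted_T: "rooted_tree T"
proof -
  have "arcs \<subseteq> {0..<N} \<times> {0..<N}" using pr_internal by (auto simp: arcs_def)
  moreover have "\<exists>!p. (p, x) \<in> arcs" if "x \<in> {0..<N} - {n}" for x
    using that by (auto simp: arcs_def)
  moreover have "(p, n) \<notin> arcs" for p by (auto simp: arcs_def)
  ultimately show ?thesis using nN root_ancestor by (simp add: rooted_tree_def)
qed

lemma ordered_T: "ordered_tree T"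
proof -
  have *: "c \<in> leaves_below T x"
    if "x < N" "a \<in> leaves_below T x" "b \<in> leaves_below T x" "c < n"
      "(a, c) \<in> order_of_list vs" "(c, b) \<in> order_of_list vs" for x a b c
  proof (cases "x < n")
    case True
    then have "a = x" "b = x" using that leaves_below_leaf by auto
    then have "c = x" using that pos_inj[of c x] by (auto simp: in_order)
    then show ?thesis using True leaves_below_leaf by simp
  next
    case False
    then show ?thesis using that leaves_below_T[of x] by (auto simp: in_order)
  qed
  have "linear_order_on {0..<n} (order_of_list vs)"
    using G by (simp add: ordered_graph_def)
  then show ?thesis
    unfolding ordered_tree_def T_simps leaves_T
  proof (intro conjI ballI impI)
    fix x a b c
    assume "x \<in> {0..<N}" "a \<in> leaves_below T x" "b \<in> leaves_below T x" "c \<in> {0..<n}"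
      "(a, c) \<in> order_of_list vs \<and> (c, b) \<in> order_of_list vs"
    then show "c \<in> leaves_below T x" by (intro *[of x a b c]) simp_all
  qed (rule rooted_T)
qed

text \<open>Any child of \<open>pr l\<close> covers some position of this singleton interval, which
  is the position of \<open>l\<close>; so it coincides with \<open>l\<close>.\<close>

lemma only_child: "l < n \<Longrightarrow> children T (pr l) = {l}"
proof -
  assume l: "l < n"
  have "y = l" if y: "y < N" "y \<noteq> n" "pr y = pr l" for y
  proof -
    obtain p where p: "p < n" "child (pr y) p y" using child_cases[OF y(1,2)] by blast
    have "L (pr l) \<le> p" "p < R (pr l)" using child_covers[OF p(2,1)] y by auto
    then have "p = pos l" using leaf_parent[OF l] by simp
    then have "child (pr l) p l" using l nN vs by (simp add: child_def covers_def)
    then show ?thesis using child_unique[OF p(2)] p(1) y by auto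
  qed
  then show ?thesis using l nN by (auto simp: children_T)
qed

lemma meets_grandchildren:
  assumes "meets x p q u v" "p < n" "q < n"
  shows "x < N" "u \<in> grandchildren T x" "v \<in> grandchildren T x" "u \<noteq> v"
proof -
  obtain y y' where y: "child x p y" "child x q y'" "y \<noteq> y'" "child y p u" "child y' q v"
    using assms(1) by (auto simp: meets_def)
  then show "x < N" "u \<in> grandchildren T x" "v \<in> grandchildren T x" "u \<noteq> v"
    using child_covers assms by (auto simp: child_def grandchildren_def children_T)
qed

lemma simple_GE: "simple_graph (grandchildren T x) (GE x)"
proof -
  have "grandchildren T x \<subseteq> {..<N}" by (auto simp: grandchildren_def children_T)
  then have "finite (grandchildren T x)" by (rule finite_subset) simp
  moreover have "GE x \<subseteq> {{u, v} | u v. u \<in> grandchildren T x \<and> v \<in> grandchildren T x \<and> u \<noteq> v}"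
  proof
    fix e assume "e \<in> GE x"
    then obtain u v p q where e: "e = {u, v}" and m: "p < n" "q < n" "meets x p q u v"
      unfolding GE mem_Collect_eq by (elim exE conjE)
    show "e \<in> {{u, v} | u v. u \<in> grandchildren T x \<and> v \<in> grandchildren T x \<and> u \<noteq> v}"
      using meets_grandchildren[OF m(3,1,2)] unfolding e by blast
  qed
  ultimately show ?thesis by (simp add: simple_graph_def)
qed

lemma delayed_T: "delayed_structured_tree T"
proof -
  have "\<exists>p\<in>{0..<N}. children T p = {l}" if "l < n" for l
    using only_child[OF that] leaf_parent(2)[OF that] by (intro bexI[of _ "pr l"]) auto
  then show ?thesis using ordered_T simple_GE by (simp add: delayed_structured_tree_def leaves_T)
qed

text \<open>\<open>hom\<close> compares neighbouring positions only. On a walk through the piece no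
  interior position is a cut, so the adjacency to the outside position \<open>v\<close> never
  changes.\<close>

lemma hom_segment:
  assumes "Suc a < b" "b \<le> n" "segment C a b l r" "v < n" "v < a \<or> b \<le> v"
    and "l \<le> p" "p < r" "l \<le> q" "q < r"
  shows "E v p = E v q"
proof -
  have seg: "a \<le> l" "r \<le> b" using segment_proper assms C_sub C_ne by meson+
  have *: "E v q = E v l" if "l \<le> q" "q < r" for q
    using that
  proof (induction q rule: dec_induct)
    case (step q)
    have "Suc q \<notin> C a b" using segment_inside[OF assms(3)] step by simp
    then have "E v q = E v (Suc q)"
      using hom[of a b "Suc q" v] assms(1,2,4,5) seg step by simp
    then show ?case using step by simp
  qed simp
  show ?thesis using *[of p] *[of q] assms by simp
qed

text \<open>The position \<open>v\<close> has to be outside the parent \<open>y\<close>, not just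
  outside \<open>w\<close>: it is the cuts of \<open>y\<close> that delimit
  \<open>w\<close>.\<close>

lemma hom_child:
  assumes "child y p w" "child y q w" "p < n" "q < n" "v < n" "v < L y \<or> R y \<le> v"
  shows "E v p = E v q"
proof (cases "w < n")
  case True
  then have "w = vs ! p" "w = vs ! q" using assms by (auto simp: child_def covers_def)
  then have "p = q" using vs(2) assms by metis
  then show ?thesis by simp
next
  case False
  then have w: "n < w" "w < N" "pr w = y" "L w \<le> p" "p < R w" "L w \<le> q" "q < R w"
    using assms by (auto simp: child_def covers_def)
  have "n \<le> y" "y < N" using child_covers assms by blast+
  then have "R y \<le> n" using LR by blast
  then show ?thesis using hom_segment[of "L y" "R y" "L w" "R w" v p q] pr[OF w(1,2)] w assms by simp
qed

text \<open>The positions are exchanged one at a time. As \<open>q\<close> lies outside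
  \<open>y1\<close>, moving from \<open>p\<close> to \<open>p'\<close> inside \<open>u\<close>, a
  child of \<open>y1\<close>, keeps the adjacency; then \<open>p'\<close> lies outside
  \<open>y2\<close>, and \<open>q\<close> can move to \<open>q'\<close> inside \<open>v\<close>.
  This argument fails for the children of \<open>z\<close>, since all these positions lie inside
  \<open>z\<close>.\<close>

lemma hom_meets:
  assumes "meets z p q u v" "meets z p' q' u v" "p < n" "q < n" "p' < n" "q' < n" "E p q"
  shows "E p' q'"
proof -
  obtain y1 y2 where 1: "child z p y1" "child z q y2" "y1 \<noteq> y2" "child y1 p u" "child y2 q v"
    using assms(1) by (auto simp: meets_def)
  obtain x1 x2 where 2: "child z p' x1" "child z q' x2" "x1 \<noteq> x2" "child x1 p' u" "child x2 q' v"
    using assms(2) by (auto simp: meets_def)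
  have x: "x1 = y1" "x2 = y2" using 1 2 by (auto simp: child_def)
  note int = child_not_n[OF 1(1,4) assms(3)] child_not_n[OF 1(2,5) assms(4)]
  have out: "\<not> (L y1 \<le> k \<and> k < R y1)" if "child z k y2" "k < n" for k
  proof
    assume "L y1 \<le> k \<and> k < R y1"
    then have "child z k y1" using 1(1) int by (auto simp: child_def covers_def)
    then show False using child_unique that 1(3) by blast
  qed
  have out': "\<not> (L y2 \<le> k \<and> k < R y2)" if "child z k y1" "k < n" for k
  proof
    assume "L y2 \<le> k \<and> k < R y2"
    then have "child z k y2" using 1(2) int by (auto simp: child_def covers_def)
    then show False using child_unique that 1(3) by blast
  qed
  have "E q p = E q p'"
    using hom_child[of y1 p u p' q] 1 2 x out[OF 1(2)] assms by auto
  then have "E p' q" using E_sym assms(7) by simp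
  moreover have "E p' q = E p' q'"
    using hom_child[of y2 q v q' p'] 1 2 x out'[of p'] assms by auto
  ultimately show ?thesis by simp
qed

lemma edge_realization:
  "e \<in> edges (realization T) \<longleftrightarrow>
     (\<exists>a b. e = {a, b} \<and> a < n \<and> b < n \<and> a \<noteq> b \<and>
       (\<exists>z u v. closest_common_ancestor T z a b \<and> u \<in> grandchildren T z \<and> ancestor T u a \<and>
          v \<in> grandchildren T z \<and> ancestor T v b \<and> {u, v} \<in> GE z))"
  by (simp add: realization_def leaves_T)

text \<open>For an edge of \<open>G\<close>, the node separating its two positions is the closest
  common ancestor and supplies the pair in \<open>GE\<close>. Conversely, an edge of
  \<open>GE\<close> stems from some adjacent pair of positions, and \<open>hom_meets\<close>
  transfers the adjacency to every pair of leaves below the same two grandchildren.\<close>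

lemma edges_T: "edges (realization T) = edges G"
proof (rule set_eqI)
  fix e
  show "e \<in> edges (realization T) \<longleftrightarrow> e \<in> edges G"
  proof
    assume "e \<in> edges G"
    moreover have "edges G \<subseteq> {{u, v} | u v. u < n \<and> v < n \<and> u \<noteq> v}"
      using G(1,2) by (simp add: ordered_graph_def simple_graph_def)
    ultimately obtain a b where e: "e = {a, b}" "a < n" "b < n" "a \<noteq> b" by blast
    define p q where "p = pos a" and "q = pos b"
    have pq: "p < n" "q < n" "p \<noteq> q" using e vs(3) pos_inj by (auto simp: p_def q_def)
    have E: "E p q" using \<open>e \<in> edges G\<close> e vs(4) by (simp add: E_def p_def q_def)
    obtain z u v where m: "meets z p q u v" using ex_meets pq by blast
    then obtain y y' where y: "child z p y" "child z q y'" "y \<noteq> y'" "child y p u" "child y' q v"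
      by (auto simp: meets_def)
    have anc: "ancestor T x w" if "child x (pos w) c" "w < n" for x w c
      using child_covers[OF that(1) vs(3)[OF that(2)]] ancestor_leaf that by simp
    have anc': "ancestor T c w" if "child x (pos w) c" "w < n" for x w c
    proof (cases "c < n")
      case True
      then have "c = w" using that vs(4) by (simp add: child_def covers_def)
      then show ?thesis using that nN by (simp add: ancestor_def)
    next
      case False
      then show ?thesis using that ancestor_leaf by (auto simp: child_def covers_def)
    qed
    have zc: "n \<le> z" "z < N" using child_covers y(1) pq by blast+
    have cca: "closest_common_ancestor T z a b"
      unfolding closest_common_ancestor_def
    proof (intro conjI allI impI)
      show "ancestor T z a" "ancestor T z b" using anc y e by (auto simp: p_def q_def)
      fix w assume w: "ancestor T w a \<and> ancestor T w b"
      have "n \<le> w"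
      proof (rule ccontr)
        assume "\<not> n \<le> w"
        then have "a = w" "b = w" using w rtrancl_leaf by (auto simp: ancestor_def)
        then show False using e by simp
      qed
      moreover from this have "w < N" "covers w p" "covers w q"
        using w ancestor_leaf e by (auto simp: covers_def p_def q_def)
      ultimately have "(w, z) \<in> arcs\<^sup>*" using separates_lowest[OF y(1-3) pq(1,2)] by blast
      then show "ancestor T w z" using \<open>w < N\<close> zc by (simp add: ancestor_def)
    qed
    have "{u, v} \<in> GE z"
      unfolding GE mem_Collect_eq using pq E m by (intro exI conjI) simp_all
    moreover have "ancestor T u a" "ancestor T v b" using anc' y e by (auto simp: p_def q_def)
    ultimately show "e \<in> edges (realization T)"
      unfolding edge_realization using e cca meets_grandchildren(2,3)[OF m pq(1,2)]
      by (intro exI[of _ a] exI[of _ b] exI[of _ z] exI[of _ u] exI[of _ v] conjI) simp_all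
  next
    assume "e \<in> edges (realization T)"
    then obtain a b z u v where e: "e = {a, b}" "a < n" "b < n" and
      uv: "u \<in> grandchildren T z" "ancestor T u a" "v \<in> grandchildren T z" "ancestor T v b"
      "{u, v} \<in> GE z"
      unfolding edge_realization by (elim exE conjE)
    obtain u' v' p q where pq: "p < n" "q < n" "E p q" "meets z p q u' v'" "{u, v} = {u', v'}"
      using uv(5) unfolding GE mem_Collect_eq by (elim exE conjE)
    \<comment> \<open>The set \<open>{u, v}\<close> may have been produced in the other
      order.\<close>
    have "\<exists>p q. p < n \<and> q < n \<and> E p q \<and> meets z p q u v"
    proof (cases "u = u' \<and> v = v'")
      case False
      then have "u = v'" "v = u'" using pq(5) by (auto simp: doubleton_eq_iff)
      then show ?thesis using pq E_sym meets_sym by blast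
    qed (use pq in blast)
    then obtain p q where pq: "p < n" "q < n" "E p q" "meets z p q u v" by blast
    then obtain y y' where y: "child z p y" "child z q y'" "y \<noteq> y'" "child y p u" "child y' q v"
      by (auto simp: meets_def)
    \<comment> \<open>A leaf below the grandchild \<open>u\<close> has a position covered by
      \<open>u\<close> and thus by \<open>y\<close>; so \<open>u\<close> and \<open>v\<close> are
      also the grandchildren for the positions of \<open>a\<close> and \<open>b\<close>.\<close>
    have move: "child z (pos w) y \<and> child y (pos w) u"
      if "child z p y" "child y p u" "ancestor T u w" "w < n" "p < n" for y p u w
    proof -
      have u: "u < N" "u \<noteq> n" "pr u = y" using that by (auto simp: child_def)
      have c: "covers u (pos w)"
      proof (cases "u < n")
        case True
        then have "w = u" using that rtrancl_leaf by (auto simp: ancestor_def)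
        then show ?thesis using that vs True by (simp add: covers_def)
      next
        case False
        then show ?thesis using that ancestor_leaf by (simp add: covers_def)
      qed
      then have 1: "child y (pos w) u" using u by (simp add: child_def)
      then have "covers y (pos w)" using child_covers[OF 1 vs(3)] that by (simp add: covers_def)
      then show ?thesis using 1 that by (simp add: child_def)
    qed
    have "meets z (pos a) (pos b) u v"
      using move[OF y(1,4) uv(2) e(2) pq(1)] move[OF y(2,5) uv(4) e(3) pq(2)] y(3)
      by (auto simp: meets_def)
    then have "E (pos a) (pos b)" using hom_meets[OF pq(4) _ pq(1,2)] pq(3) vs(3) e by blast
    then show "e \<in> edges G" using e vs(4) by (simp add: E_def)
  qed
qed

theorem delayed_decomposition_T: "delayed_decomposition T G"
proof -
  have v: "verts (realization T) = verts G" "vorder (realization T) = vorder G"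
    using G(2,3) leaves_T by (simp_all add: realization_def)
  have "realization T = \<lparr>verts = verts (realization T), edges = edges (realization T),
    vorder = vorder (realization T)\<rparr>" by simp
  also have "\<dots> = G" unfolding v edges_T by simp
  finally show ?thesis using delayed_T by (simp add: delayed_decomposition_def)
qed

text \<open>Distinct children have distinct right ends, and each of these is a cut or the right end
  of \<open>x\<close>. Thus three children force two cuts, as \<open>dist\<close> demands.\<close>

lemma card_children:
  assumes "n \<le> x" "x < N" "Suc (L x) < R x"
  shows "card (children T x) \<le> Suc (card (C (L x) (R x)))"
proof -
  have int: "n < y" if "y \<in> children T x" for y
    using that leaf_parent[of y] assms by (cases "y < n") (auto simp: children_T)
  have fin: "finite (C (L x) (R x))" using C_sub[OF assms(3)] finite_subset by blast
  have "inj_on R (children T x)"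
  proof (rule inj_onI)
    fix y z assume yz: "y \<in> children T x" "z \<in> children T x" "R y = R z"
    have "child x (R w - 1) w" if "w \<in> children T x" for w
      using that int[OF that] LR[of w] by (auto simp: child_def children_T covers_def)
    moreover have "R y - 1 < n" using LR[of y] int yz by (fastforce simp: children_T)
    ultimately show "y = z" using child_unique yz by metis
  qed
  moreover have "R ` children T x \<subseteq> insert (R x) (C (L x) (R x))"
  proof
    fix r assume "r \<in> R ` children T x"
    then obtain y where y: "y \<in> children T x" "r = R y" by blast
    have "segment C (L x) (R x) (L y) (R y)" using pr[OF int[OF y(1)]] y by (simp add: children_T)
    then have "R y \<in> points C (L x) (R x)" "L x \<le> L y" "L y < R y"
      using segment_proper C_sub C_ne assms(3) by (auto simp: segment_def)
    then show "r \<in> insert (R x) (C (L x) (R x))" using y by (auto simp: points_def)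
  qed
  ultimately have "card (children T x) \<le> card (insert (R x) (C (L x) (R x)))"
    using fin by (intro card_inj_on_le[of R]) auto
  also have "\<dots> \<le> Suc (card (C (L x) (R x)))" by (rule card_insert_le_m1) simp_all
  finally show ?thesis .
qed

theorem distinguishing_T: "distinguishing T G"
  unfolding distinguishing_def
proof (intro ballI impI allI)
  fix x x1 x2
  assume x: "x \<in> nodes T" and card: "3 \<le> card (children T x)" and cons: "consecutive_children T x x1 x2"
  have "x1 \<in> children T x" using cons by (simp add: consecutive_children_def)
  then have xn: "n \<le> x" using pr_internal by (auto simp: children_T)
  have xN: "x < N" using x by simp
  \<comment> \<open>A singleton node has its leaf as only child.\<close>
  have wide: "Suc (L x) < R x"
  proof (rule ccontr)
    assume "\<not> Suc (L x) < R x"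
    then have "R x = Suc (L x)" using LR[OF xn xN] by simp
    then have "pr (vs ! L x) = x" "L x < n" using pr_leaf[OF xn xN] LR[OF xn xN] by auto
    then show False using only_child[of "vs ! L x"] vs card by simp
  qed
  have int: "n < y \<and> y < N \<and> pr y = x" if "y \<in> children T x" for y
    using that leaf_parent[of y] wide by (cases "y < n") (auto simp: children_T)
  have x12: "x1 \<in> children T x" "x2 \<in> children T x" "node_less T x1 x2"
    and between: "\<And>y. y \<in> children T x \<Longrightarrow> \<not> (node_less T x1 y \<and> node_less T y x2)"
    using cons by (auto simp: consecutive_children_def)
  note i1 = int[OF x12(1)] and i2 = int[OF x12(2)]
  have lr: "L x1 < R x1" "L x2 < R x2" "R x1 \<le> n" "R x2 \<le> n" using LR i1 i2 by auto
  have less_nodes: "node_less T y z" if "y \<in> children T x" "z \<in> children T x" "R y \<le> L z" for y z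
  proof -
    note i = int[OF that(1)] int[OF that(2)]
    have ly: "L y < R y" "L z < R z" "R y \<le> n" "R z \<le> n" using LR i by auto
    have "\<not> ancestor T y z"
    proof
      assume "ancestor T y z"
      then have "(y, z) \<in> arcs\<^sup>*" by (simp add: ancestor_def)
      then have "covers y (L z)" using rtrancl_covers ly i by (auto simp: covers_def)
      then show False using that i by (simp add: covers_def)
    qed
    moreover have "\<not> ancestor T z y"
    proof
      assume "ancestor T z y"
      then have "(z, y) \<in> arcs\<^sup>*" by (simp add: ancestor_def)
      then have "covers z (L y)" using rtrancl_covers ly i by (auto simp: covers_def)
      then show False using that i ly by (simp add: covers_def)
    qed
    moreover have "(u, v) \<in> order_of_list vs \<and> u \<noteq> v"
      if "u \<in> leaves_below T y" "v \<in> leaves_below T z" for u v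
    proof -
      have "u < n" "v < n" "pos u < R y" "L z \<le> pos v"
        using that leaves_below_T[of y] leaves_below_T[of z] i by auto
      then show ?thesis using \<open>R y \<le> L z\<close> by (auto simp: in_order)
    qed
    ultimately show ?thesis unfolding node_less_def T_simps by blast
  qed
  have below: "vs ! p \<in> leaves_below T y" if "y \<in> children T x" "L y \<le> p" "p < R y" for y p
  proof -
    have "p < n" using that LR[of y] int[OF that(1)] by auto
    then show ?thesis using leaves_below_T[of y] int[OF that(1)] that vs by simp
  qed
  \<comment> \<open>\<open>node_less\<close> is about leaves: compare the last leaf of
    \<open>x1\<close> with the first leaf of \<open>x2\<close>.\<close>
  have ord: "R x1 \<le> L x2"
  proof (rule ccontr)
    assume "\<not> R x1 \<le> L x2"
    moreover have "(vs ! (R x1 - 1), vs ! L x2) \<in> order_of_list vs \<and> vs ! (R x1 - 1) \<noteq> vs ! L x2"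
      using x12(3) below[OF x12(1), of "R x1 - 1"] below[OF x12(2), of "L x2"] lr
      by (auto simp: node_less_def)
    moreover have "pos (vs ! (R x1 - 1)) = R x1 - 1" "pos (vs ! L x2) = L x2"
      using vs(2) lr by auto
    ultimately have "R x1 - 1 \<le> L x2" "R x1 - 1 \<noteq> L x2" "\<not> R x1 \<le> L x2"
      by (auto simp: in_order)
    then show False by linarith
  qed
  define k where "k = R x1"
  have bounds: "L x \<le> L x1" "R x1 \<le> R x" "L x \<le> L x2" "R x2 \<le> R x" "R x \<le> n"
    using pr_proper[of x1] pr_proper[of x2] i1 i2 LR[OF xn xN] by auto
  \<comment> \<open>Otherwise the child covering position \<open>k\<close> would lie between two
    consecutive children.\<close>
  have "k = L x2"
  proof (rule ccontr)
    assume "k \<noteq> L x2"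
    then have kl: "k < L x2" using ord by (simp add: k_def)
    then obtain y where y: "n < y" "child x k y"
      using internal_child[OF xn xN wide, of k] bounds lr by (auto simp: k_def)
    then have yc: "y \<in> children T x" "L y \<le> k" "k < R y"
      by (auto simp: children_T child_def covers_def)
    have disj: "R y \<le> L z \<or> R z \<le> L y" if "z \<in> children T x" "z \<noteq> y" for z
    proof (rule ccontr)
      assume a: "\<not> (R y \<le> L z \<or> R z \<le> L y)"
      note iz = int[OF that(1)]
      let ?p = "max (L y) (L z)"
      have "child x ?p y" "child x ?p z" "?p < n"
        using a y iz LR[of y] LR[of z] by (auto simp: child_def covers_def)
      then show False using child_unique that(2) by blast
    qed
    have ne: "x1 \<noteq> y" "x2 \<noteq> y" using yc kl by (auto simp: k_def)
    have "R x1 \<le> L y" using disj[OF x12(1) ne(1)] yc lr by (auto simp: k_def)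
    moreover have "R y \<le> L x2" using disj[OF x12(2) ne(2)] yc lr kl by auto
    ultimately show False using between[OF yc(1)] less_nodes yc(1) x12 by blast
  qed
  have kC: "k \<in> C (L x) (R x)"
  proof -
    have "segment C (L x) (R x) (L x1) (R x1)" using pr[of x1] i1 by simp
    then have "k \<in> points C (L x) (R x)" by (simp add: segment_def k_def)
    then show ?thesis using bounds lr \<open>k = L x2\<close> by (auto simp: points_def k_def)
  qed
  \<comment> \<open>Now \<open>dist\<close> yields an outside witness for the cut \<open>k\<close>
    between \<open>x1\<close> and \<open>x2\<close>; by \<open>hom_child\<close> its adjacency is
    constant on either child, so it distinguishes all of \<open>x1\<close> from all of
    \<open>x2\<close>.\<close>
  have "2 \<le> card (C (L x) (R x))" using card card_children[OF xn xN wide] by linarith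
  then obtain p where p: "p < n" "p < L x \<or> R x \<le> p" "E p (k - 1) \<noteq> E p k"
    using dist[OF wide bounds(5) kC] by blast
  have cov: "child x q y" if "y \<in> children T x" "L y \<le> q" "q < R y" for y q
    using that int[OF that(1)] by (auto simp: child_def covers_def)
  have hom': "E p q = E p q'" if "y \<in> children T x" "L y \<le> q" "q < R y" "L y \<le> q'" "q' < R y" for y q q'
  proof -
    have "q < n" "q' < n" using that LR[of y] int[OF that(1)] by auto
    then show ?thesis using hom_child[OF cov cov] that p by blast
  qed
  have adj: "{vs ! p, u} \<in> edges G \<longleftrightarrow> E p (pos u)" if "u < n" for u
    using that vs(4) by (simp add: E_def)
  have e1: "{vs ! p, u} \<in> edges G \<longleftrightarrow> E p (k - 1)" if "u \<in> leaves_below T x1" for u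
  proof -
    have "u < n" "L x1 \<le> pos u" "pos u < R x1" using that leaves_below_T[of x1] i1 by auto
    then show ?thesis using adj hom'[OF x12(1), of "pos u" "k - 1"] lr by (simp add: k_def)
  qed
  have e2: "{vs ! p, u} \<in> edges G \<longleftrightarrow> E p k" if "u \<in> leaves_below T x2" for u
  proof -
    have "u < n" "L x2 \<le> pos u" "pos u < R x2" using that leaves_below_T[of x2] i2 by auto
    then show ?thesis using adj hom'[OF x12(2), of "pos u" k] lr \<open>k = L x2\<close> by simp
  qed
  have "vs ! p \<in> verts G - leaves_below T x"
    using p vs G(2) leaves_below_T[OF xn xN] by auto
  then show "\<exists>v\<in>verts G - leaves_below T x.
    (\<forall>u\<in>leaves_below T x1. {v, u} \<in> edges G) \<and> (\<forall>u\<in>leaves_below T x2. {v, u} \<notin> edges G) \<or>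
    (\<forall>u\<in>leaves_below T x2. {v, u} \<in> edges G) \<and> (\<forall>u\<in>leaves_below T x1. {v, u} \<notin> edges G)"
    using e1 e2 p(3) by (intro bexI[of _ "vs ! p"]) auto
qed

end

section \<open>Extremal distinguishing vertices\<close>

locale input =
  fixes vs :: "nat list" and es :: "(nat \<times> nat) list" and n m B :: nat
  assumes n: "0 < n" "length vs = n" "distinct vs" "set vs = {0..<n}"
    and m: "length es = m"
    and es: "\<And>j. j < m \<Longrightarrow> fst (es ! j) < n \<and> snd (es ! j) < n \<and> fst (es ! j) \<noteq> snd (es ! j)"
    and B: "64 * n + 64 * m + 64 \<le> B"
begin

definition pos :: "nat \<Rightarrow> nat" where
  "pos v = inv_into {..<n} ((!) vs) v"

lemma vs_bij: "bij_betw ((!) vs) {..<n} {0..<n}"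
  using n by (intro bij_betw_nth) auto

lemma vs_less: "i < n \<Longrightarrow> vs ! i < n"
  using bij_betwE[OF vs_bij] by simp

lemma pos_vs: "i < n \<Longrightarrow> pos (vs ! i) = i"
  unfolding pos_def using vs_bij by (simp add: bij_betw_def)

lemma pos_less: "v < n \<Longrightarrow> pos v < n"
  unfolding pos_def using vs_bij inv_into_into[of v "(!) vs" "{..<n}"] by (simp add: bij_betw_def)

lemma vs_pos: "v < n \<Longrightarrow> vs ! pos v = v"
  unfolding pos_def using vs_bij by (simp add: bij_betw_def f_inv_into_f)

text \<open>Arcs \<open>2j\<close> and \<open>2j + 1\<close> are the two orientations of the edge \<open>j\<close>, between positions.\<close>

definition src :: "nat \<Rightarrow> nat" where
  "src a = pos ((if even a then fst else snd) (es ! (a div 2)))"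

definition dst :: "nat \<Rightarrow> nat" where
  "dst a = pos ((if even a then snd else fst) (es ! (a div 2)))"

lemma arc_bounds: "a < 2 * m \<Longrightarrow> src a < n \<and> dst a < n \<and> src a \<noteq> dst a"
proof -
  assume "a < 2 * m"
  then have "a div 2 < m" by simp
  note e = es[OF this]
  have "pos (fst (es ! (a div 2))) \<noteq> pos (snd (es ! (a div 2)))"
  proof
    assume "pos (fst (es ! (a div 2))) = pos (snd (es ! (a div 2)))"
    then have "vs ! pos (fst (es ! (a div 2))) = vs ! pos (snd (es ! (a div 2)))" by (rule arg_cong)
    then show False using e by (simp add: vs_pos)
  qed
  then show ?thesis using e pos_less by (simp add: src_def dst_def)
qed

definition adj :: "nat \<Rightarrow> nat \<Rightarrow> bool" where
  "adj p q \<longleftrightarrow> (\<exists>a < 2 * m. src a = p \<and> dst a = q)"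

lemma adj_bounds: "adj p q \<Longrightarrow> p < n \<and> q < n \<and> p \<noteq> q"
  using arc_bounds by (auto simp: adj_def)

text \<open>Arc numbers in the adjacency lists are shifted by one, \<open>0\<close> being the end of a list.\<close>

primrec last_arc :: "nat \<Rightarrow> nat \<Rightarrow> nat" where
  "last_arc 0 v = 0"
| "last_arc (Suc N) v = (if src N = v then Suc N else last_arc N v)"

lemma last_arc_le: "last_arc N v \<le> N"
  by (induction N) auto

lemma last_arc_src: "0 < last_arc N v \<Longrightarrow> src (last_arc N v - 1) = v"
  by (induction N) (auto split: if_splits)

lemma last_arc_none: "last_arc N v \<le> a \<Longrightarrow> a < N \<Longrightarrow> src a \<noteq> v"
  by (induction N) (auto simp: less_Suc_eq split: if_splits)

text \<open>Each adjacency list runs through its arcs from the greatest index down; with the shifted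
  list pointer at \<open>p\<close>, the arcs from \<open>p\<close> on are those already
  visited.\<close>

definition arcs_from :: "nat \<Rightarrow> nat \<Rightarrow> nat set" where
  "arcs_from v p = {a. p \<le> a \<and> a < 2 * m \<and> src a = v}"

lemma finite_arcs_from [simp]: "finite (arcs_from v p)"
  by (rule finite_subset[of _ "{..<2 * m}"]) (auto simp: arcs_from_def)

lemma arcs_from_last: "arcs_from v (last_arc (2 * m) v) = {}"
  using last_arc_none by (auto simp: arcs_from_def)

lemma arcs_from_step:
  assumes "0 < p" "p \<le> 2 * m" "src (p - 1) = v"
  shows "arcs_from v (last_arc (p - 1) v) = insert (p - 1) (arcs_from v p)"
    "card (arcs_from v (last_arc (p - 1) v)) = Suc (card (arcs_from v p))"
proof -
  show eq: "arcs_from v (last_arc (p - 1) v) = insert (p - 1) (arcs_from v p)"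
  proof (rule set_eqI)
    fix a
    have "a < p - 1 \<or> a = p - 1 \<or> p \<le> a" using assms(1) by linarith
    then show "a \<in> arcs_from v (last_arc (p - 1) v) \<longleftrightarrow> a \<in> insert (p - 1) (arcs_from v p)"
      using assms last_arc_none[of "p - 1" v a] last_arc_le[of "p - 1" v]
      by (auto simp: arcs_from_def)
  qed
  have "p - 1 \<notin> arcs_from v p" using assms(1) by (auto simp: arcs_from_def)
  then show "card (arcs_from v (last_arc (p - 1) v)) = Suc (card (arcs_from v p))" unfolding eq by simp
qed

text \<open>Telescoped over \<open>v\<close>, this is the degree sum: a loop over the list of each
  vertex makes \<open>2 * m\<close> iterations in total.\<close>

lemma card_arcs_from: "card {a. a < 2 * m \<and> src a < Suc v} = card {a. a < 2 * m \<and> src a < v} + card (arcs_from v 0)"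
proof -
  have "{a. a < 2 * m \<and> src a < Suc v} = {a. a < 2 * m \<and> src a < v} \<union> arcs_from v 0"
    by (auto simp: arcs_from_def less_Suc_eq)
  moreover have "{a. a < 2 * m \<and> src a < v} \<inter> arcs_from v 0 = {}"
    by (auto simp: arcs_from_def)
  moreover have "finite {a. a < 2 * m \<and> src a < v}" by simp
  ultimately show ?thesis by (simp add: card_Un_disjoint)
qed

lemma card_arcs_le: "card {a. a < 2 * m \<and> src a < v} \<le> 2 * m"
proof -
  have "card {a. a < 2 * m \<and> src a < v} \<le> card {..<2 * m}" by (rule card_mono) auto
  then show ?thesis by simp
qed

section \<open>Inverse of the vertex order and adjacency lists\<close>

definition init_step :: com where
  "init_step =
     ''pos''.[''order''.[Reg ''i'']] \<leftarrow> Reg ''i'' ;;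
     ''leaf''.[Reg ''i''] \<leftarrow> ''order''.[Reg ''i''] ;;
     ''lo''.[Reg ''i''] \<leftarrow> Reg ''i'' ;;
     ''nh''.[Reg ''i''] \<leftarrow> Reg ''n'' ;;
     ''i'' ::= Reg ''i'' .+ Const 1"

definition init_loop :: com where
  "init_loop = While (Reg ''i'' .< Reg ''n'') init_step"

lemma init_writes [simp]:
  "wregs init_step = {''i''}" "warrs init_step = {''pos'', ''leaf'', ''lo'', ''nh''}"
  "wregs init_loop = {''i''}" "warrs init_loop = {''pos'', ''leaf'', ''lo'', ''nh''}"
  by (auto simp: init_step_def init_loop_def)

lemma runs_init_loop:
  assumes s: "reg s ''i'' = 0" "reg s ''n'' = n" "arr s ''order'' = list_arr vs"
      "arr s ''lo'' = (\<lambda>_. 0)" "arr s ''nh'' = (\<lambda>_. 0)"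
  shows "runs B init_loop s (\<lambda>s' t. t \<le> 40 * n + 10 \<and>
    (\<forall>v<n. arr s' ''pos'' v = pos v) \<and> (\<forall>i<n. arr s' ''leaf'' i = vs ! i) \<and>
    (\<forall>k. arr s' ''lo'' k = (if k < n then k else 0)) \<and>
    (\<forall>k. arr s' ''nh'' k = (if k < n then n else 0)))"
  unfolding init_loop_def
proof (rule runs_While[where T = "40 * n" and I = "\<lambda>s' t. reg s' ''i'' \<le> n \<and> t \<le> 40 * reg s' ''i'' \<and>
    (\<forall>v<n. pos v < reg s' ''i'' \<longrightarrow> arr s' ''pos'' v = pos v) \<and>
    (\<forall>i<reg s' ''i''. arr s' ''leaf'' i = vs ! i) \<and>
    (\<forall>k. arr s' ''lo'' k = (if k < reg s' ''i'' then k else 0)) \<and>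
    (\<forall>k. arr s' ''nh'' k = (if k < reg s' ''i'' then n else 0))"])
  let ?I = "\<lambda>s' t. reg s' ''i'' \<le> n \<and> t \<le> 40 * reg s' ''i'' \<and>
    (\<forall>v<n. pos v < reg s' ''i'' \<longrightarrow> arr s' ''pos'' v = pos v) \<and>
    (\<forall>i<reg s' ''i''. arr s' ''leaf'' i = vs ! i) \<and>
    (\<forall>k. arr s' ''lo'' k = (if k < reg s' ''i'' then k else 0)) \<and>
    (\<forall>k. arr s' ''nh'' k = (if k < reg s' ''i'' then n else 0))"
  fix s' t
  assume I: "?I s' t" and ag: "agree init_step s s'"
  have r: "reg s' ''n'' = n" "arr s' ''order'' = list_arr vs"
    by (simp_all add: agree_reg[OF ag] agree_arr[OF ag] s)
  show "fits B (Reg ''i'' .< Reg ''n'') s'" using I r B by simp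
  show "t + (cost (Reg ''i'' .< Reg ''n'') + 1) \<le> 40 * n + 10 \<and>
    (\<forall>v<n. arr s' ''pos'' v = pos v) \<and> (\<forall>i<n. arr s' ''leaf'' i = vs ! i) \<and>
    (\<forall>k. arr s' ''lo'' k = (if k < n then k else 0)) \<and>
    (\<forall>k. arr s' ''nh'' k = (if k < n then n else 0))" if "aval (Reg ''i'' .< Reg ''n'') s' = 0"
  proof -
    have "reg s' ''i'' = n" using that I r by (simp split: if_splits)
    then show ?thesis using I pos_less by simp
  qed
  assume "aval (Reg ''i'' .< Reg ''n'') s' \<noteq> 0"
  then have i: "reg s' ''i'' < n" using r by (simp split: if_splits)
  define i where "i = reg s' ''i''"
  have o: "list_arr vs i = vs ! i" "vs ! i < n" "pos (vs ! i) = i"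
    using i n vs_less pos_vs by (auto simp: list_arr_def i_def)
  have ps: "(if v = vs ! i then i else arr s' ''pos'' v) = pos v" if "v < n" "pos v < Suc i" for v
  proof (cases "v = vs ! i")
    case False
    then have "pos v \<noteq> i" using vs_pos[OF that(1)] by metis
    then show ?thesis using I that False by (simp add: i_def)
  qed (use o in simp)
  have iB: "Suc i < B" "i < B" "vs ! i < B" "n < B" "Suc 0 < B" using i o B by (auto simp: i_def)
  show "runs B init_step s' (\<lambda>s'' t'. ?I s'' (t + (cost (Reg ''i'' .< Reg ''n'') + 1) + t'))"
    using I i iB ps unfolding init_step_def
    by (simp add: runs_simps r i_def[symmetric] o less_Suc_eq)
qed (use s in auto)

text \<open>The head of the list is set after \<open>a\<close> has been incremented, which is how
  the shift by one enters.\<close>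

definition add_arc :: "string \<Rightarrow> string \<Rightarrow> com" where
  "add_arc x y =
     ''to''.[Reg ''a''] \<leftarrow> Reg y ;; ''nxt''.[Reg ''a''] \<leftarrow> ''head''.[Reg x] ;;
     ''a'' ::= Reg ''a'' .+ Const 1 ;; ''head''.[Reg x] \<leftarrow> Reg ''a''"

definition arc_step :: com where
  "arc_step =
     (''u'' ::= ''pos''.[''src''.[Reg ''j'']] ;; ''w'' ::= ''pos''.[''tgt''.[Reg ''j'']]) ;;
     add_arc ''u'' ''w'' ;; add_arc ''w'' ''u'' ;; ''j'' ::= Reg ''j'' .+ Const 1"

definition arc_loop :: com where
  "arc_loop = While (Reg ''j'' .< Reg ''m'') arc_step"

lemma arc_writes [simp]:
  "wregs (add_arc x y) = {''a''}" "warrs (add_arc x y) = {''to'', ''nxt'', ''head''}"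
  "wregs arc_step = {''u'', ''w'', ''a'', ''j''}" "warrs arc_step = {''to'', ''nxt'', ''head''}"
  "wregs arc_loop = {''u'', ''w'', ''a'', ''j''}" "warrs arc_loop = {''to'', ''nxt'', ''head''}"
  by (auto simp: add_arc_def arc_step_def arc_loop_def)

definition arcs_ok :: "nat \<Rightarrow> state \<Rightarrow> bool" where
  "arcs_ok N s \<longleftrightarrow> (\<forall>v. arr s ''head'' v = last_arc N v) \<and>
    (\<forall>a<N. arr s ''to'' a = dst a \<and> arr s ''nxt'' a = last_arc a (src a))"

lemma runs_add_arc:
  assumes "arcs_ok N s" "reg s ''a'' = N" "N < 2 * m" "reg s x = src N" "reg s y = dst N" "x \<noteq> ''a''"
  shows "runs B (add_arc x y) s (\<lambda>s' t. t \<le> 20 \<and> arcs_ok (Suc N) s' \<and> reg s' ''a'' = Suc N)"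
proof -
  have "last_arc N v < B" for v using last_arc_le[of N v] assms(3) B by linarith
  moreover have "N < B" "Suc N < B" "Suc 0 < B" "src N < B" "dst N < B"
    using arc_bounds[OF assms(3)] assms(3) B by auto
  ultimately show ?thesis
    using assms by (auto simp: add_arc_def runs_simps arcs_ok_def less_Suc_eq)
qed

lemma runs_arc_loop:
  assumes s: "reg s ''j'' = 0" "reg s ''a'' = 0" "reg s ''m'' = m" "arr s ''src'' = list_arr (map fst es)"
      "arr s ''tgt'' = list_arr (map snd es)" "\<And>v. v < n \<Longrightarrow> arr s ''pos'' v = pos v"
      "arr s ''head'' = (\<lambda>_. 0)"
  shows "runs B arc_loop s (\<lambda>s' t. t \<le> 70 * m + 10 \<and> arcs_ok (2 * m) s')"
  unfolding arc_loop_def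
proof (rule runs_While[where T = "70 * m" and I = "\<lambda>s' t. reg s' ''j'' \<le> m \<and> t \<le> 70 * reg s' ''j'' \<and>
    reg s' ''a'' = 2 * reg s' ''j'' \<and> arcs_ok (2 * reg s' ''j'') s'"])
  let ?I = "\<lambda>s' t. reg s' ''j'' \<le> m \<and> t \<le> 70 * reg s' ''j'' \<and>
    reg s' ''a'' = 2 * reg s' ''j'' \<and> arcs_ok (2 * reg s' ''j'') s'"
  let ?g = "Reg ''j'' .< Reg ''m''"
  fix s' :: state and t :: nat
  assume I: "?I s' t" and ag: "agree arc_step s s'"
  have r: "reg s' ''m'' = m" "arr s' ''src'' = list_arr (map fst es)"
      "arr s' ''tgt'' = list_arr (map snd es)" "\<And>v. v < n \<Longrightarrow> arr s' ''pos'' v = pos v"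
    by (simp_all add: agree_reg[OF ag] agree_arr[OF ag] s)
  show "fits B ?g s'" using I r B by simp
  show "t + (cost ?g + 1) \<le> 70 * m + 10 \<and> arcs_ok (2 * m) s'" if "aval ?g s' = 0"
  proof -
    have "reg s' ''j'' = m" using that I r by (simp split: if_splits)
    then show ?thesis using I by simp
  qed
  assume "aval ?g s' \<noteq> 0"
  then have j: "reg s' ''j'' < m" using r by (simp split: if_splits)
  define j where "j = reg s' ''j''"
  obtain u w where uw: "es ! j = (u, w)" by (cases "es ! j")
  have uwn: "u < n" "w < n" using es[of j] j uw by (auto simp: j_def)
  have la: "list_arr (map fst es) j = u" "list_arr (map snd es) j = w"
    using j m uw by (simp_all add: list_arr_def j_def)
  have sd: "src (2 * j) = pos u" "dst (2 * j) = pos w" "src (Suc (2 * j)) = pos w" "dst (Suc (2 * j)) = pos u"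
    using uw by (simp_all add: src_def dst_def)
  have pB: "pos u < B" "pos w < B" "u < B" "w < B" "j < B" "Suc j < B" "Suc 0 < B"
    using pos_less[OF uwn(1)] pos_less[OF uwn(2)] uwn j B by (simp_all add: j_def)
  let ?p = "''u'' ::= ''pos''.[''src''.[Reg ''j'']] ;; ''w'' ::= ''pos''.[''tgt''.[Reg ''j'']]"
  have 1: "runs B ?p s' (\<lambda>s1 t1. t1 = 8 \<and> reg s1 ''u'' = pos u \<and> reg s1 ''w'' = pos w)"
    using pB by (simp add: runs_simps r j_def[symmetric] la uwn)
  show "runs B arc_step s' (\<lambda>s'' t'. ?I s'' (t + (cost ?g + 1) + t'))"
    unfolding arc_step_def
  proof (rule runs_SeqF[OF 1])
    fix s1 :: state and t1 :: nat
    assume 1: "t1 = 8 \<and> reg s1 ''u'' = pos u \<and> reg s1 ''w'' = pos w" and ag: "agree ?p s' s1"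
    have r1: "reg s1 ''a'' = 2 * j" "reg s1 ''j'' = j" "reg s1 ''u'' = pos u" "reg s1 ''w'' = pos w"
      "arr s1 = arr s'"
      using I 1 by (simp_all add: agree_reg[OF ag] agree_arr[OF ag] fun_eq_iff j_def)
    have ok1: "arcs_ok (2 * j) s1" using I r1 by (simp add: arcs_ok_def j_def)
    have 2: "runs B (add_arc ''u'' ''w'') s1 (\<lambda>s' t. t \<le> 20 \<and> arcs_ok (Suc (2 * j)) s' \<and>
        reg s' ''a'' = Suc (2 * j))"
      by (rule runs_add_arc[OF ok1]) (use r1 sd j in \<open>auto simp: j_def\<close>)
    show "runs B (add_arc ''u'' ''w'' ;; add_arc ''w'' ''u'' ;; ''j'' ::= Reg ''j'' .+ Const 1) s1
      (\<lambda>s2 t2. ?I s2 (t + (cost ?g + 1) + (t1 + t2)))"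
    proof (rule runs_SeqF[OF 2])
      fix s2 :: state and t2 :: nat
      assume 2: "t2 \<le> 20 \<and> arcs_ok (Suc (2 * j)) s2 \<and> reg s2 ''a'' = Suc (2 * j)"
        and ag: "agree (add_arc ''u'' ''w'') s1 s2"
      have r2: "reg s2 ''j'' = j" "reg s2 ''u'' = pos u" "reg s2 ''w'' = pos w"
        by (simp_all add: agree_reg[OF ag] r1)
      have 3: "runs B (add_arc ''w'' ''u'') s2 (\<lambda>s' t. t \<le> 20 \<and> arcs_ok (Suc (Suc (2 * j))) s' \<and>
        reg s' ''a'' = Suc (Suc (2 * j)))"
        by (rule runs_add_arc[OF conjunct1[OF conjunct2[OF 2]]]) (use 2 r2 sd j in \<open>auto simp: j_def\<close>)
      show "runs B (add_arc ''w'' ''u'' ;; ''j'' ::= Reg ''j'' .+ Const 1) s2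
        (\<lambda>s3 t3. ?I s3 (t + (cost ?g + 1) + (t1 + (t2 + t3))))"
      proof (rule runs_SeqF[OF 3])
        fix s3 :: state and t3 :: nat
        assume 3: "t3 \<le> 20 \<and> arcs_ok (Suc (Suc (2 * j))) s3 \<and> reg s3 ''a'' = Suc (Suc (2 * j))"
          and ag: "agree (add_arc ''w'' ''u'') s2 s3"
        have r3: "reg s3 ''j'' = j" by (simp add: agree_reg[OF ag] r2)
        show "runs B (''j'' ::= Reg ''j'' .+ Const 1) s3
          (\<lambda>s4 t4. ?I s4 (t + (cost ?g + 1) + (t1 + (t2 + (t3 + t4)))))"
          using I j 1 2 3 pB unfolding j_def[symmetric] by (simp add: runs_simps r3 arcs_ok_def)
      qed
    qed
  qed
qed (use s in \<open>auto simp: arcs_ok_def\<close>)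

section \<open>Least and greatest distinguishing vertex of every cut\<close>

definition lower :: com where
  "lower =
     If (Reg ''v'' .< ''lo''.[Reg ''k'']) (''lo''.[Reg ''k''] \<leftarrow> Reg ''v'') Skip ;;
     If (Reg ''n'' .- Reg ''v'' .< ''nh''.[Reg ''k'']) (''nh''.[Reg ''k''] \<leftarrow> Reg ''n'' .- Reg ''v'') Skip"

definition mark_loop :: com where
  "mark_loop = While (Const 0 .< Reg ''p'')
     (''mark''.[''to''.[Reg ''p'' .- Const 1] .+ Const 1] \<leftarrow> Reg ''v'' .+ Const 1 ;;
      ''p'' ::= ''nxt''.[Reg ''p'' .- Const 1])"

definition hit_step :: com where
  "hit_step =
     (''k'' ::= ''to''.[Reg ''p'' .- Const 1] ;;
      If (''mark''.[Reg ''k''] .= Reg ''v'' .+ Const 1) Skip lower) ;;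
     (''k'' ::= Reg ''k'' .+ Const 1 ;;
      If (''mark''.[Reg ''k'' .+ Const 1] .= Reg ''v'' .+ Const 1) Skip lower) ;;
     ''p'' ::= ''nxt''.[Reg ''p'' .- Const 1]"

definition hit_loop :: com where
  "hit_loop = While (Const 0 .< Reg ''p'') hit_step"

definition vert_step :: com where
  "vert_step =
     (''mark''.[Reg ''v'' .+ Const 1] \<leftarrow> Reg ''v'' .+ Const 1 ;; ''p'' ::= ''head''.[Reg ''v'']) ;;
     mark_loop ;; (''p'' ::= ''head''.[Reg ''v'']) ;; hit_loop ;; ''v'' ::= Reg ''v'' .+ Const 1"

definition vert_loop :: com where
  "vert_loop = While (Reg ''v'' .< Reg ''n'') vert_step"

lemma vert_writes [simp]:
  "wregs lower = {}" "warrs lower = {''lo'', ''nh''}"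
  "wregs mark_loop = {''p''}" "warrs mark_loop = {''mark''}"
  "wregs hit_step = {''k'', ''p''}" "warrs hit_step = {''lo'', ''nh''}"
  "wregs hit_loop = {''k'', ''p''}" "warrs hit_loop = {''lo'', ''nh''}"
  "wregs vert_step = {''k'', ''p'', ''v''}" "warrs vert_step = {''mark'', ''lo'', ''nh''}"
  "wregs vert_loop = {''k'', ''p'', ''v''}" "warrs vert_loop = {''mark'', ''lo'', ''nh''}"
  by (auto simp: lower_def mark_loop_def hit_step_def hit_loop_def vert_step_def vert_loop_def)

lemma runs_lower:
  assumes "reg s ''v'' < n" "reg s ''n'' = n" "reg s ''k'' \<le> n" "arr s ''lo'' (reg s ''k'') \<le> n"
    "arr s ''nh'' (reg s ''k'') \<le> n"
  shows "runs B lower s (\<lambda>s' t. t \<le> 25 \<and>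
    arr s' ''lo'' = (arr s ''lo'')(reg s ''k'' := min (arr s ''lo'' (reg s ''k'')) (reg s ''v'')) \<and>
    arr s' ''nh'' = (arr s ''nh'')(reg s ''k'' := min (arr s ''nh'' (reg s ''k'')) (n - reg s ''v'')))"
  using assms B by (auto simp: lower_def runs_simps min_def fun_eq_iff)

text \<open>The index is shifted by one, so that the test of position \<open>k - 1\<close> reads
  entry \<open>k\<close>, also for \<open>k = 0\<close>. Marking \<open>v\<close> itself discards
  \<open>v\<close> as a distinguisher of the two cuts next to it.\<close>

definition marked :: "nat \<Rightarrow> nat \<Rightarrow> bool" where
  "marked v x \<longleftrightarrow> (\<exists>i. x = Suc i \<and> (i = v \<or> adj v i))"

text \<open>A cut distinguished by \<open>v\<close> is adjacent to a neighbour of \<open>v\<close>, so inspecting the two cuts next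
  to each neighbour suffices. The marks are stamped with \<open>v + 1\<close> and never need clearing.\<close>

definition hits :: "nat \<Rightarrow> nat \<Rightarrow> nat \<Rightarrow> bool" where
  "hits v p k \<longleftrightarrow> (\<exists>a \<in> arcs_from v p.
     dst a = k \<and> \<not> marked v k \<or> Suc (dst a) = k \<and> \<not> marked v (Suc k))"

text \<open>The first alternative of \<open>hits\<close> finds the cuts of which only the right side
  \<open>k\<close> is adjacent to \<open>v\<close>, the second those of which only the left side
  \<open>k - 1\<close> is. If both are adjacent, both are marked and neither alternative
  applies.\<close>

lemma hits_0:
  assumes "0 < k" "k < n"
  shows "hits v 0 k \<longleftrightarrow> v \<noteq> k - 1 \<and> v \<noteq> k \<and> adj v (k - 1) \<noteq> adj v k"
proof -
  have h: "hits v 0 k \<longleftrightarrow> adj v k \<and> \<not> marked v k \<or> adj v (k - 1) \<and> \<not> marked v (Suc k)"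
    using assms(1) by (auto simp: hits_def arcs_from_def adj_def)
  have "marked v k \<longleftrightarrow> v = k - 1 \<or> adj v (k - 1)" "marked v (Suc k) \<longleftrightarrow> v = k \<or> adj v k"
    using assms(1) by (auto simp: marked_def gr0_conv_Suc)
  then show ?thesis using h adj_bounds by blast
qed

text \<open>The greatest element of \<open>H\<close> is stored as its distance to \<open>n\<close>, so that it is also found by a
  minimum query; \<open>k\<close> and \<open>n\<close> are neutral values for an empty \<open>H\<close>.\<close>

definition bnd_ok :: "nat \<Rightarrow> nat \<Rightarrow> nat \<Rightarrow> nat set \<Rightarrow> bool" where
  "bnd_ok l h k H \<longleftrightarrow> (\<forall>a. l < a \<longleftrightarrow> k < a \<or> (\<exists>v \<in> H. v < a)) \<and>
     (\<forall>c. h \<le> c \<longleftrightarrow> n \<le> c \<or> (\<exists>v \<in> H. n - v \<le> c))"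

text \<open>As the extrema are described by thresholds, taking a minimum turns into a disjunction,
  and no minimum over a set has to be formed.\<close>

lemma bnd_ok_insert: "bnd_ok l h k H \<Longrightarrow> bnd_ok (min l v) (min h (n - v)) k (insert v H)"
  unfolding bnd_ok_def by (simp add: min_less_iff_disj min_le_iff_disj) blast

lemma bnd_ok_empty: "bnd_ok k n k {}"
  by (simp add: bnd_ok_def)

text \<open>Stamps left by earlier vertices are at most \<open>v\<close>, so exactly the entries
  equal to \<open>Suc v\<close> are current. The time is charged to the degree of
  \<open>v\<close>.\<close>

lemma runs_mark_loop:
  assumes s: "reg s ''v'' = v" "v < n" "reg s ''p'' = last_arc (2 * m) v"
    and arcs: "\<And>a. a < 2 * m \<Longrightarrow> arr s ''to'' a = dst a \<and> arr s ''nxt'' a = last_arc a (src a)"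
    and mark: "\<And>x. arr s ''mark'' x \<le> v \<or> x = Suc v \<and> arr s ''mark'' x = Suc v" "arr s ''mark'' (Suc v) = Suc v"
  shows "runs B mark_loop s (\<lambda>s' t. t \<le> 20 * card (arcs_from v 0) + 10 \<and>
    (\<forall>x. arr s' ''mark'' x = Suc v \<longleftrightarrow> marked v x) \<and> (\<forall>x. arr s' ''mark'' x \<le> Suc v))"
  unfolding mark_loop_def
proof (rule runs_While[where T = "40 * m" and I = "\<lambda>s' t. t \<le> 20 * card (arcs_from v (reg s' ''p'')) \<and>
    reg s' ''p'' \<le> 2 * m \<and> (0 < reg s' ''p'' \<longrightarrow> src (reg s' ''p'' - 1) = v) \<and>
    (\<forall>x. arr s' ''mark'' x = Suc v \<longleftrightarrow> x = Suc v \<or> (\<exists>a \<in> arcs_from v (reg s' ''p''). x = Suc (dst a))) \<and>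
    (\<forall>x. arr s' ''mark'' x \<le> Suc v)"])
  let ?c = "''mark''.[''to''.[Reg ''p'' .- Const 1] .+ Const 1] \<leftarrow> Reg ''v'' .+ Const 1 ;;
      ''p'' ::= ''nxt''.[Reg ''p'' .- Const 1]"
  let ?I = "\<lambda>s' t. t \<le> 20 * card (arcs_from v (reg s' ''p'')) \<and>
    reg s' ''p'' \<le> 2 * m \<and> (0 < reg s' ''p'' \<longrightarrow> src (reg s' ''p'' - 1) = v) \<and>
    (\<forall>x. arr s' ''mark'' x = Suc v \<longleftrightarrow> x = Suc v \<or> (\<exists>a \<in> arcs_from v (reg s' ''p''). x = Suc (dst a))) \<and>
    (\<forall>x. arr s' ''mark'' x \<le> Suc v)"
  show "?I s 0"
    using s mark last_arc_le[of "2 * m" v] last_arc_src[of "2 * m" v] arcs_from_last[of v]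
    by (auto simp: le_Suc_eq) (metis Suc_n_not_le_n)
  fix s' :: state and t :: nat
  have "card (arcs_from v p) \<le> card {..<2 * m}" for p
    by (rule card_mono) (auto simp: arcs_from_def)
  then show "?I s' t \<Longrightarrow> t \<le> 40 * m" by (force intro: le_trans)
  assume I: "?I s' t" and ag: "agree ?c s s'"
  have r: "reg s' ''v'' = v" "arr s' ''to'' = arr s ''to''" "arr s' ''nxt'' = arr s ''nxt''"
    by (simp_all add: agree_reg[OF ag] agree_arr[OF ag] s)
  show "fits B (Const 0 .< Reg ''p'') s'" using I B by simp
  show "t + (cost (Const 0 .< Reg ''p'') + 1) \<le> 20 * card (arcs_from v 0) + 10 \<and>
    (\<forall>x. arr s' ''mark'' x = Suc v \<longleftrightarrow> marked v x) \<and> (\<forall>x. arr s' ''mark'' x \<le> Suc v)"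
    if "aval (Const 0 .< Reg ''p'') s' = 0"
  proof -
    have p0: "reg s' ''p'' = 0" using that by (simp split: if_splits)
    have mk: "marked v x \<longleftrightarrow> x = Suc v \<or> (\<exists>a \<in> arcs_from v 0. x = Suc (dst a))" for x
      by (auto simp: marked_def adj_def arcs_from_def)
    show ?thesis using I unfolding p0 mk by simp
  qed
  assume "aval (Const 0 .< Reg ''p'') s' \<noteq> 0"
  then have p0: "0 < reg s' ''p''" by (simp split: if_splits)
  define p where "p = reg s' ''p''"
  have p: "0 < p" "p \<le> 2 * m" "src (p - 1) = v" using I p0 by (auto simp: p_def)
  have pa: "p - Suc 0 < 2 * m" using p by simp
  note st = arcs_from_step[OF p]
  define q where "q = last_arc (p - 1) v"
  have q: "q \<le> 2 * m" "0 < q \<longrightarrow> src (q - 1) = v"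
    using last_arc_le[of "p - 1" v] last_arc_src[of "p - 1" v] p by (auto simp: q_def)
  have to: "arr s ''to'' (p - Suc 0) = dst (p - 1)" "arr s ''nxt'' (p - Suc 0) = q"
    using arcs[OF pa] p(3) by (simp_all add: q_def)
  have d: "dst (p - 1) < n" using arc_bounds[of "p - 1"] pa by simp
  have cnt: "t + 20 \<le> 20 * card (arcs_from v q)" using I st by (simp add: p_def[symmetric] q_def)
  have mk: "(if x = Suc (dst (p - 1)) then Suc v else arr s' ''mark'' x) = Suc v \<longleftrightarrow>
      x = Suc v \<or> (\<exists>a \<in> arcs_from v q. x = Suc (dst a))" for x
    using I st(1) unfolding p_def[symmetric] q_def by auto
  have bB: "p < B" "q < B" "Suc v < B" "v < B" "Suc (dst (p - 1)) < B" "Suc 0 < B" "p - Suc 0 < B"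
    using p q d s B by auto
  have mle: "arr s' ''mark'' x \<le> Suc v" for x using I by simp
  show "runs B ?c s' (\<lambda>s'' t'. ?I s'' (t + (cost (Const 0 .< Reg ''p'') + 1) + t'))"
    using bB q cnt mk mle by (simp add: runs_simps r p_def[symmetric] to)
qed

text \<open>A neighbour at position \<open>d\<close> is the right side of cut \<open>d\<close> and
  the left side of cut \<open>d + 1\<close>; the bounds of either cut are lowered unless its other
  side is marked.\<close>

lemma runs_hit_step:
  assumes s: "reg s ''v'' = v" "v < n" "reg s ''n'' = n" "reg s ''p'' = p" "0 < p" "p \<le> 2 * m"
    "src (p - 1) = v"
    and arcs: "arr s ''to'' (p - 1) = dst (p - 1)" "arr s ''nxt'' (p - 1) = last_arc (p - 1) v"
    and mark: "\<And>x. arr s ''mark'' x = Suc v \<longleftrightarrow> marked v x" "\<And>x. arr s ''mark'' x \<le> Suc v"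
    and le: "\<And>k. arr s ''lo'' k \<le> n" "\<And>k. arr s ''nh'' k \<le> n"
  shows "runs B hit_step s (\<lambda>s' t. t \<le> 100 \<and> reg s' ''p'' = last_arc (p - 1) v \<and>
    (\<forall>k. arr s' ''lo'' k = (if dst (p - 1) = k \<and> \<not> marked v k \<or> Suc (dst (p - 1)) = k \<and> \<not> marked v (Suc k)
       then min (arr s ''lo'' k) v else arr s ''lo'' k)) \<and>
    (\<forall>k. arr s' ''nh'' k = (if dst (p - 1) = k \<and> \<not> marked v k \<or> Suc (dst (p - 1)) = k \<and> \<not> marked v (Suc k)
       then min (arr s ''nh'' k) (n - v) else arr s ''nh'' k)))"
proof -
  define d where "d = dst (p - 1)"
  have d: "d < n" using arc_bounds[of "p - 1"] s by (simp add: d_def)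
  have bB: "p < B" "Suc v < B" "v < B" "Suc (Suc d) < B" "Suc d < B" "d < B" "Suc 0 < B" "n < B"
    using s d B by auto
  have mB: "arr s ''mark'' x < B" for x using mark(2)[of x] bB by linarith
  let ?u = "\<lambda>f b k w. if b then f(k := min (f k) w) else (f :: nat \<Rightarrow> nat)"
  let ?p1 = "''k'' ::= ''to''.[Reg ''p'' .- Const 1] ;;
      If (''mark''.[Reg ''k''] .= Reg ''v'' .+ Const 1) Skip lower"
  let ?p2 = "''k'' ::= Reg ''k'' .+ Const 1 ;;
      If (''mark''.[Reg ''k'' .+ Const 1] .= Reg ''v'' .+ Const 1) Skip lower"
  let ?R1 = "\<lambda>s' t. t \<le> 40 \<and> reg s' ''k'' = d \<and>
    arr s' ''lo'' = ?u (arr s ''lo'') (\<not> marked v d) d v \<and>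
    arr s' ''nh'' = ?u (arr s ''nh'') (\<not> marked v d) d (n - v)"
  have 1: "runs B ?p1 s ?R1"
  proof (rule runs_SeqF[where R = "\<lambda>s' t. t = 5 \<and> reg s' ''k'' = d"])
    show "runs B (''k'' ::= ''to''.[Reg ''p'' .- Const 1]) s (\<lambda>s' t. t = 5 \<and> reg s' ''k'' = d)"
      using bB arcs by (simp add: runs_simps s d_def)
    fix s1 :: state and t1 :: nat
    assume k: "t1 = 5 \<and> reg s1 ''k'' = d" and ag: "agree (''k'' ::= ''to''.[Reg ''p'' .- Const 1]) s s1"
    have r: "reg s1 ''v'' = v" "reg s1 ''n'' = n" "arr s1 = arr s" "reg s1 ''k'' = d"
      using k by (simp_all add: agree_reg[OF ag] agree_arr[OF ag] s fun_eq_iff)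
    have ev: "aval (''mark''.[Reg ''k''] .= Reg ''v'' .+ Const 1) s1 = (if marked v d then 1 else 0)"
      using mark(1)[of d] by (simp add: r)
    have ft: "fits B (''mark''.[Reg ''k''] .= Reg ''v'' .+ Const 1) s1" using bB mB by (simp add: r)
    show "runs B (If (''mark''.[Reg ''k''] .= Reg ''v'' .+ Const 1) Skip lower) s1 (\<lambda>s2 t2. ?R1 s2 (t1 + t2))"
    proof (cases "marked v d")
      case True
      then show ?thesis using ft ev k by (intro runs_IfT) (simp_all add: runs_Skip r)
    next
      case False
      have "runs B lower s1 (\<lambda>s2 t2. ?R1 s2 (t1 + (cost (''mark''.[Reg ''k''] .= Reg ''v'' .+ Const 1) + 1 + t2)))"
        by (rule runs_mono[OF runs_agree[OF runs_lower]])
          (use k le False s d in \<open>auto simp: r agree_def\<close>)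
      then show ?thesis using ft ev False by (intro runs_IfF) simp_all
    qed
  qed
  let ?lo1 = "?u (arr s ''lo'') (\<not> marked v d) d v"
  let ?nh1 = "?u (arr s ''nh'') (\<not> marked v d) d (n - v)"
  let ?R2 = "\<lambda>s' t. t \<le> 40 \<and>
    arr s' ''lo'' = ?u ?lo1 (\<not> marked v (Suc (Suc d))) (Suc d) v \<and>
    arr s' ''nh'' = ?u ?nh1 (\<not> marked v (Suc (Suc d))) (Suc d) (n - v)"
  show ?thesis unfolding hit_step_def
  proof (rule runs_SeqF[OF 1])
    fix s1 :: state and t1 :: nat
    assume R1: "?R1 s1 t1" and ag: "agree ?p1 s s1"
    have r1: "reg s1 ''v'' = v" "reg s1 ''n'' = n" "reg s1 ''p'' = p" "arr s1 ''mark'' = arr s ''mark''"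
      "arr s1 ''nxt'' = arr s ''nxt''" "reg s1 ''k'' = d"
      using R1 by (simp_all add: agree_reg[OF ag] agree_arr[OF ag] s)
    have le1: "arr s1 ''lo'' k \<le> n" "arr s1 ''nh'' k \<le> n" for k using R1 le by (simp_all add: min.coboundedI1)
    have 2: "runs B ?p2 s1 ?R2"
    proof (rule runs_SeqF[where R = "\<lambda>s' t. t = 4 \<and> reg s' ''k'' = Suc d"])
      show "runs B (''k'' ::= Reg ''k'' .+ Const 1) s1 (\<lambda>s' t. t = 4 \<and> reg s' ''k'' = Suc d)"
        using bB by (simp add: runs_simps r1)
      fix s2 :: state and t2 :: nat
      assume k: "t2 = 4 \<and> reg s2 ''k'' = Suc d" and ag: "agree (''k'' ::= Reg ''k'' .+ Const 1) s1 s2"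
      have r: "reg s2 ''v'' = v" "reg s2 ''n'' = n" "arr s2 = arr s1" "reg s2 ''k'' = Suc d"
        using k by (simp_all add: agree_reg[OF ag] agree_arr[OF ag] r1 fun_eq_iff)
      have ev: "aval (''mark''.[Reg ''k'' .+ Const 1] .= Reg ''v'' .+ Const 1) s2 =
          (if marked v (Suc (Suc d)) then 1 else 0)"
        using mark(1)[of "Suc (Suc d)"] by (simp add: r r1)
      have ft: "fits B (''mark''.[Reg ''k'' .+ Const 1] .= Reg ''v'' .+ Const 1) s2"
        using bB mB by (simp add: r r1)
      show "runs B (If (''mark''.[Reg ''k'' .+ Const 1] .= Reg ''v'' .+ Const 1) Skip lower) s2
        (\<lambda>s3 t3. ?R2 s3 (t2 + t3))"
      proof (cases "marked v (Suc (Suc d))")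
        case True
        then show ?thesis using ft ev k R1 by (intro runs_IfT) (simp_all add: runs_Skip r)
      next
        case False
        have "runs B lower s2
          (\<lambda>s3 t3. ?R2 s3 (t2 + (cost (''mark''.[Reg ''k'' .+ Const 1] .= Reg ''v'' .+ Const 1) + 1 + t3)))"
          by (rule runs_mono[OF runs_lower])
            (use k le1 False s d R1 in \<open>auto simp: r\<close>)
        then show ?thesis using ft ev False by (intro runs_IfF) simp_all
      qed
    qed
    show "runs B (?p2 ;; ''p'' ::= ''nxt''.[Reg ''p'' .- Const 1]) s1
      (\<lambda>s2 t2. t1 + t2 \<le> 100 \<and> reg s2 ''p'' = last_arc (p - 1) v \<and>
    (\<forall>k. arr s2 ''lo'' k = (if dst (p - 1) = k \<and> \<not> marked v k \<or> Suc (dst (p - 1)) = k \<and> \<not> marked v (Suc k)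
       then min (arr s ''lo'' k) v else arr s ''lo'' k)) \<and>
    (\<forall>k. arr s2 ''nh'' k = (if dst (p - 1) = k \<and> \<not> marked v k \<or> Suc (dst (p - 1)) = k \<and> \<not> marked v (Suc k)
       then min (arr s ''nh'' k) (n - v) else arr s ''nh'' k)))"
    proof (rule runs_SeqF[OF 2])
      fix s2 :: state and t2 :: nat
      assume R2: "?R2 s2 t2" and ag: "agree ?p2 s1 s2"
      have r2: "reg s2 ''p'' = p" "arr s2 ''nxt'' = arr s ''nxt''"
        by (simp_all add: agree_reg[OF ag] agree_arr[OF ag] r1)
      have t12: "t1 \<le> 40" "t2 \<le> 40" using R1 R2 by blast+
      have "arr s2 ''lo'' = ?u ?lo1 (\<not> marked v (Suc (Suc d))) (Suc d) v"
        "arr s2 ''nh'' = ?u ?nh1 (\<not> marked v (Suc (Suc d))) (Suc d) (n - v)" using R2 by blast+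
      \<comment> \<open>The two updates are for different cuts and do not interfere.\<close>
      then have lo: "arr s2 ''lo'' k = (if d = k \<and> \<not> marked v k \<or> Suc d = k \<and> \<not> marked v (Suc k)
          then min (arr s ''lo'' k) v else arr s ''lo'' k)"
        and nh: "arr s2 ''nh'' k = (if d = k \<and> \<not> marked v k \<or> Suc d = k \<and> \<not> marked v (Suc k)
          then min (arr s ''nh'' k) (n - v) else arr s ''nh'' k)" for k
        by (cases "k = d"; cases "k = Suc d"; simp)+
      have "last_arc (p - Suc 0) v < B" using last_arc_le[of "p - Suc 0" v] bB(1) by linarith
      then show "runs B (''p'' ::= ''nxt''.[Reg ''p'' .- Const 1]) s2
        (\<lambda>s3 t3. t1 + (t2 + t3) \<le> 100 \<and> reg s3 ''p'' = last_arc (p - 1) v \<and>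
    (\<forall>k. arr s3 ''lo'' k = (if dst (p - 1) = k \<and> \<not> marked v k \<or> Suc (dst (p - 1)) = k \<and> \<not> marked v (Suc k)
       then min (arr s ''lo'' k) v else arr s ''lo'' k)) \<and>
    (\<forall>k. arr s3 ''nh'' k = (if dst (p - 1) = k \<and> \<not> marked v k \<or> Suc (dst (p - 1)) = k \<and> \<not> marked v (Suc k)
       then min (arr s ''nh'' k) (n - v) else arr s ''nh'' k)))"
        unfolding d_def[symmetric] using bB t12 arcs lo nh by (simp add: runs_simps r2)
    qed
  qed
qed

lemma runs_hit_loop:
  assumes s: "reg s ''v'' = v" "v < n" "reg s ''n'' = n" "reg s ''p'' = last_arc (2 * m) v"
    and arcs: "arcs_ok (2 * m) s"
    and mark: "\<And>x. arr s ''mark'' x = Suc v \<longleftrightarrow> marked v x" "\<And>x. arr s ''mark'' x \<le> Suc v"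
    and le: "\<And>k. arr s ''lo'' k \<le> n \<and> arr s ''nh'' k \<le> n"
    and bnd: "\<And>k. k < n \<Longrightarrow> bnd_ok (arr s ''lo'' k) (arr s ''nh'' k) k (H k)"
  shows "runs B hit_loop s (\<lambda>s' t. t \<le> 120 * card (arcs_from v 0) + 10 \<and>
    (\<forall>k. arr s' ''lo'' k \<le> n \<and> arr s' ''nh'' k \<le> n) \<and>
    (\<forall>k<n. bnd_ok (arr s' ''lo'' k) (arr s' ''nh'' k) k (H k \<union> (if hits v 0 k then {v} else {}))))"
  unfolding hit_loop_def
proof (rule runs_While[where T = "240 * m" and I = "\<lambda>s' t. t \<le> 120 * card (arcs_from v (reg s' ''p'')) \<and>
    reg s' ''p'' \<le> 2 * m \<and> (0 < reg s' ''p'' \<longrightarrow> src (reg s' ''p'' - 1) = v) \<and>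
    (\<forall>k. arr s' ''lo'' k \<le> n \<and> arr s' ''nh'' k \<le> n) \<and>
    (\<forall>k<n. bnd_ok (arr s' ''lo'' k) (arr s' ''nh'' k) k
      (H k \<union> (if hits v (reg s' ''p'') k then {v} else {})))"])
  let ?I = "\<lambda>s' t. t \<le> 120 * card (arcs_from v (reg s' ''p'')) \<and>
    reg s' ''p'' \<le> 2 * m \<and> (0 < reg s' ''p'' \<longrightarrow> src (reg s' ''p'' - 1) = v) \<and>
    (\<forall>k. arr s' ''lo'' k \<le> n \<and> arr s' ''nh'' k \<le> n) \<and>
    (\<forall>k<n. bnd_ok (arr s' ''lo'' k) (arr s' ''nh'' k) k
      (H k \<union> (if hits v (reg s' ''p'') k then {v} else {})))"
  let ?g = "Const 0 .< Reg ''p''"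
  show "?I s 0"
    using s last_arc_le[of "2 * m" v] last_arc_src[of "2 * m" v] arcs_from_last[of v] le bnd
    by (simp add: hits_def)
  fix s' :: state and t :: nat
  have "card (arcs_from v p) \<le> card {..<2 * m}" for p
    by (rule card_mono) (auto simp: arcs_from_def)
  then show "?I s' t \<Longrightarrow> t \<le> 240 * m" by (force intro: le_trans)
  assume I: "?I s' t" and ag: "agree hit_step s s'"
  have r: "reg s' ''v'' = v" "reg s' ''n'' = n" "arr s' ''to'' = arr s ''to''"
    "arr s' ''nxt'' = arr s ''nxt''" "arr s' ''mark'' = arr s ''mark''"
    by (simp_all add: agree_reg[OF ag] agree_arr[OF ag] s)
  show "fits B ?g s'" using I B by simp
  show "t + (cost ?g + 1) \<le> 120 * card (arcs_from v 0) + 10 \<and>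
    (\<forall>k. arr s' ''lo'' k \<le> n \<and> arr s' ''nh'' k \<le> n) \<and>
    (\<forall>k<n. bnd_ok (arr s' ''lo'' k) (arr s' ''nh'' k) k (H k \<union> (if hits v 0 k then {v} else {})))"
    if "aval ?g s' = 0"
  proof -
    have p0: "reg s' ''p'' = 0" using that by (simp split: if_splits)
    show ?thesis using I unfolding p0 by simp
  qed
  assume "aval ?g s' \<noteq> 0"
  then have p0: "0 < reg s' ''p''" by (simp split: if_splits)
  define p where "p = reg s' ''p''"
  define q where "q = last_arc (p - 1) v"
  have p: "0 < p" "p \<le> 2 * m" "src (p - 1) = v" using I p0 by (auto simp: p_def)
  have pa: "p - 1 < 2 * m" using p by simp
  note st = arcs_from_step[OF p, folded q_def]
  have q: "q \<le> 2 * m" "0 < q \<longrightarrow> src (q - 1) = v"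
    using last_arc_le[of "p - 1" v] last_arc_src[of "p - 1" v] p by (auto simp: q_def)
  have to: "arr s' ''to'' (p - 1) = dst (p - 1)" "arr s' ''nxt'' (p - 1) = last_arc (p - 1) v"
    using arcs pa p(3) unfolding r by (auto simp: arcs_ok_def)
  let ?c = "\<lambda>k. dst (p - 1) = k \<and> \<not> marked v k \<or> Suc (dst (p - 1)) = k \<and> \<not> marked v (Suc k)"
  have hq: "hits v q k \<longleftrightarrow> ?c k \<or> hits v p k" for k unfolding hits_def st(1) by blast
  \<comment> \<open>The extra name \<open>s'a\<close> denotes the start state where the bound result
    state shadows \<open>s'\<close>.\<close>
  have step: "runs B hit_step s' (\<lambda>s' t. t \<le> 100 \<and> reg s' ''p'' = last_arc (p - 1) v \<and>
    (\<forall>k. arr s' ''lo'' k = (if ?c k then min (arr s'a ''lo'' k) v else arr s'a ''lo'' k)) \<and>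
    (\<forall>k. arr s' ''nh'' k = (if ?c k then min (arr s'a ''nh'' k) (n - v) else arr s'a ''nh'' k)))"
    if "s'a = s'" for s'a
    unfolding that by (rule runs_hit_step) (use r s p to mark I in \<open>simp_all add: p_def\<close>)
  show "runs B hit_step s' (\<lambda>s'' t'. ?I s'' (t + (cost ?g + 1) + t'))"
  proof (rule runs_mono[OF step[OF refl]])
    fix s1 :: state and t1 :: nat
    assume 1: "t1 \<le> 100 \<and> reg s1 ''p'' = last_arc (p - 1) v \<and>
    (\<forall>k. arr s1 ''lo'' k = (if ?c k then min (arr s' ''lo'' k) v else arr s' ''lo'' k)) \<and>
    (\<forall>k. arr s1 ''nh'' k = (if ?c k then min (arr s' ''nh'' k) (n - v) else arr s' ''nh'' k))"
    then have p1: "reg s1 ''p'' = q" and t1: "t1 \<le> 100"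
      and lo: "\<And>k. arr s1 ''lo'' k = (if ?c k then min (arr s' ''lo'' k) v else arr s' ''lo'' k)"
      and nh: "\<And>k. arr s1 ''nh'' k = (if ?c k then min (arr s' ''nh'' k) (n - v) else arr s' ''nh'' k)"
      unfolding q_def by blast+
    have le1: "\<forall>k. arr s1 ''lo'' k \<le> n \<and> arr s1 ''nh'' k \<le> n"
      unfolding lo nh using I by (simp add: min.coboundedI1)
    have b1: "bnd_ok (arr s1 ''lo'' k) (arr s1 ''nh'' k) k (H k \<union> (if hits v q k then {v} else {}))"
      if k: "k < n" for k
    proof -
      have b: "bnd_ok (arr s' ''lo'' k) (arr s' ''nh'' k) k (H k \<union> (if hits v p k then {v} else {}))"
        using I k by (simp add: p_def)
      show ?thesis
      proof (cases "?c k")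
        case True
        have e: "arr s1 ''lo'' k = min (arr s' ''lo'' k) v" "arr s1 ''nh'' k = min (arr s' ''nh'' k) (n - v)"
          by (simp_all only: lo nh True if_True)
        have h: "hits v q k" using hq True by blast
        have "insert v (H k \<union> (if hits v p k then {v} else {})) = H k \<union> {v}" by auto
        then show ?thesis using bnd_ok_insert[OF b, of v] unfolding e by (simp only: h if_True)
      next
        case False
        then have e: "arr s1 ''lo'' k = arr s' ''lo'' k" "arr s1 ''nh'' k = arr s' ''nh'' k"
          by (simp_all only: lo nh if_False)
        have "hits v q k = hits v p k" using hq False by blast
        then show ?thesis using b unfolding e by (simp only:)
      qed
    qed
    have "t + 4 + t1 \<le> 120 * card (arcs_from v q)" using I t1 st(2) by (simp add: p_def)
    then show "?I s1 (t + (cost ?g + 1) + t1)"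
      unfolding p1 using q le1 b1 by simp
  qed
qed

definition distinguishers :: "nat \<Rightarrow> nat set" where
  "distinguishers k = {v. v < n \<and> hits v 0 k}"

text \<open>The budget is 200 per vertex and 200 per arc; \<open>card_arcs_from\<close> releases the
  degree of \<open>v\<close> when \<open>v\<close> is finished.\<close>

lemma runs_vert_loop:
  assumes s: "reg s ''v'' = 0" "reg s ''n'' = n" "arr s ''mark'' = (\<lambda>_. 0)"
    and arcs: "arcs_ok (2 * m) s"
    and init: "\<And>k. arr s ''lo'' k = (if k < n then k else 0)" "\<And>k. arr s ''nh'' k = (if k < n then n else 0)"
  shows "runs B vert_loop s (\<lambda>s' t. t \<le> 200 * n + 400 * m + 10 \<and>
    (\<forall>k. arr s' ''lo'' k \<le> n \<and> arr s' ''nh'' k \<le> n) \<and>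
    (\<forall>k<n. bnd_ok (arr s' ''lo'' k) (arr s' ''nh'' k) k (distinguishers k)))"
  unfolding vert_loop_def
proof (rule runs_While[where T = "200 * n + 400 * m" and I = "\<lambda>s' t. reg s' ''v'' \<le> n \<and>
    t \<le> 200 * reg s' ''v'' + 200 * card {a. a < 2 * m \<and> src a < reg s' ''v''} \<and>
    (\<forall>x. arr s' ''mark'' x \<le> reg s' ''v'') \<and>
    (\<forall>k. arr s' ''lo'' k \<le> n \<and> arr s' ''nh'' k \<le> n) \<and>
    (\<forall>k<n. bnd_ok (arr s' ''lo'' k) (arr s' ''nh'' k) k {v. v < reg s' ''v'' \<and> hits v 0 k})"])
  let ?I = "\<lambda>s' t. reg s' ''v'' \<le> n \<and>
    t \<le> 200 * reg s' ''v'' + 200 * card {a. a < 2 * m \<and> src a < reg s' ''v''} \<and>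
    (\<forall>x. arr s' ''mark'' x \<le> reg s' ''v'') \<and>
    (\<forall>k. arr s' ''lo'' k \<le> n \<and> arr s' ''nh'' k \<le> n) \<and>
    (\<forall>k<n. bnd_ok (arr s' ''lo'' k) (arr s' ''nh'' k) k {v. v < reg s' ''v'' \<and> hits v 0 k})"
  let ?g = "Reg ''v'' .< Reg ''n''"
  show "?I s 0" using s init bnd_ok_empty by simp
  fix s' :: state and t :: nat
  show T: "t \<le> 200 * n + 400 * m" if "?I s' t"
    using that card_arcs_le[of "reg s' ''v''"] by linarith
  assume I: "?I s' t" and ag: "agree vert_step s s'"
  have r: "reg s' ''n'' = n" "arr s' ''to'' = arr s ''to''" "arr s' ''nxt'' = arr s ''nxt''"
    "arr s' ''head'' = arr s ''head''"
    by (simp_all add: agree_reg[OF ag] agree_arr[OF ag] s)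
  have ok: "arcs_ok (2 * m) s'" using arcs by (simp add: arcs_ok_def r)
  show "fits B ?g s'" using I B r by simp
  show "t + (cost ?g + 1) \<le> 200 * n + 400 * m + 10 \<and>
    (\<forall>k. arr s' ''lo'' k \<le> n \<and> arr s' ''nh'' k \<le> n) \<and>
    (\<forall>k<n. bnd_ok (arr s' ''lo'' k) (arr s' ''nh'' k) k (distinguishers k))"
    if "aval ?g s' = 0"
  proof -
    have vn: "reg s' ''v'' = n" using that I r by (simp split: if_splits)
    have "t + 4 \<le> 200 * n + 400 * m + 10" using T[OF I] by simp
    then show ?thesis using I unfolding vn distinguishers_def by simp
  qed
  assume "aval ?g s' \<noteq> 0"
  then have v0: "reg s' ''v'' < n" using r by (simp split: if_splits)
  define v where "v = reg s' ''v''"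
  have v: "v < n" using v0 by (simp add: v_def)
  define la where "la = last_arc (2 * m) v"
  have bB: "v < B" "Suc v < B" "la < B" "Suc 0 < B"
    using v B last_arc_le[of "2 * m" v] by (auto simp: la_def)
  let ?p1 = "''mark''.[Reg ''v'' .+ Const 1] \<leftarrow> Reg ''v'' .+ Const 1 ;; ''p'' ::= ''head''.[Reg ''v'']"
  have hd: "arr s ''head'' v = la" using arcs by (simp add: arcs_ok_def la_def)
  have 1: "runs B ?p1 s' (\<lambda>s1 t1. t1 = 10 \<and> reg s1 ''p'' = la \<and>
    arr s1 ''mark'' = (arr s' ''mark'')(Suc v := Suc v))"
    using bB hd by (simp add: runs_simps r v_def[symmetric])
  show "runs B vert_step s' (\<lambda>s'' t'. ?I s'' (t + (cost ?g + 1) + t'))"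
    unfolding vert_step_def
  proof (rule runs_SeqF[OF 1])
    fix s1 :: state and t1 :: nat
    assume 1: "t1 = 10 \<and> reg s1 ''p'' = la \<and> arr s1 ''mark'' = (arr s' ''mark'')(Suc v := Suc v)"
      and ag: "agree ?p1 s' s1"
    have r1: "reg s1 ''v'' = v" "reg s1 ''n'' = n" "arr s1 ''to'' = arr s ''to''"
      "arr s1 ''nxt'' = arr s ''nxt''" "arr s1 ''head'' = arr s ''head''"
      "arr s1 ''lo'' = arr s' ''lo''" "arr s1 ''nh'' = arr s' ''nh''" "reg s1 ''p'' = la"
      using 1 by (simp_all add: agree_reg[OF ag] agree_arr[OF ag] r v_def)
    have 2: "runs B mark_loop s1 (\<lambda>s' t. t \<le> 20 * card (arcs_from v 0) + 10 \<and>
      (\<forall>x. arr s' ''mark'' x = Suc v \<longleftrightarrow> marked v x) \<and> (\<forall>x. arr s' ''mark'' x \<le> Suc v))"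
    proof (rule runs_mark_loop)
      show "arr s1 ''mark'' x \<le> v \<or> x = Suc v \<and> arr s1 ''mark'' x = Suc v" for x
        using 1 I by (simp add: v_def)
      show "arr s1 ''to'' a = dst a \<and> arr s1 ''nxt'' a = last_arc a (src a)" if "a < 2 * m" for a
        using arcs that by (simp add: r1 arcs_ok_def)
    qed (use 1 r1 v in \<open>simp_all add: la_def\<close>)
    show "runs B (mark_loop ;; (''p'' ::= ''head''.[Reg ''v'']) ;; hit_loop ;; ''v'' ::= Reg ''v'' .+ Const 1)
      s1 (\<lambda>s2 t2. ?I s2 (t + (cost ?g + 1) + (t1 + t2)))"
    proof (rule runs_SeqF[OF 2])
      fix s2 :: state and t2 :: nat
      assume 2: "t2 \<le> 20 * card (arcs_from v 0) + 10 \<and>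
        (\<forall>x. arr s2 ''mark'' x = Suc v \<longleftrightarrow> marked v x) \<and> (\<forall>x. arr s2 ''mark'' x \<le> Suc v)"
        and ag: "agree mark_loop s1 s2"
      have r2: "reg s2 ''v'' = v" "reg s2 ''n'' = n" "arr s2 ''to'' = arr s ''to''"
        "arr s2 ''nxt'' = arr s ''nxt''" "arr s2 ''head'' = arr s ''head''"
        "arr s2 ''lo'' = arr s' ''lo''" "arr s2 ''nh'' = arr s' ''nh''"
        by (simp_all add: agree_reg[OF ag] agree_arr[OF ag] r1)
      have 3: "runs B (''p'' ::= ''head''.[Reg ''v'']) s2 (\<lambda>s3 t3. t3 = 3 \<and> reg s3 ''p'' = la)"
        using bB by (simp add: runs_simps r2 hd)
      show "runs B ((''p'' ::= ''head''.[Reg ''v'']) ;; hit_loop ;; ''v'' ::= Reg ''v'' .+ Const 1)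
        s2 (\<lambda>s3 t3. ?I s3 (t + (cost ?g + 1) + (t1 + (t2 + t3))))"
      proof (rule runs_SeqF[OF 3])
        fix s3 :: state and t3 :: nat
        assume 3: "t3 = 3 \<and> reg s3 ''p'' = la" and ag: "agree (''p'' ::= ''head''.[Reg ''v'']) s2 s3"
        have r3: "reg s3 ''v'' = v" "reg s3 ''n'' = n" "arr s3 = arr s2" "reg s3 ''p'' = la"
          using 3 by (simp_all add: agree_reg[OF ag] agree_arr[OF ag] r2 fun_eq_iff)
        let ?H = "\<lambda>k. {u. u < v \<and> hits u 0 k}"
        have 4: "runs B hit_loop s3 (\<lambda>s' t. t \<le> 120 * card (arcs_from v 0) + 10 \<and>
          (\<forall>k. arr s' ''lo'' k \<le> n \<and> arr s' ''nh'' k \<le> n) \<and>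
          (\<forall>k<n. bnd_ok (arr s' ''lo'' k) (arr s' ''nh'' k) k (?H k \<union> (if hits v 0 k then {v} else {}))))"
        proof (rule runs_hit_loop)
          show "arcs_ok (2 * m) s3" using arcs by (simp add: arcs_ok_def r3 r2)
        qed (use 2 I v in \<open>simp_all add: r3 r2 la_def v_def\<close>)
        show "runs B (hit_loop ;; ''v'' ::= Reg ''v'' .+ Const 1)
          s3 (\<lambda>s4 t4. ?I s4 (t + (cost ?g + 1) + (t1 + (t2 + (t3 + t4)))))"
        proof (rule runs_SeqF[OF 4])
          fix s4 :: state and t4 :: nat
          assume 4: "t4 \<le> 120 * card (arcs_from v 0) + 10 \<and>
            (\<forall>k. arr s4 ''lo'' k \<le> n \<and> arr s4 ''nh'' k \<le> n) \<and>
            (\<forall>k<n. bnd_ok (arr s4 ''lo'' k) (arr s4 ''nh'' k) k (?H k \<union> (if hits v 0 k then {v} else {})))"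
            and ag: "agree hit_loop s3 s4"
          have r4: "reg s4 ''v'' = v" "arr s4 ''mark'' = arr s2 ''mark''"
            by (simp_all add: agree_reg[OF ag] agree_arr[OF ag] r3)
          have H: "?H k \<union> (if hits v 0 k then {v} else {}) = {u. u < Suc v \<and> hits u 0 k}" for k
            by (auto simp: less_Suc_eq)
          have tt: "t + (4 + (t1 + (t2 + (t3 + (t5 :: nat))))) \<le> 200 * Suc v + 200 * card {a. a < 2 * m \<and> src a < Suc v}"
            if "t5 \<le> t4 + 4" for t5
            using that I 1 2 3 4 card_arcs_from[of v] by (simp add: v_def)
          have mk: "\<forall>x. arr s4 ''mark'' x \<le> Suc v" using 2 by (simp add: r4)
          show "runs B (''v'' ::= Reg ''v'' .+ Const 1) s4
            (\<lambda>s5 t5. ?I s5 (t + (cost ?g + 1) + (t1 + (t2 + (t3 + (t4 + t5))))))"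
            using bB v tt[of "t4 + 4"] mk 4 unfolding H by (simp add: runs_simps r4)
        qed
      qed
    qed
  qed
qed

section \<open>Splitting the nodes\<close>

definition forced :: "nat \<Rightarrow> nat \<Rightarrow> nat set" where
  "forced a b = {k. a < k \<and> k < b \<and> (\<exists>v \<in> distinguishers k. v < a \<or> b \<le> v)}"

text \<open>In the default case any interior position would do, since two children need no witness;
  \<open>Suc a\<close> is interior whenever there is something to split.\<close>

definition cuts :: "nat \<Rightarrow> nat \<Rightarrow> nat set" where
  "cuts a b = (if forced a b = {} then {Suc a} else forced a b)"

lemma cuts_sub: "Suc a < b \<Longrightarrow> cuts a b \<subseteq> {a<..<b}"
  by (auto simp: cuts_def forced_def)

lemma cuts_ne: "cuts a b \<noteq> {}"
  by (simp add: cuts_def)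

lemma cuts_segment:
  assumes "segment cuts a b l r" "Suc a < b"
  shows "a \<le> l" "r \<le> b" "r - l < b - a"
  by (rule segment_proper[OF assms(1) cuts_sub[OF assms(2)] cuts_ne])+

section \<open>Invariants of the splitting procedure\<close>

definition tree_ok :: "nat \<Rightarrow> (nat \<Rightarrow> nat) \<Rightarrow> (nat \<Rightarrow> nat) \<Rightarrow> (nat \<Rightarrow> nat) \<Rightarrow> bool" where
  "tree_ok N pr L R \<longleftrightarrow> n < N \<and> L n = 0 \<and> R n = n \<and>
     (\<forall>y. n \<le> y \<and> y < N \<longrightarrow> L y < R y \<and> R y \<le> n) \<and>
     (\<forall>y. n < y \<and> y < N \<longrightarrow> n \<le> pr y \<and> pr y < y \<and> Suc (L (pr y)) < R (pr y) \<and>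
        segment cuts (L (pr y)) (R (pr y)) (L y) (R y)) \<and>
     (\<forall>y y'. n \<le> y \<and> y < y' \<and> y' < N \<longrightarrow>
        R y \<le> L y' \<or> R y' \<le> L y \<or> L y \<le> L (pr y') \<and> R (pr y') \<le> R y)"

text \<open>Children are found by their right ends. A cut belongs to one node only, so an array over
  positions, \<open>lch\<close>, can hold the child that ends there; the right end of the last child
  is not a cut of \<open>w\<close>, hence the separate entry \<open>lc w\<close>.\<close>

definition done_ok ::
    "nat \<Rightarrow> (nat \<Rightarrow> nat) \<Rightarrow> (nat \<Rightarrow> nat) \<Rightarrow> (nat \<Rightarrow> nat) \<Rightarrow> (nat \<Rightarrow> nat) \<Rightarrow>
      (nat \<Rightarrow> nat) \<Rightarrow> (nat \<Rightarrow> nat) \<Rightarrow> nat \<Rightarrow> bool" where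
  "done_ok N pr L R key lc lch w \<longleftrightarrow>
     (R w = Suc (L w) \<longrightarrow> pr (vs ! L w) = w \<and> lc w = vs ! L w) \<and>
     (Suc (L w) < R w \<longrightarrow> (\<forall>k \<in> cuts (L w) (R w). key k = w * n + k) \<and>
        (\<forall>l r. segment cuts (L w) (R w) l r \<longrightarrow>
           (\<exists>y. n < y \<and> y < N \<and> pr y = w \<and> L y = l \<and> R y = r \<and>
              (if r < R w then lch r = y else lc w = y))))"

text \<open>\<open>0\<close> marks a position at which no cut has been recorded; genuine keys are
  positive because \<open>w \<ge> n > 0\<close>.\<close>

definition keys_ok :: "nat \<Rightarrow> (nat \<Rightarrow> nat) \<Rightarrow> (nat \<Rightarrow> nat) \<Rightarrow> (nat \<Rightarrow> nat) \<Rightarrow> bool" where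
  "keys_ok x L R key \<longleftrightarrow> (\<forall>k. key k \<noteq> 0 \<longrightarrow>
     (\<exists>w. n \<le> w \<and> w < x \<and> Suc (L w) < R w \<and> k \<in> cuts (L w) (R w) \<and> key k = w * n + k))"

text \<open>Node \<open>x\<close> is the next one to be split.\<close>

definition outer_ok ::
    "nat \<Rightarrow> nat \<Rightarrow> (nat \<Rightarrow> nat) \<Rightarrow> (nat \<Rightarrow> nat) \<Rightarrow> (nat \<Rightarrow> nat) \<Rightarrow> (nat \<Rightarrow> nat) \<Rightarrow>
      (nat \<Rightarrow> nat) \<Rightarrow> (nat \<Rightarrow> nat) \<Rightarrow> bool" where
  "outer_ok x N pr L R key lc lch \<longleftrightarrow> tree_ok N pr L R \<and> n \<le> x \<and> x \<le> N \<and>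
     (\<forall>y. n < y \<and> y < N \<longrightarrow> pr y < x) \<and>
     (\<forall>w. n \<le> w \<and> w < x \<longrightarrow> done_ok N pr L R key lc lch w) \<and> keys_ok x L R key \<and>
     (\<forall>y k. x \<le> y \<and> y < N \<and> L y < k \<and> k < R y \<longrightarrow> key k = 0)"

text \<open>Node \<open>x\<close> is being split: its children below position \<open>l\<close> exist, and the stack holds the
  cuts found beyond \<open>l\<close>, on top of the right end of \<open>x\<close>.\<close>

definition inner_ok ::
    "nat \<Rightarrow> nat \<Rightarrow> nat \<Rightarrow> (nat \<Rightarrow> nat) \<Rightarrow> nat \<Rightarrow> (nat \<Rightarrow> nat) \<Rightarrow> (nat \<Rightarrow> nat) \<Rightarrow> (nat \<Rightarrow> nat) \<Rightarrow>
      (nat \<Rightarrow> nat) \<Rightarrow> (nat \<Rightarrow> nat) \<Rightarrow> (nat \<Rightarrow> nat) \<Rightarrow> bool" where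
  "inner_ok x l sp stk N pr L R key lc lch \<longleftrightarrow> tree_ok N pr L R \<and> n \<le> x \<and> x < N \<and>
     Suc (L x) < R x \<and>
     (\<forall>y. n < y \<and> y < N \<longrightarrow> pr y \<le> x) \<and>
     (\<forall>w. n \<le> w \<and> w < x \<longrightarrow> done_ok N pr L R key lc lch w) \<and> keys_ok (Suc x) L R key \<and>
     (\<forall>y k. x < y \<and> y < N \<and> L y < k \<and> k < R y \<longrightarrow> key k = 0) \<and>
     (\<forall>y. x < y \<and> y < N \<and> pr y = x \<longrightarrow> R y \<le> l) \<and>
     (\<forall>k. l < k \<and> k < R x \<and> k \<notin> stk ` {..<sp} \<longrightarrow> key k = 0) \<and>
     (\<forall>k \<in> cuts (L x) (R x). k \<le> l \<longrightarrow> key k = x * n + k) \<and>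
     l \<in> points cuts (L x) (R x) \<and> (sp = 0 \<longrightarrow> l = R x) \<and> (0 < sp \<longrightarrow> stk 0 = R x) \<and>
     (\<forall>i < sp. l < stk i \<and> (0 < i \<longrightarrow> stk i \<in> cuts (L x) (R x) \<and> key (stk i) = x * n + stk i)) \<and>
     (\<forall>i j. i < j \<and> j < sp \<longrightarrow> stk j < stk i) \<and>
     (\<forall>l' r. segment cuts (L x) (R x) l' r \<and> r \<le> l \<longrightarrow>
        (\<exists>y. n < y \<and> y < N \<and> pr y = x \<and> L y = l' \<and> R y = r \<and>
           (if r < R x then lch r = y else lc x = y)))"

lemma tree_okD:
  assumes "tree_ok N pr L R"
  shows "n < N" "L n = 0" "R n = n" "\<And>y. n \<le> y \<Longrightarrow> y < N \<Longrightarrow> L y < R y \<and> R y \<le> n"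
    "\<And>y. n < y \<Longrightarrow> y < N \<Longrightarrow> n \<le> pr y \<and> pr y < y \<and> Suc (L (pr y)) < R (pr y) \<and>
        segment cuts (L (pr y)) (R (pr y)) (L y) (R y)"
    "\<And>y y'. n \<le> y \<Longrightarrow> y < y' \<Longrightarrow> y' < N \<Longrightarrow>
        R y \<le> L y' \<or> R y' \<le> L y \<or> L y \<le> L (pr y') \<and> R (pr y') \<le> R y"
  using assms unfolding tree_ok_def by blast+

lemma tree_ok_parent:
  assumes "tree_ok N pr L R" "n < y" "y < N"
  shows "L (pr y) \<le> L y" "R y \<le> R (pr y)" "R y - L y < R (pr y) - L (pr y)"
proof -
  have "Suc (L (pr y)) < R (pr y)" "segment cuts (L (pr y)) (R (pr y)) (L y) (R y)"
    using tree_okD(5)[OF assms] by auto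
  then show "L (pr y) \<le> L y" "R y \<le> R (pr y)" "R y - L y < R (pr y) - L (pr y)"
    using cuts_segment by blast+
qed

lemma inner_okD:
  assumes "inner_ok x l sp stk N pr L R key lc lch"
  shows "tree_ok N pr L R"
    "n \<le> x"
    "x < N"
    "Suc (L x) < R x"
    "\<And>y. n < y \<Longrightarrow> y < N \<Longrightarrow> pr y \<le> x"
    "\<And>w. n \<le> w \<Longrightarrow> w < x \<Longrightarrow> done_ok N pr L R key lc lch w"
    "keys_ok (Suc x) L R key"
    "\<And>y k. x < y \<Longrightarrow> y < N \<Longrightarrow> L y < k \<Longrightarrow> k < R y \<Longrightarrow> key k = 0"
    "\<And>y. x < y \<Longrightarrow> y < N \<Longrightarrow> pr y = x \<Longrightarrow> R y \<le> l"
    "\<And>k. l < k \<Longrightarrow> k < R x \<Longrightarrow> k \<notin> stk ` {..<sp} \<Longrightarrow> key k = 0"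
    "\<And>k. k \<in> cuts (L x) (R x) \<Longrightarrow> k \<le> l \<Longrightarrow> key k = x * n + k"
    "l \<in> points cuts (L x) (R x)"
    "sp = 0 \<Longrightarrow> l = R x"
    "0 < sp \<Longrightarrow> stk 0 = R x"
    "\<And>i. i < sp \<Longrightarrow> l < stk i \<and> (0 < i \<longrightarrow> stk i \<in> cuts (L x) (R x) \<and> key (stk i) = x * n + stk i)"
    "\<And>i j. i < j \<Longrightarrow> j < sp \<Longrightarrow> stk j < stk i"
    "\<And>l' r. segment cuts (L x) (R x) l' r \<Longrightarrow> r \<le> l \<Longrightarrow> \<exists>y. n < y \<and> y < N \<and> pr y = x \<and> L y = l' \<and> R y = r \<and> (if r < R x then lch r = y else lc x = y)"
proof -
  have p: "tree_ok N pr L R"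
    "n \<le> x"
    "x < N"
    "Suc (L x) < R x"
    "\<forall>y. n < y \<and> y < N \<longrightarrow> pr y \<le> x"
    "\<forall>w. n \<le> w \<and> w < x \<longrightarrow> done_ok N pr L R key lc lch w"
    "keys_ok (Suc x) L R key"
    "\<forall>y k. x < y \<and> y < N \<and> L y < k \<and> k < R y \<longrightarrow> key k = 0"
    "\<forall>y. x < y \<and> y < N \<and> pr y = x \<longrightarrow> R y \<le> l"
    "\<forall>k. l < k \<and> k < R x \<and> k \<notin> stk ` {..<sp} \<longrightarrow> key k = 0"
    "\<forall>k \<in> cuts (L x) (R x). k \<le> l \<longrightarrow> key k = x * n + k"
    "l \<in> points cuts (L x) (R x)"
    "sp = 0 \<longrightarrow> l = R x"
    "0 < sp \<longrightarrow> stk 0 = R x"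
    "\<forall>i < sp. l < stk i \<and> (0 < i \<longrightarrow> stk i \<in> cuts (L x) (R x) \<and> key (stk i) = x * n + stk i)"
    "\<forall>i j. i < j \<and> j < sp \<longrightarrow> stk j < stk i"
    "\<forall>l' r. segment cuts (L x) (R x) l' r \<and> r \<le> l \<longrightarrow> (\<exists>y. n < y \<and> y < N \<and> pr y = x \<and> L y = l' \<and> R y = r \<and> (if r < R x then lch r = y else lc x = y))"
    using assms[unfolded inner_ok_def] by - (elim conjE, assumption)+
  show "tree_ok N pr L R" using p(1) by blast
  show "n \<le> x" using p(2) by blast
  show "x < N" using p(3) by blast
  show "Suc (L x) < R x" using p(4) by blast
  show "\<And>y. n < y \<Longrightarrow> y < N \<Longrightarrow> pr y \<le> x" using p(5) by blast
  show "\<And>w. n \<le> w \<Longrightarrow> w < x \<Longrightarrow> done_ok N pr L R key lc lch w" using p(6) by blast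
  show "keys_ok (Suc x) L R key" using p(7) by blast
  show "\<And>y k. x < y \<Longrightarrow> y < N \<Longrightarrow> L y < k \<Longrightarrow> k < R y \<Longrightarrow> key k = 0" using p(8) by blast
  show "\<And>y. x < y \<Longrightarrow> y < N \<Longrightarrow> pr y = x \<Longrightarrow> R y \<le> l" using p(9) by blast
  show "\<And>k. l < k \<Longrightarrow> k < R x \<Longrightarrow> k \<notin> stk ` {..<sp} \<Longrightarrow> key k = 0" using p(10) by blast
  show "\<And>k. k \<in> cuts (L x) (R x) \<Longrightarrow> k \<le> l \<Longrightarrow> key k = x * n + k" using p(11) by blast
  show "l \<in> points cuts (L x) (R x)" using p(12) by blast
  show "sp = 0 \<Longrightarrow> l = R x" using p(13) by blast
  show "0 < sp \<Longrightarrow> stk 0 = R x" using p(14) by blast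
  show "\<And>i. i < sp \<Longrightarrow> l < stk i \<and> (0 < i \<longrightarrow> stk i \<in> cuts (L x) (R x) \<and> key (stk i) = x * n + stk i)" using p(15) by blast
  show "\<And>i j. i < j \<Longrightarrow> j < sp \<Longrightarrow> stk j < stk i" using p(16) by blast
  show "\<And>l' r. segment cuts (L x) (R x) l' r \<Longrightarrow> r \<le> l \<Longrightarrow> \<exists>y. n < y \<and> y < N \<and> pr y = x \<and> L y = l' \<and> R y = r \<and> (if r < R x then lch r = y else lc x = y)" using p(17) by blast
qed

text \<open>If they met, \<open>y\<close> would contain the parent of \<open>y'\<close> by
  laminarity. That parent is older than \<open>y\<close> and meets it, hence contains the parent of
  \<open>y\<close>; so \<open>y\<close> would contain its own parent.\<close>

lemma disjoint_siblings:
  assumes "tree_ok N pr L R" "n \<le> y" "y < y'" "y' < N" "pr y' < y"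
  shows "R y \<le> L y' \<or> R y' \<le> L y"
proof (rule ccontr)
  assume a: "\<not> ?thesis"
  note D = tree_okD[OF assms(1)]
  have y': "n < y'" using assms by simp
  have sub: "L y \<le> L (pr y')" "R (pr y') \<le> R y" using D(6)[OF assms(2-4)] a by auto
  have p: "n \<le> pr y'" "L (pr y') < R (pr y')" using D(5)[OF y' assms(4)] by auto
  have y: "n < y" "y < N" using p assms by auto
  have "L (pr y') \<le> L (pr y)" "R (pr y) \<le> R (pr y')"
    using D(6)[OF p(1) assms(5) y(2)] sub p(2) by auto
  then show False using sub tree_ok_parent[OF assms(1) y] D(4)[of y] y by linarith
qed

lemma key_split: "0 < k \<Longrightarrow> k < n \<Longrightarrow> (w * n + k) div n = w"
  using n by simp

lemma inner_start:
  assumes "outer_ok x N pr L R key lc lch" "x < N" "Suc (L x) < R x" "stk 0 = R x"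
  shows "inner_ok x (L x) 1 stk N pr L R key lc lch"
proof -
  have o: "tree_ok N pr L R" "n \<le> x" "\<And>y. n < y \<Longrightarrow> y < N \<Longrightarrow> pr y < x"
    "\<And>w. n \<le> w \<Longrightarrow> w < x \<Longrightarrow> done_ok N pr L R key lc lch w" "keys_ok x L R key"
    "\<And>y k. x \<le> y \<Longrightarrow> y < N \<Longrightarrow> L y < k \<Longrightarrow> k < R y \<Longrightarrow> key k = 0"
    using assms(1) unfolding outer_ok_def by blast+
  have cut: "L x < k" if "k \<in> cuts (L x) (R x)" for k using cuts_sub[OF assms(3)] that by auto
  have seg: "\<not> (segment cuts (L x) (R x) l' r \<and> r \<le> L x)" for l' r
    using cuts_segment(1)[OF _ assms(3), of l' r] by (auto simp: segment_def)
  have keys: "keys_ok (Suc x) L R key" using o(5) unfolding keys_ok_def by (meson less_SucI)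
  have pl: "L x \<in> points cuts (L x) (R x)" by (simp add: points_def)
  show ?thesis unfolding inner_ok_def
  proof (intro conjI)
    show "\<forall>y. n < y \<and> y < N \<longrightarrow> pr y \<le> x" using o(3) less_imp_le by blast
    show "\<forall>y. x < y \<and> y < N \<and> pr y = x \<longrightarrow> R y \<le> L x" using o(2,3) by (metis le_less_trans nat_neq_iff)
    show "\<forall>y k. x < y \<and> y < N \<and> L y < k \<and> k < R y \<longrightarrow> key k = 0" using o(6) less_imp_le by blast
    show "\<forall>k. L x < k \<and> k < R x \<and> k \<notin> stk ` {..<1} \<longrightarrow> key k = 0" using o(6)[of x] assms(2) by blast
    show "\<forall>k\<in>cuts (L x) (R x). k \<le> L x \<longrightarrow> key k = x * n + k" using cut by (meson not_le)
  qed (use o assms keys pl seg in \<open>simp_all, blast+\<close>)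
qed

text \<open>Decoding a key: the quotient by \<open>n\<close> is the node, because
  \<open>k < n\<close>.\<close>

lemma done_ok_cut:
  assumes "tree_ok N pr L R" "n \<le> w" "w < N" "Suc (L w) < R w" "done_ok N pr L R key lc lch w"
    "k \<in> cuts (L w) (R w)"
  shows "key k = w * n + k" "0 < k" "k < n" "key k \<noteq> 0" "key k div n = w"
proof -
  show k: "key k = w * n + k" using assms by (simp add: done_ok_def)
  have "L w < k" "k < R w" using cuts_sub[OF assms(4)] assms(6) by auto
  then show "0 < k" "k < n" using tree_okD(4)[OF assms(1-3)] by auto
  then show "key k \<noteq> 0" "key k div n = w" using k key_split by auto
qed

text \<open>The stack is decreasing from its bottom \<open>R x\<close>, so its top is the nearest
  known end of a piece to the right of \<open>l\<close>.\<close>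

lemma inner_top:
  assumes "inner_ok x l sp stk N pr L R key lc lch" "0 < sp"
  defines "r \<equiv> stk (sp - 1)"
  shows "l < r" "r \<le> R x" "r \<in> points cuts (L x) (R x)" "L x \<le> l" "\<And>i. i < sp \<Longrightarrow> r \<le> stk i"
    "sp = 1 \<Longrightarrow> r = R x" "1 < sp \<Longrightarrow> r < R x"
proof -
  note I = inner_okD(4)[OF assms(1)]
    inner_okD(12)[OF assms(1)]
    inner_okD(14)[OF assms(1,2)]
    inner_okD(15)[OF assms(1)]
    inner_okD(16)[OF assms(1)]
  show "l < r" using I(4)[of "sp - 1"] assms(2) by (simp add: r_def)
  show le: "r \<le> stk i" if "i < sp" for i
  proof (cases "i = sp - 1")
    case False
    then have "i < sp - 1" using that by linarith
    then show ?thesis using I(5)[of i "sp - 1"] that by (simp add: r_def)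
  qed (simp add: r_def)
  show "r \<le> R x" using le[of 0] I(3) assms(2) by simp
  show "r \<in> points cuts (L x) (R x)"
    using I(3) I(4)[of "sp - 1"] assms(2) by (cases "sp = 1") (auto simp: r_def points_def)
  show "L x \<le> l" using I(1,2) cuts_sub[OF I(1)] by (auto simp: points_def)
  show "sp = 1 \<Longrightarrow> r = R x" using I(3) by (simp add: r_def)
  show "1 < sp \<Longrightarrow> r < R x" using I(5)[of 0 "sp - 1"] I(3) by (simp add: r_def)
qed

text \<open>Hence every cut found in the gap is a new one, and progress can be measured by counting
  nonzero keys.\<close>

lemma inner_key_free:
  assumes "inner_ok x l sp stk N pr L R key lc lch" "0 < sp" "l < k" "k < stk (sp - 1)"
  shows "key k = 0"
proof -
  note t = inner_top[OF assms(1,2)]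
  have "k \<notin> stk ` {..<sp}" using t(5) assms(4) by fastforce
  moreover have "k < R x" using t(2) assms(4) by simp
  ultimately show ?thesis using inner_okD(10)[OF assms(1)] assms(3) by blast
qed

text \<open>A node younger than \<open>x\<close> is either a child of \<open>x\<close>, and these
  exist only up to \<open>l\<close>, or it has a parent older than \<open>x\<close> and is then
  disjoint from \<open>x\<close>.\<close>

lemma inner_disjoint:
  assumes "inner_ok x l sp stk N pr L R key lc lch" "x < y" "y < N"
  shows "R y \<le> l \<or> R x \<le> L y"
proof -
  note I = inner_okD(1)[OF assms(1)]
    inner_okD(2)[OF assms(1)]
    inner_okD(5)[OF assms(1)]
    inner_okD(9)[OF assms(1)]
    inner_okD(12)[OF assms(1)]
    inner_okD(4)[OF assms(1)]
  have "L x \<le> l" using I(5,6) cuts_sub[OF I(6)] by (auto simp: points_def)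
  then show ?thesis
    using disjoint_siblings[OF I(1,2) assms(2,3)] I(3)[of y] I(4)[OF assms(2,3)] I(2) assms
    by (cases "pr y = x") auto
qed

lemma inner_push:
  assumes I: "inner_ok x l sp stk N pr L R key lc lch" "0 < sp"
    and f: "f \<in> cuts (L x) (R x)" "l < f" "f < stk (sp - 1)"
  shows "inner_ok x l (Suc sp) (stk(sp := f)) N pr L R (key(f := x * n + f)) lc lch"
proof -
  note J = inner_okD(1)[OF I(1)]
    inner_okD(2)[OF I(1)]
    inner_okD(3)[OF I(1)]
    inner_okD(4)[OF I(1)]
    inner_okD(6)[OF I(1)]
    inner_okD(7)[OF I(1)]
    inner_okD(8)[OF I(1)]
    inner_okD(10)[OF I(1)]
    inner_okD(11)[OF I(1)]
    inner_okD(14)[OF I(1,2)]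
    inner_okD(15)[OF I(1)]
    inner_okD(16)[OF I(1)]
  note t = inner_top[OF I]
  have kf: "key f = 0" by (rule inner_key_free[OF I f(2,3)])
  let ?key = "key(f := x * n + f)"
  \<comment> \<open>Position \<open>f\<close> has key \<open>0\<close>, whereas the cuts of finished
    nodes carry nonzero keys; so the assignment spoils none of them.\<close>
  have dn: "done_ok N pr L R ?key lc lch w" if w: "n \<le> w" "w < x" for w
  proof -
    have d: "done_ok N pr L R key lc lch w" using J(5) w .
    have "k \<noteq> f" if "Suc (L w) < R w" "k \<in> cuts (L w) (R w)" for k
      using done_ok_cut(4)[OF J(1) w(1) _ that(1) d that(2)] w J(3) kf by auto
    then show ?thesis using d unfolding done_ok_def by auto
  qed
  have keys: "keys_ok (Suc x) L R ?key"
    using J(2,4,6) f(1) unfolding keys_ok_def by auto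
  have img: "(stk(sp := f)) ` {..<Suc sp} = insert f (stk ` {..<sp})" by (auto simp: lessThan_Suc)
  have fresh: "?key k = 0" if "x < y" "y < N" "L y < k" "k < R y" for y k
  proof -
    have "f < R x" using f(3) t(2) by simp
    then have "k \<noteq> f" using inner_disjoint[OF I(1) that(1,2)] that f(2) by auto
    then show ?thesis using J(7) that by simp
  qed
  have nf: "stk i \<noteq> f" if "i < sp" for i using t(5)[OF that] f(3) by auto
  show ?thesis unfolding inner_ok_def
  proof (intro conjI)
    show "\<forall>k. l < k \<and> k < R x \<and> k \<notin> (stk(sp := f)) ` {..<Suc sp} \<longrightarrow> ?key k = 0"
      unfolding img using J(8) by simp
    show "\<forall>i<Suc sp. l < (stk(sp := f)) i \<and> (0 < i \<longrightarrow> (stk(sp := f)) i \<in> cuts (L x) (R x) \<and>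
      ?key ((stk(sp := f)) i) = x * n + (stk(sp := f)) i)"
      using J(11) f nf by (auto simp: less_Suc_eq)
    show "\<forall>i j. i < j \<and> j < Suc sp \<longrightarrow> (stk(sp := f)) j < (stk(sp := f)) i"
      using J(12) t(5) f(3) by (auto simp: less_Suc_eq intro: less_le_trans)
    show "\<forall>y k. x < y \<and> y < N \<and> L y < k \<and> k < R y \<longrightarrow> ?key k = 0" using fresh by blast
    show "\<forall>k\<in>cuts (L x) (R x). k \<le> l \<longrightarrow> ?key k = x * n + k" using J(9) by simp
    show "\<forall>w. n \<le> w \<and> w < x \<longrightarrow> done_ok N pr L R ?key lc lch w" using dn by blast
    show "0 < Suc sp \<longrightarrow> (stk(sp := f)) 0 = R x" using J(10) I(2) by simp
    show "\<forall>y. n < y \<and> y < N \<longrightarrow> pr y \<le> x" using inner_okD(5)[OF I(1)] by blast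
    show "\<forall>y. x < y \<and> y < N \<and> pr y = x \<longrightarrow> R y \<le> l" using inner_okD(9)[OF I(1)] by blast
    show "\<forall>l' r. segment cuts (L x) (R x) l' r \<and> r \<le> l \<longrightarrow>
        (\<exists>y. n < y \<and> y < N \<and> pr y = x \<and> L y = l' \<and> R y = r \<and>
           (if r < R x then lch r = y else lc x = y))" using inner_okD(17)[OF I(1)] by blast
  qed (use keys J(1-4) inner_okD(12)[OF I(1)] in simp_all)
qed

text \<open>No cut lies between \<open>l\<close> and the top \<open>r\<close>, so
  \<open>[l, r)\<close> is a piece and becomes node \<open>N\<close>. The entry \<open>lc x\<close>
  is overwritten by every child and ends up with the last one.\<close>

lemma inner_emit:
  assumes I: "inner_ok x l sp stk N pr L R key lc lch" "0 < sp"
    and none: "\<And>k. l < k \<Longrightarrow> k < stk (sp - 1) \<Longrightarrow> k \<notin> cuts (L x) (R x)"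
  defines "r \<equiv> stk (sp - 1)"
  shows "inner_ok x r (sp - 1) stk (Suc N) (pr(N := x)) (L(N := l)) (R(N := r)) key (lc(x := N))
    (if r < R x then lch(r := N) else lch)"
proof -
  note J = inner_okD(1)[OF I(1)]
    inner_okD(2)[OF I(1)]
    inner_okD(3)[OF I(1)]
    inner_okD(4)[OF I(1)]
    inner_okD(5)[OF I(1)]
    inner_okD(6)[OF I(1)]
    inner_okD(7)[OF I(1)]
    inner_okD(8)[OF I(1)]
    inner_okD(9)[OF I(1)]
    inner_okD(10)[OF I(1)]
    inner_okD(11)[OF I(1)]
    inner_okD(14)[OF I(1,2)]
    inner_okD(12)[OF I(1)]
    inner_okD(15)[OF I(1)]
    inner_okD(16)[OF I(1)]
    inner_okD(17)[OF I(1)]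
  note t = inner_top[OF I, folded r_def]
  note D = tree_okD[OF J(1)]
  let ?pr = "pr(N := x)" and ?L = "L(N := l)" and ?R = "R(N := r)" and ?lc = "lc(x := N)"
  let ?lch = "if r < R x then lch(r := N) else lch"
  have sub: "cuts (L x) (R x) \<subseteq> {L x<..<R x}" by (rule cuts_sub[OF J(4)])
  have seg: "segment cuts (L x) (R x) l r"
    unfolding segment_def
  proof (intro conjI ballI)
    fix k assume "k \<in> points cuts (L x) (R x)"
    then show "\<not> (l < k \<and> k < r)" using none t(2,4) by (auto simp: points_def r_def)
  qed (use J(13) t in auto)
  have xN: "x \<noteq> N" "n < N" using J(3) D(1) by auto
  have rn: "r \<le> n" using t(2) D(4)[OF J(2,3)] by simp
  have tree: "tree_ok (Suc N) ?pr ?L ?R"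
    unfolding tree_ok_def
  proof (intro conjI allI impI)
    show "n < Suc N" "?L n = 0" "?R n = n" using D(1-3) by auto
  next
    fix y assume "n \<le> y \<and> y < Suc N"
    then show "?L y < ?R y" "?R y \<le> n" using D(4)[of y] t(1) rn by (auto simp: less_Suc_eq)
  next
    fix y assume y: "n < y \<and> y < Suc N"
    have "n \<le> ?pr y \<and> ?pr y < y \<and> Suc (?L (?pr y)) < ?R (?pr y) \<and>
      segment cuts (?L (?pr y)) (?R (?pr y)) (?L y) (?R y)"
    proof (cases "y = N")
      case True
      then show ?thesis using J(2-4) seg by simp
    next
      case False
      then have "y < N" using y by simp
      then show ?thesis using D(5)[of y] y by simp
    qed
    then show "n \<le> ?pr y" "?pr y < y" "Suc (?L (?pr y)) < ?R (?pr y)"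
      "segment cuts (?L (?pr y)) (?R (?pr y)) (?L y) (?R y)" by blast+
  next
    fix y y' assume y: "n \<le> y \<and> y < y' \<and> y' < Suc N"
    show "?R y \<le> ?L y' \<or> ?R y' \<le> ?L y \<or> ?L y \<le> ?L (?pr y') \<and> ?R (?pr y') \<le> ?R y"
    proof (cases "y' = N")
      case False
      then have y'N: "y' < N" "y < N" "n < y'" using y by auto
      then have "pr y' < N" using D(5)[of y'] by auto
      then show ?thesis using D(6)[of y y'] y y'N by simp
    next
      case True
      then have yN: "y < N" using y by simp
      \<comment> \<open>The parent of the new node is \<open>x\<close>, so \<open>x\<close> replaces
        \<open>pr y'\<close> in the laminarity condition. An older \<open>y\<close> inherits it from
        the pair \<open>y\<close>, \<open>x\<close>; a younger one is disjoint from the new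
        piece.\<close>
      consider "y < x" | "y = x" | "x < y" by linarith
      then have "R y \<le> l \<or> r \<le> L y \<or> L y \<le> L x \<and> R x \<le> R y"
      proof cases
        case 1
        then have nx: "n < x" using y by simp
        show ?thesis
          using D(6)[of y x] 1 y J(3) tree_ok_parent(1,2)[OF J(1) nx J(3)] t(2,4) by auto
      next
        case 3
        then show ?thesis using inner_disjoint[OF I(1) 3 yN] t(2) by auto
      qed simp
      then show ?thesis using True yN xN by simp
    qed
  qed
  have rkey: "key r = x * n + r" "r \<in> cuts (L x) (R x)" if "r < R x"
  proof -
    have "sp \<noteq> 1" using t(6) that by auto
    then have "0 < sp - 1" using I(2) by simp
    then show "key r = x * n + r" "r \<in> cuts (L x) (R x)"
      using J(14)[of "sp - 1"] I(2) unfolding r_def by auto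
  qed
  have dn: "done_ok (Suc N) ?pr ?L ?R key ?lc ?lch w" if w: "n \<le> w" "w < x" for w
  proof -
    have d: "done_ok N pr L R key lc lch w" using J(6) w .
    have wN: "w \<noteq> N" "w \<noteq> x" "w < N" using w J(3) by auto
    have leaf: "vs ! L w \<noteq> N" if "R w = Suc (L w)"
    proof -
      have "L w < n" using D(4)[of w] w wN by auto
      then show ?thesis using vs_less[of "L w"] D(1) by auto
    qed
    have ch: "\<exists>y. n < y \<and> y < Suc N \<and> ?pr y = w \<and> ?L y = l' \<and> ?R y = r' \<and>
        (if r' < R w then ?lch r' = y else ?lc w = y)"
      if wide: "Suc (L w) < R w" and s: "segment cuts (L w) (R w) l' r'" for l' r'
    proof -
      obtain y where y: "n < y" "y < N" "pr y = w" "L y = l'" "R y = r'"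
        "if r' < R w then lch r' = y else lc w = y"
        using d wide s unfolding done_ok_def by blast
      \<comment> \<open>Writing \<open>lch r\<close> cannot hit a cut of another node
        \<open>w\<close>: the key of a cut determines its node.\<close>
      have "?lch r' = lch r'" if rw: "r' < R w"
      proof (cases "r < R x \<and> r' = r")
        case True
        have "r' \<in> cuts (L w) (R w)"
          using s rw cuts_segment(1)[OF s wide] by (auto simp: segment_def points_def)
        note k = done_ok_cut[OF J(1) w(1) wN(3) wide d this]
        have "key r div n = x" using True rkey(1) k(2,3) key_split by simp
        then show ?thesis using k(5) True wN by simp
      qed auto
      then show ?thesis using y wN by (intro exI[of _ y]) auto
    qed
    show ?thesis
      unfolding done_ok_def using d leaf ch wN unfolding done_ok_def by auto
  qed
  have keys: "keys_ok (Suc x) ?L ?R key"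
    unfolding keys_ok_def
  proof (intro allI impI)
    fix k assume "key k \<noteq> 0"
    then obtain w where w: "n \<le> w" "w < Suc x" "Suc (L w) < R w" "k \<in> cuts (L w) (R w)" "key k = w * n + k"
      using J(7) unfolding keys_ok_def by blast
    then have "w \<noteq> N" using J(3) by simp
    then show "\<exists>w. n \<le> w \<and> w < Suc x \<and> Suc (?L w) < ?R w \<and> k \<in> cuts (?L w) (?R w) \<and> key k = w * n + k"
      using w by (intro exI[of _ w]) auto
  qed
  have kf: "key k = 0" if "l < k" "k < r" for k
    using inner_key_free[OF I that(1)] that(2) by (simp add: r_def)
  have Rn: "?R x = R x" "?L x = L x" using xN by simp_all
  have stk0: "stk (sp - 1) = r" by (simp add: r_def)
  show ?thesis unfolding inner_ok_def Rn
  proof (intro conjI)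
    show "\<forall>y. n < y \<and> y < Suc N \<longrightarrow> ?pr y \<le> x" using J(5) by (simp add: less_Suc_eq)
    show "\<forall>w. n \<le> w \<and> w < x \<longrightarrow> done_ok (Suc N) ?pr ?L ?R key ?lc ?lch w" using dn by blast
    show "\<forall>y k. x < y \<and> y < Suc N \<and> ?L y < k \<and> k < ?R y \<longrightarrow> key k = 0"
      using J(8) kf by (auto simp: less_Suc_eq)
    show "\<forall>y. x < y \<and> y < Suc N \<and> ?pr y = x \<longrightarrow> ?R y \<le> r"
      using J(9) t(1) by (fastforce simp: less_Suc_eq)
    show "\<forall>k. r < k \<and> k < R x \<and> k \<notin> stk ` {..<sp - 1} \<longrightarrow> key k = 0"
    proof (intro allI impI)
      fix k assume k: "r < k \<and> k < R x \<and> k \<notin> stk ` {..<sp - 1}"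
      have "k \<notin> stk ` {..<sp}"
      proof
        assume "k \<in> stk ` {..<sp}"
        then obtain i where i: "i < sp" "k = stk i" by blast
        then have "i \<noteq> sp - 1" using k stk0 by auto
        then have "i < sp - 1" using i(1) by simp
        then show False using k i(2) by blast
      qed
      then show "key k = 0" using J(10)[of k] k t(1) by auto
    qed
    show "\<forall>k\<in>cuts (L x) (R x). k \<le> r \<longrightarrow> key k = x * n + k"
    proof (intro ballI impI)
      fix k assume k: "k \<in> cuts (L x) (R x)" "k \<le> r"
      consider "k \<le> l" | "l < k" "k < r" | "k = r" using k(2) by linarith
      then show "key k = x * n + k"
      proof cases
        case 2
        then show ?thesis using none k(1) by (simp add: r_def)
      next
        case 3
        then have "r < R x" using sub k(1) by auto
        then show ?thesis using rkey(1) 3 by simp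
      qed (use J(11) k in blast)
    qed
    show "sp - 1 = 0 \<longrightarrow> r = R x" using t(6) I(2) by auto
    show "\<forall>i<sp - 1. r < stk i \<and> (0 < i \<longrightarrow> stk i \<in> cuts (L x) (R x) \<and> key (stk i) = x * n + stk i)"
      using J(14) J(15)[of _ "sp - 1"] I(2) stk0 by auto
    show "\<forall>i j. i < j \<and> j < sp - 1 \<longrightarrow> stk j < stk i" using J(15) by auto
    show "\<forall>l' r'. segment cuts (L x) (R x) l' r' \<and> r' \<le> r \<longrightarrow>
        (\<exists>y. n < y \<and> y < Suc N \<and> ?pr y = x \<and> ?L y = l' \<and> ?R y = r' \<and>
           (if r' < R x then ?lch r' = y else ?lc x = y))"
    proof (intro allI impI)
      fix l' r' assume s: "segment cuts (L x) (R x) l' r' \<and> r' \<le> r"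
      then have p: "l' \<in> points cuts (L x) (R x)" "r' \<in> points cuts (L x) (R x)" "l' < r'"
        "\<And>k. k \<in> points cuts (L x) (R x) \<Longrightarrow> \<not> (l' < k \<and> k < r')"
        by (auto simp: segment_def)
      show "\<exists>y. n < y \<and> y < Suc N \<and> ?pr y = x \<and> ?L y = l' \<and> ?R y = r' \<and>
           (if r' < R x then ?lch r' = y else ?lc x = y)"
      proof (cases "r' \<le> l")
        case True
        then obtain y where y: "n < y" "y < N" "pr y = x" "L y = l'" "R y = r'"
          "if r' < R x then lch r' = y else lc x = y" using J(16) s by blast
        have "r' < R x" "r' \<noteq> r" using True t(1,2) by auto
        then show ?thesis using y by (intro exI[of _ y]) auto
      next
        case False
        \<comment> \<open>A piece that ends beyond \<open>l\<close> but not beyond \<open>r\<close>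
          must be \<open>[l, r)\<close> itself, as the ends of both pieces are points.\<close>
        have "\<not> (l < r' \<and> r' < r)" using seg p(2) unfolding segment_def by blast
        then have r': "r' = r" using False s by linarith
        have "\<not> (l < l' \<and> l' < r)" using seg p(1) unfolding segment_def by blast
        moreover have "\<not> (l' < l \<and> l < r')" using p(4) J(13) by blast
        ultimately have "l' = l" using p(3) t(1) r' by linarith
        then show ?thesis using r' xN by (intro exI[of _ N]) auto
      qed
    qed
  qed (use tree J xN keys t I in simp_all)
qed

text \<open>An empty stack forces \<open>l = R x\<close>, so the claims about cuts and pieces up to
  \<open>l\<close> become claims about all of them.\<close>

lemma inner_finish:
  assumes "inner_ok x l 0 stk N pr L R key lc lch"
  shows "outer_ok (Suc x) N pr L R key lc lch"
proof -
  note J = inner_okD(1)[OF assms]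
    inner_okD(2)[OF assms]
    inner_okD(3)[OF assms]
    inner_okD(4)[OF assms]
    inner_okD(5)[OF assms]
    inner_okD(6)[OF assms]
    inner_okD(7)[OF assms]
    inner_okD(8)[OF assms]
    inner_okD(11)[OF assms]
    inner_okD(13)[OF assms refl]
    inner_okD(17)[OF assms]
  have "done_ok N pr L R key lc lch x"
    unfolding done_ok_def
  proof (intro conjI impI)
    show "\<forall>k\<in>cuts (L x) (R x). key k = x * n + k" using J(9,10) cuts_sub[OF J(4)] by fastforce
    show "\<forall>l r. segment cuts (L x) (R x) l r \<longrightarrow> (\<exists>y. n < y \<and> y < N \<and> pr y = x \<and> L y = l \<and>
      R y = r \<and> (if r < R x then lch r = y else lc x = y))"
      using J(10,11) cuts_segment(2)[OF _ J(4)] by blast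
  qed (use J(4) in auto)
  then have dn: "\<forall>w. n \<le> w \<and> w < Suc x \<longrightarrow> done_ok N pr L R key lc lch w"
    using J(6) less_Suc_eq by auto
  show ?thesis
    unfolding outer_ok_def
  proof (intro conjI)
    show "\<forall>y. n < y \<and> y < N \<longrightarrow> pr y < Suc x" using J(5) le_imp_less_Suc by blast
    show "\<forall>y k. Suc x \<le> y \<and> y < N \<and> L y < k \<and> k < R y \<longrightarrow> key k = 0"
      using J(8) Suc_le_lessD by blast
  qed (use J(1-3,7) dn in simp_all)
qed

lemma outer_leaf:
  assumes O: "outer_ok x N pr L R key lc lch" and x: "x < N" "R x = Suc (L x)"
  shows "outer_ok (Suc x) N (pr(vs ! L x := x)) L R key (lc(x := vs ! L x)) lch"
proof -
  have o: "tree_ok N pr L R" "n \<le> x" "\<And>y. n < y \<Longrightarrow> y < N \<Longrightarrow> pr y < x"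
    "\<And>w. n \<le> w \<Longrightarrow> w < x \<Longrightarrow> done_ok N pr L R key lc lch w" "keys_ok x L R key"
    "\<And>y k. x \<le> y \<Longrightarrow> y < N \<Longrightarrow> L y < k \<Longrightarrow> k < R y \<Longrightarrow> key k = 0"
    using O unfolding outer_ok_def by blast+
  note D = tree_okD[OF o(1)]
  have Lx: "L x < n" using D(4)[OF o(2) x(1)] x(2) by simp
  then have v: "vs ! L x < n" by (rule vs_less)
  let ?pr = "pr(vs ! L x := x)" and ?lc = "lc(x := vs ! L x)"
  have same: "?pr y = pr y" if "n \<le> y" for y using that v by auto
  have tree: "tree_ok N ?pr L R"
    unfolding tree_ok_def
  proof (intro conjI allI impI)
    fix y assume y: "n < y \<and> y < N"
    have e: "?pr y = pr y" using same[of y] y by simp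
    show "n \<le> ?pr y" "?pr y < y" "Suc (L (?pr y)) < R (?pr y)"
      "segment cuts (L (?pr y)) (R (?pr y)) (L y) (R y)"
      unfolding e using D(5)[of y] y by blast+
  next
    fix y y' assume y: "n \<le> y \<and> y < y' \<and> y' < N"
    have e: "?pr y' = pr y'" using same[of y'] y by simp
    show "R y \<le> L y' \<or> R y' \<le> L y \<or> L y \<le> L (?pr y') \<and> R (?pr y') \<le> R y"
      unfolding e using D(6)[of y y'] y by blast
  qed (use D in auto)
  have dn: "done_ok N ?pr L R key ?lc lch w" if w: "n \<le> w" "w < x" for w
  proof -
    have d: "done_ok N pr L R key lc lch w" using o(4) w .
    \<comment> \<open>Two singleton nodes cannot share a position: the older one would contain the
      parent of the younger one, which is wider.\<close>
    have ne: "vs ! L w \<noteq> vs ! L x" if "R w = Suc (L w)"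
    proof
      assume e: "vs ! L w = vs ! L x"
      have Lw: "L w < n" using D(4)[of w] w x(1) by auto
      have "L w = L x" using arg_cong[OF e, of pos] unfolding pos_vs[OF Lw] pos_vs[OF Lx] .
      moreover have nx: "n < x" using w by simp
      ultimately have "L w \<le> L (pr x)" "R (pr x) \<le> R w"
        using D(6)[OF w x(1)] that x(2) by auto
      then show False using D(5)[OF nx x(1)] that by auto
    qed
    have ch: "\<exists>y. n < y \<and> y < N \<and> ?pr y = w \<and> L y = l \<and> R y = r \<and> (if r < R w then lch r = y else ?lc w = y)"
      if wide: "Suc (L w) < R w" and s: "segment cuts (L w) (R w) l r" for l r
    proof -
      obtain y where y: "n < y" "y < N" "pr y = w" "L y = l" "R y = r"
        "if r < R w then lch r = y else lc w = y"
        using d wide s unfolding done_ok_def by blast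
      have lcw: "?lc w = lc w" and pry: "?pr y = w" using w y(1,3) same[of y] by simp_all
      show ?thesis unfolding lcw using y pry by blast
    qed
    show ?thesis
      unfolding done_ok_def
    proof (intro conjI impI)
      assume s: "R w = Suc (L w)"
      show "?pr (vs ! L w) = w" "?lc w = vs ! L w"
        using d s ne[OF s] w unfolding done_ok_def by simp_all
    next
      assume wide: "Suc (L w) < R w"
      show "\<forall>k\<in>cuts (L w) (R w). key k = w * n + k" using d wide unfolding done_ok_def by blast
      show "\<forall>l r. segment cuts (L w) (R w) l r \<longrightarrow> (\<exists>y. n < y \<and> y < N \<and> ?pr y = w \<and>
        L y = l \<and> R y = r \<and> (if r < R w then lch r = y else ?lc w = y))"
        using ch[OF wide] by blast
    qed
  qed
  have dx: "done_ok N ?pr L R key ?lc lch x" unfolding done_ok_def using x(2) by simp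
  have keys: "keys_ok (Suc x) L R key" using o(5) unfolding keys_ok_def by (meson less_SucI)
  show ?thesis unfolding outer_ok_def
  proof (intro conjI)
    show "\<forall>y. n < y \<and> y < N \<longrightarrow> ?pr y < Suc x" using o(3) same by (auto intro: less_SucI)
    show "\<forall>w. n \<le> w \<and> w < Suc x \<longrightarrow> done_ok N ?pr L R key ?lc lch w"
      using dn dx less_Suc_eq by auto
    show "\<forall>y k. Suc x \<le> y \<and> y < N \<and> L y < k \<and> k < R y \<longrightarrow> key k = 0"
      using o(6) Suc_leD by blast
  qed (use tree o x keys in auto)
qed

lemma outer_init:
  assumes "L n = 0" "R n = n" "\<And>k. key k = 0"
  shows "outer_ok n (Suc n) pr L R key lc lch"
  using assms n(1) by (auto simp: outer_ok_def tree_ok_def keys_ok_def less_Suc_eq)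

lemma outer_final:
  assumes "outer_ok N N pr L R key lc lch"
  shows "interval_tree n N vs pos pr L R cuts"
proof -
  have o: "tree_ok N pr L R" "\<And>w. n \<le> w \<Longrightarrow> w < N \<Longrightarrow> done_ok N pr L R key lc lch w"
    using assms unfolding outer_ok_def by blast+
  note D = tree_okD[OF o(1)]
  show ?thesis
  proof
    show "\<exists>y. n < y \<and> y < N \<and> pr y = w \<and> L y = l \<and> R y = r"
      if "n \<le> w" "w < N" "Suc (L w) < R w" "segment cuts (L w) (R w) l r" for w l r
      using o(2)[OF that(1,2)] that(3,4) unfolding done_ok_def by blast
    show "pr (vs ! L w) = w" if "n \<le> w" "w < N" "R w = Suc (L w)" for w
      using o(2)[OF that(1,2)] that(3) unfolding done_ok_def by blast
    show "L y < R y \<and> R y \<le> n" if "n \<le> y" "y < N" for y using D(4)[OF that] .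
    show "n \<le> pr y \<and> pr y < y \<and> Suc (L (pr y)) < R (pr y) \<and>
      segment cuts (L (pr y)) (R (pr y)) (L y) (R y)" if "n < y" "y < N" for y using D(5)[OF that] .
    show "R y \<le> L y' \<or> R y' \<le> L y \<or> L y \<le> L (pr y') \<and> R (pr y') \<le> R y"
      if "n \<le> y" "y < y'" "y' < N" for y y' using D(6)[OF that] .
  qed (use n(1) D(1-3) vs_less pos_vs pos_less vs_pos cuts_sub cuts_ne in simp_all)
qed

end

text \<open>A key is a node number times \<open>n\<close> plus a position, and node numbers stay
  within \<open>3 * n + 4\<close>; so this is the bound for keys, the only values that are not
  linear.\<close>

locale word_input = input +
  assumes key_bound: "(3 * n + 4) * n + n < B"
begin

lemma key_less: "w \<le> 3 * n + 4 \<Longrightarrow> k \<le> n \<Longrightarrow> w * n + k < B"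
  using mult_le_mono1[of w "3 * n + 4" n] key_bound by linarith

definition search_ok :: "state \<Rightarrow> bool" where
  "search_ok s \<longleftrightarrow> tables_ok n s \<and> rmq_ok n ''lo'' ''lom'' ''los'' s \<and> rmq_ok n ''nh'' ''nhm'' ''nhs'' s \<and>
     (\<forall>k. arr s ''lo'' k \<le> n \<and> arr s ''nh'' k \<le> n) \<and>
     (\<forall>k<n. bnd_ok (arr s ''lo'' k) (arr s ''nh'' k) k (distinguishers k))"

text \<open>Lists the memory that the search structures occupy, so that they can be carried along
  any command not writing to it.\<close>

lemma search_ok_cong:
  assumes "search_ok s" "reg s' ''n'' = reg s ''n''" "reg s' ''b'' = reg s ''b''" "reg s' ''K'' = reg s ''K''"
    "arr s' ''pw'' = arr s ''pw''" "arr s' ''lb'' = arr s ''lb''" "arr s' ''len'' = arr s ''len''"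
    "arr s' ''lo'' = arr s ''lo''" "arr s' ''lom'' = arr s ''lom''" "arr s' ''los'' = arr s ''los''"
    "arr s' ''nh'' = arr s ''nh''" "arr s' ''nhm'' = arr s ''nhm''" "arr s' ''nhs'' = arr s ''nhs''"
  shows "search_ok s'"
  using assms(1) unfolding search_ok_def tables_ok_def rmq_ok_def assms(2-) .

lemma search_okD:
  assumes "search_ok s"
  shows "tables_ok n s" "rmq_ok n ''lo'' ''lom'' ''los'' s" "rmq_ok n ''nh'' ''nhm'' ''nhs'' s"
    "\<And>k. arr s ''lo'' k \<le> n" "\<And>k. arr s ''nh'' k \<le> n"
    "\<And>k. k < n \<Longrightarrow> bnd_ok (arr s ''lo'' k) (arr s ''nh'' k) k (distinguishers k)" "reg s ''n'' = n"
  using assms unfolding search_ok_def tables_ok_def by blast+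

text \<open>Because of \<open>a < k\<close> the neutral value \<open>k\<close> does not pass the
  left test, and because of \<open>b > 0\<close> the neutral value \<open>n\<close> does not pass
  the right one. The right test has the form \<open>< n - b + 1\<close> so that both probes use a
  strict comparison.\<close>

lemma forced_iff:
  assumes "search_ok s" "a < k" "k < b" "b \<le> n"
  shows "k \<in> forced a b \<longleftrightarrow> arr s ''lo'' k < a \<or> arr s ''nh'' k < n - b + 1"
proof -
  have kn: "k < n" using assms by simp
  have bnd: "bnd_ok (arr s ''lo'' k) (arr s ''nh'' k) k (distinguishers k)"
    using search_okD(6)[OF assms(1) kn] .
  have "arr s ''lo'' k < a \<longleftrightarrow> (\<exists>v\<in>distinguishers k. v < a)"
    using bnd assms(2) unfolding bnd_ok_def by auto
  moreover have "arr s ''nh'' k \<le> n - b \<longleftrightarrow> (\<exists>v\<in>distinguishers k. b \<le> v)"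
  proof -
    have "n - v \<le> n - b \<longleftrightarrow> b \<le> v" if "v \<in> distinguishers k" for v
      using that assms(4) by (auto simp: distinguishers_def)
    moreover have "\<not> n \<le> n - b" using assms by auto
    ultimately show ?thesis using bnd unfolding bnd_ok_def by blast
  qed
  ultimately show ?thesis using assms(2,3) by (auto simp: forced_def less_Suc_eq_le)
qed

section \<open>Finding a cut in a range\<close>

definition probe :: "string \<Rightarrow> string \<Rightarrow> string \<Rightarrow> aexp \<Rightarrow> com" where
  "probe A M S e =
     (''ql'' ::= Reg ''l'' .+ Const 1 ;; ''qr'' ::= Reg ''r'' .- Const 1) ;; rmq_query A M S ;;
     If (A.[Reg ''qi''] .< e) (''f'' ::= Reg ''qi'') Skip"

definition probe_both :: com where
  "probe_both =
     probe ''lo'' ''lom'' ''los'' (Reg ''lx'') ;;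
     If (Reg ''f'' .= Const 0)
       (probe ''nh'' ''nhm'' ''nhs'' (Reg ''n'' .- Reg ''rx'' .+ Const 1)) Skip"

text \<open>\<open>f = 0\<close> encodes failure, which is unambiguous because cuts are positive.
  The default cut is produced only after the whole node has been searched in vain; in a proper part
  of the node, failure means that the part is a piece.\<close>

definition find_cut :: com where
  "find_cut =
     (''f'' ::= Const 0) ;;
     If (Reg ''l'' .+ Const 1 .< Reg ''r'') probe_both Skip ;;
     If ((Reg ''f'' .= Const 0) .* ((Reg ''l'' .= Reg ''lx'') .* (Reg ''r'' .= Reg ''rx'')))
       (''f'' ::= Reg ''lx'' .+ Const 1) Skip"

lemma find_cut_writes [simp]:
  "wregs (probe A M S e) = {''ql'', ''qr'', ''kl'', ''kr'', ''qj'', ''qc'', ''qi'', ''f''}"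
  "warrs (probe A M S e) = {}"
  "wregs probe_both = {''ql'', ''qr'', ''kl'', ''kr'', ''qj'', ''qc'', ''qi'', ''f''}"
  "warrs probe_both = {}"
  "wregs find_cut = {''ql'', ''qr'', ''kl'', ''kr'', ''qj'', ''qc'', ''qi'', ''f''}"
  "warrs find_cut = {}"
  by (auto simp: probe_def probe_both_def find_cut_def)

text \<open>A minimizer decides for the whole range: if it misses the threshold, so does every
  position. The threshold \<open>e\<close> may only depend on registers that the query leaves
  alone.\<close>

lemma runs_probe:
  assumes ok: "tables_ok n s" "rmq_ok n A M S s" "\<And>x. arr s A x \<le> n"
    and s: "reg s ''l'' = l" "reg s ''r'' = r" "Suc l < r" "r \<le> n" "reg s ''f'' = 0"
    and e: "\<And>s'. (\<And>x. x \<in> {''lx'', ''rx'', ''n''} \<Longrightarrow> reg s' x = reg s x) \<Longrightarrow> aval e s' = v \<and> fits B e s'"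
      "cost e \<le> 5"
  shows "runs B (probe A M S e) s (\<lambda>s' t. t \<le> 250 \<and>
    (reg s' ''f'' = 0 \<and> (\<forall>k. l < k \<and> k < r \<longrightarrow> \<not> arr s A k < v) \<or>
     l < reg s' ''f'' \<and> reg s' ''f'' < r \<and> arr s A (reg s' ''f'') < v))" (is "runs B _ s ?Q")
  unfolding probe_def
proof -
  let ?p1 = "''ql'' ::= Reg ''l'' .+ Const 1 ;; ''qr'' ::= Reg ''r'' .- Const 1"
  have Bn: "64 * n + 64 \<le> B" using B by simp
  have bB: "Suc l < B" "l < B" "r < B" "Suc 0 < B" "r - Suc 0 < B" using s B by auto
  have 1: "runs B ?p1 s (\<lambda>s' t. t = 8 \<and> reg s' ''ql'' = Suc l \<and> reg s' ''qr'' = r - 1)"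
    using bB by (simp add: runs_simps s)
  show "runs B (?p1 ;; rmq_query A M S ;; If (A.[Reg ''qi''] .< e) (''f'' ::= Reg ''qi'') Skip) s ?Q"
  proof (rule runs_SeqF[OF 1])
    fix s1 :: state and t1 :: nat
    assume 1: "t1 = 8 \<and> reg s1 ''ql'' = Suc l \<and> reg s1 ''qr'' = r - 1" and ag: "agree ?p1 s s1"
    have r1: "reg s1 ''b'' = reg s ''b''" "reg s1 ''K'' = reg s ''K''" "reg s1 ''n'' = reg s ''n''"
      "reg s1 ''lx'' = reg s ''lx''" "reg s1 ''rx'' = reg s ''rx''" "reg s1 ''f'' = 0"
      "arr s1 = arr s"
      by (simp_all add: agree_reg[OF ag] agree_arr[OF ag] s fun_eq_iff)
    have ok1: "tables_ok n s1" "rmq_ok n A M S s1"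
      using ok by (simp_all add: tables_ok_def rmq_ok_def r1)
    have 2: "runs B (rmq_query A M S) s1 (\<lambda>s' t. t \<le> 200 \<and>
      argmin_on (arr s1 A) (Suc l) (Suc (r - 1)) (reg s' ''qi''))"
    proof (rule runs_rmq_query[OF Bn _ ok1])
      show "arr s1 A x < B" for x using ok(3)[of x] B by (simp add: r1)
    qed (use 1 s in auto)
    show "runs B (rmq_query A M S ;; If (A.[Reg ''qi''] .< e) (''f'' ::= Reg ''qi'') Skip) s1
      (\<lambda>s2 t2. ?Q s2 (t1 + t2))"
    proof (rule runs_SeqF[OF 2])
      fix s2 :: state and t2 :: nat
      assume 2: "t2 \<le> 200 \<and> argmin_on (arr s1 A) (Suc l) (Suc (r - 1)) (reg s2 ''qi'')"
        and ag: "agree (rmq_query A M S) s1 s2"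
      have r2: "reg s2 ''n'' = reg s ''n''" "reg s2 ''lx'' = reg s ''lx''" "reg s2 ''rx'' = reg s ''rx''"
        "reg s2 ''f'' = 0" "arr s2 = arr s"
        by (simp_all add: agree_reg[OF ag] agree_arr[OF ag] r1 fun_eq_iff)
      define q where "q = reg s2 ''qi''"
      have q: "l < q" "q < r" "\<And>k. l < k \<Longrightarrow> k < r \<Longrightarrow> arr s A q \<le> arr s A k"
        using 2 s(3) unfolding r1 q_def argmin_on_def by auto
      have ev: "aval e s2 = v" "fits B e s2" using e(1)[of s2] r2 by auto
      have qB: "q < B" "arr s A q < B" using q(2) s(4) B ok(3)[of q] by auto
      have ft: "fits B (A.[Reg ''qi''] .< e) s2" using ev qB bB by (simp add: r2 q_def[symmetric])
      show "runs B (If (A.[Reg ''qi''] .< e) (''f'' ::= Reg ''qi'') Skip) s2 (\<lambda>s3 t3. ?Q s3 (t1 + (t2 + t3)))"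
      proof (cases "arr s A q < v")
        case True
        show ?thesis
        proof (rule runs_IfT[OF ft])
          show "aval (A.[Reg ''qi''] .< e) s2 \<noteq> 0" using True ev by (simp add: r2 q_def[symmetric])
          show "runs B (''f'' ::= Reg ''qi'') s2
            (\<lambda>s' t. ?Q s' (t1 + (t2 + (cost (A.[Reg ''qi''] .< e) + 1 + t))))"
            using True 1 2 q(1,2) qB e(2) by (simp add: runs_simps q_def[symmetric])
        qed
      next
        case False
        have none: "\<forall>k. l < k \<and> k < r \<longrightarrow> \<not> arr s A k < v" using q(3) False by fastforce
        show ?thesis
        proof (rule runs_IfF[OF ft])
          show "aval (A.[Reg ''qi''] .< e) s2 = 0" using False ev by (simp add: r2 q_def[symmetric])
          show "runs B Skip s2
            (\<lambda>s' t. ?Q s' (t1 + (t2 + (cost (A.[Reg ''qi''] .< e) + 1 + t))))"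
            using none 1 2 e(2) by (simp add: runs_simps r2)
        qed
      qed
    qed
  qed
qed

lemma runs_probe_both:
  assumes ok: "search_ok s"
    and s: "reg s ''l'' = l" "reg s ''r'' = r" "reg s ''lx'' = a" "reg s ''rx'' = b"
      "a \<le> l" "Suc l < r" "r \<le> b" "b \<le> n" "reg s ''f'' = 0"
  shows "runs B probe_both s (\<lambda>s' t. t \<le> 520 \<and>
    (reg s' ''f'' = 0 \<and> (\<forall>k. l < k \<and> k < r \<longrightarrow> k \<notin> forced a b) \<or>
     l < reg s' ''f'' \<and> reg s' ''f'' < r \<and> reg s' ''f'' \<in> forced a b))" (is "runs B _ s ?Q")
proof -
  note D = search_okD[OF ok]
  have frc: "k \<in> forced a b \<longleftrightarrow> arr s ''lo'' k < a \<or> arr s ''nh'' k < n - b + 1" if "l < k" "k < r" for k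
    using forced_iff[OF ok, of a k b] that s by simp
  have abB: "a < B" "b < B" "n < B" "Suc 0 < B" "0 < B" "Suc n < B" using s B by auto
  have rn: "r \<le> n" using s by simp
  have 1: "runs B (probe ''lo'' ''lom'' ''los'' (Reg ''lx'')) s (\<lambda>s' t. t \<le> 250 \<and>
    (reg s' ''f'' = 0 \<and> (\<forall>k. l < k \<and> k < r \<longrightarrow> \<not> arr s ''lo'' k < a) \<or>
     l < reg s' ''f'' \<and> reg s' ''f'' < r \<and> arr s ''lo'' (reg s' ''f'') < a))"
    by (rule runs_probe[OF D(1,2,4) s(1,2,6) rn s(9)]) (use s abB in auto)
  show ?thesis unfolding probe_both_def
  proof (rule runs_SeqF[OF 1])
    fix s1 :: state and t1 :: nat
    assume 1: "t1 \<le> 250 \<and>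
      (reg s1 ''f'' = 0 \<and> (\<forall>k. l < k \<and> k < r \<longrightarrow> \<not> arr s ''lo'' k < a) \<or>
       l < reg s1 ''f'' \<and> reg s1 ''f'' < r \<and> arr s ''lo'' (reg s1 ''f'') < a)"
      and ag: "agree (probe ''lo'' ''lom'' ''los'' (Reg ''lx'')) s s1"
    have r1: "reg s1 ''l'' = l" "reg s1 ''r'' = r" "reg s1 ''lx'' = a" "reg s1 ''rx'' = b" "reg s1 ''n'' = n"
      "arr s1 = arr s"
      using s D(7) by (simp_all add: agree_reg[OF ag] agree_arr[OF ag] fun_eq_iff)
    have ok1: "search_ok s1"
      by (rule search_ok_cong[OF ok]) (simp_all add: agree_reg[OF ag] agree_arr[OF ag])
    note D1 = search_okD[OF ok1]
    have fB: "reg s1 ''f'' < B" using 1 rn B by auto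
    have ft: "fits B (Reg ''f'' .= Const 0) s1" using fB abB by simp
    show "runs B (If (Reg ''f'' .= Const 0)
       (probe ''nh'' ''nhm'' ''nhs'' (Reg ''n'' .- Reg ''rx'' .+ Const 1)) Skip) s1 (\<lambda>s2 t2. ?Q s2 (t1 + t2))"
    proof (cases "reg s1 ''f'' = 0")
      case False
      then have f: "l < reg s1 ''f''" "reg s1 ''f'' < r" "arr s ''lo'' (reg s1 ''f'') < a" using 1 by auto
      then have "reg s1 ''f'' \<in> forced a b" using frc by blast
      then show ?thesis using False f 1 by (intro runs_IfF[OF ft]) (simp_all add: runs_simps)
    next
      case True
      then have nolo: "\<forall>k. l < k \<and> k < r \<longrightarrow> \<not> arr s ''lo'' k < a" using 1 by auto
      have 2: "runs B (probe ''nh'' ''nhm'' ''nhs'' (Reg ''n'' .- Reg ''rx'' .+ Const 1)) s1 (\<lambda>s' t. t \<le> 250 \<and>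
        (reg s' ''f'' = 0 \<and> (\<forall>k. l < k \<and> k < r \<longrightarrow> \<not> arr s1 ''nh'' k < n - b + 1) \<or>
         l < reg s' ''f'' \<and> reg s' ''f'' < r \<and> arr s1 ''nh'' (reg s' ''f'') < n - b + 1))"
      proof (rule runs_probe[OF D1(1,3,5) r1(1,2) s(6) rn True])
        fix s' :: state
        assume h: "\<And>x. x \<in> {''lx'', ''rx'', ''n''} \<Longrightarrow> reg s' x = reg s1 x"
        have "reg s' ''n'' = n" "reg s' ''rx'' = b" using h[of "''n''"] h[of "''rx''"] r1 by simp_all
        moreover have "n - b < B" "n - b + 1 < B" using abB by linarith+
        ultimately show "aval (Reg ''n'' .- Reg ''rx'' .+ Const 1) s' = n - b + 1 \<and>
          fits B (Reg ''n'' .- Reg ''rx'' .+ Const 1) s'" using abB by simp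
      qed simp
      show ?thesis
      proof (rule runs_IfT[OF ft])
        show "aval (Reg ''f'' .= Const 0) s1 \<noteq> 0" using True by simp
        show "runs B (probe ''nh'' ''nhm'' ''nhs'' (Reg ''n'' .- Reg ''rx'' .+ Const 1)) s1
          (\<lambda>s2 t2. ?Q s2 (t1 + (cost (Reg ''f'' .= Const 0) + 1 + t2)))"
        proof (rule runs_mono[OF 2])
          fix s2 :: state and t2 :: nat
          assume 2: "t2 \<le> 250 \<and>
            (reg s2 ''f'' = 0 \<and> (\<forall>k. l < k \<and> k < r \<longrightarrow> \<not> arr s1 ''nh'' k < n - b + 1) \<or>
             l < reg s2 ''f'' \<and> reg s2 ''f'' < r \<and> arr s1 ''nh'' (reg s2 ''f'') < n - b + 1)"
          have "reg s2 ''f'' = 0 \<and> (\<forall>k. l < k \<and> k < r \<longrightarrow> k \<notin> forced a b) \<or>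
             l < reg s2 ''f'' \<and> reg s2 ''f'' < r \<and> reg s2 ''f'' \<in> forced a b"
            using 2 nolo frc unfolding r1 by blast
          then show "?Q s2 (t1 + (cost (Reg ''f'' .= Const 0) + 1 + t2))" using 1 2 by simp
        qed
      qed
    qed
  qed
qed

lemma runs_find_cut:
  assumes ok: "search_ok s"
    and s: "reg s ''l'' = l" "reg s ''r'' = r" "reg s ''lx'' = a" "reg s ''rx'' = b"
      "a \<le> l" "l < r" "r \<le> b" "b \<le> n" "Suc a < b" "l \<in> points cuts a b" "r \<in> points cuts a b"
  shows "runs B find_cut s (\<lambda>s' t. t \<le> 600 \<and>
    (reg s' ''f'' = 0 \<and> (\<forall>k. l < k \<and> k < r \<longrightarrow> k \<notin> cuts a b) \<or>
     l < reg s' ''f'' \<and> reg s' ''f'' < r \<and> reg s' ''f'' \<in> cuts a b))" (is "runs B _ s ?Q")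
proof -
  let ?g = "(Reg ''f'' .= Const 0) .* ((Reg ''l'' .= Reg ''lx'') .* (Reg ''r'' .= Reg ''rx''))"
  have bB: "Suc l < B" "l < B" "r < B" "a < B" "b < B" "Suc 0 < B" "0 < B" "Suc a < B" using s B by auto
  have 0: "runs B (''f'' ::= Const 0) s (\<lambda>s' t. t = 2 \<and> reg s' ''f'' = 0)"
    using bB by (simp add: runs_simps)
  show ?thesis unfolding find_cut_def
  proof (rule runs_SeqF[OF 0])
    fix s1 :: state and t1 :: nat
    assume 1: "t1 = 2 \<and> reg s1 ''f'' = 0" and ag: "agree (''f'' ::= Const 0) s s1"
    have r1: "reg s1 ''l'' = l" "reg s1 ''r'' = r" "reg s1 ''lx'' = a" "reg s1 ''rx'' = b"
      using s by (simp_all add: agree_reg[OF ag])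
    have ok1: "search_ok s1"
      by (rule search_ok_cong[OF ok]) (simp_all add: agree_reg[OF ag] agree_arr[OF ag])
    let ?R = "\<lambda>s' t. t \<le> 530 \<and>
      (reg s' ''f'' = 0 \<and> (\<forall>k. l < k \<and> k < r \<longrightarrow> k \<notin> forced a b) \<or>
       l < reg s' ''f'' \<and> reg s' ''f'' < r \<and> reg s' ''f'' \<in> forced a b)"
    have ft: "fits B (Reg ''l'' .+ Const 1 .< Reg ''r'') s1" using bB r1 by simp
    have 2: "runs B (If (Reg ''l'' .+ Const 1 .< Reg ''r'') probe_both Skip) s1 ?R"
    proof (cases "Suc l < r")
      case True
      show ?thesis
      proof (rule runs_IfT[OF ft])
        show "aval (Reg ''l'' .+ Const 1 .< Reg ''r'') s1 \<noteq> 0" using True r1 by simp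
        show "runs B probe_both s1 (\<lambda>s' t. ?R s' (cost (Reg ''l'' .+ Const 1 .< Reg ''r'') + 1 + t))"
          by (rule runs_mono[OF runs_probe_both[OF ok1 r1 s(5) True s(7,8)]]) (use 1 in auto)
      qed
    next
      case False
      show ?thesis
        by (rule runs_IfF[OF ft]) (use False r1 1 in \<open>auto simp: runs_simps\<close>)
    qed
    show "runs B (If (Reg ''l'' .+ Const 1 .< Reg ''r'') probe_both Skip ;;
      If ?g (''f'' ::= Reg ''lx'' .+ Const 1) Skip) s1 (\<lambda>s2 t2. ?Q s2 (t1 + t2))"
    proof (rule runs_SeqF[OF 2])
      fix s2 :: state and t2 :: nat
      assume 2: "?R s2 t2" and ag: "agree (If (Reg ''l'' .+ Const 1 .< Reg ''r'') probe_both Skip) s1 s2"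
      have r2: "reg s2 ''l'' = l" "reg s2 ''r'' = r" "reg s2 ''lx'' = a" "reg s2 ''rx'' = b"
        using r1 by (simp_all add: agree_reg[OF ag])
      have fB: "reg s2 ''f'' < B" using 2 bB by auto
      have ft: "fits B ?g s2" using fB bB by (simp add: r2)
      have t12: "t1 = 2" "t2 \<le> 530" using 1 2 by auto
      show "runs B (If ?g (''f'' ::= Reg ''lx'' .+ Const 1) Skip) s2 (\<lambda>s3 t3. ?Q s3 (t1 + (t2 + t3)))"
      proof (cases "reg s2 ''f'' = 0 \<and> l = a \<and> r = b")
        case True
        then have "forced a b = {}" using 2 by (auto simp: forced_def)
        then have "cuts a b = {Suc a}" by (simp add: cuts_def)
        then show ?thesis using True s(9) t12 bB
          by (intro runs_IfT[OF ft]) (simp_all add: runs_simps r2)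
      next
        case False
        have "reg s2 ''f'' = 0 \<and> (\<forall>k. l < k \<and> k < r \<longrightarrow> k \<notin> cuts a b) \<or>
          l < reg s2 ''f'' \<and> reg s2 ''f'' < r \<and> reg s2 ''f'' \<in> cuts a b"
        proof (cases "forced a b = {}")
          case F: True
          then have c: "cuts a b = {Suc a}" by (simp add: cuts_def)
          have f0: "reg s2 ''f'' = 0" using 2 F by auto
          then have "l \<noteq> a \<or> r \<noteq> b" using False by auto
          \<comment> \<open>Here \<open>l\<close> and \<open>r\<close> are among \<open>a\<close>,
            \<open>Suc a\<close>, \<open>b\<close> without being both outer ones, so the default cut
            is an end of the range.\<close>
          then have "\<not> (l < Suc a \<and> Suc a < r)" using s(5,6,10,11) c by (auto simp: points_def)
          then show ?thesis using f0 c by auto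
        next
          case F: False
          then show ?thesis using 2 by (auto simp: cuts_def)
        qed
        moreover have "aval ?g s2 = 0" using False by (auto simp: r2)
        ultimately show ?thesis using t12 by (intro runs_IfF[OF ft]) (simp_all add: runs_simps)
      qed
    qed
  qed
qed

section \<open>The splitting loop and its amortized cost\<close>

definition push :: com where
  "push =
     ''key''.[Reg ''f''] \<leftarrow> Reg ''x'' .* Reg ''n'' .+ Reg ''f'' ;;
     ''stk''.[Reg ''sp''] \<leftarrow> Reg ''f'' ;; ''sp'' ::= Reg ''sp'' .+ Const 1"

definition emit :: com where
  "emit =
     (''L''.[Reg ''nodes''] \<leftarrow> Reg ''l'' ;; ''R''.[Reg ''nodes''] \<leftarrow> Reg ''r'' ;;
      ''parent''.[Reg ''nodes''] \<leftarrow> Reg ''x'' ;; ''lc''.[Reg ''x''] \<leftarrow> Reg ''nodes'') ;;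
     If (Reg ''r'' .< Reg ''rx'') (''lch''.[Reg ''r''] \<leftarrow> Reg ''nodes'') Skip ;;
     (''nodes'' ::= Reg ''nodes'' .+ Const 1 ;; ''l'' ::= Reg ''r'' ;; ''sp'' ::= Reg ''sp'' .- Const 1)"

definition split_step :: com where
  "split_step =
     (''r'' ::= ''stk''.[Reg ''sp'' .- Const 1]) ;; find_cut ;; If (Reg ''f'' .= Const 0) emit push"

definition split_loop :: com where
  "split_loop = While (Const 0 .< Reg ''sp'') split_step"

definition node_step :: com where
  "node_step =
     (''lx'' ::= ''L''.[Reg ''x''] ;; ''rx'' ::= ''R''.[Reg ''x'']) ;;
     If (Reg ''lx'' .+ Const 1 .= Reg ''rx'')
       (''f'' ::= ''order''.[Reg ''lx''] ;; ''parent''.[Reg ''f''] \<leftarrow> Reg ''x'' ;;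
        ''lc''.[Reg ''x''] \<leftarrow> Reg ''f'')
       ((''l'' ::= Reg ''lx'' ;; ''stk''.[Const 0] \<leftarrow> Reg ''rx'' ;; ''sp'' ::= Const 1) ;; split_loop) ;;
     ''x'' ::= Reg ''x'' .+ Const 1"

definition node_loop :: com where
  "node_loop = While (Reg ''x'' .< Reg ''nodes'') node_step"

lemma push_writes [simp]:
  "wregs push = {''sp''}" "warrs push = {''key'', ''stk''}"
  by (auto simp: push_def)

lemma emit_writes [simp]:
  "wregs emit = {''nodes'', ''l'', ''sp''}" "warrs emit = {''L'', ''R'', ''parent'', ''lc'', ''lch''}"
  by (auto simp: emit_def)

lemma split_writes [simp]:
  "wregs split_step = {''r'', ''ql'', ''qr'', ''kl'', ''kr'', ''qj'', ''qc'', ''qi'', ''f'', ''nodes'', ''l'', ''sp''}"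
  "warrs split_step = {''L'', ''R'', ''parent'', ''lc'', ''lch'', ''key'', ''stk''}"
  "wregs split_loop = {''r'', ''ql'', ''qr'', ''kl'', ''kr'', ''qj'', ''qc'', ''qi'', ''f'', ''nodes'', ''l'', ''sp''}"
  "warrs split_loop = {''L'', ''R'', ''parent'', ''lc'', ''lch'', ''key'', ''stk''}"
  by (auto simp: split_step_def split_loop_def)

lemma node_writes [simp]:
  "wregs node_step = {''lx'', ''rx'', ''x'', ''r'', ''ql'', ''qr'', ''kl'', ''kr'', ''qj'', ''qc'', ''qi'', ''f'', ''nodes'', ''l'', ''sp''}"
  "warrs node_step = {''L'', ''R'', ''parent'', ''lc'', ''lch'', ''key'', ''stk''}"
  "wregs node_loop = {''lx'', ''rx'', ''x'', ''r'', ''ql'', ''qr'', ''kl'', ''kr'', ''qj'', ''qc'', ''qi'', ''f'', ''nodes'', ''l'', ''sp''}"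
  "warrs node_loop = {''L'', ''R'', ''parent'', ''lc'', ''lch'', ''key'', ''stk''}"
  by (auto simp: node_step_def node_loop_def)

text \<open>The potential of the analysis: keys are never reset to \<open>0\<close>, and at most
  \<open>n\<close> positions can receive one.\<close>

definition cut_count :: "(nat \<Rightarrow> nat) \<Rightarrow> nat" where
  "cut_count key = card {k. k < n \<and> key k \<noteq> 0}"

lemma cut_count_le: "cut_count key \<le> n"
proof -
  have "cut_count key \<le> card {..<n}" unfolding cut_count_def by (rule card_mono) auto
  then show ?thesis by simp
qed

lemma cut_count_upd: "key f = 0 \<Longrightarrow> f < n \<Longrightarrow> v \<noteq> 0 \<Longrightarrow> cut_count (key(f := v)) = Suc (cut_count key)"
proof -
  assume f: "key f = 0" "f < n" "v \<noteq> 0"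
  then have "{k. k < n \<and> (key(f := v)) k \<noteq> 0} = insert f {k. k < n \<and> key k \<noteq> 0}" by auto
  moreover have "f \<notin> {k. k < n \<and> key k \<noteq> 0}" "finite {k. k < n \<and> key k \<noteq> 0}" using f by auto
  ultimately show ?thesis unfolding cut_count_def by simp
qed

abbreviation inner_state :: "nat \<Rightarrow> state \<Rightarrow> bool" where
  "inner_state x s \<equiv> inner_ok x (reg s ''l'') (reg s ''sp'') (arr s ''stk'') (reg s ''nodes'')
     (arr s ''parent'') (arr s ''L'') (arr s ''R'') (arr s ''key'') (arr s ''lc'') (arr s ''lch'')"

abbreviation outer_state :: "nat \<Rightarrow> state \<Rightarrow> bool" where
  "outer_state x s \<equiv> outer_ok x (reg s ''nodes'')
     (arr s ''parent'') (arr s ''L'') (arr s ''R'') (arr s ''key'') (arr s ''lc'') (arr s ''lch'')"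

lemma runs_push:
  assumes "reg s ''x'' = x" "reg s ''n'' = n" "reg s ''f'' = f" "reg s ''sp'' = sp" "x \<le> 3 * n + 4" "f \<le> n" "sp \<le> n"
  shows "runs B push s (\<lambda>s' t. t \<le> 20 \<and> arr s' ''key'' = (arr s ''key'')(f := x * n + f) \<and>
    arr s' ''stk'' = (arr s ''stk'')(sp := f) \<and> reg s' ''sp'' = Suc sp)"
proof -
  have "x * n + f < B" using key_less assms by simp
  moreover have "x < B" "n < B" "f < B" "Suc sp < B" "sp < B" "Suc 0 < B" using assms B by auto
  ultimately show ?thesis by (simp add: push_def runs_simps assms(1-4))
qed

lemma runs_emit:
  assumes "reg s ''nodes'' = N" "reg s ''l'' = l" "reg s ''r'' = r" "reg s ''x'' = x" "reg s ''rx'' = rx"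
    "reg s ''sp'' = sp" "N \<le> 3 * n + 4" "l \<le> n" "r \<le> n" "x \<le> 3 * n + 4" "rx \<le> n" "sp \<le> n"
  shows "runs B emit s (\<lambda>s' t. t \<le> 50 \<and> arr s' ''L'' = (arr s ''L'')(N := l) \<and>
    arr s' ''R'' = (arr s ''R'')(N := r) \<and> arr s' ''parent'' = (arr s ''parent'')(N := x) \<and>
    arr s' ''lc'' = (arr s ''lc'')(x := N) \<and>
    arr s' ''lch'' = (if r < rx then (arr s ''lch'')(r := N) else arr s ''lch'') \<and>
    reg s' ''nodes'' = Suc N \<and> reg s' ''l'' = r \<and> reg s' ''sp'' = sp - 1)"
proof -
  have bB: "Suc N < B" "N < B" "l < B" "r < B" "x < B" "rx < B" "sp < B" "sp - Suc 0 < B" "Suc 0 < B" "0 < B"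
    using assms B by auto
  show ?thesis
    by (cases "r < rx") (use bB in \<open>simp_all add: emit_def runs_simps assms(1-6)\<close>)
qed

text \<open>Every iteration records a new cut or creates a node, which pays for it.\<close>

lemma runs_split_loop:
  assumes ok: "search_ok s" and I0: "inner_state x s"
    and s: "reg s ''x'' = x" "reg s ''lx'' = arr s ''L'' x" "reg s ''rx'' = arr s ''R'' x"
      "reg s ''sp'' = 1" "reg s ''l'' = arr s ''L'' x"
    and N0: "reg s ''nodes'' \<le> n + 1 + 2 * cut_count (arr s ''key'')"
  shows "runs B split_loop s (\<lambda>s' t. outer_state (Suc x) s' \<and>
    reg s' ''nodes'' \<le> n + 1 + 2 * cut_count (arr s' ''key'') \<and>
    t + 1000 * cut_count (arr s ''key'') + 1000 * reg s ''nodes'' \<le>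
      1000 * cut_count (arr s' ''key'') + 1000 * reg s' ''nodes'' + 10)"
  unfolding split_loop_def
proof -
  let ?P0 = "cut_count (arr s ''key'')"
  let ?N0 = "reg s ''nodes''"
  let ?g = "Const 0 .< Reg ''sp''"
  \<comment> \<open>The equation keeps the books: a push adds a stack entry and a cut, an emission
    trades a stack entry for a node. The disjunction says that a cut has been found unless nothing
    has happened yet; the bound of two nodes per cut depends on it.\<close>
  let ?I = "\<lambda>s' t. inner_state x s' \<and>
    arr s' ''L'' x = arr s ''L'' x \<and> arr s' ''R'' x = arr s ''R'' x \<and>
    reg s' ''nodes'' + reg s' ''sp'' + ?P0 = ?N0 + 1 + cut_count (arr s' ''key'') \<and>
    (?P0 < cut_count (arr s' ''key'') \<or> ?P0 = cut_count (arr s' ''key'') \<and> reg s' ''l'' = arr s ''L'' x \<and> reg s' ''sp'' = 1) \<and>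
    t + 1000 * ?P0 + 1000 * ?N0 \<le> 1000 * cut_count (arr s' ''key'') + 1000 * reg s' ''nodes''"
  note J0 = inner_okD[OF I0]
  have ab: "Suc (arr s ''L'' x) < arr s ''R'' x" "arr s ''R'' x \<le> n"
    using J0(4) tree_okD(4)[OF J0(1,2,3)] by auto
  have P0n: "?P0 \<le> n" by (rule cut_count_le)
  have xN: "x \<le> 3 * n + 4" using J0(3) N0 P0n by linarith
  show "runs B (While ?g split_step) s (\<lambda>s' t. outer_state (Suc x) s' \<and>
    reg s' ''nodes'' \<le> n + 1 + 2 * cut_count (arr s' ''key'') \<and>
    t + 1000 * ?P0 + 1000 * ?N0 \<le> 1000 * cut_count (arr s' ''key'') + 1000 * reg s' ''nodes'' + 10)"
    (is "runs B _ s ?Q")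
  proof (rule runs_While[where I = ?I and T = "2000 * n + 1000"])
    show "?I s 0" using I0 s by simp
    fix s' :: state and t :: nat
    show "t \<le> 2000 * n + 1000" if "?I s' t"
    proof -
      have "reg s' ''nodes'' + reg s' ''sp'' + ?P0 = ?N0 + 1 + cut_count (arr s' ''key'')"
        "t + 1000 * ?P0 + 1000 * ?N0 \<le> 1000 * cut_count (arr s' ''key'') + 1000 * reg s' ''nodes''"
        using that by blast+
      then show ?thesis using cut_count_le[of "arr s' ''key''"] by linarith
    qed
    assume I: "?I s' t" and ag: "agree split_step s s'"
    define l sp N where "l = reg s' ''l''" and "sp = reg s' ''sp''" and "N = reg s' ''nodes''"
    let ?cur = "cut_count (arr s' ''key'')"
    have Pn: "?cur \<le> n" by (rule cut_count_le)
    have inn: "inner_ok x l sp (arr s' ''stk'') N (arr s' ''parent'') (arr s' ''L'') (arr s' ''R'')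
      (arr s' ''key'') (arr s' ''lc'') (arr s' ''lch'')" using I by (simp add: l_def sp_def N_def)
    have cnt: "N + sp + ?P0 = ?N0 + 1 + ?cur"
      and tt: "t + 1000 * ?P0 + 1000 * ?N0 \<le> 1000 * ?cur + 1000 * N"
      and fst: "?P0 < ?cur \<or> ?P0 = ?cur \<and> l = arr s ''L'' x \<and> sp = 1"
      using I unfolding sp_def N_def l_def by - (elim conjE, assumption)+
    have P: "?P0 \<le> ?cur" using fst by linarith
    have LRx: "arr s' ''L'' x = arr s ''L'' x" "arr s' ''R'' x = arr s ''R'' x" using I by blast+
    note J = inner_okD[OF inn]
    have r: "reg s' ''x'' = x" "reg s' ''lx'' = arr s ''L'' x" "reg s' ''rx'' = arr s ''R'' x" "reg s' ''n'' = n"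
      using s search_okD(7)[OF ok] by (simp_all add: agree_reg[OF ag])
    have ok': "search_ok s'"
      by (rule search_ok_cong[OF ok]) (simp_all add: agree_reg[OF ag] agree_arr[OF ag])
    \<comment> \<open>The stack consists of distinct positions between \<open>1\<close> and
      \<open>n\<close>.\<close>
    have spn: "sp \<le> n"
    proof (cases "sp = 0")
      case False
      have inj: "inj_on (arr s' ''stk'') {..<sp}"
        using J(16) by (intro inj_onI) (metis lessThan_iff nat_neq_iff)
      have "arr s' ''stk'' ` {..<sp} \<subseteq> {0<..n}"
      proof
        fix k assume "k \<in> arr s' ''stk'' ` {..<sp}"
        then obtain i where i: "i < sp" "k = arr s' ''stk'' i" by blast
        have "k \<le> arr s' ''stk'' 0" using J(16)[of 0 i] i by (cases "i = 0") auto
        then show "k \<in> {0<..n}" using J(14,15) i ab LRx by fastforce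
      qed
      then have "card {..<sp} \<le> card {0<..n}" using inj by (intro card_inj_on_le) auto
      then show ?thesis by simp
    qed simp
    have bB: "sp < B" "Suc 0 < B" "0 < B" "sp - Suc 0 < B" using spn B by auto
    show "fits B ?g s'" using bB by (simp add: sp_def[symmetric])
    show "?Q s' (t + (cost ?g + 1))" if "aval ?g s' = 0"
    proof -
      have sp0: "sp = 0" using that by (simp add: sp_def split: if_splits)
      have out: "outer_ok (Suc x) N (arr s' ''parent'') (arr s' ''L'') (arr s' ''R'')
        (arr s' ''key'') (arr s' ''lc'') (arr s' ''lch'')"
        by (rule inner_finish) (use inn sp0 in simp)
      \<comment> \<open>With \<open>c\<close> new cuts the loop has made \<open>c + 1\<close> nodes,
        which is at most \<open>2 * c\<close> because \<open>c \<ge> 1\<close>.\<close>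
      have "?P0 < ?cur" using fst sp0 by simp
      then have "N \<le> n + 1 + 2 * ?cur" using cnt sp0 N0 by linarith
      then show ?thesis using out tt by (simp add: N_def)
    qed
    assume "aval ?g s' \<noteq> 0"
    then have sp0: "0 < sp" by (simp add: sp_def split: if_splits)
    define rr where "rr = arr s' ''stk'' (sp - 1)"
    note top = inner_top[OF inn sp0, folded rr_def]
    have rrB: "rr \<le> n" "rr < B" "l \<le> n" using top ab LRx B by auto
    have 1: "runs B (''r'' ::= ''stk''.[Reg ''sp'' .- Const 1]) s' (\<lambda>s1 t1. t1 = 5 \<and> reg s1 ''r'' = rr)"
      using bB rrB by (simp add: runs_simps sp_def[symmetric] rr_def)
    show "runs B split_step s' (\<lambda>s'' t'. ?I s'' (t + (cost ?g + 1) + t'))"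
      unfolding split_step_def
    proof (rule runs_SeqF[OF 1])
      fix s1 :: state and t1 :: nat
      assume 1: "t1 = 5 \<and> reg s1 ''r'' = rr" and ag: "agree (''r'' ::= ''stk''.[Reg ''sp'' .- Const 1]) s' s1"
      have r1: "reg s1 ''x'' = x" "reg s1 ''lx'' = arr s ''L'' x" "reg s1 ''rx'' = arr s ''R'' x" "reg s1 ''n'' = n"
        "reg s1 ''r'' = rr" "reg s1 ''l'' = l" "reg s1 ''sp'' = sp" "reg s1 ''nodes'' = N" "arr s1 = arr s'"
        using r 1 by (simp_all add: agree_reg[OF ag] agree_arr[OF ag] fun_eq_iff l_def sp_def N_def)
      have ok1: "search_ok s1"
        by (rule search_ok_cong[OF ok']) (simp_all add: agree_reg[OF ag] agree_arr[OF ag])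
      let ?C = "cuts (arr s ''L'' x) (arr s ''R'' x)"
      have 2: "runs B find_cut s1 (\<lambda>s' t. t \<le> 600 \<and>
        (reg s' ''f'' = 0 \<and> (\<forall>k. l < k \<and> k < rr \<longrightarrow> k \<notin> ?C) \<or>
         l < reg s' ''f'' \<and> reg s' ''f'' < rr \<and> reg s' ''f'' \<in> ?C))"
        by (rule runs_find_cut[OF ok1]) (use r1 top J(12) ab LRx in auto)
      show "runs B (find_cut ;; If (Reg ''f'' .= Const 0) emit push) s1
        (\<lambda>s2 t2. ?I s2 (t + (cost ?g + 1) + (t1 + t2)))"
      proof (rule runs_SeqF[OF 2])
        fix s2 :: state and t2 :: nat
        assume 2: "t2 \<le> 600 \<and> (reg s2 ''f'' = 0 \<and> (\<forall>k. l < k \<and> k < rr \<longrightarrow> k \<notin> ?C) \<or>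
         l < reg s2 ''f'' \<and> reg s2 ''f'' < rr \<and> reg s2 ''f'' \<in> ?C)"
          and ag: "agree find_cut s1 s2"
        have r2: "reg s2 ''x'' = x" "reg s2 ''rx'' = arr s ''R'' x" "reg s2 ''n'' = n"
          "reg s2 ''r'' = rr" "reg s2 ''l'' = l" "reg s2 ''sp'' = sp" "reg s2 ''nodes'' = N" "arr s2 = arr s'"
          using r1 by (simp_all add: agree_reg[OF ag] agree_arr[OF ag] fun_eq_iff)
        have fB: "reg s2 ''f'' < B" using 2 rrB by auto
        have ft: "fits B (Reg ''f'' .= Const 0) s2" using fB bB by simp
        have tb: "t + 4 + (t1 + (t2 + 60)) \<le> t + 1000" using 1 2 by simp
        show "runs B (If (Reg ''f'' .= Const 0) emit push) s2
          (\<lambda>s3 t3. ?I s3 (t + (cost ?g + 1) + (t1 + (t2 + t3))))"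
        proof (cases "reg s2 ''f'' = 0")
          case True
          have none: "\<And>k. l < k \<Longrightarrow> k < arr s' ''stk'' (sp - 1) \<Longrightarrow> k \<notin> cuts (arr s' ''L'' x) (arr s' ''R'' x)"
            using 2 True unfolding LRx rr_def by auto
          note new = inner_emit[OF inn sp0 none, folded rr_def]
          have N3: "N \<le> 3 * n + 4" using cnt N0 Pn P0n by linarith
          have 3: "runs B emit s2 (\<lambda>s3 t3. t3 \<le> 50 \<and> arr s3 ''L'' = (arr s2 ''L'')(N := l) \<and>
            arr s3 ''R'' = (arr s2 ''R'')(N := rr) \<and> arr s3 ''parent'' = (arr s2 ''parent'')(N := x) \<and>
            arr s3 ''lc'' = (arr s2 ''lc'')(x := N) \<and>
            arr s3 ''lch'' = (if rr < arr s ''R'' x then (arr s2 ''lch'')(rr := N) else arr s2 ''lch'') \<and>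
            reg s3 ''nodes'' = Suc N \<and> reg s3 ''l'' = rr \<and> reg s3 ''sp'' = sp - 1)"
            by (rule runs_emit) (use r2 N3 rrB xN ab spn in auto)
          \<comment> \<open>The search of the whole node never fails, so a push precedes the first
            emission.\<close>
          have P1: "?P0 < ?cur"
          proof (rule ccontr)
            assume "\<not> ?P0 < ?cur"
            then have l: "l = arr s ''L'' x" "sp = 1" using fst by simp_all
            then have "rr = arr s ''R'' x" using top(6) LRx by simp
            then have "\<forall>k\<in>?C. False" using 2 True l cuts_sub[OF ab(1)] by auto
            then show False using cuts_ne by blast
          qed
          show ?thesis
          proof (rule runs_IfT[OF ft])
            show "aval (Reg ''f'' .= Const 0) s2 \<noteq> 0" using True by simp
            show "runs B emit s2
              (\<lambda>s3 t3. ?I s3 (t + (cost ?g + 1) + (t1 + (t2 + (cost (Reg ''f'' .= Const 0) + 1 + t3)))))"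
            proof (rule runs_mono[OF runs_agree[OF 3]], elim conjE)
              fix s3 :: state and t3 :: nat
              assume t3: "t3 \<le> 50" and w: "arr s3 ''L'' = (arr s2 ''L'')(N := l)"
                "arr s3 ''R'' = (arr s2 ''R'')(N := rr)" "arr s3 ''parent'' = (arr s2 ''parent'')(N := x)"
                "arr s3 ''lc'' = (arr s2 ''lc'')(x := N)"
                "arr s3 ''lch'' = (if rr < arr s ''R'' x then (arr s2 ''lch'')(rr := N) else arr s2 ''lch'')"
                "reg s3 ''nodes'' = Suc N" "reg s3 ''l'' = rr" "reg s3 ''sp'' = sp - 1"
                and ag: "agree emit s2 s3"
              have k3: "arr s3 ''key'' = arr s' ''key''" "arr s3 ''stk'' = arr s' ''stk''"
                by (simp_all add: agree_arr[OF ag] r2)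
              have inn3: "inner_state x s3" using new unfolding w k3 r2 LRx .
              have xN': "x \<noteq> N" using J(3) by simp
              have c3: "Suc N + (sp - 1) + ?P0 = ?N0 + 1 + ?cur" using cnt sp0 by linarith
              have t3': "t + 4 + (t1 + (t2 + (4 + t3))) + 1000 * ?P0 + 1000 * ?N0 \<le> 1000 * ?cur + 1000 * Suc N"
                using tt tb t3 unfolding mult_Suc_right by linarith
              show "?I s3 (t + (cost ?g + 1) + (t1 + (t2 + (cost (Reg ''f'' .= Const 0) + 1 + t3))))"
                using inn3 LRx xN' c3 P1 t3' unfolding k3 w r2 by simp
            qed
          qed
        next
          case False
          define f where "f = reg s2 ''f''"
          have f: "f \<in> cuts (arr s' ''L'' x) (arr s' ''R'' x)" "l < f" "f < arr s' ''stk'' (sp - 1)"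
            using 2 False unfolding LRx rr_def f_def by auto
          note new = inner_push[OF inn sp0 f]
          have kf: "arr s' ''key'' f = 0" by (rule inner_key_free[OF inn sp0 f(2,3)])
          have fn: "f < n" using f(3) rrB by (simp add: rr_def)
          have kv: "x * n + f \<noteq> 0" using f(2) by simp
          have cu: "cut_count ((arr s' ''key'')(f := x * n + f)) = Suc ?cur" using kf fn kv by (rule cut_count_upd)
          have 3: "runs B push s2 (\<lambda>s3 t3. t3 \<le> 20 \<and> arr s3 ''key'' = (arr s2 ''key'')(f := x * n + f) \<and>
            arr s3 ''stk'' = (arr s2 ''stk'')(sp := f) \<and> reg s3 ''sp'' = Suc sp)"
            by (rule runs_push) (use r2 xN fn spn in \<open>auto simp: f_def\<close>)
          show ?thesis
          proof (rule runs_IfF[OF ft])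
            show "aval (Reg ''f'' .= Const 0) s2 = 0" using False by simp
            show "runs B push s2
              (\<lambda>s3 t3. ?I s3 (t + (cost ?g + 1) + (t1 + (t2 + (cost (Reg ''f'' .= Const 0) + 1 + t3)))))"
            proof (rule runs_mono[OF runs_agree[OF 3]], elim conjE)
              fix s3 :: state and t3 :: nat
              assume t3: "t3 \<le> 20" and w: "arr s3 ''key'' = (arr s2 ''key'')(f := x * n + f)"
                "arr s3 ''stk'' = (arr s2 ''stk'')(sp := f)" "reg s3 ''sp'' = Suc sp"
                and ag: "agree push s2 s3"
              have k3: "arr s3 ''L'' = arr s' ''L''" "arr s3 ''R'' = arr s' ''R''"
                "arr s3 ''parent'' = arr s' ''parent''" "arr s3 ''lc'' = arr s' ''lc''"
                "arr s3 ''lch'' = arr s' ''lch''" "reg s3 ''l'' = l" "reg s3 ''nodes'' = N"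
                by (simp_all add: agree_arr[OF ag] agree_reg[OF ag] r2)
              have inn3: "inner_state x s3" using new unfolding w k3 r2 .
              have c3: "N + Suc sp + ?P0 = ?N0 + 1 + Suc ?cur" using cnt by linarith
              have t3': "t + 4 + (t1 + (t2 + (4 + t3))) + 1000 * ?P0 + 1000 * ?N0 \<le> 1000 * Suc ?cur + 1000 * N"
                using tt tb t3 unfolding mult_Suc_right by linarith
              show "?I s3 (t + (cost ?g + 1) + (t1 + (t2 + (cost (Reg ''f'' .= Const 0) + 1 + t3))))"
                using inn3 LRx c3 P t3' unfolding k3 w r2 cu by simp
            qed
          qed
        qed
      qed
    qed
  qed
qed

lemma runs_node_step:
  assumes ok: "search_ok s" and O: "outer_state x s" and s: "reg s ''x'' = x" "x < reg s ''nodes''"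
    and ord: "arr s ''order'' = list_arr vs"
    and N0: "reg s ''nodes'' \<le> n + 1 + 2 * cut_count (arr s ''key'')"
  shows "runs B node_step s (\<lambda>s' t. outer_state (Suc x) s' \<and> reg s' ''x'' = Suc x \<and>
    reg s' ''nodes'' \<le> n + 1 + 2 * cut_count (arr s' ''key'') \<and>
    t + 1000 * cut_count (arr s ''key'') + 1000 * reg s ''nodes'' \<le>
      1000 * cut_count (arr s' ''key'') + 1000 * reg s' ''nodes'' + 60)" (is "runs B _ s ?Q")
proof -
  define a b where "a = arr s ''L'' x" and "b = arr s ''R'' x"
  let ?P0 = "cut_count (arr s ''key'')"
  let ?N0 = "reg s ''nodes''"
  have tree: "tree_ok ?N0 (arr s ''parent'') (arr s ''L'') (arr s ''R'')" and nx: "n \<le> x"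
    using O unfolding outer_ok_def by blast+
  have ab: "a < b" "b \<le> n" using tree_okD(4)[OF tree nx s(2)] by (auto simp: a_def b_def)
  have xN: "x \<le> 3 * n + 1" using s(2) N0 cut_count_le[of "arr s ''key''"] by linarith
  have bB: "x < B" "Suc x < B" "a < B" "b < B" "Suc a < B" "Suc 0 < B" "0 < B" using xN ab B by auto
  let ?p1 = "''lx'' ::= ''L''.[Reg ''x''] ;; ''rx'' ::= ''R''.[Reg ''x'']"
  let ?leaf = "''f'' ::= ''order''.[Reg ''lx''] ;; ''parent''.[Reg ''f''] \<leftarrow> Reg ''x'' ;; ''lc''.[Reg ''x''] \<leftarrow> Reg ''f''"
  let ?p2 = "''l'' ::= Reg ''lx'' ;; ''stk''.[Const 0] \<leftarrow> Reg ''rx'' ;; ''sp'' ::= Const 1"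
  let ?g = "Reg ''lx'' .+ Const 1 .= Reg ''rx''"
  let ?R = "\<lambda>s' t. outer_state (Suc x) s' \<and>
    reg s' ''nodes'' \<le> n + 1 + 2 * cut_count (arr s' ''key'') \<and>
    t + 1000 * ?P0 + 1000 * ?N0 \<le> 1000 * cut_count (arr s' ''key'') + 1000 * reg s' ''nodes'' + 40"
  have 1: "runs B ?p1 s (\<lambda>s1 t1. t1 = 6 \<and> reg s1 ''lx'' = a \<and> reg s1 ''rx'' = b)"
    using bB by (simp add: runs_simps s a_def b_def)
  show ?thesis unfolding node_step_def
  proof (rule runs_SeqF[OF 1])
    fix s1 :: state and t1 :: nat
    assume 1: "t1 = 6 \<and> reg s1 ''lx'' = a \<and> reg s1 ''rx'' = b" and ag: "agree ?p1 s s1"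
    have r1: "reg s1 ''x'' = x" "reg s1 ''nodes'' = ?N0" "reg s1 ''lx'' = a" "reg s1 ''rx'' = b" "arr s1 = arr s"
      using s 1 by (simp_all add: agree_reg[OF ag] agree_arr[OF ag] fun_eq_iff)
    have ok1: "search_ok s1"
      by (rule search_ok_cong[OF ok]) (simp_all add: agree_reg[OF ag] agree_arr[OF ag])
    have ft: "fits B ?g s1" using bB by (simp add: r1)
    have 2: "runs B (If ?g ?leaf (?p2 ;; split_loop)) s1 ?R"
    proof (cases "Suc a = b")
      case True
      have a: "a < n" "list_arr vs a = vs ! a" "vs ! a < n"
        using True ab n vs_less by (auto simp: list_arr_def)
      have out: "outer_ok (Suc x) ?N0 ((arr s ''parent'')(vs ! a := x)) (arr s ''L'') (arr s ''R'') (arr s ''key'')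
        ((arr s ''lc'')(x := vs ! a)) (arr s ''lch'')"
        unfolding a_def by (rule outer_leaf[OF O s(2)]) (use True in \<open>simp add: a_def b_def\<close>)
      have vB: "vs ! a < B" using a B by simp
      show ?thesis
      proof (rule runs_IfT[OF ft])
        show "aval ?g s1 \<noteq> 0" using True by (simp add: r1)
        have "runs B ?leaf s1 (\<lambda>s2 t2. t2 \<le> 20 \<and> arr s2 ''parent'' = (arr s ''parent'')(vs ! a := x) \<and>
          arr s2 ''lc'' = (arr s ''lc'')(x := vs ! a))"
          using bB vB by (simp add: runs_simps r1 ord a(2))
        from runs_agree[OF this]
        show "runs B ?leaf s1 (\<lambda>s2 t2. ?R s2 (cost ?g + 1 + t2))"
        proof (rule runs_mono, elim conjE)
          fix s2 :: state and t2 :: nat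
          assume t2: "t2 \<le> 20" and w: "arr s2 ''parent'' = (arr s ''parent'')(vs ! a := x)"
            "arr s2 ''lc'' = (arr s ''lc'')(x := vs ! a)" and ag: "agree ?leaf s1 s2"
          have r2: "arr s2 ''L'' = arr s ''L''" "arr s2 ''R'' = arr s ''R''" "arr s2 ''key'' = arr s ''key''"
            "arr s2 ''lch'' = arr s ''lch''" "reg s2 ''nodes'' = ?N0"
            by (simp_all add: agree_reg[OF ag] agree_arr[OF ag] r1)
          show "?R s2 (cost ?g + 1 + t2)" unfolding w r2 using out N0 t2 by simp
        qed
      qed
    next
      case False
      then have wide: "Suc a < b" using ab by simp
      show ?thesis
      proof (rule runs_IfF[OF ft])
        show "aval ?g s1 = 0" using False by (simp add: r1)
        have 2: "runs B ?p2 s1 (\<lambda>s2 t2. t2 = 7 \<and> reg s2 ''l'' = a \<and> reg s2 ''sp'' = 1 \<and> arr s2 ''stk'' 0 = b)"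
          using bB by (simp add: runs_simps r1)
        show "runs B (?p2 ;; split_loop) s1 (\<lambda>s2 t2. ?R s2 (cost ?g + 1 + t2))"
        proof (rule runs_SeqF[OF 2])
          fix s2 :: state and t2 :: nat
          assume 2: "t2 = 7 \<and> reg s2 ''l'' = a \<and> reg s2 ''sp'' = 1 \<and> arr s2 ''stk'' 0 = b" and ag: "agree ?p2 s1 s2"
          have r2: "reg s2 ''x'' = x" "reg s2 ''lx'' = a" "reg s2 ''rx'' = b" "reg s2 ''nodes'' = ?N0"
            "arr s2 ''L'' = arr s ''L''" "arr s2 ''R'' = arr s ''R''" "arr s2 ''key'' = arr s ''key''"
            "arr s2 ''lch'' = arr s ''lch''" "arr s2 ''lc'' = arr s ''lc''" "arr s2 ''parent'' = arr s ''parent''"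
            "reg s2 ''l'' = a" "reg s2 ''sp'' = 1"
            using 2 by (simp_all add: agree_reg[OF ag] agree_arr[OF ag] r1)
          have ok2: "search_ok s2"
            by (rule search_ok_cong[OF ok1]) (simp_all add: agree_reg[OF ag] agree_arr[OF ag])
          have inn: "inner_state x s2"
            unfolding r2 a_def by (rule inner_start[OF O s(2)]) (use wide 2 in \<open>simp_all add: a_def b_def\<close>)
          show "runs B split_loop s2 (\<lambda>s3 t3. ?R s3 (cost ?g + 1 + (t2 + t3)))"
          proof (rule runs_mono[OF runs_split_loop[OF ok2 inn r2(1)]])
            show "reg s2 ''lx'' = arr s2 ''L'' x" "reg s2 ''rx'' = arr s2 ''R'' x" "reg s2 ''sp'' = 1"
              "reg s2 ''l'' = arr s2 ''L'' x" "reg s2 ''nodes'' \<le> n + 1 + 2 * cut_count (arr s2 ''key'')"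
              using N0 by (simp_all add: r2 a_def b_def)
            fix s3 :: state and t3 :: nat
            assume "outer_state (Suc x) s3 \<and>
              reg s3 ''nodes'' \<le> n + 1 + 2 * cut_count (arr s3 ''key'') \<and>
              t3 + 1000 * cut_count (arr s2 ''key'') + 1000 * reg s2 ''nodes'' \<le>
                1000 * cut_count (arr s3 ''key'') + 1000 * reg s3 ''nodes'' + 10"
            then show "?R s3 (cost ?g + 1 + (t2 + t3))" using 2 unfolding r2 by simp
          qed
        qed
      qed
    qed
    show "runs B (If ?g ?leaf (?p2 ;; split_loop) ;; ''x'' ::= Reg ''x'' .+ Const 1) s1
      (\<lambda>s2 t2. ?Q s2 (t1 + t2))"
    proof (rule runs_SeqF[OF 2])
      fix s2 :: state and t2 :: nat
      assume 2: "?R s2 t2" and ag: "agree (If ?g ?leaf (?p2 ;; split_loop)) s1 s2"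
      have x2: "reg s2 ''x'' = x" by (simp add: agree_reg[OF ag] r1)
      show "runs B (''x'' ::= Reg ''x'' .+ Const 1) s2 (\<lambda>s3 t3. ?Q s3 (t1 + (t2 + t3)))"
        using 1 2 bB by (simp add: runs_simps x2)
    qed
  qed
qed

text \<open>The allowance of 1000 per cut and per node pays for the splitting, 64 per node for the
  outer loop; with at most \<open>n\<close> cuts and \<open>3 * n + 1\<close> nodes the total is
  linear.\<close>

lemma runs_node_loop:
  assumes ok: "search_ok s" and s: "reg s ''x'' = n" "reg s ''nodes'' = Suc n" "arr s ''order'' = list_arr vs"
    "arr s ''L'' n = 0" "arr s ''R'' n = n" "\<And>k. arr s ''key'' k = 0"
  shows "runs B node_loop s (\<lambda>s' t. t \<le> 5000 * n + 5000 \<and> outer_state (reg s' ''nodes'') s' \<and>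
    reg s' ''nodes'' \<le> 3 * n + 1)" (is "runs B _ s ?Q")
  unfolding node_loop_def
proof -
  let ?g = "Reg ''x'' .< Reg ''nodes''"
  let ?I = "\<lambda>s' t. outer_state (reg s' ''x'') s' \<and>
    reg s' ''nodes'' \<le> n + 1 + 2 * cut_count (arr s' ''key'') \<and>
    t + 64 * n + 1000 * n \<le> 1000 * cut_count (arr s' ''key'') + 1000 * reg s' ''nodes'' + 64 * reg s' ''x''"
  have x_le: "reg s' ''x'' \<le> reg s' ''nodes''" if "outer_state (reg s' ''x'') s'" for s'
    using that unfolding outer_ok_def by blast
  show "runs B (While ?g node_step) s ?Q"
  proof (rule runs_While[where I = ?I and T = "5000 * n + 4000"])
    show "?I s 0" using s outer_init by simp
    fix s' :: state and t :: nat
    assume I: "?I s' t"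
    have bd: "reg s' ''nodes'' \<le> 3 * n + 1" "reg s' ''x'' \<le> reg s' ''nodes''" "cut_count (arr s' ''key'') \<le> n"
      "reg s' ''nodes'' \<le> n + 1 + 2 * cut_count (arr s' ''key'')"
      using I x_le cut_count_le[of "arr s' ''key''"] by auto
    show T: "t \<le> 5000 * n + 4000" using I bd by linarith
    assume ag: "agree node_step s s'"
    have ok': "search_ok s'"
      by (rule search_ok_cong[OF ok]) (simp_all add: agree_reg[OF ag] agree_arr[OF ag])
    have ord: "arr s' ''order'' = list_arr vs" using s by (simp add: agree_arr[OF ag])
    show "fits B ?g s'" using bd B by simp
    show "?Q s' (t + (cost ?g + 1))" if "aval ?g s' = 0"
    proof -
      have "reg s' ''x'' = reg s' ''nodes''" using that bd by (simp split: if_splits)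
      then show ?thesis using I T bd by simp
    qed
    assume "aval ?g s' \<noteq> 0"
    then have x: "reg s' ''x'' < reg s' ''nodes''" by (simp split: if_splits)
    have O: "outer_state (reg s' ''x'') s'" using I by blast
    show "runs B node_step s' (\<lambda>s'' t'. ?I s'' (t + (cost ?g + 1) + t'))"
    proof (rule runs_mono[OF runs_node_step[OF ok' O refl x ord bd(4)]], elim conjE)
      fix s1 :: state and t1 :: nat
      assume o1: "outer_state (Suc (reg s' ''x'')) s1" and x1: "reg s1 ''x'' = Suc (reg s' ''x'')"
        and N1: "reg s1 ''nodes'' \<le> n + 1 + 2 * cut_count (arr s1 ''key'')"
        and t1: "t1 + 1000 * cut_count (arr s' ''key'') + 1000 * reg s' ''nodes'' \<le>
          1000 * cut_count (arr s1 ''key'') + 1000 * reg s1 ''nodes'' + 60"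
      have "t + 64 * n + 1000 * n \<le> 1000 * cut_count (arr s' ''key'') + 1000 * reg s' ''nodes'' + 64 * reg s' ''x''"
        using I by blast
      then have "t + 4 + t1 + 64 * n + 1000 * n \<le>
        1000 * cut_count (arr s1 ''key'') + 1000 * reg s1 ''nodes'' + 64 * Suc (reg s' ''x'')"
        using t1 unfolding mult_Suc_right by linarith
      then show "?I s1 (t + (cost ?g + 1) + t1)" unfolding x1 using o1 N1 by simp
    qed
  qed
qed

section \<open>Locating the edges\<close>

definition final_ok :: "nat \<Rightarrow> (nat \<Rightarrow> nat) \<Rightarrow> (nat \<Rightarrow> nat) \<Rightarrow> (nat \<Rightarrow> nat) \<Rightarrow> (nat \<Rightarrow> nat) \<Rightarrow>
    (nat \<Rightarrow> nat) \<Rightarrow> (nat \<Rightarrow> nat) \<Rightarrow> bool" where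
  "final_ok N pr L R key lc lch \<longleftrightarrow> outer_ok N N pr L R key lc lch"

lemma final_tree: "final_ok N pr L R key lc lch \<Longrightarrow> interval_tree n N vs pos pr L R cuts"
  unfolding final_ok_def by (rule outer_final)

lemma final_done: "final_ok N pr L R key lc lch \<Longrightarrow> n \<le> w \<Longrightarrow> w < N \<Longrightarrow> done_ok N pr L R key lc lch w"
  unfolding final_ok_def outer_ok_def by blast

lemma final_tree_ok: "final_ok N pr L R key lc lch \<Longrightarrow> tree_ok N pr L R"
  unfolding final_ok_def outer_ok_def by blast

text \<open>Climb from \<open>y\<close> to the child of \<open>w\<close> above it: intervals only
  grow on the way, and a child contains no cut of its parent in its interior.\<close>

lemma no_outer_cut:
  assumes t: "tree_ok N pr L R" and w: "n \<le> w" "w < y" "y < N" "L w \<le> L y" "R y \<le> R w"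
    and k: "k \<in> cuts (L w) (R w)"
  shows "\<not> (L y < k \<and> k < R y)"
  using w(2-)
proof (induction y rule: less_induct)
  case (less y)
  note D = tree_okD[OF t]
  have ny: "n < y" using w(1) less.prems by simp
  note P = tree_ok_parent[OF t ny less.prems(2)]
  have p: "n \<le> pr y" "pr y < y" "segment cuts (L (pr y)) (R (pr y)) (L y) (R y)"
    using D(5)[OF ny less.prems(2)] by auto
  have Ly: "L y < R y" using D(4)[of y] ny less.prems by simp
  have sub: "L w \<le> L (pr y)" "R (pr y) \<le> R w"
    using D(6)[OF w(1) less.prems(1,2)] less.prems Ly by auto
  show ?case
  proof (cases "pr y = w")
    case True
    then show ?thesis using p(3) k segment_inside by blast
  next
    case False
    \<comment> \<open>If the parent were older than \<open>w\<close>, it would contain the parent of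
      \<open>w\<close> although it lies inside \<open>w\<close>.\<close>
    have "w < pr y"
    proof (rule ccontr)
      assume "\<not> w < pr y"
      then have lt: "pr y < w" using False by simp
      then have nw: "n < w" "w < N" using p(1) less.prems by auto
      have "L (pr y) \<le> L (pr w)" "R (pr w) \<le> R (pr y)"
        using D(6)[OF p(1) lt nw(2)] sub Ly P by auto
      then show False using tree_ok_parent[OF t nw] sub D(4)[of w] nw by linarith
    qed
    then have "\<not> (L (pr y) < k \<and> k < R (pr y))"
      using less.IH[OF p(2)] sub p(2) less.prems(2) by simp
    then show ?thesis using P by auto
  qed
qed

text \<open>The node separating positions \<open>k - 1\<close> and \<open>k\<close> has a child
  starting at \<open>k\<close>, so \<open>k\<close> is one of its cuts.\<close>

lemma key_total:
  assumes f: "final_ok N pr L R key lc lch" and k: "0 < k" "k < n"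
  shows "\<exists>w. n \<le> w \<and> w < N \<and> Suc (L w) < R w \<and> k \<in> cuts (L w) (R w) \<and> key k = w * n + k"
proof -
  interpret T: interval_tree n N vs pos pr L R cuts by (rule final_tree[OF f])
  have k1: "k - 1 < n" "k - 1 \<noteq> k" using k by auto
  obtain z u v where "T.meets z (k - 1) k u v" using T.ex_meets[OF k1(1) k(2) k1(2)] by blast
  then obtain y y' where y: "T.child z (k - 1) y" "T.child z k y'" "y \<noteq> y'" "T.child y' k v"
    unfolding T.meets_def by blast
  note cz = T.child_covers[OF y(1) k1(1)] T.child_covers[OF y(2) k(2)]
  have ny: "n < y'" using T.child_not_n[OF y(2,4) k(2)] .
  then have y': "y' < N" "pr y' = z" "L y' \<le> k" "k < R y'"
    using y(2) unfolding T.child_def T.covers_def by auto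
  have "L y' = k"
  proof (rule ccontr)
    assume "L y' \<noteq> k"
    then have "T.child z (k - 1) y'" using y' ny y(2) unfolding T.child_def T.covers_def by auto
    then show False using T.child_unique[OF y(1)] y(3) k1(1) by blast
  qed
  moreover have wide: "Suc (L z) < R z" and "segment cuts (L z) (R z) (L y') (R y')"
    using T.pr[OF ny y'(1)] y'(2) by auto
  ultimately have "k \<in> points cuts (L z) (R z)" by (simp add: segment_def)
  then have kz: "k \<in> cuts (L z) (R z)" using cz k by (auto simp: points_def)
  then have "key k = z * n + k"
    using done_ok_cut(1)[OF final_tree_ok[OF f] cz(1,2) wide final_done[OF f cz(1,2)]] by blast
  then show ?thesis using cz wide kz by blast
qed

text \<open>A node older than \<open>y\<close> that cuts inside \<open>y\<close> would meet
  \<open>y\<close> and hence contain it, and then \<open>no_outer_cut\<close> forbids the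
  cut.\<close>

lemma key_ge:
  assumes f: "final_ok N pr L R key lc lch" and y: "n \<le> y" "y < N" and k: "L y < k" "k < R y"
  shows "\<exists>w. y \<le> w \<and> w < N \<and> k \<in> cuts (L w) (R w) \<and> key k = w * n + k"
proof -
  note t = final_tree_ok[OF f]
  note D = tree_okD[OF t]
  have kn: "0 < k" "k < n" using k D(4)[OF y] by auto
  obtain w where w: "n \<le> w" "w < N" "Suc (L w) < R w" "k \<in> cuts (L w) (R w)" "key k = w * n + k"
    using key_total[OF f kn] by blast
  have kw: "L w < k" "k < R w" using cuts_sub[OF w(3)] w(4) by auto
  have "\<not> w < y"
  proof
    assume wy: "w < y"
    then have ny: "n < y" using w(1) by simp
    have "L w \<le> L (pr y)" "R (pr y) \<le> R w" using D(6)[OF w(1) wy y(2)] kw k by auto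
    then have "L w \<le> L y" "R y \<le> R w" using tree_ok_parent[OF t ny y(2)] by auto
    then show False using no_outer_cut[OF t w(1) wy y(2) _ _ w(4)] k by blast
  qed
  then show ?thesis using w by (intro exI[of _ w]) auto
qed

text \<open>Keys compare lexicographically as long as positions are smaller than
  \<open>n\<close>.\<close>

lemma key_le_cases:
  assumes "v * n + k \<le> y * n + r" "y \<le> v" "r < n"
  shows "v = y" "k \<le> r"
proof -
  show v: "v = y"
  proof (rule ccontr)
    assume "v \<noteq> y"
    then have "Suc y \<le> v" using assms(2) by simp
    then have "Suc y * n \<le> v * n" by (rule mult_le_mono1)
    then show False using assms by simp
  qed
  then show "k \<le> r" using assms(1) by simp
qed

text \<open>Keys order the cuts first by the node making them and then by position, so a minimal key
  beyond \<open>p\<close> belongs to the next cut of \<open>y\<close> if there is one.\<close>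

lemma descend_child:
  assumes f: "final_ok N pr L R key lc lch" and y: "n \<le> y" "y < N" and p: "L y \<le> p" "p < R y"
    and q: "Suc p < R y \<Longrightarrow> argmin_on key (Suc p) (R y) q"
  shows "interval_tree.child n N vs pr L R y p
    (if Suc p < R y \<and> key q div n = y then lch q else lc y)" (is "interval_tree.child n N vs pr L R y p ?c")
proof -
  interpret T: interval_tree n N vs pos pr L R cuts by (rule final_tree[OF f])
  note t = final_tree_ok[OF f]
  note D = tree_okD[OF t]
  note d = final_done[OF f y]
  have Ry: "R y \<le> n" using D(4)[OF y] by simp
  show ?thesis
  proof (cases "Suc (L y) < R y")
    case False
    then have e: "L y = p" "R y = Suc (L y)" using p by auto
    then have c: "lc y = vs ! p" "pr (vs ! p) = y" using d unfolding done_ok_def by auto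
    have "p < n" using p Ry by simp
    then have "T.child y p (vs ! p)" using c vs_less[of p] D(1) unfolding T.child_def T.covers_def by simp
    then show ?thesis using e c by simp
  next
    case wide: True
    obtain l r where lr: "segment cuts (L y) (R y) l r" "l \<le> p" "p < r"
      using segment_cover[of "L y" p "R y" cuts] p cuts_sub[OF wide] by blast
    obtain c where c: "n < c" "c < N" "pr c = y" "L c = l" "R c = r"
      "if r < R y then lch r = c else lc y = c"
      using d wide lr(1) unfolding done_ok_def by blast
    have ch: "T.child y p c" using c lr unfolding T.child_def T.covers_def by simp
    have rR: "r \<le> R y" using cuts_segment(2)[OF lr(1) wide] .
    have "?c = c"
    proof (cases "r < R y")
      case True
      then have pr: "Suc p < R y" using lr(3) by simp
      note am = q[OF pr]
      have rC: "r \<in> cuts (L y) (R y)"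
        using lr(1) True cuts_segment(1)[OF lr(1) wide] by (auto simp: segment_def points_def)
      note kr = done_ok_cut[OF t y wide d rC]
      have q': "p < q" "q < R y" "key q \<le> key r" using am lr(3) True by (auto simp: argmin_on_def)
      \<comment> \<open>All keys in the range belong to \<open>y\<close> or to later nodes, and
        \<open>r\<close> has a key of \<open>y\<close>. So the minimal key belongs to
        \<open>y\<close> and to a position \<open>q \<le> r\<close>, and the first cut of
        \<open>y\<close> beyond \<open>p\<close> is \<open>r\<close>.\<close>
      obtain w where w: "y \<le> w" "q \<in> cuts (L w) (R w)" "key q = w * n + q"
        using key_ge[OF f y, of q] q' p by auto
      have wy: "w = y" and qr: "q \<le> r"
        using key_le_cases[of w q y r] q'(3) w kr by auto
      have "\<not> q < r" using segment_inside[OF lr(1), of q] w(2) wy q'(1) lr(2) by auto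
      then have "q = r" using qr by linarith
      then show ?thesis using pr kr(5) c(6) True by simp
    next
      case False
      then have r: "r = R y" using rR by simp
      \<comment> \<open>Here \<open>p\<close> lies in the last child, beyond all cuts of
        \<open>y\<close>; the minimal key has another owner, and \<open>lc y\<close> is
        chosen.\<close>
      have "key q div n \<noteq> y" if pr: "Suc p < R y"
      proof
        assume a: "key q div n = y"
        have q': "p < q" "q < R y" using q[OF pr] by (auto simp: argmin_on_def)
        obtain w where w: "y \<le> w" "q \<in> cuts (L w) (R w)" "key q = w * n + q"
          using key_ge[OF f y, of q] q' p by auto
        have "0 < q" "q < n" using q' Ry by auto
        then have "w = y" using a w(3) key_split by simp
        then show False using segment_inside[OF lr(1), of q] w(2) q' lr(2) r by auto
      qed
      then show ?thesis using c(6) False by auto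
    qed
    then show ?thesis using ch by simp
  qed
qed

text \<open>Let \<open>z\<close> separate \<open>p\<close> and \<open>p'\<close>. The right end of
  its child over \<open>p\<close> is a cut of \<open>z\<close> in the range, and no older node cuts
  there, so the minimal key is one of \<open>z\<close>.\<close>

lemma separating_node:
  assumes f: "final_ok N pr L R key lc lch" and p: "p < p'" "p' < n"
    and q: "argmin_on key (Suc p) (Suc p') q"
  shows "\<exists>y y'. interval_tree.child n N vs pr L R (key q div n) p y \<and>
    interval_tree.child n N vs pr L R (key q div n) p' y' \<and> y \<noteq> y'"
proof -
  interpret T: interval_tree n N vs pos pr L R cuts by (rule final_tree[OF f])
  note t = final_tree_ok[OF f]
  have pn: "p < n" "p \<noteq> p'" using p by auto
  obtain z u v where "T.meets z p p' u v" using T.ex_meets[OF pn(1) p(2) pn(2)] by blast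
  then obtain y y' where y: "T.child z p y" "T.child z p' y'" "y \<noteq> y'" "T.child y p u"
    unfolding T.meets_def by blast
  note cz = T.child_covers[OF y(1) pn(1)] T.child_covers[OF y(2) p(2)]
  have ny: "n < y" using T.child_not_n[OF y(1,4) pn(1)] .
  then have y1: "y < N" "pr y = z" "L y \<le> p" "p < R y"
    using y(1) unfolding T.child_def T.covers_def by auto
  have wide: "Suc (L z) < R z" and seg: "segment cuts (L z) (R z) (L y) (R y)"
    using T.pr[OF ny y1(1)] y1(2) by auto
  define k where "k = R y"
  have kp: "k \<le> p'"
  proof (rule ccontr)
    assume "\<not> k \<le> p'"
    then have "T.child z p' y" using y1 ny p(1) unfolding T.child_def T.covers_def k_def by auto
    then show False using T.child_unique[OF y(2)] y(3) p(2) by blast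
  qed
  have "k \<in> points cuts (L z) (R z)" using seg by (simp add: segment_def k_def)
  then have kC: "k \<in> cuts (L z) (R z)" using cz kp y1 by (auto simp: points_def k_def)
  note kk = done_ok_cut[OF t cz(1,2) wide final_done[OF f cz(1,2)] kC]
  have q': "p < q" "q \<le> p'" "key q \<le> key k" using q y1(4) kp by (auto simp: argmin_on_def k_def)
  obtain w where w: "z \<le> w" "key q = w * n + q"
    using key_ge[OF f cz(1,2), of q] q' cz by auto
  have "w = z" using key_le_cases(1)[of w q z k] q'(3) w kk by simp
  moreover have "0 < q" "q < n" using q' p by auto
  ultimately have "key q div n = z" using w key_split by simp
  then show ?thesis using y by blast
qed

section \<open>Locating one edge in constant time\<close>

definition descend :: com where
  "descend =
     (''ql'' ::= Reg ''dp'' .+ Const 1 ;; ''qr'' ::= ''R''.[Reg ''dy''] .- Const 1) ;;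
     If (Reg ''ql'' .< ''R''.[Reg ''dy''])
       (rmq_query ''key'' ''keym'' ''keys'' ;;
        If (''key''.[Reg ''qi''] .div Reg ''n'' .= Reg ''dy'')
          (''dc'' ::= ''lch''.[Reg ''qi'']) (''dc'' ::= ''lc''.[Reg ''dy'']))
       (''dc'' ::= ''lc''.[Reg ''dy''])"

lemma descend_writes [simp]:
  "wregs descend = {''ql'', ''qr'', ''kl'', ''kr'', ''qj'', ''qc'', ''qi'', ''dc''}" "warrs descend = {}"
  by (auto simp: descend_def)

definition locate_ok :: "nat \<Rightarrow> state \<Rightarrow> bool" where
  "locate_ok N s \<longleftrightarrow> tables_ok n s \<and> rmq_ok n ''key'' ''keym'' ''keys'' s \<and> N \<le> 3 * n + 1 \<and>
     final_ok N (arr s ''parent'') (arr s ''L'') (arr s ''R'') (arr s ''key'') (arr s ''lc'') (arr s ''lch'')"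

lemma locate_ok_cong:
  assumes "locate_ok N s" "reg s' ''n'' = reg s ''n''" "reg s' ''b'' = reg s ''b''" "reg s' ''K'' = reg s ''K''"
    "arr s' ''pw'' = arr s ''pw''" "arr s' ''lb'' = arr s ''lb''" "arr s' ''len'' = arr s ''len''"
    "arr s' ''key'' = arr s ''key''" "arr s' ''keym'' = arr s ''keym''" "arr s' ''keys'' = arr s ''keys''"
    "arr s' ''parent'' = arr s ''parent''" "arr s' ''L'' = arr s ''L''" "arr s' ''R'' = arr s ''R''"
    "arr s' ''lc'' = arr s ''lc''" "arr s' ''lch'' = arr s ''lch''"
  shows "locate_ok N s'"
  using assms(1) unfolding locate_ok_def tables_ok_def rmq_ok_def assms(2-) .

lemma final_key_less:
  assumes f: "final_ok N pr L R key lc lch" and N: "N \<le> 3 * n + 1" and k: "k < n"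
  shows "key k < B"
proof (cases "key k = 0")
  case True
  then show ?thesis using B by simp
next
  case False
  have "keys_ok N L R key" using f unfolding final_ok_def outer_ok_def by blast
  then obtain w where "w < N" "key k = w * n + k" using False unfolding keys_ok_def by blast
  then show ?thesis using key_less[of w k] N k by simp
qed

abbreviation child_in :: "nat \<Rightarrow> state \<Rightarrow> nat \<Rightarrow> nat \<Rightarrow> nat \<Rightarrow> bool" where
  "child_in N s \<equiv> interval_tree.child n N vs (arr s ''parent'') (arr s ''L'') (arr s ''R'')"

text \<open>The test \<open>Suc p < R y\<close> avoids a query on an empty range; the last position
  of \<open>y\<close> always belongs to its last child.\<close>

lemma runs_descend:
  assumes ok: "locate_ok N s" and s: "reg s ''dy'' = y" "reg s ''dp'' = p" "n \<le> y" "y < N"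
    "arr s ''L'' y \<le> p" "p < arr s ''R'' y"
  shows "runs B descend s (\<lambda>s' t. t \<le> 250 \<and> child_in N s y p (reg s' ''dc''))" (is "runs B _ s ?Q")
proof -
  let ?key = "arr s ''key''" and ?lch = "arr s ''lch''" and ?lc = "arr s ''lc''"
  define r where "r = arr s ''R'' y"
  have f: "final_ok N (arr s ''parent'') (arr s ''L'') (arr s ''R'') ?key ?lc ?lch"
    and N: "N \<le> 3 * n + 1" and tab: "tables_ok n s" and rmq: "rmq_ok n ''key'' ''keym'' ''keys'' s"
    using ok unfolding locate_ok_def by blast+
  interpret T: interval_tree n N vs pos "arr s ''parent''" "arr s ''L''" "arr s ''R''" cuts
    by (rule final_tree[OF f])
  note D = tree_okD[OF final_tree_ok[OF f]]
  have rn: "r \<le> n" using D(4)[OF s(3,4)] by (simp add: r_def)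
  have pr: "p < r" using s by (simp add: r_def)
  have nr: "reg s ''n'' = n" using tab by (simp add: tables_ok_def)
  note desc = descend_child[OF f s(3-6), folded r_def]
  have less: "c < N" if "T.child y p c" for c using that by (simp add: T.child_def)
  have bB: "y < B" "p < B" "Suc p < B" "r < B" "Suc 0 < B" "0 < B" "r - Suc 0 < B" "n < B" "N < B"
    using s N rn pr B by auto
  have Bn: "64 * n + 64 \<le> B" using B by simp
  let ?p1 = "''ql'' ::= Reg ''dp'' .+ Const 1 ;; ''qr'' ::= ''R''.[Reg ''dy''] .- Const 1"
  let ?g = "Reg ''ql'' .< ''R''.[Reg ''dy'']"
  let ?h = "''key''.[Reg ''qi''] .div Reg ''n'' .= Reg ''dy''"
  have 1: "runs B ?p1 s (\<lambda>s1 t1. t1 \<le> 10 \<and> reg s1 ''ql'' = Suc p \<and> reg s1 ''qr'' = r - 1)"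
    using bB by (simp add: runs_simps s r_def[symmetric])
  show ?thesis unfolding descend_def
  proof (rule runs_SeqF[OF 1])
    fix s1 :: state and t1 :: nat
    assume 1: "t1 \<le> 10 \<and> reg s1 ''ql'' = Suc p \<and> reg s1 ''qr'' = r - 1" and ag: "agree ?p1 s s1"
    have r1: "reg s1 ''dy'' = y" "reg s1 ''n'' = n" "reg s1 ''ql'' = Suc p" "reg s1 ''qr'' = r - 1"
      "reg s1 ''b'' = reg s ''b''" "reg s1 ''K'' = reg s ''K''" "arr s1 = arr s"
      using s nr 1 by (simp_all add: agree_reg[OF ag] agree_arr[OF ag] fun_eq_iff)
    have ok1: "tables_ok n s1" "rmq_ok n ''key'' ''keym'' ''keys'' s1"
      using tab rmq nr by (simp_all add: tables_ok_def rmq_ok_def r1)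
    have ft: "fits B ?g s1" using bB by (simp add: r1 r_def[symmetric])
    show "runs B (If ?g (rmq_query ''key'' ''keym'' ''keys'' ;;
        If ?h (''dc'' ::= ''lch''.[Reg ''qi'']) (''dc'' ::= ''lc''.[Reg ''dy'']))
       (''dc'' ::= ''lc''.[Reg ''dy''])) s1 (\<lambda>s2 t2. ?Q s2 (t1 + t2))"
    proof (cases "Suc p < r")
      case False
      have c: "T.child y p (?lc y)" using desc[of 0] False by simp
      have cB: "?lc y < B" using less[OF c] bB by simp
      show ?thesis
      proof (rule runs_IfF[OF ft])
        show "aval ?g s1 = 0" using False by (simp add: r1 r_def[symmetric])
        show "runs B (''dc'' ::= ''lc''.[Reg ''dy'']) s1 (\<lambda>s' t. ?Q s' (t1 + (cost ?g + 1 + t)))"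
          using c cB bB 1 by (simp add: runs_simps r1)
      qed
    next
      case True
      have 2: "runs B (rmq_query ''key'' ''keym'' ''keys'') s1 (\<lambda>s' t. t \<le> 200 \<and>
        argmin_on (arr s1 ''key'') (Suc p) (Suc (r - 1)) (reg s' ''qi''))"
      proof (rule runs_rmq_query[OF Bn _ ok1 r1(3,4)])
        show "arr s1 ''key'' x < B" if "x < n" for x using final_key_less[OF f N that] by (simp add: r1)
      qed (use True rn in auto)
      show ?thesis
      proof (rule runs_IfT[OF ft])
        show "aval ?g s1 \<noteq> 0" using True by (simp add: r1 r_def[symmetric])
        show "runs B (rmq_query ''key'' ''keym'' ''keys'' ;;
          If ?h (''dc'' ::= ''lch''.[Reg ''qi'']) (''dc'' ::= ''lc''.[Reg ''dy''])) s1
          (\<lambda>s' t. ?Q s' (t1 + (cost ?g + 1 + t)))"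
        proof (rule runs_SeqF[OF 2])
          fix s2 :: state and t2 :: nat
          assume 2: "t2 \<le> 200 \<and> argmin_on (arr s1 ''key'') (Suc p) (Suc (r - 1)) (reg s2 ''qi'')"
            and ag: "agree (rmq_query ''key'' ''keym'' ''keys'') s1 s2"
          have r2: "reg s2 ''dy'' = y" "reg s2 ''n'' = n" "arr s2 = arr s"
            by (simp_all add: agree_reg[OF ag] agree_arr[OF ag] fun_eq_iff r1)
          define q where "q = reg s2 ''qi''"
          have am: "argmin_on ?key (Suc p) r q" using 2 True by (simp add: r1 q_def)
          have qn: "q < n" using am rn by (simp add: argmin_on_def)
          have c: "T.child y p (if ?key q div n = y then ?lch q else ?lc y)"
            using desc[of q] am True by simp
          have kB: "?key q < B" "q < B" using final_key_less[OF f N qn] qn bB by auto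
          have kd: "?key q div n < B" using div_le_dividend kB(1) by (rule le_less_trans)
          have ft: "fits B ?h s2" using kB kd bB by (simp add: r2 q_def[symmetric])
          show "runs B (If ?h (''dc'' ::= ''lch''.[Reg ''qi'']) (''dc'' ::= ''lc''.[Reg ''dy''])) s2
            (\<lambda>s3 t3. ?Q s3 (t1 + (cost ?g + 1 + (t2 + t3))))"
          proof (cases "?key q div n = y")
            case eq: True
            then have c: "T.child y p (?lch q)" using c by simp
            have cB: "?lch q < B" using less[OF c] bB by simp
            show ?thesis
            proof (rule runs_IfT[OF ft])
              show "aval ?h s2 \<noteq> 0" using eq by (simp add: r2 q_def[symmetric])
              show "runs B (''dc'' ::= ''lch''.[Reg ''qi'']) s2
                (\<lambda>s3 t3. ?Q s3 (t1 + (cost ?g + 1 + (t2 + (cost ?h + 1 + t3)))))"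
                using c cB kB 1 2 by (simp add: runs_simps r2 q_def[symmetric])
            qed
          next
            case neq: False
            then have c: "T.child y p (?lc y)" using c by simp
            have cB: "?lc y < B" using less[OF c] bB by simp
            show ?thesis
            proof (rule runs_IfF[OF ft])
              show "aval ?h s2 = 0" using neq by (simp add: r2 q_def[symmetric])
              show "runs B (''dc'' ::= ''lc''.[Reg ''dy'']) s2
                (\<lambda>s3 t3. ?Q s3 (t1 + (cost ?g + 1 + (t2 + (cost ?h + 1 + t3)))))"
                using c cB bB 1 2 by (simp add: runs_simps r2)
            qed
          qed
        qed
      qed
    qed
  qed
qed

definition descend_twice :: "string \<Rightarrow> com" where
  "descend_twice e =
     (''dy'' ::= Reg ''z'' ;; ''dp'' ::= Reg e) ;; descend ;; (''dy'' ::= Reg ''dc'') ;; descend"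

definition order_ends :: com where
  "order_ends =
     ''ep'' ::= ''pos''.[''src''.[Reg ''j'']] ;; ''eq'' ::= ''pos''.[''tgt''.[Reg ''j'']] ;;
     If (Reg ''eq'' .< Reg ''ep'') (''ql'' ::= Reg ''ep'' ;; ''ep'' ::= Reg ''eq'' ;; ''eq'' ::= Reg ''ql'') Skip"

definition find_node :: com where
  "find_node =
     (''ql'' ::= Reg ''ep'' .+ Const 1 ;; ''qr'' ::= Reg ''eq'') ;; rmq_query ''key'' ''keym'' ''keys'' ;;
     ''z'' ::= ''key''.[Reg ''qi''] .div Reg ''n''"

definition edge_step :: com where
  "edge_step =
     order_ends ;; find_node ;; descend_twice ''ep'' ;; (''gsrc''.[Reg ''j''] \<leftarrow> Reg ''dc'') ;;
     descend_twice ''eq'' ;;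
     (''gtgt''.[Reg ''j''] \<leftarrow> Reg ''dc'' ;; ''gnode''.[Reg ''j''] \<leftarrow> Reg ''z'' ;;
      ''j'' ::= Reg ''j'' .+ Const 1)"

definition edge_loop :: com where
  "edge_loop = While (Reg ''j'' .< Reg ''m'') edge_step"

lemma descend_twice_writes [simp]:
  "wregs (descend_twice e) = {''dy'', ''dp'', ''ql'', ''qr'', ''kl'', ''kr'', ''qj'', ''qc'', ''qi'', ''dc''}"
  "warrs (descend_twice e) = {}"
  by (auto simp: descend_twice_def)

lemma edge_part_writes [simp]:
  "wregs order_ends = {''ep'', ''eq'', ''ql''}" "warrs order_ends = {}"
  "wregs find_node = {''ql'', ''qr'', ''kl'', ''kr'', ''qj'', ''qc'', ''qi'', ''z''}" "warrs find_node = {}"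
  by (auto simp: order_ends_def find_node_def)

lemma edge_writes [simp]:
  "wregs edge_step =
     {''ep'', ''eq'', ''z'', ''j'', ''dy'', ''dp'', ''ql'', ''qr'', ''kl'', ''kr'', ''qj'', ''qc'', ''qi'', ''dc''}"
  "warrs edge_step = {''gsrc'', ''gtgt'', ''gnode''}"
  "wregs edge_loop =
     {''ep'', ''eq'', ''z'', ''j'', ''dy'', ''dp'', ''ql'', ''qr'', ''kl'', ''kr'', ''qj'', ''qc'', ''qi'', ''dc''}"
  "warrs edge_loop = {''gsrc'', ''gtgt'', ''gnode''}"
  by (auto simp: edge_step_def edge_loop_def)

text \<open>\<open>descend\<close> delivers some child covering \<open>p\<close>; uniqueness
  identifies it with \<open>y\<close> and, one level down, with \<open>u\<close>.\<close>

lemma runs_descend_twice: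
  assumes ok: "locate_ok N s" and s: "reg s ''z'' = z" "reg s e = p" "e \<noteq> ''dy''" "p < n"
    and c: "child_in N s z p y" "child_in N s y p u" "n < y"
  shows "runs B (descend_twice e) s (\<lambda>s' t. t \<le> 550 \<and> reg s' ''dc'' = u)" (is "runs B _ s ?Q")
proof -
  have f: "final_ok N (arr s ''parent'') (arr s ''L'') (arr s ''R'') (arr s ''key'') (arr s ''lc'') (arr s ''lch'')"
    and N: "N \<le> 3 * n + 1"
    using ok unfolding locate_ok_def by blast+
  interpret T: interval_tree n N vs pos "arr s ''parent''" "arr s ''L''" "arr s ''R''" cuts
    by (rule final_tree[OF f])
  note cz = T.child_covers[OF c(1) s(4)] and cy = T.child_covers[OF c(2) s(4)]
  have bB: "z < B" "p < B" "y < B" using cz(2) cy(2) N s(4) B by auto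
  let ?p1 = "''dy'' ::= Reg ''z'' ;; ''dp'' ::= Reg e"
  have 1: "runs B ?p1 s (\<lambda>s1 t1. t1 = 4 \<and> reg s1 ''dy'' = z \<and> reg s1 ''dp'' = p)"
    using bB by (simp add: runs_simps s)
  show ?thesis unfolding descend_twice_def
  proof (rule runs_SeqF[OF 1])
    fix s1 :: state and t1 :: nat
    assume 1: "t1 = 4 \<and> reg s1 ''dy'' = z \<and> reg s1 ''dp'' = p" and ag: "agree ?p1 s s1"
    have r1: "reg s1 ''dy'' = z" "reg s1 ''dp'' = p" "arr s1 = arr s"
      using 1 by (simp_all add: agree_reg[OF ag] agree_arr[OF ag] fun_eq_iff)
    have ok1: "locate_ok N s1"
      by (rule locate_ok_cong[OF ok]) (simp_all add: agree_reg[OF ag] agree_arr[OF ag])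
    have 2: "runs B descend s1 (\<lambda>s' t. t \<le> 250 \<and> child_in N s1 z p (reg s' ''dc''))"
      by (rule runs_descend[OF ok1]) (use cz in \<open>simp_all add: r1\<close>)
    show "runs B (descend ;; (''dy'' ::= Reg ''dc'') ;; descend) s1 (\<lambda>s2 t2. ?Q s2 (t1 + t2))"
    proof (rule runs_SeqF[OF 2])
      fix s2 :: state and t2 :: nat
      assume 2: "t2 \<le> 250 \<and> child_in N s1 z p (reg s2 ''dc'')" and ag: "agree descend s1 s2"
      have dc: "reg s2 ''dc'' = y" using 2 T.child_unique[OF _ c(1) s(4)] unfolding r1 by blast
      have r2: "reg s2 ''dp'' = p" "arr s2 = arr s"
        by (simp_all add: agree_reg[OF ag] agree_arr[OF ag] fun_eq_iff r1)
      have ok2: "locate_ok N s2"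
        by (rule locate_ok_cong[OF ok1]) (simp_all add: agree_reg[OF ag] agree_arr[OF ag])
      have 3: "runs B (''dy'' ::= Reg ''dc'') s2 (\<lambda>s3 t3. t3 = 2 \<and> reg s3 ''dy'' = y)"
        using bB by (simp add: runs_simps dc)
      show "runs B ((''dy'' ::= Reg ''dc'') ;; descend) s2 (\<lambda>s3 t3. ?Q s3 (t1 + (t2 + t3)))"
      proof (rule runs_SeqF[OF 3])
        fix s3 :: state and t3 :: nat
        assume 3: "t3 = 2 \<and> reg s3 ''dy'' = y" and ag: "agree (''dy'' ::= Reg ''dc'') s2 s3"
        have r3: "reg s3 ''dy'' = y" "reg s3 ''dp'' = p" "arr s3 = arr s"
          using 3 by (simp_all add: agree_reg[OF ag] agree_arr[OF ag] fun_eq_iff r2)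
        have ok3: "locate_ok N s3"
          by (rule locate_ok_cong[OF ok2]) (simp_all add: agree_reg[OF ag] agree_arr[OF ag])
        have 4: "runs B descend s3 (\<lambda>s' t. t \<le> 250 \<and> child_in N s3 y p (reg s' ''dc''))"
          by (rule runs_descend[OF ok3]) (use cy in \<open>simp_all add: r3\<close>)
        show "runs B descend s3 (\<lambda>s4 t4. ?Q s4 (t1 + (t2 + (t3 + t4))))"
        proof (rule runs_mono[OF 4])
          fix s4 :: state and t4 :: nat
          assume 4: "t4 \<le> 250 \<and> child_in N s3 y p (reg s4 ''dc'')"
          have "reg s4 ''dc'' = u" using 4 T.child_unique[OF _ c(2) s(4)] unfolding r3 by blast
          then show "?Q s4 (t1 + (t2 + (t3 + t4)))" using 1 2 3 4 by simp
        qed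
      qed
    qed
  qed
qed

abbreviation meets_in :: "nat \<Rightarrow> state \<Rightarrow> nat \<Rightarrow> nat \<Rightarrow> nat \<Rightarrow> nat \<Rightarrow> nat \<Rightarrow> bool" where
  "meets_in N s \<equiv> interval_tree.meets n N vs (arr s ''parent'') (arr s ''L'') (arr s ''R'')"

definition edge_meets :: "nat \<Rightarrow> state \<Rightarrow> nat \<Rightarrow> nat \<Rightarrow> nat \<Rightarrow> nat \<Rightarrow> bool" where
  "edge_meets N s i z u v \<longleftrightarrow> meets_in N s z (src (2 * i)) (dst (2 * i)) u v \<or>
     meets_in N s z (dst (2 * i)) (src (2 * i)) u v"

lemma runs_find_node:
  assumes ok: "locate_ok N s" and s: "reg s ''ep'' = p" "reg s ''eq'' = q" "p < q" "q < n"
  shows "runs B find_node s (\<lambda>s' t. t \<le> 250 \<and>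
    (\<exists>y y'. child_in N s (reg s' ''z'') p y \<and> child_in N s (reg s' ''z'') q y' \<and> y \<noteq> y'))" (is "runs B _ s ?Q")
proof -
  have f: "final_ok N (arr s ''parent'') (arr s ''L'') (arr s ''R'') (arr s ''key'') (arr s ''lc'') (arr s ''lch'')"
    and N: "N \<le> 3 * n + 1" and tab: "tables_ok n s" and rmq: "rmq_ok n ''key'' ''keym'' ''keys'' s"
    using ok unfolding locate_ok_def by blast+
  have bB: "Suc p < B" "p < B" "q < B" "Suc 0 < B" "n < B" using s B by auto
  have Bn: "64 * n + 64 \<le> B" using B by simp
  have nr: "reg s ''n'' = n" using tab by (simp add: tables_ok_def)
  let ?p1 = "''ql'' ::= Reg ''ep'' .+ Const 1 ;; ''qr'' ::= Reg ''eq''"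
  have 1: "runs B ?p1 s (\<lambda>s1 t1. t1 = 6 \<and> reg s1 ''ql'' = Suc p \<and> reg s1 ''qr'' = q)"
    using bB by (simp add: runs_simps s)
  show ?thesis unfolding find_node_def
  proof (rule runs_SeqF[OF 1])
    fix s1 :: state and t1 :: nat
    assume 1: "t1 = 6 \<and> reg s1 ''ql'' = Suc p \<and> reg s1 ''qr'' = q" and ag: "agree ?p1 s s1"
    have r1: "reg s1 ''n'' = n" "reg s1 ''ql'' = Suc p" "reg s1 ''qr'' = q"
      "reg s1 ''b'' = reg s ''b''" "reg s1 ''K'' = reg s ''K''" "arr s1 = arr s"
      using nr 1 by (simp_all add: agree_reg[OF ag] agree_arr[OF ag] fun_eq_iff)
    have ok1: "tables_ok n s1" "rmq_ok n ''key'' ''keym'' ''keys'' s1"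
      using tab rmq nr by (simp_all add: tables_ok_def rmq_ok_def r1)
    have 2: "runs B (rmq_query ''key'' ''keym'' ''keys'') s1 (\<lambda>s' t. t \<le> 200 \<and>
      argmin_on (arr s1 ''key'') (Suc p) (Suc q) (reg s' ''qi''))"
    proof (rule runs_rmq_query[OF Bn _ ok1 r1(2,3)])
      show "arr s1 ''key'' x < B" if "x < n" for x using final_key_less[OF f N that] by (simp add: r1)
    qed (use s in auto)
    show "runs B (rmq_query ''key'' ''keym'' ''keys'' ;; ''z'' ::= ''key''.[Reg ''qi''] .div Reg ''n'') s1
      (\<lambda>s2 t2. ?Q s2 (t1 + t2))"
    proof (rule runs_SeqF[OF 2])
      fix s2 :: state and t2 :: nat
      assume 2: "t2 \<le> 200 \<and> argmin_on (arr s1 ''key'') (Suc p) (Suc q) (reg s2 ''qi'')"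
        and ag: "agree (rmq_query ''key'' ''keym'' ''keys'') s1 s2"
      have r2: "reg s2 ''n'' = n" "arr s2 = arr s"
        by (simp_all add: agree_reg[OF ag] agree_arr[OF ag] fun_eq_iff r1)
      define k where "k = reg s2 ''qi''"
      have am: "argmin_on (arr s ''key'') (Suc p) (Suc q) k" using 2 by (simp add: r1 k_def)
      have kn: "k < n" using am s(4) by (simp add: argmin_on_def)
      have kB: "arr s ''key'' k < B" "k < B" using final_key_less[OF f N kn] kn bB by auto
      have kd: "arr s ''key'' k div n < B" using div_le_dividend kB(1) by (rule le_less_trans)
      show "runs B (''z'' ::= ''key''.[Reg ''qi''] .div Reg ''n'') s2 (\<lambda>s3 t3. ?Q s3 (t1 + (t2 + t3)))"
        using 1 2 kB kd bB separating_node[OF f s(3,4) am] by (simp add: runs_simps r2 k_def[symmetric])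
    qed
  qed
qed

lemma runs_order_ends:
  assumes s: "reg s ''j'' = j" "j < m" "arr s ''src'' = list_arr (map fst es)"
    "arr s ''tgt'' = list_arr (map snd es)" "\<And>v. v < n \<Longrightarrow> arr s ''pos'' v = pos v"
  shows "runs B order_ends s (\<lambda>s' t. t \<le> 30 \<and> reg s' ''ep'' < reg s' ''eq'' \<and> reg s' ''eq'' < n \<and>
    (reg s' ''ep'' = src (2 * j) \<and> reg s' ''eq'' = dst (2 * j) \<or>
     reg s' ''ep'' = dst (2 * j) \<and> reg s' ''eq'' = src (2 * j)))"
proof -
  obtain u w where uw: "es ! j = (u, w)" by (cases "es ! j")
  have uwn: "u < n" "w < n" "u \<noteq> w" using es[OF s(2)] uw by auto
  have la: "list_arr (map fst es) j = u" "list_arr (map snd es) j = w"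
    using s(2) m uw by (simp_all add: list_arr_def)
  have sd: "src (2 * j) = pos u" "dst (2 * j) = pos w"
    using uw by (simp_all add: src_def dst_def)
  have ne: "pos u \<noteq> pos w" and pn: "pos u < n" "pos w < n"
    using arc_bounds[of "2 * j"] s(2) sd by auto
  have bB: "u < B" "w < B" "pos u < B" "pos w < B" "j < B" "Suc 0 < B" "0 < B"
    using uwn pn s(2) B by auto
  show ?thesis
    by (cases "pos w < pos u") (use bB ne pn in \<open>auto simp: order_ends_def runs_simps s la uwn sd\<close>)
qed

lemma runs_edge_step:
  assumes ok: "locate_ok N s" and s: "reg s ''j'' = j" "j < m" "arr s ''src'' = list_arr (map fst es)"
    "arr s ''tgt'' = list_arr (map snd es)" "\<And>v. v < n \<Longrightarrow> arr s ''pos'' v = pos v"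
  shows "runs B edge_step s (\<lambda>s' t. t \<le> 1500 \<and> reg s' ''j'' = Suc j \<and> (\<exists>z u v. edge_meets N s j z u v \<and>
    arr s' ''gnode'' = (arr s ''gnode'')(j := z) \<and> arr s' ''gsrc'' = (arr s ''gsrc'')(j := u) \<and>
    arr s' ''gtgt'' = (arr s ''gtgt'')(j := v)))" (is "runs B _ s ?Q")
proof -
  have f: "final_ok N (arr s ''parent'') (arr s ''L'') (arr s ''R'') (arr s ''key'') (arr s ''lc'') (arr s ''lch'')"
    and N: "N \<le> 3 * n + 1"
    using ok unfolding locate_ok_def by blast+
  interpret T: interval_tree n N vs pos "arr s ''parent''" "arr s ''L''" "arr s ''R''" cuts
    by (rule final_tree[OF f])
  have jB: "j < B" "Suc j < B" "Suc 0 < B" using s(2) B by auto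
  show ?thesis unfolding edge_step_def
  proof (rule runs_SeqF[OF runs_order_ends[OF s]])
    fix s1 :: state and t1 :: nat
    assume 1: "t1 \<le> 30 \<and> reg s1 ''ep'' < reg s1 ''eq'' \<and> reg s1 ''eq'' < n \<and>
      (reg s1 ''ep'' = src (2 * j) \<and> reg s1 ''eq'' = dst (2 * j) \<or>
       reg s1 ''ep'' = dst (2 * j) \<and> reg s1 ''eq'' = src (2 * j))" and ag: "agree order_ends s s1"
    define p q where "p = reg s1 ''ep''" and "q = reg s1 ''eq''"
    have pq: "p < q" "q < n" "p < n" "p \<noteq> q" and ends: "p = src (2 * j) \<and> q = dst (2 * j) \<or> p = dst (2 * j) \<and> q = src (2 * j)"
      using 1 by (auto simp: p_def q_def)
    have t1: "t1 \<le> 30" using 1 by simp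
    obtain z u v where mt: "T.meets z p q u v" using T.ex_meets[OF pq(3,2,4)] by blast
    then obtain y y' where y: "T.child z p y" "T.child z q y'" "y \<noteq> y'" "T.child y p u" "T.child y' q v"
      unfolding T.meets_def by blast
    note ny = T.child_not_n[OF y(1,4) pq(3)] T.child_not_n[OF y(2,5) pq(2)]
    have r1: "reg s1 ''j'' = j" "reg s1 ''ep'' = p" "reg s1 ''eq'' = q" "arr s1 = arr s"
      using s by (simp_all add: agree_reg[OF ag] agree_arr[OF ag] fun_eq_iff p_def q_def)
    have ok1: "locate_ok N s1"
      by (rule locate_ok_cong[OF ok]) (simp_all add: agree_reg[OF ag] agree_arr[OF ag])
    show "runs B (find_node ;; descend_twice ''ep'' ;; (''gsrc''.[Reg ''j''] \<leftarrow> Reg ''dc'') ;;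
      descend_twice ''eq'' ;; (''gtgt''.[Reg ''j''] \<leftarrow> Reg ''dc'' ;; ''gnode''.[Reg ''j''] \<leftarrow> Reg ''z'' ;;
      ''j'' ::= Reg ''j'' .+ Const 1)) s1 (\<lambda>s2 t2. ?Q s2 (t1 + t2))"
    proof (rule runs_SeqF[OF runs_find_node[OF ok1 r1(2,3) pq(1,2)]])
      fix s2 :: state and t2 :: nat
      assume 2: "t2 \<le> 250 \<and> (\<exists>y y'. child_in N s1 (reg s2 ''z'') p y \<and> child_in N s1 (reg s2 ''z'') q y' \<and> y \<noteq> y')"
        and ag: "agree find_node s1 s2"
      \<comment> \<open>Both nodes separate \<open>p\<close> and \<open>q\<close>, so each is an
        ancestor of the other.\<close>
      have zz: "reg s2 ''z'' = z"
      proof -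
        obtain x x' where x: "T.child (reg s2 ''z'') p x" "T.child (reg s2 ''z'') q x'" "x \<noteq> x'"
          using 2 unfolding r1 by blast
        note cx = T.child_covers[OF x(1) pq(3)] T.child_covers[OF x(2) pq(2)]
          and cy = T.child_covers[OF y(1) pq(3)] T.child_covers[OF y(2) pq(2)]
        have "T.covers (reg s2 ''z'') p" "T.covers (reg s2 ''z'') q" "T.covers z p" "T.covers z q"
          using cx cy by (simp_all add: T.covers_def)
        then show ?thesis
          using T.separates_lowest[OF x pq(3,2) cy(1,2)] T.separates_lowest[OF y(1-3) pq(3,2) cx(1,2)]
            T.rtrancl_antisym cx(1) cy(1) by blast
      qed
      have r2: "reg s2 ''j'' = j" "reg s2 ''ep'' = p" "reg s2 ''eq'' = q" "reg s2 ''z'' = z" "arr s2 = arr s"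
        using zz by (simp_all add: agree_reg[OF ag] agree_arr[OF ag] fun_eq_iff r1)
      have ok2: "locate_ok N s2"
        by (rule locate_ok_cong[OF ok1]) (simp_all add: agree_reg[OF ag] agree_arr[OF ag])
      have zB: "z < B" "u < B" "v < B"
        using T.child_covers(2)[OF y(1) pq(3)] y(4,5) N B by (auto simp: T.child_def)
      have t2: "t2 \<le> 250" using 2 by simp
      have 3: "runs B (descend_twice ''ep'') s2 (\<lambda>s' t. t \<le> 550 \<and> reg s' ''dc'' = u)"
        by (rule runs_descend_twice[OF ok2 r2(4,2) _ pq(3) _ _ ny(1)]) (use y in \<open>simp_all add: r2\<close>)
      show "runs B (descend_twice ''ep'' ;; (''gsrc''.[Reg ''j''] \<leftarrow> Reg ''dc'') ;;
        descend_twice ''eq'' ;; (''gtgt''.[Reg ''j''] \<leftarrow> Reg ''dc'' ;; ''gnode''.[Reg ''j''] \<leftarrow> Reg ''z'' ;;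
        ''j'' ::= Reg ''j'' .+ Const 1)) s2 (\<lambda>s3 t3. ?Q s3 (t1 + (t2 + t3)))"
      proof (rule runs_SeqF[OF 3])
        fix s3 :: state and t3 :: nat
        assume 3: "t3 \<le> 550 \<and> reg s3 ''dc'' = u" and ag: "agree (descend_twice ''ep'') s2 s3"
        have r3: "reg s3 ''j'' = j" "reg s3 ''eq'' = q" "reg s3 ''z'' = z" "reg s3 ''dc'' = u" "arr s3 = arr s"
          using 3 by (simp_all add: agree_reg[OF ag] agree_arr[OF ag] fun_eq_iff r2)
        have ok3: "locate_ok N s3"
          by (rule locate_ok_cong[OF ok2]) (simp_all add: agree_reg[OF ag] agree_arr[OF ag])
        have 4: "runs B (''gsrc''.[Reg ''j''] \<leftarrow> Reg ''dc'') s3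
          (\<lambda>s4 t4. t4 = 3 \<and> arr s4 ''gsrc'' = (arr s ''gsrc'')(j := u))"
          using jB zB by (simp add: runs_simps r3)
        show "runs B ((''gsrc''.[Reg ''j''] \<leftarrow> Reg ''dc'') ;;
          descend_twice ''eq'' ;; (''gtgt''.[Reg ''j''] \<leftarrow> Reg ''dc'' ;; ''gnode''.[Reg ''j''] \<leftarrow> Reg ''z'' ;;
          ''j'' ::= Reg ''j'' .+ Const 1)) s3 (\<lambda>s4 t4. ?Q s4 (t1 + (t2 + (t3 + t4))))"
        proof (rule runs_SeqF[OF 4])
          fix s4 :: state and t4 :: nat
          assume 4: "t4 = 3 \<and> arr s4 ''gsrc'' = (arr s ''gsrc'')(j := u)"
            and ag: "agree (''gsrc''.[Reg ''j''] \<leftarrow> Reg ''dc'') s3 s4"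
          have r4: "reg s4 ''j'' = j" "reg s4 ''eq'' = q" "reg s4 ''z'' = z"
            "arr s4 ''parent'' = arr s ''parent''" "arr s4 ''L'' = arr s ''L''" "arr s4 ''R'' = arr s ''R''"
            "arr s4 ''gnode'' = arr s ''gnode''" "arr s4 ''gtgt'' = arr s ''gtgt''"
            by (simp_all add: agree_reg[OF ag] agree_arr[OF ag] r3)
          have ok4: "locate_ok N s4"
            by (rule locate_ok_cong[OF ok3]) (simp_all add: agree_reg[OF ag] agree_arr[OF ag])
          have 5: "runs B (descend_twice ''eq'') s4 (\<lambda>s' t. t \<le> 550 \<and> reg s' ''dc'' = v)"
            by (rule runs_descend_twice[OF ok4 r4(3,2) _ pq(2) _ _ ny(2)]) (use y in \<open>simp_all add: r4\<close>)
          show "runs B (descend_twice ''eq'' ;; (''gtgt''.[Reg ''j''] \<leftarrow> Reg ''dc'' ;;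
            ''gnode''.[Reg ''j''] \<leftarrow> Reg ''z'' ;; ''j'' ::= Reg ''j'' .+ Const 1)) s4
            (\<lambda>s5 t5. ?Q s5 (t1 + (t2 + (t3 + (t4 + t5)))))"
          proof (rule runs_SeqF[OF 5])
            fix s5 :: state and t5 :: nat
            assume 5: "t5 \<le> 550 \<and> reg s5 ''dc'' = v" and ag: "agree (descend_twice ''eq'') s4 s5"
            have r5: "reg s5 ''j'' = j" "reg s5 ''z'' = z" "reg s5 ''dc'' = v"
              "arr s5 ''gnode'' = arr s ''gnode''" "arr s5 ''gtgt'' = arr s ''gtgt''"
              "arr s5 ''gsrc'' = (arr s ''gsrc'')(j := u)"
              using 4 5 by (simp_all add: agree_reg[OF ag] agree_arr[OF ag] r4)
            have em: "edge_meets N s j z u v" using mt ends unfolding edge_meets_def by blast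
            have 6: "runs B (''gtgt''.[Reg ''j''] \<leftarrow> Reg ''dc'' ;; ''gnode''.[Reg ''j''] \<leftarrow> Reg ''z'' ;;
              ''j'' ::= Reg ''j'' .+ Const 1) s5 (\<lambda>s6 t6. t6 \<le> 20 \<and> reg s6 ''j'' = Suc j \<and>
                arr s6 ''gnode'' = (arr s ''gnode'')(j := z) \<and> arr s6 ''gsrc'' = (arr s ''gsrc'')(j := u) \<and>
                arr s6 ''gtgt'' = (arr s ''gtgt'')(j := v))"
              using jB zB by (simp add: runs_simps r5)
            show "runs B (''gtgt''.[Reg ''j''] \<leftarrow> Reg ''dc'' ;; ''gnode''.[Reg ''j''] \<leftarrow> Reg ''z'' ;;
              ''j'' ::= Reg ''j'' .+ Const 1) s5 (\<lambda>s6 t6. ?Q s6 (t1 + (t2 + (t3 + (t4 + (t5 + t6))))))"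
              by (rule runs_mono[OF 6]) (use t1 t2 3 4 5 em in auto)
          qed
        qed
      qed
    qed
  qed
qed

lemma runs_edge_loop:
  assumes ok: "locate_ok N s" and s: "reg s ''j'' = 0" "reg s ''m'' = m"
    "arr s ''src'' = list_arr (map fst es)" "arr s ''tgt'' = list_arr (map snd es)"
    "\<And>v. v < n \<Longrightarrow> arr s ''pos'' v = pos v"
  shows "runs B edge_loop s (\<lambda>s' t. t \<le> 1600 * m + 10 \<and>
    (\<forall>i<m. edge_meets N s i (arr s' ''gnode'' i) (arr s' ''gsrc'' i) (arr s' ''gtgt'' i)))"
  unfolding edge_loop_def
proof (rule runs_While[where T = "1600 * m" and I = "\<lambda>s' t. reg s' ''j'' \<le> m \<and> t \<le> 1600 * reg s' ''j'' \<and>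
    (\<forall>i<reg s' ''j''. edge_meets N s i (arr s' ''gnode'' i) (arr s' ''gsrc'' i) (arr s' ''gtgt'' i))"])
  let ?I = "\<lambda>s' t. reg s' ''j'' \<le> m \<and> t \<le> 1600 * reg s' ''j'' \<and>
    (\<forall>i<reg s' ''j''. edge_meets N s i (arr s' ''gnode'' i) (arr s' ''gsrc'' i) (arr s' ''gtgt'' i))"
  let ?g = "Reg ''j'' .< Reg ''m''"
  fix s' :: state and t :: nat
  assume I: "?I s' t" and ag: "agree edge_step s s'"
  have r: "reg s' ''m'' = m" "arr s' ''src'' = list_arr (map fst es)" "arr s' ''tgt'' = list_arr (map snd es)"
    "\<And>v. v < n \<Longrightarrow> arr s' ''pos'' v = pos v" "arr s' ''parent'' = arr s ''parent''"
    "arr s' ''L'' = arr s ''L''" "arr s' ''R'' = arr s ''R''"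
    by (simp_all add: agree_reg[OF ag] agree_arr[OF ag] s)
  have ok': "locate_ok N s'"
    by (rule locate_ok_cong[OF ok]) (simp_all add: agree_reg[OF ag] agree_arr[OF ag])
  have em: "edge_meets N s' = edge_meets N s" by (simp add: edge_meets_def fun_eq_iff r)
  show "fits B ?g s'" using I r B by simp
  show "t + (cost ?g + 1) \<le> 1600 * m + 10 \<and>
    (\<forall>i<m. edge_meets N s i (arr s' ''gnode'' i) (arr s' ''gsrc'' i) (arr s' ''gtgt'' i))"
    if "aval ?g s' = 0"
  proof -
    have "reg s' ''j'' = m" using that I r by (simp split: if_splits)
    then show ?thesis using I by simp
  qed
  assume "aval ?g s' \<noteq> 0"
  then have j: "reg s' ''j'' < m" using r by (simp split: if_splits)
  define j where "j = reg s' ''j''"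
  have tj: "t \<le> 1600 * j" and jm: "Suc j \<le> m"
    and old: "\<And>i. i < j \<Longrightarrow> edge_meets N s i (arr s' ''gnode'' i) (arr s' ''gsrc'' i) (arr s' ''gtgt'' i)"
    using I j by (auto simp: j_def)
  show "runs B edge_step s' (\<lambda>s'' t'. ?I s'' (t + (cost ?g + 1) + t'))"
  proof (rule runs_mono[OF runs_edge_step[OF ok' refl j r(2,3)]])
    show "arr s' ''pos'' v = pos v" if "v < n" for v using r(4) that .
  next
    fix s1 :: state and t1 :: nat
    assume "t1 \<le> 1500 \<and> reg s1 ''j'' = Suc (reg s' ''j'') \<and> (\<exists>z u v. edge_meets N s' (reg s' ''j'') z u v \<and>
      arr s1 ''gnode'' = (arr s' ''gnode'')(reg s' ''j'' := z) \<and> arr s1 ''gsrc'' = (arr s' ''gsrc'')(reg s' ''j'' := u) \<and>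
      arr s1 ''gtgt'' = (arr s' ''gtgt'')(reg s' ''j'' := v))"
    then obtain z u v where 1: "t1 \<le> 1500" "reg s1 ''j'' = Suc (reg s' ''j'')" "edge_meets N s' (reg s' ''j'') z u v"
      "arr s1 ''gnode'' = (arr s' ''gnode'')(reg s' ''j'' := z)" "arr s1 ''gsrc'' = (arr s' ''gsrc'')(reg s' ''j'' := u)"
      "arr s1 ''gtgt'' = (arr s' ''gtgt'')(reg s' ''j'' := v)"
      by blast
    have new: "edge_meets N s i (arr s1 ''gnode'' i) (arr s1 ''gsrc'' i) (arr s1 ''gtgt'' i)" if "i < Suc j" for i
      using that old[of i] 1(3) unfolding 1(4-6) em j_def[symmetric] by (cases "i = j") auto
    show "?I s1 (t + (cost ?g + 1) + t1)"
      unfolding 1(2) j_def[symmetric] using jm new tj 1(1) by simp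
  qed
qed (use s in auto)

lemma adj_iff:
  assumes "p < n" "q < n"
  shows "adj p q \<longleftrightarrow> {vs ! p, vs ! q} \<in> set (map (\<lambda>(u, v). {u, v}) es)"
proof
  assume "adj p q"
  then obtain a where a: "a < 2 * m" "src a = p" "dst a = q" unfolding adj_def by blast
  have j: "a div 2 < m" using a(1) by simp
  note e = es[OF j]
  have v: "vs ! pos (fst (es ! (a div 2))) = fst (es ! (a div 2))"
    "vs ! pos (snd (es ! (a div 2))) = snd (es ! (a div 2))" using e vs_pos by blast+
  have "{vs ! p, vs ! q} = {fst (es ! (a div 2)), snd (es ! (a div 2))}"
    unfolding a(2,3)[symmetric] src_def dst_def using v by (cases "even a") auto
  also have "\<dots> = (\<lambda>(u, v). {u, v}) (es ! (a div 2))" by (cases "es ! (a div 2)") simp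
  also have "\<dots> \<in> set (map (\<lambda>(u, v). {u, v}) es)" using j m by simp
  finally show "{vs ! p, vs ! q} \<in> set (map (\<lambda>(u, v). {u, v}) es)" .
next
  assume "{vs ! p, vs ! q} \<in> set (map (\<lambda>(u, v). {u, v}) es)"
  then obtain j where j: "j < m" "{vs ! p, vs ! q} = (\<lambda>(u, v). {u, v}) (es ! j)"
    using m by (auto simp: in_set_conv_nth)
  then have "{vs ! p, vs ! q} = {fst (es ! j), snd (es ! j)}" by (cases "es ! j") simp
  then consider "fst (es ! j) = vs ! p" "snd (es ! j) = vs ! q" | "fst (es ! j) = vs ! q" "snd (es ! j) = vs ! p"
    by (auto simp: doubleton_eq_iff)
  then show "adj p q"
  proof cases
    case 1
    then have "src (2 * j) = p" "dst (2 * j) = q" using pos_vs assms by (simp_all add: src_def dst_def)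
    then show ?thesis unfolding adj_def using j(1) by (intro exI[of _ "2 * j"]) simp
  next
    case 2
    then have "src (Suc (2 * j)) = p" "dst (Suc (2 * j)) = q"
      using pos_vs assms by (simp_all add: src_def dst_def)
    then show ?thesis unfolding adj_def using j(1) by (intro exI[of _ "Suc (2 * j)"]) simp
  qed
qed

section \<open>The whole program and its running time\<close>

definition bounds_phase :: com where
  "bounds_phase = init_loop ;; arc_loop ;; vert_loop"

definition search_phase :: com where
  "search_phase = tables ;; rmq_build ''lo'' ''lom'' ''los'' ;; rmq_build ''nh'' ''nhm'' ''nhs''"

definition tree_phase :: com where
  "tree_phase =
     (''L''.[Reg ''n''] \<leftarrow> Const 0 ;; ''R''.[Reg ''n''] \<leftarrow> Reg ''n'' ;;
      ''nodes'' ::= Reg ''n'' .+ Const 1 ;; ''x'' ::= Reg ''n'') ;;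
     node_loop ;; rmq_build ''key'' ''keym'' ''keys''"

definition edge_phase :: com where
  "edge_phase =
     (''j'' ::= Const 0) ;; edge_loop ;;
     (''gedges'' ::= Reg ''m'' ;; ''leaves'' ::= Reg ''n'' ;; ''root'' ::= Reg ''n'')"

text \<open>No parameter of the locale occurs in the program, so outside the locale it is one fixed
  constant; this is what makes the algorithm uniform in the input.\<close>

definition decompose :: com where
  "decompose = bounds_phase ;; search_phase ;; tree_phase ;; edge_phase"

lemma phase_writes [simp]:
  "wregs bounds_phase = {''i'', ''u'', ''w'', ''a'', ''j'', ''k'', ''p'', ''v''}"
  "warrs bounds_phase = {''pos'', ''leaf'', ''lo'', ''nh'', ''to'', ''nxt'', ''head'', ''mark''}"
  "wregs search_phase = {''b'', ''p'', ''K'', ''x'', ''h'', ''base'', ''i'', ''j'', ''k'', ''c'', ''d''}"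
  "warrs search_phase = {''pw'', ''len'', ''lb'', ''prv'', ''lom'', ''los'', ''nhm'', ''nhs''}"
  "wregs tree_phase = {''lx'', ''rx'', ''x'', ''r'', ''ql'', ''qr'', ''kl'', ''kr'', ''qj'', ''qc'', ''qi'', ''f'',
     ''nodes'', ''l'', ''sp'', ''base'', ''i'', ''j'', ''k'', ''c'', ''d''}"
  "warrs tree_phase = {''L'', ''R'', ''parent'', ''lc'', ''lch'', ''key'', ''stk'', ''prv'', ''keym'', ''keys''}"
  by (auto simp: bounds_phase_def search_phase_def tree_phase_def tables_writes)

lemma runs_bounds_phase:
  "runs B bounds_phase (input_state vs es) (\<lambda>s' t. t \<le> 300 * n + 500 * m + 30 \<and>
    (\<forall>k. arr s' ''lo'' k \<le> n \<and> arr s' ''nh'' k \<le> n) \<and>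
    (\<forall>k<n. bnd_ok (arr s' ''lo'' k) (arr s' ''nh'' k) k (distinguishers k)) \<and>
    (\<forall>v<n. arr s' ''pos'' v = pos v) \<and> (\<forall>i<n. arr s' ''leaf'' i = vs ! i))"
  (is "runs B _ ?s ?Q")
proof -
  have s: "reg ?s ''i'' = 0" "reg ?s ''n'' = n" "arr ?s ''order'' = list_arr vs"
    "arr ?s ''lo'' = (\<lambda>_. 0)" "arr ?s ''nh'' = (\<lambda>_. 0)"
    "reg ?s ''j'' = 0" "reg ?s ''a'' = 0" "reg ?s ''v'' = 0" "reg ?s ''m'' = m"
    "arr ?s ''src'' = list_arr (map fst es)" "arr ?s ''tgt'' = list_arr (map snd es)"
    "arr ?s ''head'' = (\<lambda>_. 0)" "arr ?s ''mark'' = (\<lambda>_. 0)"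
    using n m by (simp_all add: input_state_def fun_eq_iff)
  show ?thesis unfolding bounds_phase_def
  proof (rule runs_SeqF[OF runs_init_loop[OF s(1-5)]])
    fix s1 :: state and t1 :: nat
    assume 1: "t1 \<le> 40 * n + 10 \<and> (\<forall>v<n. arr s1 ''pos'' v = pos v) \<and> (\<forall>i<n. arr s1 ''leaf'' i = vs ! i) \<and>
      (\<forall>k. arr s1 ''lo'' k = (if k < n then k else 0)) \<and> (\<forall>k. arr s1 ''nh'' k = (if k < n then n else 0))"
      and ag: "agree init_loop ?s s1"
    have r1: "reg s1 ''j'' = 0" "reg s1 ''a'' = 0" "reg s1 ''m'' = m" "arr s1 ''src'' = list_arr (map fst es)"
      "arr s1 ''tgt'' = list_arr (map snd es)" "arr s1 ''head'' = (\<lambda>_. 0)" "reg s1 ''v'' = 0" "reg s1 ''n'' = n"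
      "arr s1 ''mark'' = (\<lambda>_. 0)"
      by (simp_all add: agree_reg[OF ag] agree_arr[OF ag] s)
    have 2: "runs B arc_loop s1 (\<lambda>s' t. t \<le> 70 * m + 10 \<and> arcs_ok (2 * m) s')"
      by (rule runs_arc_loop[OF r1(1-5) _ r1(6)]) (use 1 in blast)
    show "runs B (arc_loop ;; vert_loop) s1 (\<lambda>s2 t2. ?Q s2 (t1 + t2))"
    proof (rule runs_SeqF[OF 2])
      fix s2 :: state and t2 :: nat
      assume 2: "t2 \<le> 70 * m + 10 \<and> arcs_ok (2 * m) s2" and ag: "agree arc_loop s1 s2"
      have r2: "reg s2 ''v'' = 0" "reg s2 ''n'' = n" "arr s2 ''mark'' = (\<lambda>_. 0)"
        "arr s2 ''lo'' = arr s1 ''lo''" "arr s2 ''nh'' = arr s1 ''nh''"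
        "arr s2 ''pos'' = arr s1 ''pos''" "arr s2 ''leaf'' = arr s1 ''leaf''"
        by (simp_all add: agree_reg[OF ag] agree_arr[OF ag] r1)
      have 3: "runs B vert_loop s2 (\<lambda>s' t. t \<le> 200 * n + 400 * m + 10 \<and>
        (\<forall>k. arr s' ''lo'' k \<le> n \<and> arr s' ''nh'' k \<le> n) \<and>
        (\<forall>k<n. bnd_ok (arr s' ''lo'' k) (arr s' ''nh'' k) k (distinguishers k)))"
      proof (rule runs_vert_loop[OF r2(1-3)])
        show "arcs_ok (2 * m) s2" using 2 by blast
        show "arr s2 ''lo'' k = (if k < n then k else 0)" "arr s2 ''nh'' k = (if k < n then n else 0)" for k
          using 1 unfolding r2(4,5) by blast+
      qed
      show "runs B vert_loop s2 (\<lambda>s3 t3. ?Q s3 (t1 + (t2 + t3)))"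
      proof (rule runs_mono[OF runs_agree[OF 3]])
        fix s3 :: state and t3 :: nat
        assume 3: "(t3 \<le> 200 * n + 400 * m + 10 \<and> (\<forall>k. arr s3 ''lo'' k \<le> n \<and> arr s3 ''nh'' k \<le> n) \<and>
          (\<forall>k<n. bnd_ok (arr s3 ''lo'' k) (arr s3 ''nh'' k) k (distinguishers k))) \<and> agree vert_loop s2 s3"
        then have ag: "agree vert_loop s2 s3" by blast
        have r3: "arr s3 ''pos'' = arr s1 ''pos''" "arr s3 ''leaf'' = arr s1 ''leaf''"
          by (simp_all add: agree_arr[OF ag] r2)
        have "t1 + (t2 + t3) \<le> 300 * n + 500 * m + 30" using 1 2 3 by linarith
        then show "?Q s3 (t1 + (t2 + t3))" unfolding r3 using 1 3 by blast
      qed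
    qed
  qed
qed

lemma runs_search_phase:
  assumes s: "reg s ''n'' = n" "arr s ''len'' 0 = 0" "\<And>k. arr s ''lo'' k \<le> n" "\<And>k. arr s ''nh'' k \<le> n"
    "\<And>k. k < n \<Longrightarrow> bnd_ok (arr s ''lo'' k) (arr s ''nh'' k) k (distinguishers k)"
  shows "runs B search_phase s (\<lambda>s' t. t \<le> 1200 * n + 400 \<and> search_ok s')" (is "runs B _ s ?Q")
  unfolding search_phase_def
proof -
  have Bn: "64 * n + 64 \<le> B" and nB: "x \<le> n \<Longrightarrow> x < B" for x using B by auto
  show "runs B (tables ;; rmq_build ''lo'' ''lom'' ''los'' ;; rmq_build ''nh'' ''nhm'' ''nhs'') s ?Q"
  proof (rule runs_SeqF[OF runs_tables[OF Bn n(1) s(1,2)]])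
    fix s1 :: state and t1 :: nat
    assume 1: "t1 \<le> 200 * n + 200 \<and> tables_ok n s1" and ag: "agree tables s s1"
    have r1: "arr s1 ''lo'' = arr s ''lo''" "arr s1 ''nh'' = arr s ''nh''"
      by (simp_all add: agree_arr[OF ag] tables_writes)
    have 2: "runs B (rmq_build ''lo'' ''lom'' ''los'') s1
      (\<lambda>s' t. t \<le> 500 * n + 100 \<and> rmq_ok n ''lo'' ''lom'' ''los'' s')"
      by (rule runs_rmq_build[OF Bn]) (use 1 nB s(3) in \<open>simp_all add: r1\<close>)
    show "runs B (rmq_build ''lo'' ''lom'' ''los'' ;; rmq_build ''nh'' ''nhm'' ''nhs'') s1
      (\<lambda>s2 t2. ?Q s2 (t1 + t2))"
    proof (rule runs_SeqF[OF 2])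
      fix s2 :: state and t2 :: nat
      assume 2: "t2 \<le> 500 * n + 100 \<and> rmq_ok n ''lo'' ''lom'' ''los'' s2"
        and ag: "agree (rmq_build ''lo'' ''lom'' ''los'') s1 s2"
      have r2: "arr s2 ''lo'' = arr s ''lo''" "arr s2 ''nh'' = arr s ''nh''"
        by (simp_all add: agree_arr[OF ag] r1)
      have tab2: "tables_ok n s2"
        using 1 by (simp add: tables_ok_def agree_reg[OF ag] agree_arr[OF ag])
      have 3: "runs B (rmq_build ''nh'' ''nhm'' ''nhs'') s2
        (\<lambda>s' t. t \<le> 500 * n + 100 \<and> rmq_ok n ''nh'' ''nhm'' ''nhs'' s')"
        by (rule runs_rmq_build[OF Bn]) (use tab2 nB s(4) in \<open>simp_all add: r2\<close>)
      show "runs B (rmq_build ''nh'' ''nhm'' ''nhs'') s2 (\<lambda>s3 t3. ?Q s3 (t1 + (t2 + t3)))"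
      proof (rule runs_mono[OF runs_agree[OF 3]])
        fix s3 :: state and t3 :: nat
        assume 3: "(t3 \<le> 500 * n + 100 \<and> rmq_ok n ''nh'' ''nhm'' ''nhs'' s3) \<and>
          agree (rmq_build ''nh'' ''nhm'' ''nhs'') s2 s3"
        then have ag: "agree (rmq_build ''nh'' ''nhm'' ''nhs'') s2 s3" by blast
        have r3: "arr s3 ''lo'' = arr s ''lo''" "arr s3 ''nh'' = arr s ''nh''"
          by (simp_all add: agree_arr[OF ag] r2)
        have "tables_ok n s3" "rmq_ok n ''lo'' ''lom'' ''los'' s3"
          using tab2 2 by (simp_all add: tables_ok_def rmq_ok_def agree_reg[OF ag] agree_arr[OF ag])
        then have "search_ok s3" unfolding search_ok_def r3 using 3 s(3-5) by blast
        moreover have "t1 + (t2 + t3) \<le> 1200 * n + 400" using 1 2 3 by linarith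
        ultimately show "?Q s3 (t1 + (t2 + t3))" by blast
      qed
    qed
  qed
qed

lemma runs_tree_phase:
  assumes ok: "search_ok s" and s: "arr s ''order'' = list_arr vs" "\<And>k. arr s ''key'' k = 0"
  shows "runs B tree_phase s (\<lambda>s' t. t \<le> 5500 * n + 5200 \<and> locate_ok (reg s' ''nodes'') s')" (is "runs B _ s ?Q")
proof -
  let ?p = "''L''.[Reg ''n''] \<leftarrow> Const 0 ;; ''R''.[Reg ''n''] \<leftarrow> Reg ''n'' ;;
      ''nodes'' ::= Reg ''n'' .+ Const 1 ;; ''x'' ::= Reg ''n''"
  have Bn: "64 * n + 64 \<le> B" using B by simp
  have nr: "reg s ''n'' = n" using ok by (simp add: search_ok_def tables_ok_def)
  have 1: "runs B ?p s (\<lambda>s1 t1. t1 \<le> 20 \<and> reg s1 ''x'' = n \<and> reg s1 ''nodes'' = Suc n \<and>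
    arr s1 ''L'' n = 0 \<and> arr s1 ''R'' n = n)"
    using B by (simp add: runs_simps nr)
  show ?thesis unfolding tree_phase_def
  proof (rule runs_SeqF[OF 1])
    fix s1 :: state and t1 :: nat
    assume 1: "t1 \<le> 20 \<and> reg s1 ''x'' = n \<and> reg s1 ''nodes'' = Suc n \<and> arr s1 ''L'' n = 0 \<and> arr s1 ''R'' n = n"
      and ag: "agree ?p s s1"
    have ok1: "search_ok s1"
      by (rule search_ok_cong[OF ok]) (simp_all add: agree_reg[OF ag] agree_arr[OF ag])
    have r1: "arr s1 ''order'' = list_arr vs" "arr s1 ''key'' k = 0" for k
      by (simp_all add: agree_arr[OF ag] s)
    have 2: "runs B node_loop s1 (\<lambda>s' t. t \<le> 5000 * n + 5000 \<and> outer_state (reg s' ''nodes'') s' \<and>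
      reg s' ''nodes'' \<le> 3 * n + 1)"
      by (rule runs_node_loop[OF ok1 _ _ r1(1) _ _ r1(2)]) (use 1 in blast)+
    show "runs B (node_loop ;; rmq_build ''key'' ''keym'' ''keys'') s1 (\<lambda>s2 t2. ?Q s2 (t1 + t2))"
    proof (rule runs_SeqF[OF 2])
      fix s2 :: state and t2 :: nat
      assume 2: "t2 \<le> 5000 * n + 5000 \<and> outer_state (reg s2 ''nodes'') s2 \<and> reg s2 ''nodes'' \<le> 3 * n + 1"
        and ag: "agree node_loop s1 s2"
      have tab2: "tables_ok n s2"
        using ok1 by (simp add: search_ok_def tables_ok_def agree_reg[OF ag] agree_arr[OF ag])
      have f2: "final_ok (reg s2 ''nodes'') (arr s2 ''parent'') (arr s2 ''L'') (arr s2 ''R'') (arr s2 ''key'')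
        (arr s2 ''lc'') (arr s2 ''lch'')" and N: "reg s2 ''nodes'' \<le> 3 * n + 1"
        using 2 by (simp_all add: final_ok_def)
      have 3: "runs B (rmq_build ''key'' ''keym'' ''keys'') s2
        (\<lambda>s' t. t \<le> 500 * n + 100 \<and> rmq_ok n ''key'' ''keym'' ''keys'' s')"
        by (rule runs_rmq_build[OF Bn final_key_less[OF f2 N] tab2]) simp_all
      show "runs B (rmq_build ''key'' ''keym'' ''keys'') s2 (\<lambda>s3 t3. ?Q s3 (t1 + (t2 + t3)))"
      proof (rule runs_mono[OF runs_agree[OF 3]])
        fix s3 :: state and t3 :: nat
        assume 3: "(t3 \<le> 500 * n + 100 \<and> rmq_ok n ''key'' ''keym'' ''keys'' s3) \<and>
          agree (rmq_build ''key'' ''keym'' ''keys'') s2 s3"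
        then have ag: "agree (rmq_build ''key'' ''keym'' ''keys'') s2 s3" by blast
        have "tables_ok n s3"
          using tab2 by (simp add: tables_ok_def agree_reg[OF ag] agree_arr[OF ag])
        then have "locate_ok (reg s3 ''nodes'') s3"
          using 3 f2 N by (simp add: locate_ok_def agree_reg[OF ag] agree_arr[OF ag])
        then show "?Q s3 (t1 + (t2 + t3))" using 1 2 3 by simp
      qed
    qed
  qed
qed

lemma runs_edge_phase:
  assumes ok: "locate_ok N s" and s: "reg s ''m'' = m" "reg s ''nodes'' = N"
    "arr s ''src'' = list_arr (map fst es)" "arr s ''tgt'' = list_arr (map snd es)"
    "\<And>v. v < n \<Longrightarrow> arr s ''pos'' v = pos v"
  shows "runs B edge_phase s (\<lambda>s' t. t \<le> 1600 * m + 50 \<and> locate_ok N s' \<and> reg s' ''nodes'' = N \<and>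
    reg s' ''gedges'' = m \<and> reg s' ''leaves'' = n \<and> reg s' ''root'' = n \<and> arr s' ''leaf'' = arr s ''leaf'' \<and>
    (\<forall>i<m. edge_meets N s' i (arr s' ''gnode'' i) (arr s' ''gsrc'' i) (arr s' ''gtgt'' i)))" (is "runs B _ s ?Q")
proof -
  let ?p = "''gedges'' ::= Reg ''m'' ;; ''leaves'' ::= Reg ''n'' ;; ''root'' ::= Reg ''n''"
  have bB: "n < B" "m < B" "0 < B" using B by auto
  have 1: "runs B (''j'' ::= Const 0) s (\<lambda>s1 t1. t1 = 2 \<and> reg s1 ''j'' = 0)"
    using bB by (simp add: runs_simps)
  show ?thesis unfolding edge_phase_def
  proof (rule runs_SeqF[OF 1])
    fix s1 :: state and t1 :: nat
    assume 1: "t1 = 2 \<and> reg s1 ''j'' = 0" and ag: "agree (''j'' ::= Const 0) s s1"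
    have ok1: "locate_ok N s1"
      by (rule locate_ok_cong[OF ok]) (simp_all add: agree_reg[OF ag] agree_arr[OF ag])
    have r1: "reg s1 ''j'' = 0" "reg s1 ''m'' = m" "arr s1 ''src'' = list_arr (map fst es)"
      "arr s1 ''tgt'' = list_arr (map snd es)" "reg s1 ''nodes'' = N" "arr s1 ''leaf'' = arr s ''leaf''"
      "v < n \<Longrightarrow> arr s1 ''pos'' v = pos v" for v
      using 1 by (simp_all add: agree_reg[OF ag] agree_arr[OF ag] s)
    have 2: "runs B edge_loop s1 (\<lambda>s' t. t \<le> 1600 * m + 10 \<and>
      (\<forall>i<m. edge_meets N s1 i (arr s' ''gnode'' i) (arr s' ''gsrc'' i) (arr s' ''gtgt'' i)))"
      by (rule runs_edge_loop[OF ok1 r1(1-4)]) (rule r1(7))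
    show "runs B (edge_loop ;; ?p) s1 (\<lambda>s2 t2. ?Q s2 (t1 + t2))"
    proof (rule runs_SeqF[OF 2])
      fix s2 :: state and t2 :: nat
      assume 2: "t2 \<le> 1600 * m + 10 \<and>
        (\<forall>i<m. edge_meets N s1 i (arr s2 ''gnode'' i) (arr s2 ''gsrc'' i) (arr s2 ''gtgt'' i))"
        and ag: "agree edge_loop s1 s2"
      have ok2: "locate_ok N s2"
        by (rule locate_ok_cong[OF ok1]) (simp_all add: agree_reg[OF ag] agree_arr[OF ag])
      have nr: "reg s2 ''n'' = n" using ok2 by (simp add: locate_ok_def tables_ok_def)
      have r2: "reg s2 ''m'' = m" "reg s2 ''nodes'' = N" "arr s2 ''leaf'' = arr s ''leaf''"
        "arr s2 ''parent'' = arr s1 ''parent''" "arr s2 ''L'' = arr s1 ''L''" "arr s2 ''R'' = arr s1 ''R''"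
        by (simp_all add: agree_reg[OF ag] agree_arr[OF ag] r1)
      have 3: "runs B ?p s2 (\<lambda>s' t. t = 6 \<and> reg s' ''gedges'' = m \<and> reg s' ''leaves'' = n \<and> reg s' ''root'' = n)"
        using bB by (simp add: runs_simps nr r2)
      show "runs B ?p s2 (\<lambda>s3 t3. ?Q s3 (t1 + (t2 + t3)))"
      proof (rule runs_mono[OF runs_agree[OF 3]])
        fix s3 :: state and t3 :: nat
        assume 3: "(t3 = 6 \<and> reg s3 ''gedges'' = m \<and> reg s3 ''leaves'' = n \<and> reg s3 ''root'' = n) \<and>
          agree ?p s2 s3"
        then have ag: "agree ?p s2 s3" by blast
        have ok3: "locate_ok N s3"
          by (rule locate_ok_cong[OF ok2]) (simp_all add: agree_reg[OF ag] agree_arr[OF ag])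
        have r3: "reg s3 ''nodes'' = N" "arr s3 = arr s2"
          by (simp_all add: agree_reg[OF ag] agree_arr[OF ag] r2 fun_eq_iff)
        have "edge_meets N s3 = edge_meets N s1" by (simp add: edge_meets_def fun_eq_iff r2 r3)
        then show "?Q s3 (t1 + (t2 + t3))" using ok3 1 2 3 by (simp add: r2 r3)
      qed
    qed
  qed
qed

definition output_ok :: "state \<Rightarrow> bool" where
  "output_ok s \<longleftrightarrow> locate_ok (reg s ''nodes'') s \<and> reg s ''gedges'' = m \<and> reg s ''leaves'' = n \<and>
     reg s ''root'' = n \<and> (\<forall>i<n. arr s ''leaf'' i = vs ! i) \<and>
     (\<forall>i<m. edge_meets (reg s ''nodes'') s i (arr s ''gnode'' i) (arr s ''gsrc'' i) (arr s ''gtgt'' i))"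

lemma runs_decompose:
  "runs B decompose (input_state vs es) (\<lambda>s t. t \<le> 15000 * (m + n) \<and> output_ok s)" (is "runs B _ ?s ?Q")
proof -
  have s: "reg ?s ''n'' = n" "reg ?s ''m'' = m" "arr ?s ''order'' = list_arr vs" "arr ?s ''len'' = (\<lambda>_. 0)"
    "arr ?s ''src'' = list_arr (map fst es)" "arr ?s ''tgt'' = list_arr (map snd es)" "arr ?s ''key'' = (\<lambda>_. 0)"
    using n m by (simp_all add: input_state_def fun_eq_iff)
  show ?thesis unfolding decompose_def
  proof (rule runs_SeqF[OF runs_bounds_phase])
    fix s1 :: state and t1 :: nat
    assume 1: "t1 \<le> 300 * n + 500 * m + 30 \<and> (\<forall>k. arr s1 ''lo'' k \<le> n \<and> arr s1 ''nh'' k \<le> n) \<and>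
      (\<forall>k<n. bnd_ok (arr s1 ''lo'' k) (arr s1 ''nh'' k) k (distinguishers k)) \<and>
      (\<forall>v<n. arr s1 ''pos'' v = pos v) \<and> (\<forall>i<n. arr s1 ''leaf'' i = vs ! i)"
      and ag: "agree bounds_phase ?s s1"
    have r1: "reg s1 ''n'' = n" "arr s1 ''len'' 0 = 0" "arr s1 ''order'' = list_arr vs" "reg s1 ''m'' = m"
      "arr s1 ''src'' = list_arr (map fst es)" "arr s1 ''tgt'' = list_arr (map snd es)" "arr s1 ''key'' = (\<lambda>_. 0)"
      by (simp_all add: agree_reg[OF ag] agree_arr[OF ag] s)
    have 2: "runs B search_phase s1 (\<lambda>s' t. t \<le> 1200 * n + 400 \<and> search_ok s')"
      by (rule runs_search_phase[OF r1(1,2)]) (use 1 in blast)+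
    show "runs B (search_phase ;; tree_phase ;; edge_phase) s1 (\<lambda>s2 t2. ?Q s2 (t1 + t2))"
    proof (rule runs_SeqF[OF 2])
      fix s2 :: state and t2 :: nat
      assume 2: "t2 \<le> 1200 * n + 400 \<and> search_ok s2" and ag: "agree search_phase s1 s2"
      have r2: "arr s2 ''order'' = list_arr vs" "arr s2 ''key'' k = 0" "reg s2 ''m'' = m"
        "arr s2 ''src'' = list_arr (map fst es)" "arr s2 ''tgt'' = list_arr (map snd es)"
        "arr s2 ''pos'' = arr s1 ''pos''" "arr s2 ''leaf'' = arr s1 ''leaf''" for k
        by (simp_all add: agree_reg[OF ag] agree_arr[OF ag] r1)
      have 3: "runs B tree_phase s2 (\<lambda>s' t. t \<le> 5500 * n + 5200 \<and> locate_ok (reg s' ''nodes'') s')"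
        by (rule runs_tree_phase[OF _ r2(1,2)]) (use 2 in blast)
      show "runs B (tree_phase ;; edge_phase) s2 (\<lambda>s3 t3. ?Q s3 (t1 + (t2 + t3)))"
      proof (rule runs_SeqF[OF 3])
        fix s3 :: state and t3 :: nat
        assume 3: "t3 \<le> 5500 * n + 5200 \<and> locate_ok (reg s3 ''nodes'') s3" and ag: "agree tree_phase s2 s3"
        have r3: "reg s3 ''m'' = m"
          "arr s3 ''src'' = list_arr (map fst es)" "arr s3 ''tgt'' = list_arr (map snd es)"
          "arr s3 ''pos'' = arr s1 ''pos''" "arr s3 ''leaf'' = arr s1 ''leaf''"
          by (simp_all add: agree_reg[OF ag] agree_arr[OF ag] r2)
        have ok3: "locate_ok (reg s3 ''nodes'') s3" using 3 by blast
        note 4 = runs_edge_phase[OF ok3 r3(1) refl r3(2,3)]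
        have time: "t1 + (t2 + (t3 + t4)) \<le> 15000 * (m + n)" if "t4 \<le> 1600 * m + 50" for t4
        proof -
          \<comment> \<open>The sum of the four phase bounds. As \<open>n \<ge> 1\<close>, the
            constant 5680 is absorbed by the term in \<open>n\<close>.\<close>
          have "t1 + (t2 + (t3 + t4)) \<le> 7000 * n + 2100 * m + 5680" using 1 2 3 that by linarith
          also have "\<dots> \<le> 15000 * m + 15000 * n" using n(1) by linarith
          finally show ?thesis by simp
        qed
        show "runs B edge_phase s3 (\<lambda>s4 t4. ?Q s4 (t1 + (t2 + (t3 + t4))))"
          by (rule runs_mono[OF 4]) (use 1 time in \<open>simp_all add: output_ok_def r3\<close>)
      qed
    qed
  qed
qed

text \<open>The computed cuts meet the requirements of \<open>decomposition\<close>: a position that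
  is not cut is not forced, so no outside vertex distinguishes it, and if there are two cuts or
  more, the default case is excluded and all are forced.\<close>

lemma output_correct:
  assumes out: "output_ok s"
    and G: "ordered_graph G" "verts G = {0..<n}" "vorder G = order_of_list vs"
      "edges G = set (map (\<lambda>(u, v). {u, v}) es)"
  shows "delayed_decomposition (output_tree s) G" "distinguishing (output_tree s) G"
proof -
  define N where "N = reg s ''nodes''"
  have out': "final_ok N (arr s ''parent'') (arr s ''L'') (arr s ''R'') (arr s ''key'') (arr s ''lc'') (arr s ''lch'')"
    "reg s ''gedges'' = m" "reg s ''leaves'' = n" "reg s ''root'' = n" "\<And>i. i < n \<Longrightarrow> arr s ''leaf'' i = vs ! i"
    "\<And>i. i < m \<Longrightarrow> edge_meets N s i (arr s ''gnode'' i) (arr s ''gsrc'' i) (arr s ''gtgt'' i)"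
    using out unfolding output_ok_def locate_ok_def N_def by blast+
  interpret I: interval_tree n N vs pos "arr s ''parent''" "arr s ''L''" "arr s ''R''" cuts
    by (rule final_tree[OF out'(1)])
  define GE where "GE x = {{arr s ''gsrc'' i, arr s ''gtgt'' i} | i. i < m \<and> arr s ''gnode'' i = x}" for x
  have E: "adj p q \<longleftrightarrow> {vs ! p, vs ! q} \<in> edges G" if "p < n" "q < n" for p q
    using adj_iff[OF that] G(4) by simp
  have k_less: "k - 1 < n" "k < n" "0 < k" if "a < k" "k < b" "b \<le> n" for a b k :: nat using that by auto
  interpret D: decomposition n N vs pos "arr s ''parent''" "arr s ''L''" "arr s ''R''" cuts G GE
    "\<lambda>p q. {vs ! p, vs ! q} \<in> edges G"
  proof unfold_locales
    show "ordered_graph G" "verts G = {0..<n}" "vorder G = order_of_list vs" "length vs = n"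
      using G n by auto
    show "({vs ! v, vs ! (k - 1)} \<in> edges G) = ({vs ! v, vs ! k} \<in> edges G)"
      if "Suc a < b" "b \<le> n" "a < k" "k < b" "k \<notin> cuts a b" "v < n" "v < a \<or> b \<le> v" for a b k v
    proof -
      note k = k_less[OF that(3,4,2)]
      have "k \<notin> forced a b" using that(5) by (auto simp: cuts_def split: if_splits)
      then have "\<not> hits v 0 k" using that(3,4,6,7) by (auto simp: forced_def distinguishers_def)
      moreover have "v \<noteq> k - 1" "v \<noteq> k" using that(3,4,7) by auto
      ultimately have "adj v (k - 1) \<longleftrightarrow> adj v k" using hits_0[OF k(3,2)] by blast
      then show ?thesis using E[OF that(6) k(1)] E[OF that(6) k(2)] by blast
    qed
    show "\<exists>v<n. (v < a \<or> b \<le> v) \<and> ({vs ! v, vs ! (k - 1)} \<in> edges G) \<noteq> ({vs ! v, vs ! k} \<in> edges G)"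
      if "Suc a < b" "b \<le> n" "k \<in> cuts a b" "2 \<le> card (cuts a b)" for a b k
    proof -
      have "k \<in> forced a b" using that(3,4) by (auto simp: cuts_def split: if_splits)
      then obtain v where v: "a < k" "k < b" "v < n" "hits v 0 k" "v < a \<or> b \<le> v"
        by (auto simp: forced_def distinguishers_def)
      note k = k_less[OF v(1,2) that(2)]
      have "adj v (k - 1) \<noteq> adj v k" using hits_0[OF k(3,2)] v(4) by blast
      then show ?thesis using E[OF v(3) k(1)] E[OF v(3) k(2)] v(3,5) by blast
    qed
    show "GE x = {{u, v} | u v. \<exists>p q. p < n \<and> q < n \<and> {vs ! p, vs ! q} \<in> edges G \<and> I.meets x p q u v}" (is "_ = ?X") for x
    proof
      show "GE x \<subseteq> ?X"
      proof
        fix e assume "e \<in> GE x"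
        then obtain i where i: "i < m" "arr s ''gnode'' i = x" "e = {arr s ''gsrc'' i, arr s ''gtgt'' i}"
          unfolding GE_def by blast
        have b: "src (2 * i) < n" "dst (2 * i) < n" using arc_bounds[of "2 * i"] i(1) by auto
        have "adj (src (2 * i)) (dst (2 * i))" using i(1) unfolding adj_def by (intro exI[of _ "2 * i"]) simp
        then have "{vs ! src (2 * i), vs ! dst (2 * i)} \<in> edges G" using E[OF b] by blast
        moreover have "{vs ! dst (2 * i), vs ! src (2 * i)} \<in> edges G"
          using calculation by (simp add: insert_commute)
        ultimately show "e \<in> ?X" using out'(6)[OF i(1)] b i(2,3) unfolding edge_meets_def by blast
      qed
      show "?X \<subseteq> GE x"
      proof
        fix e assume "e \<in> ?X"
        then obtain u v p q where e: "e = {u, v}" "p < n" "q < n" "{vs ! p, vs ! q} \<in> edges G" "I.meets x p q u v"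
          by blast
        then obtain a where a: "a < 2 * m" "src a = p" "dst a = q" using E[OF e(2,3)] unfolding adj_def by blast
        have i: "a div 2 < m" using a(1) by simp
        define i where "i = a div 2"
        have "src (2 * i) = p \<and> dst (2 * i) = q \<or> src (2 * i) = q \<and> dst (2 * i) = p"
        proof (cases "even a")
          case True
          then show ?thesis using a(2,3) by (simp add: i_def)
        next
          case False
          then have "a = Suc (2 * i)" by (simp add: i_def)
          then show ?thesis using a(2,3) by (simp add: src_def dst_def)
        qed
        then have "I.meets (arr s ''gnode'' i) p q (arr s ''gsrc'' i) (arr s ''gtgt'' i) \<or>
          I.meets (arr s ''gnode'' i) q p (arr s ''gsrc'' i) (arr s ''gtgt'' i)"
          using out'(6)[of i] i unfolding edge_meets_def i_def[symmetric] by auto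
        \<comment> \<open>The stored triple need not name \<open>u\<close> and \<open>v\<close> in
          this order, but the node and the unordered pair are determined by the edge.\<close>
        then have "arr s ''gnode'' i = x \<and> {arr s ''gsrc'' i, arr s ''gtgt'' i} = {u, v}"
          using I.meets_unique[OF _ e(5,2,3)] I.meets_unique[OF I.meets_sym e(5,2,3)] by (auto simp: insert_commute)
        then show "e \<in> GE x" unfolding GE_def using i e(1) by (auto simp: i_def)
      qed
    qed
  qed
  have "map (arr s ''leaf'') [0..<n] = vs" using n(2) out'(5) by (intro nth_equalityI) auto
  then have "output_tree s = D.T"
    unfolding output_tree_def D.T_def I.arcs_def out'(2-4) by (simp add: GE_def[abs_def] N_def)
  then show "delayed_decomposition (output_tree s) G" "distinguishing (output_tree s) G"
    using D.delayed_decomposition_T D.distinguishing_T by simp_all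
qed

end

text \<open>With \<open>M = n + m + 1 \<ge> 2\<close>, \<open>M ^ 8\<close> is at least
  \<open>2 ^ 6 * M ^ 2\<close>, which leaves a factor 64 above a quadratic bound. The keys need the
  quadratic part, all other values only a linear one.\<close>

lemma word_size:
  fixes n m :: nat
  assumes "0 < n"
  shows "64 * n + 64 * m + 64 \<le> (n + m + 1) ^ 8" "(3 * n + 4) * n + n < (n + m + 1) ^ 8"
proof -
  define M where "M = n + m + 1"
  have M: "2 \<le> M" "n \<le> M" using assms by (auto simp: M_def)
  have "(2 :: nat) ^ 6 * M ^ 2 \<le> M ^ 6 * M ^ 2" by (intro mult_right_mono power_mono M) simp_all
  also have "M ^ 6 * M ^ 2 = M ^ 8" by (simp flip: power_add)
  finally have *: "64 * (M * M) \<le> M ^ 8" unfolding power2_eq_square by simp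
  have "2 * M \<le> M * M" "n * n \<le> M * M" "n * 1 \<le> M * M"
    by (rule mult_le_mono; use M in simp)+
  then have **: "2 * M \<le> M * M" "n * n \<le> M * M" "n \<le> M * M" by simp_all
  have "64 * M \<le> M ^ 8" using * **(1) by linarith
  then show "64 * n + 64 * m + 64 \<le> (n + m + 1) ^ 8" by (simp add: M_def)
  have "0 < M * M" using M by simp
  then have "3 * (n * n) + 5 * n < M ^ 8" using * ** by linarith
  then show "(3 * n + 4) * n + n < (n + m + 1) ^ 8" by (simp add: M_def algebra_simps)
qed

theorem theorem8:
  shows "\<exists>(P :: com) (c :: nat) (k :: nat).
    \<forall>(G :: nat ordered_graph) (vs :: nat list) (es :: (nat \<times> nat) list) (n :: nat) (m :: nat).
      ordered_graph G \<and> n = card (verts G) \<and> m = card (edges G) \<and> n \<ge> 1 \<and>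
      verts G = {0..<n} \<and> explicit_representation G vs es \<longrightarrow>
      (\<exists>t s. exec ((n + m + 1) ^ k) P (input_state vs es) t s \<and> t \<le> c * (m + n) \<and>
             delayed_decomposition (output_tree s) G \<and> distinguishing (output_tree s) G)"
proof (rule exI[of _ "word_input.decompose"], rule exI[of _ 15000], rule exI[of _ 8], intro allI impI)
  fix G :: "nat ordered_graph" and vs :: "nat list" and es :: "(nat \<times> nat) list" and n m :: nat
  assume A: "ordered_graph G \<and> n = card (verts G) \<and> m = card (edges G) \<and> n \<ge> 1 \<and>
      verts G = {0..<n} \<and> explicit_representation G vs es"
  have G: "ordered_graph G" "verts G = {0..<n}" "vorder G = order_of_list vs"
    "edges G = set (map (\<lambda>(u, v). {u, v}) es)" and vs: "distinct vs" "verts G = set vs"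
    and es: "distinct (map (\<lambda>(u, v). {u, v}) es)" and n: "1 \<le> n" and mc: "m = card (edges G)"
    using A unfolding explicit_representation_def by blast+
  have set_vs: "set vs = {0..<n}" and pos: "0 < n" using vs(2) G(2) n by simp_all
  have len: "length vs = n" using distinct_card[OF vs(1)] set_vs by simp
  have m: "length es = m" using distinct_card[OF es] mc G(4) by simp
  have ends: "fst (es ! j) < n \<and> snd (es ! j) < n \<and> fst (es ! j) \<noteq> snd (es ! j)" if "j < m" for j
  proof -
    obtain u v where uv: "es ! j = (u, v)" by (cases "es ! j")
    have "es ! j \<in> set es" using that m by simp
    then have "{u, v} \<in> edges G" unfolding G(4) uv by force
    then have "{u, v} \<in> {{u, v} | u v. u \<in> {0..<n} \<and> v \<in> {0..<n} \<and> u \<noteq> v}"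
      using G(1,2) by (auto simp: ordered_graph_def simple_graph_def)
    then show ?thesis by (auto simp: uv doubleton_eq_iff)
  qed
  interpret W: word_input vs es n m "(n + m + 1) ^ 8"
    by unfold_locales (use pos len vs(1) set_vs m ends word_size[OF pos] in simp_all)
  obtain t s where "exec ((n + m + 1) ^ 8) word_input.decompose (input_state vs es) t s" "t \<le> 15000 * (m + n)"
    and out: "W.output_ok s"
    using W.runs_decompose unfolding runs_def by blast
  then show "\<exists>t s. exec ((n + m + 1) ^ 8) word_input.decompose (input_state vs es) t s \<and> t \<le> 15000 * (m + n) \<and>
      delayed_decomposition (output_tree s) G \<and> distinguishing (output_tree s) G"
    using W.output_correct[OF out G] by blast
qed

end
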